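(* Let $H$ be a triangular quasi-Hopf algebra, $(A,\mathrm{d})$ a differential calculus in ${}^{H}\mathscr{M}$ and $V,W$ two objects in ${}^{H}_{A}\mathscr{M}^{\mathrm{sym}}_{A}$. Given any two connections $\nabla_V=(L,1)\in\mathrm{con}(V)$ and $\nabla_W=(L',1)\in\mathrm{con}(W)$, the curvature of their sum $\nabla_V\boxplus\nabla_W\in\mathrm{con}(V\otimes_A W)$ satisfies $$\mathrm{Curv}(\nabla_V\boxplus\nabla_W)=\mathrm{Curv}(\nabla_V)\circledast1+1\circledast\mathrm{Curv}(\nabla_W).$$
   Context: BASIC SETTING. $k$ is a commutative associative ring with unit. $H$ is a quasitriangular quasi-Hopf algebra over $k$, placed in degree $0$, with coproduct $\Delta(h)=h_{(1)}\otimes h_{(2)}$, counit $\epsilon$, invertible associator $\phi=\phi^{(1)}\otimes\phi^{(2)}\otimes\phi^{(3)}$ with inverse $\phi^{-1}=\phi^{(-1)}\otimes\phi^{(-2)}\otimes\phi^{(-3)}$, quasi-antipode $(S,\alpha,\beta)$ and universal $R$-matrix $R=R^{(1)}\otimes R^{(2)}$ (summations understood). $H$ is triangular if $R=R_{21}^{-1}$, $R_{21}=R^{(2)}\otimes R^{(1)}$. Conventions: $(\mathrm{id}\otimes\Delta)\Delta(h)=\phi\,(\Delta\otimes\mathrm{id})\Delta(h)\,\phi^{-1}$; $S(h_{(1)})\alpha h_{(2)}=\epsilon(h)\alpha$; $h_{(1)}\beta S(h_{(2)})=\epsilon(h)\beta$; $\phi^{(1)}\beta S(\phi^{(2)})\alpha\phi^{(3)}=1=S(\phi^{(-1)})\alpha\phi^{(-2)}\beta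 S(\phi^{(-3)})$; $\Delta^{\mathrm{op}}(h)=R\,\Delta(h)\,R^{-1}$; the remaining axioms (pentagon, counit normalization, hexagons) are the ones making the following a braided monoidal category. ${}^{H}\mathscr{M}$: objects are bounded $\mathbb{Z}$-graded left $H$-modules $V=\bigoplus_n V_n$ ($V_n=0$ for all but finitely many $n$; action $\triangleright$ degree-preserving); morphisms are degree-preserving $H$-equivariant $k$-linear maps. $V\otimes W$ is the graded tensor product over $k$ with $h\triangleright(v\otimes w)=(h_{(1)}\triangleright v)\otimes(h_{(2)}\triangleright w)$; unit $I=k$ (degree $0$, action by $\epsilon$); associator $\Phi((v\otimes w)\otimes x)=(\phi^{(1)}\triangleright v)\otimes((\phi^{(2)}\triangleright w)\otimes(\phi^{(3)}\triangleright x))$; braiding $\tau(v\otimes w)=(-1)^{|v||w|}(R^{(2)}\triangleright w)\otimes(R^{(1)}\triangleright v)$. Internal hom: $\hom(V,W)=\bigoplus_n\bigoplus_{l-m=n}\mathrm{Hom}_k(V_m,W_l)$ with $h\triangleright L=(h_{(1)}\triangleright\cdot)\circ L\circ(S(h_{(2)})\triangleright\cdot)$. Currying bijection: for $f:V\otimes W\to X$, $\zeta(f)(v)=f((\phi^{(-1)}\triangleright v)\otimes((\phi^{(-2)}\beta S(\phi^{(-3)}))\triangleright(\cdot)))$; inverse: for $g:V\to\hom(W,X)$, $\zeta^{-1}(g)(v\otimes w)=\phi^{(1)}\triangleright(g(v)((S(\phi^{(2)})\alpha\phi^{(3)})\triangleright w))$. Evaluation $\mathrm{ev}=\zeta^{-1}(\mathrm{id}):\hom(V,W)\otimes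 V\to W$; internal composition $\bullet=\zeta(\mathrm{ev}\circ(\mathrm{id}\otimes\mathrm{ev})\circ\Phi):\hom(W,X)\otimes\hom(V,W)\to\hom(V,X)$. $\mathrm{end}(V)=\hom(V,V)$, unit $1=(\beta\triangleright\cdot)$. Commutator on $\mathrm{end}(V)$: $[L,L']=L\bullet L'-(-1)^{|L||L'|}(R^{(2)}\triangleright L')\bullet(R^{(1)}\triangleright L)$. INTERNAL TENSOR PRODUCT. $\circledast:\hom(V,W)\otimes\hom(X,Y)\to\hom(V\otimes X,W\otimes Y)$ is $\zeta$ of $(\mathrm{ev}\otimes\mathrm{ev})$ composed with the canonical isomorphism $(\hom(V,W)\otimes\hom(X,Y))\otimes(V\otimes X)\to(\hom(V,W)\otimes V)\otimes(\hom(X,Y)\otimes X)$ built from associators and the braiding $\tau:\hom(X,Y)\otimes V\to V\otimes\hom(X,Y)$. ALGEBRAS AND BIMODULES. An algebra in ${}^{H}\mathscr{M}$ is an object $A$ with ${}^{H}\mathscr{M}$-morphisms product $\mu:A\otimes A\to A$ and unit $I\to A$, with $(aa')a''=(\phi^{(1)}\triangleright a)((\phi^{(2)}\triangleright a')(\phi^{(3)}\triangleright a''))$ and $1a=a=a1$; it is braided commutative (an object of ${}^{H}\mathscr{A}^{\mathrm{com}}$) if $\mu\circ\tau=\mu$. An $A$-bimodule $V$ in ${}^{H}\mathscr{M}$ has ${}^{H}\mathscr{M}$-morphisms $l:A\otimes V\to V$, $r:V\otimes A\to V$ (written by juxtaposition) that are unital and satisfy the module and bimodule axioms with brackets changed by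 $\Phi$; it is symmetric if $r\circ\tau=l$ and $l\circ\tau=r$. ${}^{H}_{A}\mathscr{M}^{\mathrm{sym}}_{A}$ is the category of symmetric $A$-bimodules. $\hat l=\zeta(l):A\to\mathrm{end}(V)$, and $[L,a]:=[L,\hat l(a)]$ for $L\in\mathrm{end}(V)$, $a\in A$. $\mathrm{end}_A(V)=\mathrm{Ker}(\zeta([\cdot,\cdot]))\subseteq\mathrm{end}(V)$, where here $[\cdot,\cdot]:\mathrm{end}(V)\otimes A\to\mathrm{end}(V)$, $L\otimes a\mapsto[L,a]$. TENSOR PRODUCT OVER $A$. $V\otimes_A W=(V\otimes W)/\mathrm{Im}(r\otimes\mathrm{id}-(\mathrm{id}\otimes l)\circ\Phi)$, with actions $a(v\otimes_A w)=((\phi^{(-1)}\triangleright a)(\phi^{(-2)}\triangleright v))\otimes_A(\phi^{(-3)}\triangleright w)$ and $(v\otimes_A w)a=(\phi^{(1)}\triangleright v)\otimes_A((\phi^{(2)}\triangleright w)(\phi^{(3)}\triangleright a))$; it is an object of ${}^{H}_{A}\mathscr{M}^{\mathrm{sym}}_{A}$. DIFFERENTIAL CALCULUS AND CONNECTIONS. $I[1]$ is $k$ placed in degree $1$ with $H$ acting by $\epsilon$. Derivations: $\mathrm{der}(A)=\mathrm{Ker}\,\zeta([\cdot,\cdot]-\hat l\circ\mathrm{ev})\subseteq\mathrm{end}(A)$, where $[\cdot,\cdot]-\hat l\circ\mathrm{ev}:\mathrm{end}(A)\otimes A\to\mathrm{end}(A)$, $L\otimes a\mapsto[L,a]-\hat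 l(\mathrm{ev}(L\otimes a))$. A differential calculus $(A,\mathrm{d})$ in ${}^{H}\mathscr{M}$ is an object $A$ of ${}^{H}\mathscr{A}^{\mathrm{com}}$ with an ${}^{H}\mathscr{M}$-morphism $\mathrm{d}:I[1]\to\mathrm{der}(A)$ such that $\mathrm{d}(c)\bullet\mathrm{d}(c')=0$ for all $c,c'$. With $\times$ the categorical product in ${}^{H}\mathscr{M}$, $\mathrm{con}(V)=\mathrm{Ker}\,\zeta(f)\subseteq\mathrm{end}(V)\times I[1]$, where $f:(\mathrm{end}(V)\times I[1])\otimes A\to\mathrm{end}(V)$, $f((L,c)\otimes a)=[L,a]-\hat l(\mathrm{ev}(\mathrm{d}(c)\otimes a))$. SUM AND CURVATURE. For $(L,c)\in\mathrm{con}(V)$ and $(L',c)\in\mathrm{con}(W)$ with the same $c\in I[1]$, $(L,c)\boxplus(L',c)\in\mathrm{con}(V\otimes_A W)$ is the pair consisting of the map induced on the quotient $V\otimes_A W$ by $L\circledast1+1\circledast L'\in\mathrm{end}(V\otimes W)$, and $c$ (it is a fact that this map descends and that the pair lies in $\mathrm{con}(V\otimes_A W)$). The curvature of a connection $\nabla=(L,1)\in\mathrm{con}(V)$ is $\mathrm{Curv}(\nabla)=[L,L]\in\mathrm{end}_A(V)$. In the claimed identity the right-hand side is understood as the map it induces on $V\otimes_A W$. *)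

theory Defs
  imports "HOL-Algebra.Module" "HOL-Algebra.AbelCoset"
begin

section \<open>Tensor products over a commutative ring\<close>

text \<open>
  An element of the tensor product is a class of formal sums
  \<open>v\<^sub>1 \<otimes> w\<^sub>1 + \<dots> + v\<^sub>n \<otimes> w\<^sub>n\<close>, written as lists of pairs, modulo the congruence generated by
  bilinearity. Additive inverses need no generator of their own: the class of \<open>(\<ominus>v, w)\<close>
  is inverse to that of \<open>(v, w)\<close>.
\<close>

type_synonym ('a, 'b) tens = "('a \<times> 'b) list set"

inductive tens_eq ::
  "'k ring \<Rightarrow> ('k, 'v, 'm) module_scheme \<Rightarrow> ('k, 'w, 'n) module_scheme
    \<Rightarrow> ('v \<times> 'w) list \<Rightarrow> ('v \<times> 'w) list \<Rightarrow> bool"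
  for k V W where
  refl: "set xs \<subseteq> carrier V \<times> carrier W \<Longrightarrow> tens_eq k V W xs xs"
| sym: "tens_eq k V W xs ys \<Longrightarrow> tens_eq k V W ys xs"
| trans: "tens_eq k V W xs ys \<Longrightarrow> tens_eq k V W ys zs \<Longrightarrow> tens_eq k V W xs zs"
| append: "tens_eq k V W xs ys \<Longrightarrow> tens_eq k V W us vs \<Longrightarrow> tens_eq k V W (xs @ us) (ys @ vs)"
| comm: "set xs \<subseteq> carrier V \<times> carrier W \<Longrightarrow> set ys \<subseteq> carrier V \<times> carrier W
    \<Longrightarrow> tens_eq k V W (xs @ ys) (ys @ xs)"
| zero: "w \<in> carrier W \<Longrightarrow> tens_eq k V W [(\<zero>\<^bsub>V\<^esub>, w)] []"
| add_left: "v \<in> carrier V \<Longrightarrow> v' \<in> carrier V \<Longrightarrow> w \<in> carrier W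
    \<Longrightarrow> tens_eq k V W [(v \<oplus>\<^bsub>V\<^esub> v', w)] [(v, w), (v', w)]"
| add_right: "v \<in> carrier V \<Longrightarrow> w \<in> carrier W \<Longrightarrow> w' \<in> carrier W
    \<Longrightarrow> tens_eq k V W [(v, w \<oplus>\<^bsub>W\<^esub> w')] [(v, w), (v, w')]"
| balanced: "c \<in> carrier k \<Longrightarrow> v \<in> carrier V \<Longrightarrow> w \<in> carrier W
    \<Longrightarrow> tens_eq k V W [(c \<odot>\<^bsub>V\<^esub> v, w)] [(v, c \<odot>\<^bsub>W\<^esub> w)]"

definition tclass where
  "tclass k V W xs = {ys. tens_eq k V W xs ys}"

definition tpure where
  "tpure k V W v w = tclass k V W [(v, w)]"

definition trep :: "('v, 'w) tens \<Rightarrow> ('v \<times> 'w) list" where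
  "trep X = (SOME xs. xs \<in> X)"

text \<open>
  \<open>tlift M b\<close> is the linear map \<open>V \<otimes> W \<rightarrow> M\<close> induced by a bilinear map \<open>b\<close>; for an element
  \<open>X\<close> with \<open>X = X\<^sup>(\<^sup>1\<^sup>) \<otimes> X\<^sup>(\<^sup>2\<^sup>)\<close> (Sweedler) it is \<open>b X\<^sup>(\<^sup>1\<^sup>) X\<^sup>(\<^sup>2\<^sup>)\<close>, summation understood. The value does not
  depend on the representative as soon as \<open>b\<close> is bilinear.
  \<open>tlift3\<close> is the same for trilinear maps on \<open>(U \<otimes> V) \<otimes> W\<close>.
\<close>

definition tlift ::
  "('x, 'r) ring_scheme \<Rightarrow> ('v \<Rightarrow> 'w \<Rightarrow> 'x) \<Rightarrow> ('v, 'w) tens \<Rightarrow> 'x" where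
  "tlift M b X = foldr (\<lambda>(v, w) s. b v w \<oplus>\<^bsub>M\<^esub> s) (trep X) \<zero>\<^bsub>M\<^esub>"

definition tlift3 ::
  "('x, 'r) ring_scheme \<Rightarrow> ('u \<Rightarrow> 'v \<Rightarrow> 'w \<Rightarrow> 'x) \<Rightarrow> (('u, 'v) tens, 'w) tens \<Rightarrow> 'x" where
  "tlift3 M b X = tlift M (\<lambda>Y w. tlift M (\<lambda>u v. b u v w) Y) X"

text \<open>
  The fields \<^const>\<open>mult\<close> and \<^const>\<open>one\<close> are those of the tensor product of two algebras. They
  carry no meaning if the factors are mere modules (the library's record of modules extends
  that of rings).
\<close>

definition tens ::
  "'k ring \<Rightarrow> ('k, 'v, 'm) module_scheme \<Rightarrow> ('k, 'w, 'n) module_scheme \<Rightarrow> ('k, ('v, 'w) tens) module"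
where
  "tens k V W =
    \<lparr> carrier = {tclass k V W xs | xs. set xs \<subseteq> carrier V \<times> carrier W},
      mult = (\<lambda>X Y. tclass k V W
        [(v \<otimes>\<^bsub>V\<^esub> v', w \<otimes>\<^bsub>W\<^esub> w'). (v, w) \<leftarrow> trep X, (v', w') \<leftarrow> trep Y]),
      one = tpure k V W \<one>\<^bsub>V\<^esub> \<one>\<^bsub>W\<^esub>,
      zero = tclass k V W [],
      add = (\<lambda>X Y. tclass k V W (trep X @ trep Y)),
      smult = (\<lambda>c X. tclass k V W (map (\<lambda>(v, w). (c \<odot>\<^bsub>V\<^esub> v, w)) (trep X))) \<rparr>"

definition is_linear ::
  "'k ring \<Rightarrow> ('k, 'v, 'm) module_scheme \<Rightarrow> ('k, 'w, 'n) module_scheme \<Rightarrow> ('v \<Rightarrow> 'w) \<Rightarrow> bool"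
where
  "is_linear k V W f \<longleftrightarrow>
    f \<in> carrier V \<rightarrow> carrier W \<and>
    (\<forall>x\<in>carrier V. \<forall>y\<in>carrier V. f (x \<oplus>\<^bsub>V\<^esub> y) = f x \<oplus>\<^bsub>W\<^esub> f y) \<and>
    (\<forall>c\<in>carrier k. \<forall>x\<in>carrier V. f (c \<odot>\<^bsub>V\<^esub> x) = c \<odot>\<^bsub>W\<^esub> f x)"


section \<open>Triangular quasi-Hopf algebras\<close>

text \<open>Associative unital algebras (the library's locale \<^locale>\<open>algebra\<close> is for commutative ones).\<close>

definition is_kalgebra :: "'k ring \<Rightarrow> ('k, 'h, 'm) module_scheme \<Rightarrow> bool" where
  "is_kalgebra k H \<longleftrightarrow> module k H \<and> ring H \<and>
    (\<forall>c\<in>carrier k. \<forall>x\<in>carrier H. \<forall>y\<in>carrier H.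
      (c \<odot>\<^bsub>H\<^esub> x) \<otimes>\<^bsub>H\<^esub> y = c \<odot>\<^bsub>H\<^esub> (x \<otimes>\<^bsub>H\<^esub> y) \<and>
      x \<otimes>\<^bsub>H\<^esub> (c \<odot>\<^bsub>H\<^esub> y) = c \<odot>\<^bsub>H\<^esub> (x \<otimes>\<^bsub>H\<^esub> y))"

record ('k, 'h) qhopf = "('k, 'h) module" +
  base :: "'k ring"
  cop :: "'h \<Rightarrow> ('h, 'h) tens"
  cou :: "'h \<Rightarrow> 'k"
  coassoc :: "(('h, 'h) tens, 'h) tens"
  antip :: "'h \<Rightarrow> 'h"
  qalpha :: "'h"
  qbeta :: "'h"
  Rmat :: "('h, 'h) tens"

definition H2 :: "('k, 'h) qhopf \<Rightarrow> ('k, ('h, 'h) tens) module" where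
  "H2 H = tens (base H) H H"

definition H3 :: "('k, 'h) qhopf \<Rightarrow> ('k, (('h, 'h) tens, 'h) tens) module" where
  "H3 H = tens (base H) (H2 H) H"

definition H4 :: "('k, 'h) qhopf \<Rightarrow> ('k, ((('h, 'h) tens, 'h) tens, 'h) tens) module" where
  "H4 H = tens (base H) (H3 H) H"

definition p2 :: "('k, 'h) qhopf \<Rightarrow> 'h \<Rightarrow> 'h \<Rightarrow> ('h, 'h) tens" where
  "p2 H a b = tpure (base H) H H a b"

definition p3 :: "('k, 'h) qhopf \<Rightarrow> 'h \<Rightarrow> 'h \<Rightarrow> 'h \<Rightarrow> (('h, 'h) tens, 'h) tens" where
  "p3 H a b c = tpure (base H) (H2 H) H (p2 H a b) c"

definition p4 ::
  "('k, 'h) qhopf \<Rightarrow> 'h \<Rightarrow> 'h \<Rightarrow> 'h \<Rightarrow> 'h \<Rightarrow> ((('h, 'h) tens, 'h) tens, 'h) tens" where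
  "p4 H a b c d = tpure (base H) (H3 H) H (p3 H a b c) d"

definition coassoc_inv :: "('k, 'h) qhopf \<Rightarrow> (('h, 'h) tens, 'h) tens" where
  "coassoc_inv H = inv\<^bsub>H3 H\<^esub> (coassoc H)"

text \<open>
  The pentagon is
  \<open>(id \<otimes> id \<otimes> \<Delta>)(\<phi>) (\<Delta> \<otimes> id \<otimes> id)(\<phi>) = (1 \<otimes> \<phi>) (id \<otimes> \<Delta> \<otimes> id)(\<phi>) (\<phi> \<otimes> 1)\<close>.
\<close>

definition is_quasi_bialgebra :: "('k, 'h) qhopf \<Rightarrow> bool" where
  "is_quasi_bialgebra H \<longleftrightarrow>
    is_kalgebra (base H) H \<and>
    cop H \<in> ring_hom H (H2 H) \<and> is_linear (base H) H (H2 H) (cop H) \<and>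
    cou H \<in> ring_hom H (base H) \<and>
    (\<forall>c\<in>carrier (base H). \<forall>h\<in>carrier H. cou H (c \<odot>\<^bsub>H\<^esub> h) = c \<otimes>\<^bsub>base H\<^esub> cou H h) \<and>
    coassoc H \<in> Units (H3 H) \<and>
    (\<forall>h\<in>carrier H. tlift H (\<lambda>a b. cou H a \<odot>\<^bsub>H\<^esub> b) (cop H h) = h) \<and>
    (\<forall>h\<in>carrier H. tlift H (\<lambda>a b. cou H b \<odot>\<^bsub>H\<^esub> a) (cop H h) = h) \<and>
    (\<forall>h\<in>carrier H.
      tlift (H3 H) (\<lambda>a b. tlift (H3 H) (\<lambda>b1 b2. p3 H a b1 b2) (cop H b)) (cop H h) =
      coassoc H \<otimes>\<^bsub>H3 H\<^esub>
        tlift (H3 H) (\<lambda>a b. tlift (H3 H) (\<lambda>a1 a2. p3 H a1 a2 b) (cop H a)) (cop H h)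
        \<otimes>\<^bsub>H3 H\<^esub> coassoc_inv H) \<and>
    tlift3 (H4 H) (\<lambda>a b c. tlift (H4 H) (\<lambda>c1 c2. p4 H a b c1 c2) (cop H c)) (coassoc H)
      \<otimes>\<^bsub>H4 H\<^esub> tlift3 (H4 H) (\<lambda>a b c. tlift (H4 H) (\<lambda>a1 a2. p4 H a1 a2 b c) (cop H a)) (coassoc H) =
    tlift3 (H4 H) (\<lambda>a b c. p4 H \<one>\<^bsub>H\<^esub> a b c) (coassoc H)
      \<otimes>\<^bsub>H4 H\<^esub> tlift3 (H4 H) (\<lambda>a b c. tlift (H4 H) (\<lambda>b1 b2. p4 H a b1 b2 c) (cop H b)) (coassoc H)
      \<otimes>\<^bsub>H4 H\<^esub> tlift3 (H4 H) (\<lambda>a b c. p4 H a b c \<one>\<^bsub>H\<^esub>) (coassoc H) \<and>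
    tlift3 (H2 H) (\<lambda>a b c. p2 H (cou H b \<odot>\<^bsub>H\<^esub> a) c) (coassoc H) = \<one>\<^bsub>H2 H\<^esub>"

definition is_quasi_hopf :: "('k, 'h) qhopf \<Rightarrow> bool" where
  "is_quasi_hopf H \<longleftrightarrow>
    is_quasi_bialgebra H \<and>
    is_linear (base H) H H (antip H) \<and>
    antip H \<one>\<^bsub>H\<^esub> = \<one>\<^bsub>H\<^esub> \<and>
    (\<forall>x\<in>carrier H. \<forall>y\<in>carrier H. antip H (x \<otimes>\<^bsub>H\<^esub> y) = antip H y \<otimes>\<^bsub>H\<^esub> antip H x) \<and>
    qalpha H \<in> carrier H \<and> qbeta H \<in> carrier H \<and>
    (\<forall>h\<in>carrier H.
      tlift H (\<lambda>a b. antip H a \<otimes>\<^bsub>H\<^esub> qalpha H \<otimes>\<^bsub>H\<^esub> b) (cop H h) = cou H h \<odot>\<^bsub>H\<^esub> qalpha H) \<and>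
    (\<forall>h\<in>carrier H.
      tlift H (\<lambda>a b. a \<otimes>\<^bsub>H\<^esub> qbeta H \<otimes>\<^bsub>H\<^esub> antip H b) (cop H h) = cou H h \<odot>\<^bsub>H\<^esub> qbeta H) \<and>
    tlift3 H (\<lambda>a b c. a \<otimes>\<^bsub>H\<^esub> qbeta H \<otimes>\<^bsub>H\<^esub> antip H b \<otimes>\<^bsub>H\<^esub> qalpha H \<otimes>\<^bsub>H\<^esub> c) (coassoc H) = \<one>\<^bsub>H\<^esub> \<and>
    tlift3 H (\<lambda>a b c. antip H a \<otimes>\<^bsub>H\<^esub> qalpha H \<otimes>\<^bsub>H\<^esub> b \<otimes>\<^bsub>H\<^esub> qbeta H \<otimes>\<^bsub>H\<^esub> antip H c)
      (coassoc_inv H) = \<one>\<^bsub>H\<^esub>"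

definition flip2 :: "('k, 'h) qhopf \<Rightarrow> ('h, 'h) tens \<Rightarrow> ('h, 'h) tens" where
  "flip2 H X = tlift (H2 H) (\<lambda>a b. p2 H b a) X"

text \<open>
  With the braiding \<open>\<tau>(v \<otimes> w) = \<plusminus> (R\<^sup>(\<^sup>2\<^sup>) \<triangleright> w) \<otimes> (R\<^sup>(\<^sup>1\<^sup>) \<triangleright> v)\<close> and \<open>\<Phi>\<close> acting by \<open>\<phi>\<close>, the two
  hexagons amount to
  \<open>(\<Delta> \<otimes> id)(R) = \<phi>\<^sub>3\<^sub>1\<^sub>2 R\<^sub>1\<^sub>3 \<phi>\<^sup>-\<^sup>1\<^sub>1\<^sub>3\<^sub>2 R\<^sub>2\<^sub>3 \<phi>\<^sub>1\<^sub>2\<^sub>3\<close> and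
  \<open>(id \<otimes> \<Delta>)(R) = \<phi>\<^sup>-\<^sup>1\<^sub>2\<^sub>3\<^sub>1 R\<^sub>1\<^sub>3 \<phi>\<^sub>2\<^sub>1\<^sub>3 R\<^sub>1\<^sub>2 \<phi>\<^sup>-\<^sup>1\<^sub>1\<^sub>2\<^sub>3\<close>,
  where the \<open>j\<close>-th index is the slot into which the \<open>j\<close>-th tensor factor goes; for instance
  \<open>\<phi>\<^sub>3\<^sub>1\<^sub>2 = \<phi>\<^sup>(\<^sup>2\<^sup>) \<otimes> \<phi>\<^sup>(\<^sup>3\<^sup>) \<otimes> \<phi>\<^sup>(\<^sup>1\<^sup>)\<close>.
\<close>

definition is_quasitriangular :: "('k, 'h) qhopf \<Rightarrow> bool" where
  "is_quasitriangular H \<longleftrightarrow>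
    is_quasi_hopf H \<and>
    Rmat H \<in> Units (H2 H) \<and>
    (\<forall>h\<in>carrier H. flip2 H (cop H h) = Rmat H \<otimes>\<^bsub>H2 H\<^esub> cop H h \<otimes>\<^bsub>H2 H\<^esub> inv\<^bsub>H2 H\<^esub> (Rmat H)) \<and>
    tlift (H3 H) (\<lambda>r s. tlift (H3 H) (\<lambda>r1 r2. p3 H r1 r2 s) (cop H r)) (Rmat H) =
      tlift3 (H3 H) (\<lambda>a b c. p3 H b c a) (coassoc H)
      \<otimes>\<^bsub>H3 H\<^esub> tlift (H3 H) (\<lambda>r s. p3 H r \<one>\<^bsub>H\<^esub> s) (Rmat H)
      \<otimes>\<^bsub>H3 H\<^esub> tlift3 (H3 H) (\<lambda>a b c. p3 H a c b) (coassoc_inv H)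
      \<otimes>\<^bsub>H3 H\<^esub> tlift (H3 H) (\<lambda>r s. p3 H \<one>\<^bsub>H\<^esub> r s) (Rmat H)
      \<otimes>\<^bsub>H3 H\<^esub> coassoc H \<and>
    tlift (H3 H) (\<lambda>r s. tlift (H3 H) (\<lambda>s1 s2. p3 H r s1 s2) (cop H s)) (Rmat H) =
      tlift3 (H3 H) (\<lambda>a b c. p3 H c a b) (coassoc_inv H)
      \<otimes>\<^bsub>H3 H\<^esub> tlift (H3 H) (\<lambda>r s. p3 H r \<one>\<^bsub>H\<^esub> s) (Rmat H)
      \<otimes>\<^bsub>H3 H\<^esub> tlift3 (H3 H) (\<lambda>a b c. p3 H b a c) (coassoc H)
      \<otimes>\<^bsub>H3 H\<^esub> tlift (H3 H) (\<lambda>r s. p3 H r s \<one>\<^bsub>H\<^esub>) (Rmat H)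
      \<otimes>\<^bsub>H3 H\<^esub> coassoc_inv H"

definition is_triangular :: "('k, 'h) qhopf \<Rightarrow> bool" where
  "is_triangular H \<longleftrightarrow> is_quasitriangular H \<and> Rmat H = inv\<^bsub>H2 H\<^esub> (flip2 H (Rmat H))"


section \<open>Bounded graded modules\<close>

record ('k, 'h, 'v) hmod = "('k, 'v) module" +
  act :: "'h \<Rightarrow> 'v \<Rightarrow> 'v"
  gr :: "int \<Rightarrow> 'v set"

definition is_decomp :: "('k, 'h, 'v, 'm) hmod_scheme \<Rightarrow> 'v \<Rightarrow> (int \<Rightarrow> 'v) \<Rightarrow> bool" where
  "is_decomp V v c \<longleftrightarrow>
    (\<forall>n. c n \<in> gr V n) \<and> finite {n. c n \<noteq> \<zero>\<^bsub>V\<^esub>} \<and> v = (\<Oplus>\<^bsub>V\<^esub>n\<in>{n. c n \<noteq> \<zero>\<^bsub>V\<^esub>}. c n)"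

definition hcomp :: "('k, 'h, 'v, 'm) hmod_scheme \<Rightarrow> int \<Rightarrow> 'v \<Rightarrow> 'v" where
  "hcomp V n v = (THE c. is_decomp V v c) n"

definition degs :: "('k, 'h, 'v, 'm) hmod_scheme \<Rightarrow> int set" where
  "degs V = {n. gr V n \<noteq> {\<zero>\<^bsub>V\<^esub>}}"

definition is_hmod :: "('k, 'h) qhopf \<Rightarrow> ('k, 'h, 'v, 'm) hmod_scheme \<Rightarrow> bool" where
  "is_hmod H V \<longleftrightarrow>
    module (base H) V \<and>
    (\<forall>h\<in>carrier H. is_linear (base H) V V (act V h)) \<and>
    (\<forall>v\<in>carrier V. is_linear (base H) H V (\<lambda>h. act V h v)) \<and>
    (\<forall>v\<in>carrier V. act V \<one>\<^bsub>H\<^esub> v = v) \<and>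
    (\<forall>g\<in>carrier H. \<forall>h\<in>carrier H. \<forall>v\<in>carrier V. act V (g \<otimes>\<^bsub>H\<^esub> h) v = act V g (act V h v)) \<and>
    (\<forall>n. submodule (gr V n) (base H) V) \<and>
    (\<forall>v\<in>carrier V. \<exists>!c. is_decomp V v c) \<and>
    finite (degs V) \<and>
    (\<forall>n. \<forall>h\<in>carrier H. \<forall>v\<in>gr V n. act V h v \<in> gr V n)"

definition is_mor ::
  "('k, 'h) qhopf \<Rightarrow> ('k, 'h, 'v, 'm) hmod_scheme \<Rightarrow> ('k, 'h, 'w, 'n) hmod_scheme \<Rightarrow> ('v \<Rightarrow> 'w) \<Rightarrow> bool"
where
  "is_mor H V W f \<longleftrightarrow>
    is_linear (base H) V W f \<and>
    (\<forall>n. f ` gr V n \<subseteq> gr W n) \<and>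
    (\<forall>h\<in>carrier H. \<forall>v\<in>carrier V. f (act V h v) = act W h (f v))"

text \<open>The base ring in degree \<open>j\<close>: the unit object \<open>I\<close> for \<open>j = 0\<close> and \<open>I[1]\<close> for \<open>j = 1\<close>.\<close>

definition unit_obj :: "('k, 'h) qhopf \<Rightarrow> int \<Rightarrow> ('k, 'h, 'k) hmod" where
  "unit_obj H j =
    \<lparr> carrier = carrier (base H), mult = mult (base H), one = one (base H),
      zero = zero (base H), add = add (base H), smult = mult (base H),
      act = (\<lambda>h c. cou H h \<otimes>\<^bsub>base H\<^esub> c),
      gr = (\<lambda>n. if n = j then carrier (base H) else {\<zero>\<^bsub>base H\<^esub>}) \<rparr>"

definition tensor ::
  "('k, 'h) qhopf \<Rightarrow> ('k, 'h, 'v, 'm) hmod_scheme \<Rightarrow> ('k, 'h, 'w, 'n) hmod_scheme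
    \<Rightarrow> ('k, 'h, ('v, 'w) tens) hmod"
where
  "tensor H V W = (let T = tens (base H) V W in
    \<lparr> carrier = carrier T, mult = mult T, one = one T, zero = zero T, add = add T, smult = smult T,
      act = (\<lambda>h X. tlift T
        (\<lambda>h1 h2. tlift T (\<lambda>v w. tpure (base H) V W (act V h1 v) (act W h2 w)) X) (cop H h)),
      gr = (\<lambda>n. {tclass (base H) V W xs | xs.
        \<forall>(v, w)\<in>set xs. \<exists>l m. l + m = n \<and> v \<in> gr V l \<and> w \<in> gr W m}) \<rparr>)"

definition tp where
  "tp H V W v w = tpure (base H) V W v w"

text \<open>The map \<open>f \<otimes> g\<close> into \<open>V \<otimes> W\<close>.\<close>

definition tmap ::
  "('k, 'h) qhopf \<Rightarrow> ('k, 'h, 'v, 'm) hmod_scheme \<Rightarrow> ('k, 'h, 'w, 'n) hmod_scheme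
    \<Rightarrow> ('x \<Rightarrow> 'v) \<Rightarrow> ('y \<Rightarrow> 'w) \<Rightarrow> ('x, 'y) tens \<Rightarrow> ('v, 'w) tens"
where
  "tmap H V W f g = tlift (tensor H V W) (\<lambda>x y. tp H V W (f x) (g y))"

definition Assoc ::
  "('k, 'h) qhopf \<Rightarrow> ('k, 'h, 'v, 'm) hmod_scheme \<Rightarrow> ('k, 'h, 'w, 'n) hmod_scheme
    \<Rightarrow> ('k, 'h, 'x, 'o) hmod_scheme \<Rightarrow> (('v, 'w) tens, 'x) tens \<Rightarrow> ('v, ('w, 'x) tens) tens"
where
  "Assoc H V W X = (let T = tensor H V (tensor H W X) in
    tlift3 T (\<lambda>v w x. tlift3 T
      (\<lambda>a b c. tp H V (tensor H W X) (act V a v) (tp H W X (act W b w) (act X c x)))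
      (coassoc H)))"

definition Assoc_inv ::
  "('k, 'h) qhopf \<Rightarrow> ('k, 'h, 'v, 'm) hmod_scheme \<Rightarrow> ('k, 'h, 'w, 'n) hmod_scheme
    \<Rightarrow> ('k, 'h, 'x, 'o) hmod_scheme \<Rightarrow> ('v, ('w, 'x) tens) tens \<Rightarrow> (('v, 'w) tens, 'x) tens"
where
  "Assoc_inv H V W X = (let T = tensor H (tensor H V W) X in
    tlift T (\<lambda>v. tlift T (\<lambda>w x. tlift3 T
      (\<lambda>a b c. tp H (tensor H V W) X (tp H V W (act V a v) (act W b w)) (act X c x))
      (coassoc_inv H))))"

text \<open>
  The braiding \<open>v \<otimes> w \<mapsto> (-1)\<^bsup>|v| |w|\<^esup> (R\<^sup>(\<^sup>2\<^sup>) \<triangleright> w) \<otimes> (R\<^sup>(\<^sup>1\<^sup>) \<triangleright> v)\<close>, extended linearly from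
  homogeneous \<open>v\<close>, \<open>w\<close> through the homogeneous components.
\<close>

definition ksign :: "('x, 'r) ring_scheme \<Rightarrow> int \<Rightarrow> 'x \<Rightarrow> 'x" where
  "ksign M j x = (if even j then x else \<ominus>\<^bsub>M\<^esub> x)"

definition braid ::
  "('k, 'h) qhopf \<Rightarrow> ('k, 'h, 'v, 'm) hmod_scheme \<Rightarrow> ('k, 'h, 'w, 'n) hmod_scheme
    \<Rightarrow> ('v, 'w) tens \<Rightarrow> ('w, 'v) tens"
where
  "braid H V W = (let T = tensor H W V in
    tlift T (\<lambda>v w. finsum T
      (\<lambda>(m, n). ksign T (m * n)
        (tlift T (\<lambda>r s. tp H W V (act W s (hcomp W n w)) (act V r (hcomp V m v))) (Rmat H)))
      (degs V \<times> degs W)))"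


section \<open>Internal homomorphisms\<close>

text \<open>
  As \<open>V\<close> and \<open>W\<close> are bounded, the direct sum over \<open>n\<close> of the sums of \<open>Hom(V\<^sub>m, W\<^sub>l)\<close>, \<open>l - m = n\<close>, consists
  of all linear maps \<open>V \<rightarrow> W\<close>. Functions are \<^const>\<open>extensional\<close>, so that equality of elements is
  equality on the carrier of \<open>V\<close>.
\<close>

definition ihom ::
  "('k, 'h) qhopf \<Rightarrow> ('k, 'h, 'v, 'm) hmod_scheme \<Rightarrow> ('k, 'h, 'w, 'n) hmod_scheme
    \<Rightarrow> ('k, 'h, 'v \<Rightarrow> 'w) hmod"
where
  "ihom H V W =
    \<lparr> carrier = {L \<in> extensional (carrier V). is_linear (base H) V W L},
      mult = undefined, one = undefined,
      zero = (\<lambda>v\<in>carrier V. \<zero>\<^bsub>W\<^esub>),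
      add = (\<lambda>L L'. \<lambda>v\<in>carrier V. L v \<oplus>\<^bsub>W\<^esub> L' v),
      smult = (\<lambda>c L. \<lambda>v\<in>carrier V. c \<odot>\<^bsub>W\<^esub> L v),
      act = (\<lambda>h L. \<lambda>v\<in>carrier V. tlift W (\<lambda>h1 h2. act W h1 (L (act V (antip H h2) v))) (cop H h)),
      gr = (\<lambda>n. {L \<in> extensional (carrier V). is_linear (base H) V W L \<and>
        (\<forall>m. L ` gr V m \<subseteq> gr W (m + n))}) \<rparr>"

definition iend where
  "iend H V = ihom H V V"

text \<open>\<open>zeta H V W X\<close> sends \<open>f : V \<otimes> W \<rightarrow> X\<close> to \<open>\<zeta>(f) : V \<rightarrow> hom(W, X)\<close>, \<open>zeta_inv H V W X\<close> goes back.\<close>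

definition zeta ::
  "('k, 'h) qhopf \<Rightarrow> ('k, 'h, 'v, 'm) hmod_scheme \<Rightarrow> ('k, 'h, 'w, 'n) hmod_scheme
    \<Rightarrow> ('k, 'h, 'x, 'o) hmod_scheme \<Rightarrow> (('v, 'w) tens \<Rightarrow> 'x) \<Rightarrow> 'v \<Rightarrow> 'w \<Rightarrow> 'x"
where
  "zeta H V W X f v = (\<lambda>w\<in>carrier W. tlift3 X
    (\<lambda>a b c. f (tp H V W (act V a v) (act W (b \<otimes>\<^bsub>H\<^esub> qbeta H \<otimes>\<^bsub>H\<^esub> antip H c) w)))
    (coassoc_inv H))"

definition zeta_inv ::
  "('k, 'h) qhopf \<Rightarrow> ('k, 'h, 'v, 'm) hmod_scheme \<Rightarrow> ('k, 'h, 'w, 'n) hmod_scheme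
    \<Rightarrow> ('k, 'h, 'x, 'o) hmod_scheme \<Rightarrow> ('v \<Rightarrow> 'w \<Rightarrow> 'x) \<Rightarrow> ('v, 'w) tens \<Rightarrow> 'x"
where
  "zeta_inv H V W X g = tlift X (\<lambda>v w. tlift3 X
    (\<lambda>a b c. act X a (g v (act W (antip H b \<otimes>\<^bsub>H\<^esub> qalpha H \<otimes>\<^bsub>H\<^esub> c) w)))
    (coassoc H))"

definition ev ::
  "('k, 'h) qhopf \<Rightarrow> ('k, 'h, 'v, 'm) hmod_scheme \<Rightarrow> ('k, 'h, 'w, 'n) hmod_scheme
    \<Rightarrow> ('v \<Rightarrow> 'w, 'v) tens \<Rightarrow> 'w"
where
  "ev H V W = zeta_inv H (ihom H V W) V W (\<lambda>L. L)"

definition icomp ::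
  "('k, 'h) qhopf \<Rightarrow> ('k, 'h, 'v, 'm) hmod_scheme \<Rightarrow> ('k, 'h, 'w, 'n) hmod_scheme
    \<Rightarrow> ('k, 'h, 'x, 'o) hmod_scheme \<Rightarrow> ('w \<Rightarrow> 'x, 'v \<Rightarrow> 'w) tens \<Rightarrow> 'v \<Rightarrow> 'x"
where
  "icomp H V W X = zeta H (tensor H (ihom H W X) (ihom H V W)) V X
    (\<lambda>t. ev H W X (tmap H (ihom H W X) W (\<lambda>L. L) (ev H V W)
      (Assoc H (ihom H W X) (ihom H V W) V t)))"

definition iunit :: "('k, 'h) qhopf \<Rightarrow> ('k, 'h, 'v, 'm) hmod_scheme \<Rightarrow> 'v \<Rightarrow> 'v" where
  "iunit H V = (\<lambda>v\<in>carrier V. act V (qbeta H) v)"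

text \<open>\<open>ibracket H V L L'\<close> is \<open>[L, L']\<close>, that is \<open>\<bullet> - \<bullet> \<circ> \<tau>\<close> applied to \<open>L \<otimes> L'\<close>.\<close>

definition ibracket ::
  "('k, 'h) qhopf \<Rightarrow> ('k, 'h, 'v, 'm) hmod_scheme \<Rightarrow> ('v \<Rightarrow> 'v) \<Rightarrow> ('v \<Rightarrow> 'v) \<Rightarrow> 'v \<Rightarrow> 'v"
where
  "ibracket H V L L' = (let E = iend H V; t = tp H E E L L' in
    icomp H V V V t \<ominus>\<^bsub>E\<^esub> icomp H V V V (braid H E E t))"

text \<open>
  The internal tensor product is \<open>\<zeta>\<close> of
  \<open>(P \<otimes> Q) \<otimes> (V \<otimes> X) \<rightarrow> P \<otimes> (Q \<otimes> (V \<otimes> X)) \<rightarrow> P \<otimes> ((Q \<otimes> V) \<otimes> X) \<rightarrow> P \<otimes> ((V \<otimes> Q) \<otimes> X) \<rightarrow> P \<otimes> (V \<otimes> (Q \<otimes> X))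
   \<rightarrow> (P \<otimes> V) \<otimes> (Q \<otimes> X) \<rightarrow> W \<otimes> Y\<close> for \<open>P = hom(V, W)\<close>, \<open>Q = hom(X, Y)\<close>.
\<close>

definition shuffle ::
  "('k, 'h) qhopf \<Rightarrow> ('k, 'h, 'p, 'm) hmod_scheme \<Rightarrow> ('k, 'h, 'q, 'n) hmod_scheme
    \<Rightarrow> ('k, 'h, 'v, 'o) hmod_scheme \<Rightarrow> ('k, 'h, 'x, 'r) hmod_scheme
    \<Rightarrow> (('p, 'q) tens, ('v, 'x) tens) tens \<Rightarrow> (('p, 'v) tens, ('q, 'x) tens) tens"
where
  "shuffle H P Q V X t =
    Assoc_inv H P V (tensor H Q X)
     (tmap H P (tensor H V (tensor H Q X)) (\<lambda>p. p) (Assoc H V Q X)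
      (tmap H P (tensor H (tensor H V Q) X) (\<lambda>p. p) (tmap H (tensor H V Q) X (braid H Q V) (\<lambda>x. x))
       (tmap H P (tensor H (tensor H Q V) X) (\<lambda>p. p) (Assoc_inv H Q V X)
        (Assoc H P Q (tensor H V X) t))))"

definition itensor ::
  "('k, 'h) qhopf \<Rightarrow> ('k, 'h, 'v, 'm) hmod_scheme \<Rightarrow> ('k, 'h, 'w, 'n) hmod_scheme
    \<Rightarrow> ('k, 'h, 'x, 'o) hmod_scheme \<Rightarrow> ('k, 'h, 'y, 'r) hmod_scheme
    \<Rightarrow> ('v \<Rightarrow> 'w, 'x \<Rightarrow> 'y) tens \<Rightarrow> ('v, 'x) tens \<Rightarrow> ('w, 'y) tens"
where
  "itensor H V W X Y =
    zeta H (tensor H (ihom H V W) (ihom H X Y)) (tensor H V X) (tensor H W Y)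
      (\<lambda>t. tmap H W Y (ev H V W) (ev H X Y) (shuffle H (ihom H V W) (ihom H X Y) V X t))"


section \<open>Subobjects, products and quotients\<close>

definition ker_obj ::
  "('k, 'h, 'v) hmod \<Rightarrow> ('k, 'h, 'w, 'n) hmod_scheme \<Rightarrow> ('v \<Rightarrow> 'w) \<Rightarrow> ('k, 'h, 'v) hmod"
where
  "ker_obj V W f =
    V \<lparr> carrier := a_kernel V W f, gr := (\<lambda>n. gr V n \<inter> a_kernel V W f) \<rparr>"

definition prod_obj ::
  "('k, 'h, 'v, 'm) hmod_scheme \<Rightarrow> ('k, 'h, 'w, 'n) hmod_scheme \<Rightarrow> ('k, 'h, 'v \<times> 'w) hmod"
where
  "prod_obj V W =
    \<lparr> carrier = carrier V \<times> carrier W,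
      mult = undefined, one = undefined,
      zero = (\<zero>\<^bsub>V\<^esub>, \<zero>\<^bsub>W\<^esub>),
      add = (\<lambda>(v, w) (v', w'). (v \<oplus>\<^bsub>V\<^esub> v', w \<oplus>\<^bsub>W\<^esub> w')),
      smult = (\<lambda>c (v, w). (c \<odot>\<^bsub>V\<^esub> v, c \<odot>\<^bsub>W\<^esub> w)),
      act = (\<lambda>h (v, w). (act V h v, act W h w)),
      gr = (\<lambda>n. gr V n \<times> gr W n) \<rparr>"

definition crep :: "'v set \<Rightarrow> 'v" where
  "crep X = (SOME x. x \<in> X)"

definition quot_obj :: "('k, 'h, 'v, 'm) hmod_scheme \<Rightarrow> 'v set \<Rightarrow> ('k, 'h, 'v set) hmod" where
  "quot_obj V N =
    \<lparr> carrier = a_rcosets\<^bsub>V\<^esub> N,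
      mult = undefined, one = undefined,
      zero = N,
      add = (\<lambda>X Y. X <+>\<^bsub>V\<^esub> Y),
      smult = (\<lambda>c X. N +>\<^bsub>V\<^esub> (c \<odot>\<^bsub>V\<^esub> crep X)),
      act = (\<lambda>h X. N +>\<^bsub>V\<^esub> act V h (crep X)),
      gr = (\<lambda>n. (\<lambda>v. N +>\<^bsub>V\<^esub> v) ` gr V n) \<rparr>"

text \<open>The endomorphism of \<open>V/N\<close> induced by an endomorphism of \<open>V\<close> that maps \<open>N\<close> into \<open>N\<close>.\<close>

definition induced_end :: "('k, 'h, 'v, 'm) hmod_scheme \<Rightarrow> 'v set \<Rightarrow> ('v \<Rightarrow> 'v) \<Rightarrow> 'v set \<Rightarrow> 'v set" where
  "induced_end V N f = (\<lambda>X\<in>a_rcosets\<^bsub>V\<^esub> N. N +>\<^bsub>V\<^esub> f (crep X))"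


section \<open>Algebras, bimodules and the tensor product over an algebra\<close>

record ('k, 'h, 'a) halg = "('k, 'h, 'a) hmod" +
  amul :: "('a, 'a) tens \<Rightarrow> 'a"
  aunit :: "'k \<Rightarrow> 'a"

definition is_halg :: "('k, 'h) qhopf \<Rightarrow> ('k, 'h, 'a) halg \<Rightarrow> bool" where
  "is_halg H A \<longleftrightarrow>
    is_hmod H A \<and>
    is_mor H (tensor H A A) A (amul A) \<and>
    is_mor H (unit_obj H 0) A (aunit A) \<and>
    (\<forall>t\<in>carrier (tensor H (tensor H A A) A).
      amul A (tmap H A A (amul A) (\<lambda>a. a) t) =
      amul A (tmap H A A (\<lambda>a. a) (amul A) (Assoc H A A A t))) \<and>
    (\<forall>a\<in>carrier A. amul A (tp H A A (aunit A \<one>\<^bsub>base H\<^esub>) a) = a \<and>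
      amul A (tp H A A a (aunit A \<one>\<^bsub>base H\<^esub>)) = a)"

definition is_halg_com :: "('k, 'h) qhopf \<Rightarrow> ('k, 'h, 'a) halg \<Rightarrow> bool" where
  "is_halg_com H A \<longleftrightarrow> is_halg H A \<and>
    (\<forall>t\<in>carrier (tensor H A A). amul A (braid H A A t) = amul A t)"

record ('k, 'h, 'a, 'v) hbimod = "('k, 'h, 'v) hmod" +
  lact :: "('a, 'v) tens \<Rightarrow> 'v"
  ract :: "('v, 'a) tens \<Rightarrow> 'v"

definition is_bimod :: "('k, 'h) qhopf \<Rightarrow> ('k, 'h, 'a) halg \<Rightarrow> ('k, 'h, 'a, 'v) hbimod \<Rightarrow> bool" where
  "is_bimod H A V \<longleftrightarrow>
    is_hmod H V \<and>
    is_mor H (tensor H A V) V (lact V) \<and>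
    is_mor H (tensor H V A) V (ract V) \<and>
    (\<forall>v\<in>carrier V. lact V (tp H A V (aunit A \<one>\<^bsub>base H\<^esub>) v) = v \<and>
      ract V (tp H V A v (aunit A \<one>\<^bsub>base H\<^esub>)) = v) \<and>
    (\<forall>t\<in>carrier (tensor H (tensor H A A) V).
      lact V (tmap H A V (amul A) (\<lambda>v. v) t) =
      lact V (tmap H A V (\<lambda>a. a) (lact V) (Assoc H A A V t))) \<and>
    (\<forall>t\<in>carrier (tensor H (tensor H V A) A).
      ract V (tmap H V A (ract V) (\<lambda>a. a) t) =
      ract V (tmap H V A (\<lambda>v. v) (amul A) (Assoc H V A A t))) \<and>
    (\<forall>t\<in>carrier (tensor H (tensor H A V) A).
      ract V (tmap H V A (lact V) (\<lambda>a. a) t) =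
      lact V (tmap H A V (\<lambda>a. a) (ract V) (Assoc H A V A t)))"

definition is_bimod_sym :: "('k, 'h) qhopf \<Rightarrow> ('k, 'h, 'a) halg \<Rightarrow> ('k, 'h, 'a, 'v) hbimod \<Rightarrow> bool" where
  "is_bimod_sym H A V \<longleftrightarrow> is_bimod H A V \<and>
    (\<forall>t\<in>carrier (tensor H A V). ract V (braid H A V t) = lact V t) \<and>
    (\<forall>t\<in>carrier (tensor H V A). lact V (braid H V A t) = ract V t)"

definition bal_rel ::
  "('k, 'h) qhopf \<Rightarrow> ('k, 'h, 'a) halg \<Rightarrow> ('k, 'h, 'a, 'v) hbimod \<Rightarrow> ('k, 'h, 'a, 'w) hbimod
    \<Rightarrow> ('v, 'w) tens set"
where
  "bal_rel H A V W =
    (\<lambda>t. tmap H V W (ract V) (\<lambda>w. w) t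
      \<ominus>\<^bsub>tensor H V W\<^esub> tmap H V W (\<lambda>v. v) (lact W) (Assoc H V A W t))
    ` carrier (tensor H (tensor H V A) W)"

definition tensor_over ::
  "('k, 'h) qhopf \<Rightarrow> ('k, 'h, 'a) halg \<Rightarrow> ('k, 'h, 'a, 'v) hbimod \<Rightarrow> ('k, 'h, 'a, 'w) hbimod
    \<Rightarrow> ('k, 'h, 'a, ('v, 'w) tens set) hbimod"
where
  "tensor_over H A V W = (let T = tensor H V W; N = bal_rel H A V W; Q = quot_obj T N in
    hmod.extend Q
      (hbimod.fields
        (tlift Q (\<lambda>a X. N +>\<^bsub>T\<^esub> tmap H V W (lact V) (\<lambda>w. w) (Assoc_inv H A V W (tp H A T a (crep X)))))
        (tlift Q (\<lambda>X a. N +>\<^bsub>T\<^esub> tmap H V W (\<lambda>v. v) (ract W) (Assoc H V W A (tp H T A (crep X) a))))))"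


section \<open>Differential calculi, connections and curvature\<close>

definition lhat ::
  "('k, 'h) qhopf \<Rightarrow> ('k, 'h, 'a) halg \<Rightarrow> ('k, 'h, 'v, 'm) hmod_scheme \<Rightarrow> (('a, 'v) tens \<Rightarrow> 'v)
    \<Rightarrow> 'a \<Rightarrow> 'v \<Rightarrow> 'v"
where
  "lhat H A V l = zeta H A V V l"

definition der :: "('k, 'h) qhopf \<Rightarrow> ('k, 'h, 'a) halg \<Rightarrow> ('k, 'h, 'a \<Rightarrow> 'a) hmod" where
  "der H A = (let E = iend H A; l = lhat H A A (amul A) in
    ker_obj E (ihom H A E)
      (zeta H E A E (tlift E (\<lambda>L a. ibracket H A L (l a) \<ominus>\<^bsub>E\<^esub> l (ev H A A (tp H E A L a))))))"

definition is_diff_calc :: "('k, 'h) qhopf \<Rightarrow> ('k, 'h, 'a) halg \<Rightarrow> ('k \<Rightarrow> 'a \<Rightarrow> 'a) \<Rightarrow> bool" where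
  "is_diff_calc H A d \<longleftrightarrow>
    is_halg_com H A \<and>
    is_mor H (unit_obj H 1) (der H A) d \<and>
    (\<forall>c\<in>carrier (base H). \<forall>c'\<in>carrier (base H).
      icomp H A A A (tp H (iend H A) (iend H A) (d c) (d c')) = \<zero>\<^bsub>iend H A\<^esub>)"

definition con ::
  "('k, 'h) qhopf \<Rightarrow> ('k, 'h, 'a) halg \<Rightarrow> ('k \<Rightarrow> 'a \<Rightarrow> 'a) \<Rightarrow> ('k, 'h, 'a, 'v) hbimod
    \<Rightarrow> ('k, 'h, ('v \<Rightarrow> 'v) \<times> 'k) hmod"
where
  "con H A d V = (let E = iend H V; P = prod_obj E (unit_obj H 1); l = lhat H A V (lact V) in
    ker_obj P (ihom H A E)
      (zeta H P A E (tlift E (\<lambda>(L, c) a.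
        ibracket H V L (l a) \<ominus>\<^bsub>E\<^esub> l (ev H A A (tp H (iend H A) A (d c) a))))))"

text \<open>
  The sum is only meant for pairs with the same second component. It is written for elements
  of \<open>end(V) \<times> I[1]\<close>.
\<close>

definition boxplus ::
  "('k, 'h) qhopf \<Rightarrow> ('k, 'h, 'a) halg \<Rightarrow> ('k, 'h, 'a, 'v) hbimod \<Rightarrow> ('k, 'h, 'a, 'w) hbimod
    \<Rightarrow> ('v \<Rightarrow> 'v) \<times> 'k \<Rightarrow> ('w \<Rightarrow> 'w) \<times> 'k
    \<Rightarrow> (('v, 'w) tens set \<Rightarrow> ('v, 'w) tens set) \<times> 'k"
where
  "boxplus H A V W D D' =
    (induced_end (tensor H V W) (bal_rel H A V W)
      (itensor H V V W W (tp H (iend H V) (iend H W) (fst D) (iunit H W))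
        \<oplus>\<^bsub>iend H (tensor H V W)\<^esub>
       itensor H V V W W (tp H (iend H V) (iend H W) (iunit H V) (fst D'))),
     snd D)"

definition curv ::
  "('k, 'h) qhopf \<Rightarrow> ('k, 'h, 'v, 'm) hmod_scheme \<Rightarrow> ('v \<Rightarrow> 'v) \<times> 'k \<Rightarrow> 'v \<Rightarrow> 'v"
where
  "curv H V D = ibracket H V (fst D) (fst D)"

end

theory Submission
  imports Defs
begin

text \<open>
  Write \<open>T = V \<otimes> W\<close>, \<open>f = L \<circledast> 1 + 1 \<circledast> L'\<close> and let \<open>N\<close> be the image of \<open>r \<otimes> id - (id \<otimes> l) \<circ> \<Phi>\<close>.
  An element of an internal hom is determined by its evaluation, and evaluating \<open>L \<circledast> 1\<close> and \<open>1 \<circledast> L'\<close>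
  gives the evident actions of \<open>end(V)\<close> and \<open>end(W)\<close> on the two factors of \<open>T\<close>. By the pentagon and
  the hexagons both \<open>L \<mapsto> L \<circledast> 1\<close> and \<open>L' \<mapsto> 1 \<circledast> L'\<close> respect composition and their images commute
  up to the braiding. As the braiding is symmetric, the mixed brackets vanish, so that
  \<open>[f, f] = [L, L] \<circledast> 1 + 1 \<circledast> [L', L']\<close> holds in \<open>end(T)\<close>, whether or not \<open>L\<close> and \<open>L'\<close> are homogeneous.

  It remains to pass to \<open>T/N\<close>. The connections with equal second component form an object \<open>C\<close> acting on
  \<open>V\<close>, \<open>W\<close> and (through \<open>d\<close>) \<open>A\<close>, and the defining equation of \<open>con\<close> says that \<open>l\<close> commutes with the
  action of \<open>C\<close> on \<open>A \<otimes> V\<close> by the Leibniz rule. Since the braiding is symmetric and the bimodules are,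
  so does \<open>r\<close>, and since \<open>\<Phi>\<close> does too, \<open>C\<close> maps \<open>N\<close> to itself. Finally, on endomorphisms that preserve
  \<open>N\<close>, the passage to the induced endomorphism respects composition and the braiding, hence brackets.
\<close>

text \<open>The obstacle is that a connection \<open>L\<close> is neither \<open>H\<close>-invariant
  nor homogeneous. Through \<phi>, \<open>R\<close> and \<zeta> every composite involves translates
  of \<open>L\<close> under \<open>H\<close>, so a property such as preserving \<open>N\<close> has
  to be carried for all translates at once. Statements are therefore made for objects that act
  (internal homs, kernels, \<open>con\<close>) and for morphisms between them; a single element is
  inserted only at the end. The structure of \<open>H\<close> is used at two levels. Below,
  identities in tensor powers of \<open>H\<close> are read through multilinear maps into a module,
  which gives identities between nested Sweedler sums. The inverted pentagons, the counit
  normalizations of \<phi> in the outer slots and of \<open>R\<close>, and the two identities that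
  make \<zeta> and \<open>ev\<close> inverse to each other are derived there. Above, the arguments
  rest on naturality, pentagon, hexagons, symmetry and the universal property of \<open>ev\<close>.
  Rebracketing is concentrated in \<open>sig\<close>, the exchange of the first two factors of a
  right-nested product, and in two rules for moving factors past a product.\<close>

lemma lin_closed: "is_linear k V W f ==> x \<in> carrier V ==> f x \<in> carrier W"
  by (auto simp: is_linear_def)

lemma lin_add: "is_linear k V W f ==> x \<in> carrier V ==> y \<in> carrier V ==> f (x \<oplus>\<^bsub>V\<^esub> y) = f x \<oplus>\<^bsub>W\<^esub> f y"
  by (auto simp: is_linear_def)

lemma lin_smult: "is_linear k V W f ==> c \<in> carrier k ==> x \<in> carrier V ==> f (c \<odot>\<^bsub>V\<^esub> x) = c \<odot>\<^bsub>W\<^esub> f x"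
  by (auto simp: is_linear_def)

lemma linI:
  assumes "!!x. x \<in> carrier V ==> f x \<in> carrier W"
    and "!!x y. x \<in> carrier V ==> y \<in> carrier V ==> f (x \<oplus>\<^bsub>V\<^esub> y) = f x \<oplus>\<^bsub>W\<^esub> f y"
    and "!!c x. c \<in> carrier k ==> x \<in> carrier V ==> f (c \<odot>\<^bsub>V\<^esub> x) = c \<odot>\<^bsub>W\<^esub> f x"
  shows "is_linear k V W f"
  using assms by (auto simp: is_linear_def)

lemma lin_zero:
  assumes "module k V" "module k W" "is_linear k V W f"
  shows "f \<zero>\<^bsub>V\<^esub> = \<zero>\<^bsub>W\<^esub>"
proof -
  interpret V: module k V by fact
  interpret W: module k W by fact
  have "f (\<zero>\<^bsub>k\<^esub> \<odot>\<^bsub>V\<^esub> \<zero>\<^bsub>V\<^esub>) = \<zero>\<^bsub>k\<^esub> \<odot>\<^bsub>W\<^esub> f \<zero>\<^bsub>V\<^esub>"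
    using assms(3) by (intro lin_smult[of k V W f]) auto
  then show ?thesis using lin_closed[OF assms(3) V.M.zero_closed] by simp
qed

lemma lin_neg:
  assumes "module k V" "module k W" "is_linear k V W f" "x \<in> carrier V"
  shows "f (\<ominus>\<^bsub>V\<^esub> x) = \<ominus>\<^bsub>W\<^esub> f x"
proof -
  interpret V: module k V by fact
  interpret W: module k W by fact
  have "f (\<ominus>\<^bsub>V\<^esub> x) \<oplus>\<^bsub>W\<^esub> f x = \<zero>\<^bsub>W\<^esub>"
    using lin_add[OF assms(3), of "\<ominus>\<^bsub>V\<^esub> x" x] assms(4) lin_zero[OF assms(1-3)] by (simp add: V.M.l_neg)
  then show ?thesis
    using lin_closed[OF assms(3)] assms(4) by (metis W.M.minus_equality V.M.a_inv_closed)
qed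

lemma lin_minus:
  assumes "module k V" "module k W" "is_linear k V W f" "x \<in> carrier V" "y \<in> carrier V"
  shows "f (x \<ominus>\<^bsub>V\<^esub> y) = f x \<ominus>\<^bsub>W\<^esub> f y"
proof -
  interpret V: module k V by fact
  show ?thesis using assms
    by (simp add: a_minus_def lin_neg[OF assms(1-3)] lin_add[OF assms(3)])
qed

lemma lin_finsum:
  assumes "module k V" "module k W" "is_linear k V W f" "g \<in> I \<rightarrow> carrier V"
  shows "f (finsum V g I) = finsum W (\<lambda>i. f (g i)) I"
proof -
  interpret V: module k V by fact
  interpret W: module k W by fact
  note c = lin_closed[OF assms(3)]
  show ?thesis
  proof (cases "finite I")
    case False
    then show ?thesis using lin_zero[OF assms(1-3)]
      by (simp add: finsum_def finprod_def)
  next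
    case True
    then show ?thesis using assms(4)
    proof (induction I)
      case empty show ?case using lin_zero[OF assms(1-3)] by simp
    next
      case (insert i I)
      then have "finsum V g I \<in> carrier V" by (intro V.M.finsum_closed) auto
      with insert show ?case
        by (simp add: Pi_iff lin_add[OF assms(3)] c)
    qed
  qed
qed

text \<open>Linearity in one variable is proved by descending through the term with these rules;
  multilinearity is the same with the other variables fixed. Side conditions are left to the
  simplifier.\<close>

named_theorems lin_intros

lemma lin_id [lin_intros]: "is_linear k V V (\<lambda>x. x)"
  by (auto simp: is_linear_def)

lemma lin_comp: "is_linear k V W f ==> is_linear k W X g ==> is_linear k V X (\<lambda>x. g (f x))"
  by (auto simp: is_linear_def Pi_iff)

lemma lin_cong: "is_linear k V W f ==> module k V ==> (!!x. x \<in> carrier V ==> f x = g x) ==> is_linear k V W g"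
proof -
  assume a: "is_linear k V W f" "module k V" "!!x. x \<in> carrier V ==> f x = g x"
  interpret V: module k V by fact
  show ?thesis using a by (intro linI) (auto simp: lin_closed lin_add lin_smult simp flip: a(3))
qed

lemma lin_const0: 
  assumes "module k V" "module k W" shows "is_linear k V W (\<lambda>x. \<zero>\<^bsub>W\<^esub>)"
proof -
  interpret W: module k W by fact
  show ?thesis by (auto intro!: linI)
qed

lemma lin_plus [lin_intros]:
  assumes "module k W" "is_linear k V W f" "is_linear k V W g"
  shows "is_linear k V W (\<lambda>x. f x \<oplus>\<^bsub>W\<^esub> g x)"
proof -
  interpret W: module k W by fact
  show ?thesis
    using assms by (intro linI) (auto simp: lin_closed lin_add lin_smult W.smult_r_distr W.M.a_ac)
qed

lemma lin_uminus [lin_intros]: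
  assumes "module k W" "is_linear k V W f"
  shows "is_linear k V W (\<lambda>x. \<ominus>\<^bsub>W\<^esub> f x)"
proof -
  interpret W: module k W by fact
  show ?thesis
    using assms by (intro linI) (auto simp: lin_closed lin_add lin_smult W.smult_r_minus W.M.minus_add W.M.a_ac)
qed

lemma lin_diff [lin_intros]:
  assumes "module k W" "is_linear k V W f" "is_linear k V W g"
  shows "is_linear k V W (\<lambda>x. f x \<ominus>\<^bsub>W\<^esub> g x)"
  unfolding a_minus_def by (intro lin_intros assms)

lemma lin_smul [lin_intros]:
  assumes "module k W" "is_linear k V W f" "c \<in> carrier k"
  shows "is_linear k V W (\<lambda>x. c \<odot>\<^bsub>W\<^esub> f x)"
proof -
  interpret W: module k W by fact
  show ?thesis
    using assms by (intro linI) (auto simp: lin_closed lin_add lin_smult W.smult_r_distr W.R.m_comm simp flip: W.smult_assoc1)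
qed

lemma lin_finsum_fun [lin_intros]:
  assumes "module k V" "module k W" "!!i. i \<in> I ==> is_linear k V W (f i)"
  shows "is_linear k V W (\<lambda>x. finsum W (\<lambda>i. f i x) I)"
proof (cases "finite I")
  case False
  then show ?thesis using lin_const0[OF assms(1,2)]
      by (simp add: finsum_def finprod_def)
next
  case True
  interpret W: module k W by fact
  interpret V: module k V by fact
  from True show ?thesis using assms(3)
  proof (induction I)
    case empty then show ?case using lin_const0[OF assms(1,2)] by simp
  next
    case (insert i I)
    then have l: "is_linear k V W (\<lambda>x. f i x \<oplus>\<^bsub>W\<^esub> finsum W (\<lambda>i. f i x) I)" by (intro lin_plus assms(2)) auto
    show ?case
    proof (rule lin_cong[OF l assms(1)])
      fix x assume x: "x \<in> carrier V"
      have "(\<lambda>i. f i x) \<in> I \<rightarrow> carrier W" "f i x \<in> carrier W"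
        by (auto intro!: lin_closed[OF insert.prems x])
      with insert(1,2) show "f i x \<oplus>\<^bsub>W\<^esub> (\<Oplus>\<^bsub>W\<^esub>i\<in>I. f i x) = (\<Oplus>\<^bsub>W\<^esub>i\<in>insert i I. f i x)" by simp
    qed
  qed
qed

section \<open>Bilinear maps and sums over lists of pairs\<close>

definition bilin where
  "bilin k V W M b \<longleftrightarrow> (\<forall>w\<in>carrier W. is_linear k V M (\<lambda>v. b v w)) \<and> (\<forall>v\<in>carrier V. is_linear k W M (b v))"

lemma bilinI:
  "(!!w. w \<in> carrier W ==> is_linear k V M (\<lambda>v. b v w)) ==> (!!v. v \<in> carrier V ==> is_linear k W M (\<lambda>w. b v w)) ==> bilin k V W M b"
  by (auto simp: bilin_def)

lemma bilin_left: "bilin k V W M b ==> w \<in> carrier W ==> is_linear k V M (\<lambda>v. b v w)"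
  and bilin_right: "bilin k V W M b ==> v \<in> carrier V ==> is_linear k W M (b v)"
  by (auto simp: bilin_def)

lemma bilin_closed: "bilin k V W M b ==> v \<in> carrier V ==> w \<in> carrier W ==> b v w \<in> carrier M"
  using bilin_right lin_closed by metis

text \<open>The sum behind \<open>tlift\<close>, taken over an arbitrary list instead of the chosen
  representative, so that invariance under \<open>tens_eq\<close> can be stated.\<close>

definition psum where
  "psum M b xs = foldr (\<lambda>(v, w) s. b v w \<oplus>\<^bsub>M\<^esub> s) xs \<zero>\<^bsub>M\<^esub>"

lemma tlift_psum: "tlift M b X = psum M b (trep X)"
  by (simp add: tlift_def psum_def)

lemma psum_Nil [simp]: "psum M b [] = \<zero>\<^bsub>M\<^esub>"
  and psum_Cons [simp]: "psum M b ((v, w) # xs) = b v w \<oplus>\<^bsub>M\<^esub> psum M b xs"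
  by (simp_all add: psum_def)

context
  fixes k :: "'k ring" and M :: "('k, 'x, 'o) module_scheme"
  assumes M: "module k M"
begin

interpretation M: module k M by (rule M)

lemma psum_closed: "(!!v w. (v, w) \<in> set xs ==> b v w \<in> carrier M) ==> psum M b xs \<in> carrier M"
  by (induction xs) auto

lemma psum_append:
  "(!!v w. (v, w) \<in> set xs ==> b v w \<in> carrier M) ==> (!!v w. (v, w) \<in> set ys ==> b v w \<in> carrier M) ==>
    psum M b (xs @ ys) = psum M b xs \<oplus>\<^bsub>M\<^esub> psum M b ys"
  by (induction xs) (auto simp: psum_closed M.M.a_assoc)

lemma psum_add:
  "(!!v w. (v, w) \<in> set xs ==> b v w \<in> carrier M) ==> (!!v w. (v, w) \<in> set xs ==> b' v w \<in> carrier M) ==>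
    psum M (\<lambda>v w. b v w \<oplus>\<^bsub>M\<^esub> b' v w) xs = psum M b xs \<oplus>\<^bsub>M\<^esub> psum M b' xs"
  by (induction xs) (auto simp: psum_closed M.M.a_ac)

lemma psum_zero: "psum M (\<lambda>v w. \<zero>\<^bsub>M\<^esub>) xs = \<zero>\<^bsub>M\<^esub>"
  by (induction xs) auto

lemma psum_swap:
  "(!!v w v' w'. (v, w) \<in> set xs ==> (v', w') \<in> set ys ==> b v w v' w' \<in> carrier M) ==>
    psum M (\<lambda>v w. psum M (b v w) ys) xs = psum M (\<lambda>v' w'. psum M (\<lambda>v w. b v w v' w') xs) ys"
proof (induction xs)
  case Nil then show ?case by (simp add: psum_zero)
next
  case (Cons p xs)
  then show ?case by (cases p) (auto simp: psum_add psum_closed)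
qed

end

lemma psum_cong: "(!!v w. (v, w) \<in> set xs ==> b v w = b' v w) ==> psum M b xs = psum M b' xs"
  by (induction xs) auto

lemma psum_map: "psum M b (map (\<lambda>(v, w). (f v w, g v w)) xs) = psum M (\<lambda>v w. b (f v w) (g v w)) xs"
  by (induction xs) auto

lemma lin_psum:
  assumes "module k M" "module k N" "is_linear k M N f" "!!v w. (v, w) \<in> set xs ==> b v w \<in> carrier M"
  shows "f (psum M b xs) = psum N (\<lambda>v w. f (b v w)) xs"
  using assms(4)
  by (induction xs) (auto simp: lin_zero[OF assms(1-3)] lin_add[OF assms(3)] psum_closed[OF assms(1)])

lemma psum_lin:
  assumes "module k M" "module k N" "!!v w. (v, w) \<in> set xs ==> is_linear k M N (b v w)"
  shows "is_linear k M N (\<lambda>x. psum N (\<lambda>v w. b v w x) xs)"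
  using assms(3)
proof (induction xs)
  case Nil then show ?case by (simp add: lin_const0[OF assms(1,2)])
next
  case (Cons p xs)
  then show ?case by (cases p) (auto intro!: lin_plus assms(2))
qed

section \<open>Tensor products\<close>

locale two_modules =
  fixes k :: "'k ring" and V :: "('k, 'v, 'm) module_scheme" and W :: "('k, 'w, 'n) module_scheme"
  assumes V: "module k V" and W: "module k W"
begin

sublocale V: module k V by (rule V)
sublocale W: module k W by (rule W)

lemma tens_eq_carrier:
  "tens_eq k V W xs ys ==> set xs \<subseteq> carrier V \<times> carrier W \<and> set ys \<subseteq> carrier V \<times> carrier W"
  by (induction rule: tens_eq.induct) auto

lemma tclass_eqI: "tens_eq k V W xs ys ==> tclass k V W xs = tclass k V W ys"
  unfolding tclass_def by (auto intro: tens_eq.sym tens_eq.trans)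

lemma trep_tens_eq: "set xs \<subseteq> carrier V \<times> carrier W ==> tens_eq k V W xs (trep (tclass k V W xs))"
  unfolding trep_def tclass_def mem_Collect_eq by (rule someI) (rule tens_eq.refl)

lemma tens_carrierI: "set xs \<subseteq> carrier V \<times> carrier W ==> tclass k V W xs \<in> carrier (tens k V W)"
  by (auto simp: tens_def)

lemma tens_carrierE:
  assumes "X \<in> carrier (tens k V W)"
  obtains xs where "set xs \<subseteq> carrier V \<times> carrier W" "X = tclass k V W xs"
  using assms by (auto simp: tens_def)

lemma trep_carrier: "X \<in> carrier (tens k V W) ==> set (trep X) \<subseteq> carrier V \<times> carrier W"
  by (elim tens_carrierE) (use trep_tens_eq tens_eq_carrier in blast)

lemma tens_add_tclass:
  assumes "set xs \<subseteq> carrier V \<times> carrier W" "set ys \<subseteq> carrier V \<times> carrier W"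
  shows "tclass k V W xs \<oplus>\<^bsub>tens k V W\<^esub> tclass k V W ys = tclass k V W (xs @ ys)"
proof -
  have "tens_eq k V W (xs @ ys) (trep (tclass k V W xs) @ trep (tclass k V W ys))"
    by (intro tens_eq.append trep_tens_eq assms)
  then show ?thesis by (simp add: tens_def tclass_eqI)
qed

text \<open>Scalars act on the left entries of a representative, so well-definedness is a check on
  the generators of the congruence. For \<open>balanced\<close> two scalars have to be exchanged,
  which uses commutativity of \<open>k\<close>.\<close>

lemma tens_eq_smult:
  assumes c: "c \<in> carrier k"
  shows "tens_eq k V W xs ys ==>
    tens_eq k V W (map (\<lambda>(v, w). (c \<odot>\<^bsub>V\<^esub> v, w)) xs) (map (\<lambda>(v, w). (c \<odot>\<^bsub>V\<^esub> v, w)) ys)"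
proof (induction rule: tens_eq.induct)
  case (refl xs) then show ?case using c by (intro tens_eq.refl) auto
next
  case (sym xs ys) show ?case by (rule tens_eq.sym) (rule sym.IH)
next
  case (trans xs ys zs) then show ?case using tens_eq.trans by blast
next
  case (append xs ys us vs) then show ?case by (auto intro: tens_eq.append)
next
  case (comm xs ys) then show ?case using c unfolding map_append by (intro tens_eq.comm) auto
next
  case (zero w) then show ?case using c by (auto intro: tens_eq.zero)
next
  case (add_left v v' w) then show ?case using c by (auto simp: V.smult_r_distr intro: tens_eq.add_left)
next
  case (add_right v w w') then show ?case using c by (auto intro: tens_eq.add_right)
next
  case (balanced d v w)
  then show ?case using c tens_eq.balanced[of d k "c \<odot>\<^bsub>V\<^esub> v" V w W]
    by (simp add: V.R.m_comm flip: V.smult_assoc1)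
qed

lemma tens_smult_tclass:
  assumes "set xs \<subseteq> carrier V \<times> carrier W" "c \<in> carrier k"
  shows "c \<odot>\<^bsub>tens k V W\<^esub> tclass k V W xs = tclass k V W (map (\<lambda>(v, w). (c \<odot>\<^bsub>V\<^esub> v, w)) xs)"
  using tens_eq_smult[OF assms(2) trep_tens_eq[OF assms(1)]] by (simp add: tens_def tclass_eqI)

lemma tens_zero: "\<zero>\<^bsub>tens k V W\<^esub> = tclass k V W []"
  by (simp add: tens_def)

lemma tens_eq_neg:
  assumes "set xs \<subseteq> carrier V \<times> carrier W"
  shows "tens_eq k V W (map (\<lambda>(v, w). (\<ominus>\<^bsub>V\<^esub> v, w)) xs @ xs) []"
  using assms
proof (induction xs)
  case Nil then show ?case by (simp add: tens_eq.refl)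
next
  case (Cons p xs)
  obtain v w where p: "p = (v, w)" "v \<in> carrier V" "w \<in> carrier W" using Cons by auto
  let ?m = "map (\<lambda>(v, w). (\<ominus>\<^bsub>V\<^esub> v, w)) xs"
  have xs: "set xs \<subseteq> carrier V \<times> carrier W" and m: "set ?m \<subseteq> carrier V \<times> carrier W" using Cons by auto
  \<comment> \<open>The head pair is moved in front of the negated tail, where it meets its own
    negative.\<close>
  have 1: "tens_eq k V W ((?m @ [(v, w)]) @ xs) (([(v, w)] @ ?m) @ xs)"
    using p xs m by (intro tens_eq.append tens_eq.comm tens_eq.refl) auto
  have 2: "tens_eq k V W ([(\<ominus>\<^bsub>V\<^esub> v, w)] @ ((?m @ [(v, w)]) @ xs)) ([(\<ominus>\<^bsub>V\<^esub> v, w)] @ (([(v, w)] @ ?m) @ xs))"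
    using p by (intro tens_eq.append[OF tens_eq.refl 1]) auto
  have 3: "tens_eq k V W [(\<ominus>\<^bsub>V\<^esub> v, w), (v, w)] []"
    using p tens_eq.add_left[of "\<ominus>\<^bsub>V\<^esub> v" V v w W k] tens_eq.zero[of w W k V]
    by (auto simp: V.M.l_neg intro: tens_eq.sym tens_eq.trans)
  have "tens_eq k V W ([(\<ominus>\<^bsub>V\<^esub> v, w), (v, w)] @ (?m @ xs)) ([] @ [])"
    by (intro tens_eq.append 3 Cons.IH xs)
  with 2 show ?case using p by (auto intro: tens_eq.trans)
qed

lemma tens_abelian_group: "abelian_group (tens k V W)"
proof (rule abelian_groupI)
  fix X assume "X \<in> carrier (tens k V W)"
  then obtain xs where xs: "set xs \<subseteq> carrier V \<times> carrier W" "X = tclass k V W xs" by (rule tens_carrierE)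
  have n: "set (map (\<lambda>(v, w). (\<ominus>\<^bsub>V\<^esub> v, w)) xs) \<subseteq> carrier V \<times> carrier W" using xs by auto
  show "\<exists>Y\<in>carrier (tens k V W). Y \<oplus>\<^bsub>tens k V W\<^esub> X = \<zero>\<^bsub>tens k V W\<^esub>"
  proof (rule bexI)
    show "tclass k V W (map (\<lambda>(v, w). (\<ominus>\<^bsub>V\<^esub> v, w)) xs) \<oplus>\<^bsub>tens k V W\<^esub> X = \<zero>\<^bsub>tens k V W\<^esub>"
      unfolding xs(2) tens_add_tclass[OF n xs(1)] tens_zero by (rule tclass_eqI[OF tens_eq_neg[OF xs(1)]])
  qed (rule tens_carrierI[OF n])
next
  show "\<zero>\<^bsub>tens k V W\<^esub> \<in> carrier (tens k V W)" unfolding tens_zero by (rule tens_carrierI) simp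
next
  fix X Y assume "X \<in> carrier (tens k V W)" "Y \<in> carrier (tens k V W)"
  then obtain xs ys where xs: "set xs \<subseteq> carrier V \<times> carrier W" "X = tclass k V W xs"
    and ys: "set ys \<subseteq> carrier V \<times> carrier W" "Y = tclass k V W ys" by (auto elim!: tens_carrierE)
  have xy: "set (xs @ ys) \<subseteq> carrier V \<times> carrier W" using xs ys by simp
  show "X \<oplus>\<^bsub>tens k V W\<^esub> Y \<in> carrier (tens k V W)"
    unfolding xs(2) ys(2) tens_add_tclass[OF xs(1) ys(1)] by (rule tens_carrierI[OF xy])
  show "X \<oplus>\<^bsub>tens k V W\<^esub> Y = Y \<oplus>\<^bsub>tens k V W\<^esub> X"
    unfolding xs(2) ys(2) tens_add_tclass[OF xs(1) ys(1)] tens_add_tclass[OF ys(1) xs(1)]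
    by (intro tclass_eqI tens_eq.comm xs ys)
  fix Z assume "Z \<in> carrier (tens k V W)"
  then obtain zs where zs: "set zs \<subseteq> carrier V \<times> carrier W" "Z = tclass k V W zs" by (rule tens_carrierE)
  have yz: "set (ys @ zs) \<subseteq> carrier V \<times> carrier W" using zs ys by simp
  show "(X \<oplus>\<^bsub>tens k V W\<^esub> Y) \<oplus>\<^bsub>tens k V W\<^esub> Z = X \<oplus>\<^bsub>tens k V W\<^esub> (Y \<oplus>\<^bsub>tens k V W\<^esub> Z)"
    unfolding xs(2) ys(2) zs(2) tens_add_tclass[OF xs(1) ys(1)] tens_add_tclass[OF ys(1) zs(1)]
      tens_add_tclass[OF xy zs(1)] tens_add_tclass[OF xs(1) yz] by simp
next
  fix X assume "X \<in> carrier (tens k V W)"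
  then obtain xs where xs: "set xs \<subseteq> carrier V \<times> carrier W" "X = tclass k V W xs" by (rule tens_carrierE)
  show "\<zero>\<^bsub>tens k V W\<^esub> \<oplus>\<^bsub>tens k V W\<^esub> X = X"
    using tens_add_tclass[of "[]" xs] xs by (simp add: tens_zero)
qed

lemma tclass_Cons:
  assumes "v \<in> carrier V" "w \<in> carrier W" "set xs \<subseteq> carrier V \<times> carrier W"
  shows "tclass k V W ((v, w) # xs) = tpure k V W v w \<oplus>\<^bsub>tens k V W\<^esub> tclass k V W xs"
  using assms tens_add_tclass[of "[(v, w)]" xs] by (simp add: tpure_def)

lemma tpure_closed [simp]: "v \<in> carrier V ==> w \<in> carrier W ==> tpure k V W v w \<in> carrier (tens k V W)"
  unfolding tpure_def by (rule tens_carrierI) auto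

lemma tpure_smult_left:
  "c \<in> carrier k ==> v \<in> carrier V ==> w \<in> carrier W ==> tpure k V W (c \<odot>\<^bsub>V\<^esub> v) w = c \<odot>\<^bsub>tens k V W\<^esub> tpure k V W v w"
  by (simp add: tpure_def tens_smult_tclass)

lemma tpure_smult_right:
  assumes "c \<in> carrier k" "v \<in> carrier V" "w \<in> carrier W"
  shows "tpure k V W v (c \<odot>\<^bsub>W\<^esub> w) = c \<odot>\<^bsub>tens k V W\<^esub> tpure k V W v w"
  unfolding tpure_smult_left[OF assms, symmetric] unfolding tpure_def
  by (intro tclass_eqI tens_eq.sym[OF tens_eq.balanced] assms)

lemma tpure_add_left:
  assumes "v \<in> carrier V" "v' \<in> carrier V" "w \<in> carrier W"
  shows "tpure k V W (v \<oplus>\<^bsub>V\<^esub> v') w = tpure k V W v w \<oplus>\<^bsub>tens k V W\<^esub> tpure k V W v' w"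
proof -
  have "tpure k V W (v \<oplus>\<^bsub>V\<^esub> v') w = tclass k V W [(v, w), (v', w)]"
    unfolding tpure_def by (intro tclass_eqI tens_eq.add_left assms)
  then show ?thesis using assms tens_add_tclass[of "[(v, w)]" "[(v', w)]"] by (simp add: tpure_def)
qed

lemma tpure_add_right:
  assumes "v \<in> carrier V" "w \<in> carrier W" "w' \<in> carrier W"
  shows "tpure k V W v (w \<oplus>\<^bsub>W\<^esub> w') = tpure k V W v w \<oplus>\<^bsub>tens k V W\<^esub> tpure k V W v w'"
proof -
  have "tpure k V W v (w \<oplus>\<^bsub>W\<^esub> w') = tclass k V W [(v, w), (v, w')]"
    unfolding tpure_def by (intro tclass_eqI tens_eq.add_right assms)
  then show ?thesis using assms tens_add_tclass[of "[(v, w)]" "[(v, w')]"] by (simp add: tpure_def)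
qed

text \<open>Classes are represented by lists, so list induction peels off one pure tensor at a time.
  The module laws are reduced to pure tensors in this way.\<close>

lemma tens_induct [consumes 1, case_names zero add]:
  assumes "X \<in> carrier (tens k V W)"
    and "P \<zero>\<^bsub>tens k V W\<^esub>"
    and "!!v w X. v \<in> carrier V ==> w \<in> carrier W ==> X \<in> carrier (tens k V W) ==> P X ==>
      P (tpure k V W v w \<oplus>\<^bsub>tens k V W\<^esub> X)"
  shows "P X"
proof -
  obtain xs where xs: "set xs \<subseteq> carrier V \<times> carrier W" "X = tclass k V W xs" using assms(1) by (rule tens_carrierE)
  have "P (tclass k V W xs)" using xs(1)
  proof (induction xs)
    case Nil show ?case using assms(2) by (simp add: tens_zero)
  next
    case (Cons p xs)
    then show ?case by (cases p) (auto simp: tclass_Cons intro!: assms(3) tens_carrierI)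
  qed
  with xs show ?thesis by simp
qed

lemma tens_smult_closed:
  assumes "c \<in> carrier k" "X \<in> carrier (tens k V W)" shows "c \<odot>\<^bsub>tens k V W\<^esub> X \<in> carrier (tens k V W)"
proof -
  obtain xs where xs: "set xs \<subseteq> carrier V \<times> carrier W" "X = tclass k V W xs" using assms(2) by (rule tens_carrierE)
  show ?thesis unfolding xs(2) tens_smult_tclass[OF xs(1) assms(1)] using xs assms by (intro tens_carrierI) auto
qed

lemma tens_smult_add:
  assumes "c \<in> carrier k" "X \<in> carrier (tens k V W)" "Y \<in> carrier (tens k V W)"
  shows "c \<odot>\<^bsub>tens k V W\<^esub> (X \<oplus>\<^bsub>tens k V W\<^esub> Y) = c \<odot>\<^bsub>tens k V W\<^esub> X \<oplus>\<^bsub>tens k V W\<^esub> c \<odot>\<^bsub>tens k V W\<^esub> Y"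
proof -
  obtain xs where xs: "set xs \<subseteq> carrier V \<times> carrier W" "X = tclass k V W xs" using assms(2) by (rule tens_carrierE)
  obtain ys where ys: "set ys \<subseteq> carrier V \<times> carrier W" "Y = tclass k V W ys" using assms(3) by (rule tens_carrierE)
  have m: "set (map (\<lambda>(v, w). (c \<odot>\<^bsub>V\<^esub> v, w)) zs) \<subseteq> carrier V \<times> carrier W"
    if "set zs \<subseteq> carrier V \<times> carrier W" for zs using that assms(1) by auto
  have xy: "set (xs @ ys) \<subseteq> carrier V \<times> carrier W" using xs ys by simp
  show ?thesis
    unfolding xs(2) ys(2) tens_add_tclass[OF xs(1) ys(1)] tens_smult_tclass[OF xs(1) assms(1)]
      tens_smult_tclass[OF ys(1) assms(1)] tens_smult_tclass[OF xy assms(1)] tens_add_tclass[OF m[OF xs(1)] m[OF ys(1)]]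
    by (simp only: map_append)
qed

lemma tens_module: "module k (tens k V W)"
proof -
  interpret T: abelian_group "tens k V W" by (rule tens_abelian_group)
  have z: "c \<odot>\<^bsub>tens k V W\<^esub> \<zero>\<^bsub>tens k V W\<^esub> = \<zero>\<^bsub>tens k V W\<^esub>" if "c \<in> carrier k" for c
    using tens_smult_tclass[of "[]" c] that by (simp add: tens_zero)
  note s = tens_smult_closed tens_smult_add tpure_smult_left[symmetric]
  show ?thesis
  proof (rule moduleI)
    show "cring k" by (rule V.R.is_cring)
    show "abelian_group (tens k V W)" by (rule tens_abelian_group)
  next
    fix a b X assume a: "a \<in> carrier k" "b \<in> carrier k" and X: "X \<in> carrier (tens k V W)"
    show "(a \<oplus>\<^bsub>k\<^esub> b) \<odot>\<^bsub>tens k V W\<^esub> X = a \<odot>\<^bsub>tens k V W\<^esub> X \<oplus>\<^bsub>tens k V W\<^esub> b \<odot>\<^bsub>tens k V W\<^esub> X"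
      using X by (induction rule: tens_induct) (use a in \<open>simp_all add: z s V.smult_l_distr tpure_add_left T.a_ac\<close>)
    show "(a \<otimes>\<^bsub>k\<^esub> b) \<odot>\<^bsub>tens k V W\<^esub> X = a \<odot>\<^bsub>tens k V W\<^esub> (b \<odot>\<^bsub>tens k V W\<^esub> X)"
      using X by (induction rule: tens_induct) (use a in \<open>simp_all add: z s V.smult_assoc1\<close>)
  next
    fix X assume X: "X \<in> carrier (tens k V W)"
    show "\<one>\<^bsub>k\<^esub> \<odot>\<^bsub>tens k V W\<^esub> X = X"
      using X by (induction rule: tens_induct) (simp_all add: z s)
  qed (auto simp: tens_smult_closed tens_smult_add)
qed

sublocale T: module k "tens k V W" by (rule tens_module)

lemma bilin_tpure: "bilin k V W (tens k V W) (tpure k V W)"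
  by (intro bilinI linI) (auto simp: tpure_add_left tpure_add_right tpure_smult_left tpure_smult_right)

text \<open>Each generator of the congruence is respected by a bilinear \<open>b\<close>. This is
  the universal property of the tensor product: it makes \<open>tlift\<close> independent of the
  choice made by \<open>trep\<close>.\<close>

lemma bilin_psum:
  assumes M: "module k M" and b: "bilin k V W M b"
  shows "tens_eq k V W xs ys ==> psum M b xs = psum M b ys"
proof (induction rule: tens_eq.induct)
  case (append xs ys us vs)
  then have "set xs \<subseteq> carrier V \<times> carrier W" "set ys \<subseteq> carrier V \<times> carrier W"
    "set us \<subseteq> carrier V \<times> carrier W" "set vs \<subseteq> carrier V \<times> carrier W"
    using tens_eq_carrier by blast+
  then have c: "b v w \<in> carrier M" if "(v, w) \<in> set xs \<union> set ys \<union> set us \<union> set vs" for v w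
    using that by (auto intro!: bilin_closed[OF b])
  show ?case using append.IH c by (simp add: psum_append[OF M])
next
  case (comm xs ys)
  interpret M: module k M by fact
  have c: "b v w \<in> carrier M" if "(v, w) \<in> set xs \<union> set ys" for v w
    using that comm by (auto intro!: bilin_closed[OF b])
  show ?case using c by (simp add: psum_append[OF M] M.M.a_comm psum_closed[OF M])
next
  case (zero w)
  interpret M: module k M by fact
  show ?case using lin_zero[OF V M bilin_left[OF b zero]] by simp
next
  case (add_left v v' w)
  interpret M: module k M by fact
  show ?case using add_left lin_add[OF bilin_left[OF b]] bilin_closed[OF b] by (simp add: M.M.a_assoc)
next
  case (add_right v w w')
  interpret M: module k M by fact
  show ?case using add_right lin_add[OF bilin_right[OF b]] bilin_closed[OF b] by (simp add: M.M.a_assoc)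
next
  case (balanced c v w)
  interpret M: module k M by fact
  show ?case using balanced lin_smult[OF bilin_right[OF b]] lin_smult[OF bilin_left[OF b]] by simp
qed auto

lemma tlift_tclass:
  assumes "module k M" "bilin k V W M b" "set xs \<subseteq> carrier V \<times> carrier W"
  shows "tlift M b (tclass k V W xs) = psum M b xs"
  unfolding tlift_psum by (rule bilin_psum[OF assms(1,2), symmetric]) (rule trep_tens_eq[OF assms(3)])

lemma tlift_pure:
  assumes "module k M" "bilin k V W M b" "v \<in> carrier V" "w \<in> carrier W"
  shows "tlift M b (tpure k V W v w) = b v w"
proof -
  interpret M: module k M by fact
  show ?thesis unfolding tpure_def using assms bilin_closed[OF assms(2)] by (simp add: tlift_tclass)
qed

lemma tlift_linear:
  assumes M: "module k M" and b: "bilin k V W M b"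
  shows "is_linear k (tens k V W) M (tlift M b)"
proof -
  interpret M: module k M by fact
  have c: "b v w \<in> carrier M" if "(v, w) \<in> set xs" "set xs \<subseteq> carrier V \<times> carrier W" for v w xs
    using that by (auto intro!: bilin_closed[OF b])
  show ?thesis
  proof (rule linI)
    fix X assume "X \<in> carrier (tens k V W)"
    then obtain xs where xs: "set xs \<subseteq> carrier V \<times> carrier W" "X = tclass k V W xs" by (rule tens_carrierE)
    then show "tlift M b X \<in> carrier M" using c by (auto simp: tlift_tclass[OF M b] intro!: psum_closed[OF M])
    fix a assume a: "a \<in> carrier k"
    have "set (map (\<lambda>(v, w). (a \<odot>\<^bsub>V\<^esub> v, w)) xs) \<subseteq> carrier V \<times> carrier W" using xs a by auto
    then have "tlift M b (a \<odot>\<^bsub>tens k V W\<^esub> X) = psum M (\<lambda>v w. b (a \<odot>\<^bsub>V\<^esub> v) w) xs" (is "?l = _")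
      using xs a by (simp add: tens_smult_tclass tlift_tclass[OF M b] psum_map)
    also have "\<dots> = psum M (\<lambda>v w. a \<odot>\<^bsub>M\<^esub> b v w) xs"
      using xs a by (intro psum_cong lin_smult[OF bilin_left[OF b]]) auto
    also have "\<dots> = a \<odot>\<^bsub>M\<^esub> psum M b xs"
      using c[OF _ xs(1)] by (intro lin_psum[OF M M, symmetric] lin_smul[OF M lin_id a]) auto
    finally show "?l = a \<odot>\<^bsub>M\<^esub> tlift M b X"
      using xs by (simp add: tlift_tclass[OF M b])
  next
    fix X Y assume "X \<in> carrier (tens k V W)" "Y \<in> carrier (tens k V W)"
    then obtain xs ys where xs: "set xs \<subseteq> carrier V \<times> carrier W" "X = tclass k V W xs"
      and ys: "set ys \<subseteq> carrier V \<times> carrier W" "Y = tclass k V W ys" by (auto elim!: tens_carrierE)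
    then show "tlift M b (X \<oplus>\<^bsub>tens k V W\<^esub> Y) = tlift M b X \<oplus>\<^bsub>M\<^esub> tlift M b Y"
      using c by (simp add: tens_add_tclass tlift_tclass[OF M b] psum_append[OF M])
  qed
qed

text \<open>The form in which generation by pure tensors is used throughout: equations between
  linear maps are checked on them.\<close>

lemma tens_linear_ext:
  assumes M: "module k M" and f: "is_linear k (tens k V W) M f" and g: "is_linear k (tens k V W) M g"
    and eq: "!!v w. v \<in> carrier V ==> w \<in> carrier W ==> f (tpure k V W v w) = g (tpure k V W v w)"
    and X: "X \<in> carrier (tens k V W)"
  shows "f X = g X"
  using X
proof (induction rule: tens_induct)
  case zero then show ?case using lin_zero[OF tens_module M f] lin_zero[OF tens_module M g] by simp
next
  case (add v w X) then show ?case using lin_add[OF f] lin_add[OF g] eq by simp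
qed

lemma tlift_closed:
  assumes "module k M" "X \<in> carrier (tens k V W)" "!!v w. v \<in> carrier V ==> w \<in> carrier W ==> b v w \<in> carrier M"
  shows "tlift M b X \<in> carrier M"
  unfolding tlift_psum using trep_carrier[OF assms(2)] assms(3) by (intro psum_closed[OF assms(1)]) auto

lemma tlift_cong:
  assumes "X \<in> carrier (tens k V W)" "!!v w. v \<in> carrier V ==> w \<in> carrier W ==> b v w = b' v w"
  shows "tlift M b X = tlift M b' X"
  unfolding tlift_psum using trep_carrier[OF assms(1)] assms(2) by (intro psum_cong) auto

lemma lin_tlift:
  assumes "module k M" "module k N" "is_linear k M N f" "X \<in> carrier (tens k V W)"
    "!!v w. v \<in> carrier V ==> w \<in> carrier W ==> b v w \<in> carrier M"
  shows "f (tlift M b X) = tlift N (\<lambda>v w. f (b v w)) X"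
  unfolding tlift_psum using trep_carrier[OF assms(4)] assms(5) by (intro lin_psum[OF assms(1-3)]) auto

lemma tlift_lin:
  assumes "module k M" "module k N" "X \<in> carrier (tens k V W)"
    "!!v w. v \<in> carrier V ==> w \<in> carrier W ==> is_linear k M N (\<lambda>x. b x v w)"
  shows "is_linear k M N (\<lambda>x. tlift N (b x) X)"
  unfolding tlift_psum using trep_carrier[OF assms(3)] assms(4)
  by (intro psum_lin[OF assms(1-2), of _ "\<lambda>v w x. b x v w"]) auto

lemma tlift_tpure: "X \<in> carrier (tens k V W) ==> tlift (tens k V W) (tpure k V W) X = X"
  by (rule tens_linear_ext[OF tens_module tlift_linear[OF tens_module bilin_tpure] lin_id])
    (simp_all add: tlift_pure[OF tens_module bilin_tpure])

end

text \<open>Both lifts are finite sums over chosen representatives, so this is an exchange of finite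
  sums in \<open>M\<close>.\<close>

lemma tlift_swap:
  assumes "two_modules k V W" "two_modules k V' W'" "module k M"
    "X \<in> carrier (tens k V W)" "Y \<in> carrier (tens k V' W')"
    "!!v w v' w'. v \<in> carrier V ==> w \<in> carrier W ==> v' \<in> carrier V' ==> w' \<in> carrier W' ==> b v w v' w' \<in> carrier M"
  shows "tlift M (\<lambda>v w. tlift M (b v w) Y) X = tlift M (\<lambda>v' w'. tlift M (\<lambda>v w. b v w v' w') X) Y"
  unfolding tlift_psum
  using two_modules.trep_carrier[OF assms(1,4)] two_modules.trep_carrier[OF assms(2,5)] assms(6)
  by (intro psum_swap[OF assms(3)]) blast

section \<open>Tensor products of algebras\<close>

lemma kalg_module: "is_kalgebra k H ==> module k H"
  and kalg_ring: "is_kalgebra k H ==> ring H"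
  by (auto simp: is_kalgebra_def)

lemma lin_mult_left [lin_intros]:
  assumes "is_kalgebra k H" "is_linear k V H f" "y \<in> carrier H"
  shows "is_linear k V H (\<lambda>x. f x \<otimes>\<^bsub>H\<^esub> y)"
proof -
  interpret H: ring H using assms by (simp add: kalg_ring)
  show ?thesis using assms by (intro linI) (auto simp: lin_closed lin_add lin_smult H.l_distr is_kalgebra_def)
qed

lemma lin_mult_right [lin_intros]:
  assumes "is_kalgebra k H" "is_linear k V H f" "y \<in> carrier H"
  shows "is_linear k V H (\<lambda>x. y \<otimes>\<^bsub>H\<^esub> f x)"
proof -
  interpret H: ring H using assms by (simp add: kalg_ring)
  show ?thesis using assms by (intro linI) (auto simp: lin_closed lin_add lin_smult H.r_distr is_kalgebra_def)
qed

lemma lin_tpure_left [lin_intros]: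
  assumes "module k V" "module k W" "is_linear k U V f" "w \<in> carrier W"
  shows "is_linear k U (tens k V W) (\<lambda>x. tpure k V W (f x) w)"
  using two_modules.bilin_tpure[of k V W] assms by (auto intro: lin_comp dest: bilin_left simp: two_modules_def)

lemma lin_tpure_right [lin_intros]:
  assumes "module k V" "module k W" "is_linear k U W f" "v \<in> carrier V"
  shows "is_linear k U (tens k V W) (\<lambda>x. tpure k V W v (f x))"
  using two_modules.bilin_tpure[of k V W] assms by (auto intro: lin_comp dest: bilin_right simp: two_modules_def)

lemma bilin_linear_left: "bilin k V W M b ==> is_linear k U V f ==> w \<in> carrier W ==> is_linear k U M (\<lambda>x. b (f x) w)"
  by (auto dest: bilin_left intro: lin_comp)

lemma bilin_linear_right: "bilin k V W M b ==> is_linear k U W f ==> v \<in> carrier V ==> is_linear k U M (\<lambda>x. b v (f x))"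
  by (auto dest: bilin_right intro: lin_comp)

text \<open>The product of two tensor classes is a list comprehension over representatives; sums
  over such a list become double sums.\<close>

lemma psum_concat:
  fixes k :: "'k ring"
  assumes "module k M" "!!v w v' w'. (v, w) \<in> set xs ==> (v', w') \<in> set ys ==> b (f v v') (g w w') \<in> carrier M"
  shows "psum M b (concat (map (\<lambda>(v, w). map (\<lambda>(v', w'). (f v v', g w w')) ys) xs)) =
    psum M (\<lambda>v w. psum M (\<lambda>v' w'. b (f v v') (g w w')) ys) xs"
  using assms(2)
proof (induction xs)
  case Nil then show ?case by simp
next
  case (Cons p xs)
  obtain v w where p: "p = (v, w)" by force
  have "psum M b (concat (map (\<lambda>(v, w). map (\<lambda>(v', w'). (f v v', g w w')) ys) (p # xs))) =
    psum M b (map (\<lambda>(v', w'). (f v v', g w w')) ys) \<oplus>\<^bsub>M\<^esub>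
    psum M b (concat (map (\<lambda>(v, w). map (\<lambda>(v', w'). (f v v', g w w')) ys) xs))"
    unfolding p by (simp, intro psum_append[OF assms(1)]) (use Cons.prems in \<open>auto simp: p\<close>)
  also have "psum M b (concat (map (\<lambda>(v, w). map (\<lambda>(v', w'). (f v v', g w w')) ys) xs)) =
    psum M (\<lambda>v w. psum M (\<lambda>v' w'. b (f v v') (g w w')) ys) xs"
    by (rule Cons.IH) (use Cons.prems in auto)
  finally show ?case by (simp add: p psum_map)
qed

locale two_algebras =
  fixes k :: "'k ring" and V :: "('k, 'v, 'm) module_scheme" and W :: "('k, 'w, 'n) module_scheme"
  assumes Vk: "is_kalgebra k V" and Wk: "is_kalgebra k W"
begin

sublocale two_modules k V W
  by (intro two_modules.intro kalg_module Vk Wk)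

sublocale rV: ring V using Vk by (rule kalg_ring)
sublocale rW: ring W using Wk by (rule kalg_ring)

abbreviation "T \<equiv> tens k V W"

lemma tclass_psum: "set xs \<subseteq> carrier V \<times> carrier W ==> tclass k V W xs = psum T (tpure k V W) xs"
  by (induction xs) (auto simp: tens_zero tclass_Cons)

text \<open>Trades the product of representatives for an iterated \<open>tlift\<close>, so that
  linearity in either argument comes from the lifts.\<close>

lemma tens_mult_tlift:
  assumes X: "X \<in> carrier T" and Y: "Y \<in> carrier T"
  shows "X \<otimes>\<^bsub>T\<^esub> Y = tlift T (\<lambda>v w. tlift T (\<lambda>v' w'. tpure k V W (v \<otimes>\<^bsub>V\<^esub> v') (w \<otimes>\<^bsub>W\<^esub> w')) Y) X"
proof -
  let ?l = "concat (map (\<lambda>(v, w). map (\<lambda>(v', w'). (v \<otimes>\<^bsub>V\<^esub> v', w \<otimes>\<^bsub>W\<^esub> w')) (trep Y)) (trep X))"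
  note c = trep_carrier[OF X] trep_carrier[OF Y]
  have "set ?l \<subseteq> carrier V \<times> carrier W" using c by fastforce
  then have "X \<otimes>\<^bsub>T\<^esub> Y = psum T (tpure k V W) ?l" by (simp add: tens_def flip: tclass_psum[unfolded tens_def])
  also have "\<dots> = psum T (\<lambda>v w. psum T (\<lambda>v' w'. tpure k V W (v \<otimes>\<^bsub>V\<^esub> v') (w \<otimes>\<^bsub>W\<^esub> w')) (trep Y)) (trep X)"
    by (rule psum_concat[OF tens_module]) (use c in \<open>auto intro!: tpure_closed\<close>)
  finally show ?thesis by (simp add: tlift_psum)
qed

lemma tens_mult_bilin_aux:
  assumes Y: "Y \<in> carrier T"
  shows "bilin k V W T (\<lambda>v w. tlift T (\<lambda>v' w'. tpure k V W (v \<otimes>\<^bsub>V\<^esub> v') (w \<otimes>\<^bsub>W\<^esub> w')) Y)"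
  by (intro bilinI tlift_lin tens_module lin_intros V W Vk Wk Y) auto

lemma tens_mult_bilin_aux2:
  assumes "v \<in> carrier V" "w \<in> carrier W"
  shows "bilin k V W T (\<lambda>v' w'. tpure k V W (v \<otimes>\<^bsub>V\<^esub> v') (w \<otimes>\<^bsub>W\<^esub> w'))"
  by (intro bilinI tlift_lin tens_module lin_intros V W Vk Wk assms) (use assms in auto)

lemma tens_mult_linear_left: 
  assumes Y: "Y \<in> carrier T" shows "is_linear k T T (\<lambda>X. X \<otimes>\<^bsub>T\<^esub> Y)"
  by (rule lin_cong[OF tlift_linear[OF tens_module tens_mult_bilin_aux[OF Y]] tens_module])
    (simp add: tens_mult_tlift Y)

lemma tens_mult_linear_right: 
  assumes X: "X \<in> carrier T" shows "is_linear k T T (\<lambda>Y. X \<otimes>\<^bsub>T\<^esub> Y)"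
proof (rule lin_cong[OF tlift_lin[OF tens_module tens_module X] tens_module])
  show "!!v w. v \<in> carrier V ==> w \<in> carrier W ==>
    is_linear k T T (\<lambda>Y. tlift T (\<lambda>v' w'. tpure k V W (v \<otimes>\<^bsub>V\<^esub> v') (w \<otimes>\<^bsub>W\<^esub> w')) Y)"
    by (intro tlift_linear tens_module tens_mult_bilin_aux2)
qed (simp add: tens_mult_tlift X)

lemma tens_mult_pure:
  assumes "v \<in> carrier V" "w \<in> carrier W" "v' \<in> carrier V" "w' \<in> carrier W"
  shows "tpure k V W v w \<otimes>\<^bsub>T\<^esub> tpure k V W v' w' = tpure k V W (v \<otimes>\<^bsub>V\<^esub> v') (w \<otimes>\<^bsub>W\<^esub> w')"
  using assms by (simp add: tens_mult_tlift tlift_pure[OF tens_module tens_mult_bilin_aux] tlift_pure[OF tens_module tens_mult_bilin_aux2])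

lemma tens_mult_closed:
  "X \<in> carrier T ==> Y \<in> carrier T ==> X \<otimes>\<^bsub>T\<^esub> Y \<in> carrier T"
  using lin_closed[OF tens_mult_linear_left] by simp

lemma tens_one: "\<one>\<^bsub>T\<^esub> = tpure k V W \<one>\<^bsub>V\<^esub> \<one>\<^bsub>W\<^esub>"
  by (simp add: tens_def)

lemma tens_kalgebra: "is_kalgebra k T"
proof -
  have o: "\<one>\<^bsub>T\<^esub> \<in> carrier T" by (simp add: tens_one)
  note l = tens_mult_linear_left tens_mult_linear_right
  \<comment> \<open>Associativity passes from pure tensors to arbitrary ones in one argument at a
    time, in the order \<open>Z\<close>, \<open>Y\<close>, \<open>X\<close>.\<close>
  have a3: "(tpure k V W v w \<otimes>\<^bsub>T\<^esub> tpure k V W v' w') \<otimes>\<^bsub>T\<^esub> Z = tpure k V W v w \<otimes>\<^bsub>T\<^esub> (tpure k V W v' w' \<otimes>\<^bsub>T\<^esub> Z)"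
    if "v \<in> carrier V" "w \<in> carrier W" "v' \<in> carrier V" "w' \<in> carrier W"
      and Z: "Z \<in> carrier T" for v w v' w' Z
    by (rule tens_linear_ext[OF tens_module l(2) lin_comp[OF l(2) l(2)] _ Z])
      (use that in \<open>simp_all add: tens_mult_pure rV.m_assoc rW.m_assoc\<close>)
  have a2: "(tpure k V W v w \<otimes>\<^bsub>T\<^esub> Y) \<otimes>\<^bsub>T\<^esub> Z = tpure k V W v w \<otimes>\<^bsub>T\<^esub> (Y \<otimes>\<^bsub>T\<^esub> Z)"
    if p: "v \<in> carrier V" "w \<in> carrier W" 
      and Z: "Z \<in> carrier T" and Y: "Y \<in> carrier T" for v w Y Z
    by (rule tens_linear_ext[OF tens_module lin_comp[OF l(2) l(1)] lin_comp[OF l(1) l(2)] _ Y])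
      (use p Z in \<open>simp_all add: a3\<close>)
  have a1: "(X \<otimes>\<^bsub>T\<^esub> Y) \<otimes>\<^bsub>T\<^esub> Z = X \<otimes>\<^bsub>T\<^esub> (Y \<otimes>\<^bsub>T\<^esub> Z)"
    if Z: "Z \<in> carrier T" and Y: "Y \<in> carrier T" and X: "X \<in> carrier T" for X Y Z
    by (rule tens_linear_ext[OF tens_module lin_comp[OF l(1) l(1)] l(1) _ X])
      (use Y Z in \<open>simp_all add: a2 tens_mult_closed\<close>)
  have u: "\<one>\<^bsub>T\<^esub> \<otimes>\<^bsub>T\<^esub> X = X" if X: "X \<in> carrier T" for X
    by (rule tens_linear_ext[OF tens_module l(2)[OF o] lin_id _ X]) (simp add: tens_one tens_mult_pure)
  have u': "X \<otimes>\<^bsub>T\<^esub> \<one>\<^bsub>T\<^esub> = X" if X: "X \<in> carrier T" for X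
    by (rule tens_linear_ext[OF tens_module l(1)[OF o] lin_id _ X]) (simp add: tens_one tens_mult_pure)
  have "ring T"
  proof (rule ringI)
    show "abelian_group T" by (rule tens_abelian_group)
    show "Group.monoid T" by (rule monoidI) (simp_all only: o a1 u u' tens_mult_closed)
  qed (simp_all only: lin_add[OF l(1)] lin_add[OF l(2)])
  then show ?thesis
    unfolding is_kalgebra_def by (intro conjI ballI tens_module) (simp_all only: lin_smult[OF l(1)] lin_smult[OF l(2)])
qed

sublocale rT: ring T using tens_kalgebra by (rule kalg_ring)

text \<open>The rule by which bilinear maps are evaluated on products. Iterated, it converts the
  axioms of \<open>H\<close>, which are equations between products in tensor powers, into equations
  between nested sums.\<close>

lemma tlift_mult:
  assumes M: "module k M" and F: "bilin k V W M F" and X: "X \<in> carrier T" and Y: "Y \<in> carrier T"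
  shows "tlift M F (X \<otimes>\<^bsub>T\<^esub> Y) = tlift M (\<lambda>v w. tlift M (\<lambda>v' w'. F (v \<otimes>\<^bsub>V\<^esub> v') (w \<otimes>\<^bsub>W\<^esub> w')) Y) X"
proof -
  note L = tlift_linear[OF M F]
  have "tlift M F (X \<otimes>\<^bsub>T\<^esub> Y) = tlift M (\<lambda>v w. tlift M F (tlift T (\<lambda>v' w'. tpure k V W (v \<otimes>\<^bsub>V\<^esub> v') (w \<otimes>\<^bsub>W\<^esub> w')) Y)) X"
    unfolding tens_mult_tlift[OF X Y] by (rule lin_tlift[OF tens_module M L X]) (rule tlift_closed[OF tens_module Y]; simp)
  also have "\<dots> = tlift M (\<lambda>v w. tlift M (\<lambda>v' w'. F (v \<otimes>\<^bsub>V\<^esub> v') (w \<otimes>\<^bsub>W\<^esub> w')) Y) X"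
  proof (rule tlift_cong[OF X])
    fix v w assume vw: "v \<in> carrier V" "w \<in> carrier W"
    have "tlift M F (tlift T (\<lambda>v' w'. tpure k V W (v \<otimes>\<^bsub>V\<^esub> v') (w \<otimes>\<^bsub>W\<^esub> w')) Y) =
      tlift M (\<lambda>v' w'. tlift M F (tpure k V W (v \<otimes>\<^bsub>V\<^esub> v') (w \<otimes>\<^bsub>W\<^esub> w'))) Y" (is "?l = _")
      by (rule lin_tlift[OF tens_module M L Y]) (simp add: vw)
    also have "\<dots> = tlift M (\<lambda>v' w'. F (v \<otimes>\<^bsub>V\<^esub> v') (w \<otimes>\<^bsub>W\<^esub> w')) Y"
      by (rule tlift_cong[OF Y]) (simp add: tlift_pure[OF M F] vw)
    finally show "?l = \<dots>" .
  qed
  finally show ?thesis .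
qed

end

section \<open>Sweedler calculus in a triangular quasi-Hopf algebra\<close>

locale triangular_qhopf =
  fixes H :: "('k, 'h) qhopf" (structure)
  assumes tri: "is_triangular H"
begin

abbreviation "k \<equiv> base H"
abbreviation "T2 \<equiv> tens k H H"
abbreviation "T3 \<equiv> tens k T2 H"
abbreviation "T4 \<equiv> tens k T3 H"

lemmas Hn_defs = H2_def H3_def H4_def p2_def p3_def p4_def

lemma qt: "is_quasitriangular H" and qh: "is_quasi_hopf H" and qb: "is_quasi_bialgebra H"
  using tri by (auto simp: is_triangular_def is_quasitriangular_def is_quasi_hopf_def)

lemma kalgH [simp]: "is_kalgebra k H"
  using qb by (simp add: is_quasi_bialgebra_def)

lemma modH [simp]: "module k H"
  by (rule kalg_module) simp

sublocale H: ring H by (rule kalg_ring) (rule kalgH)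
sublocale modH: module k H by (rule modH)

lemma t2: "two_algebras k H H" by unfold_locales simp_all
lemma kalg2 [simp]: "is_kalgebra k T2" by (rule two_algebras.tens_kalgebra[OF t2])
lemma t3: "two_algebras k T2 H" by unfold_locales simp_all
lemma kalg3 [simp]: "is_kalgebra k T3" by (rule two_algebras.tens_kalgebra[OF t3])
lemma t4: "two_algebras k T3 H" by unfold_locales simp_all
lemma kalg4 [simp]: "is_kalgebra k T4" by (rule two_algebras.tens_kalgebra[OF t4])
lemma m2: "two_modules k H H" by unfold_locales
lemma mod2 [simp]: "module k T2" by (rule kalg_module) simp
lemma m3: "two_modules k T2 H" by (intro two_modules.intro) simp_all
lemma mod3 [simp]: "module k T3" by (rule kalg_module) simp
lemma m4: "two_modules k T3 H" by (intro two_modules.intro) simp_all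
lemma mod4 [simp]: "module k T4" by (rule kalg_module) simp

sublocale T3: ring T3 by (rule kalg_ring) (rule kalg3)
sublocale T4: ring T4 by (rule kalg_ring) (rule kalg4)
sublocale T2: ring T2 by (rule kalg_ring) (rule kalg2)

lemma pure2_closed [simp]: "a \<in> carrier H ==> b \<in> carrier H ==> tpure k H H a b \<in> carrier T2"
  by (rule two_modules.tpure_closed[OF m2])
lemma pure3_closed [simp]: "a \<in> carrier T2 ==> b \<in> carrier H ==> tpure k T2 H a b \<in> carrier T3"
  by (rule two_modules.tpure_closed[OF m3])
lemma pure4_closed [simp]: "a \<in> carrier T3 ==> b \<in> carrier H ==> tpure k T3 H a b \<in> carrier T4"
  by (rule two_modules.tpure_closed[OF m4])

section \<open>Multilinear maps on the tensor powers of \<open>H\<close>\<close>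

definition trilin where
  "trilin M F \<longleftrightarrow>
    (\<forall>b\<in>carrier H. \<forall>c\<in>carrier H. is_linear k H M (\<lambda>a. F a b c)) \<and>
    (\<forall>a\<in>carrier H. \<forall>c\<in>carrier H. is_linear k H M (\<lambda>b. F a b c)) \<and>
    (\<forall>a\<in>carrier H. \<forall>b\<in>carrier H. is_linear k H M (\<lambda>c. F a b c))"

definition quadlin where
  "quadlin M F \<longleftrightarrow>
    (\<forall>b\<in>carrier H. \<forall>c\<in>carrier H. \<forall>d\<in>carrier H. is_linear k H M (\<lambda>a. F a b c d)) \<and>
    (\<forall>a\<in>carrier H. \<forall>c\<in>carrier H. \<forall>d\<in>carrier H. is_linear k H M (\<lambda>b. F a b c d)) \<and>
    (\<forall>a\<in>carrier H. \<forall>b\<in>carrier H. \<forall>d\<in>carrier H. is_linear k H M (\<lambda>c. F a b c d)) \<and>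
    (\<forall>a\<in>carrier H. \<forall>b\<in>carrier H. \<forall>c\<in>carrier H. is_linear k H M (\<lambda>d. F a b c d))"

lemma trilinI:
  assumes "!!b c. b \<in> carrier H ==> c \<in> carrier H ==> is_linear k H M (\<lambda>a. F a b c)"
    "!!a c. a \<in> carrier H ==> c \<in> carrier H ==> is_linear k H M (\<lambda>b. F a b c)"
    "!!a b. a \<in> carrier H ==> b \<in> carrier H ==> is_linear k H M (\<lambda>c. F a b c)"
  shows "trilin M F"
  using assms by (simp add: trilin_def)

lemma quadlinI:
  assumes "!!b c d. b \<in> carrier H ==> c \<in> carrier H ==> d \<in> carrier H ==> is_linear k H M (\<lambda>a. F a b c d)"
    "!!a c d. a \<in> carrier H ==> c \<in> carrier H ==> d \<in> carrier H ==> is_linear k H M (\<lambda>b. F a b c d)"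
    "!!a b d. a \<in> carrier H ==> b \<in> carrier H ==> d \<in> carrier H ==> is_linear k H M (\<lambda>c. F a b c d)"
    "!!a b c. a \<in> carrier H ==> b \<in> carrier H ==> c \<in> carrier H ==> is_linear k H M (\<lambda>d. F a b c d)"
  shows "quadlin M F"
  using assms by (simp add: quadlin_def)

lemma bilin_lin:
  assumes "bilin k H H M F"
  shows "is_linear k U H f ==> b \<in> carrier H ==> is_linear k U M (\<lambda>x. F (f x) b)"
    and "is_linear k U H f ==> a \<in> carrier H ==> is_linear k U M (\<lambda>x. F a (f x))"
  using assms by (auto intro: bilin_linear_left bilin_linear_right)

lemma trilin_lin:
  assumes "trilin M F"
  shows "is_linear k U H f ==> b \<in> carrier H ==> c \<in> carrier H ==> is_linear k U M (\<lambda>x. F (f x) b c)"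
    and "is_linear k U H f ==> a \<in> carrier H ==> c \<in> carrier H ==> is_linear k U M (\<lambda>x. F a (f x) c)"
    and "is_linear k U H f ==> a \<in> carrier H ==> b \<in> carrier H ==> is_linear k U M (\<lambda>x. F a b (f x))"
  using assms by (auto simp: trilin_def intro: lin_comp[where W = H])

lemma quadlin_lin:
  assumes "quadlin M F"
  shows "is_linear k U H f ==> b \<in> carrier H ==> c \<in> carrier H ==> d \<in> carrier H ==> is_linear k U M (\<lambda>x. F (f x) b c d)"
    and "is_linear k U H f ==> a \<in> carrier H ==> c \<in> carrier H ==> d \<in> carrier H ==> is_linear k U M (\<lambda>x. F a (f x) c d)"
    and "is_linear k U H f ==> a \<in> carrier H ==> b \<in> carrier H ==> d \<in> carrier H ==> is_linear k U M (\<lambda>x. F a b (f x) d)"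
    and "is_linear k U H f ==> a \<in> carrier H ==> b \<in> carrier H ==> c \<in> carrier H ==> is_linear k U M (\<lambda>x. F a b c (f x))"
  using assms by (auto simp: quadlin_def intro: lin_comp[where W = H])

lemma trilin_closed: "trilin M F ==> a \<in> carrier H ==> b \<in> carrier H ==> c \<in> carrier H ==> F a b c \<in> carrier M"
  using lin_closed[of k H M "\<lambda>a. F a b c" a] by (simp add: trilin_def)

definition tlift4 where
  "tlift4 M F X = tlift M (\<lambda>Y d. tlift3 M (\<lambda>a b c. F a b c d) Y) X"

lemma tl3_closed:
  assumes "module k M" "X \<in> carrier T3" "!!a b c. a \<in> carrier H ==> b \<in> carrier H ==> c \<in> carrier H ==> F a b c \<in> carrier M"
  shows "tlift3 M F X \<in> carrier M"
  unfolding tlift3_def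
  by (intro two_modules.tlift_closed[OF m3 assms(1,2)] two_modules.tlift_closed[OF m2 assms(1)] assms(3))

lemma tl3_cong:
  assumes "X \<in> carrier T3" "!!a b c. a \<in> carrier H ==> b \<in> carrier H ==> c \<in> carrier H ==> F a b c = F' a b c"
  shows "tlift3 M F X = tlift3 M F' X"
  unfolding tlift3_def
  by (intro two_modules.tlift_cong[OF m3 assms(1)] two_modules.tlift_cong[OF m2] assms(2))

lemma lin_tl3:
  assumes "module k M" "module k N" "is_linear k M N f" "X \<in> carrier T3"
    "!!a b c. a \<in> carrier H ==> b \<in> carrier H ==> c \<in> carrier H ==> F a b c \<in> carrier M"
  shows "f (tlift3 M F X) = tlift3 N (\<lambda>a b c. f (F a b c)) X"
proof -
  have "f (tlift3 M F X) = tlift N (\<lambda>Y c. f (tlift M (\<lambda>a b. F a b c) Y)) X"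
    unfolding tlift3_def
    by (rule two_modules.lin_tlift[OF m3 assms(1-4)]) (intro two_modules.tlift_closed[OF m2 assms(1)] assms(5))
  also have "\<dots> = tlift3 N (\<lambda>a b c. f (F a b c)) X"
    unfolding tlift3_def
    by (intro two_modules.tlift_cong[OF m3 assms(4)] two_modules.lin_tlift[OF m2 assms(1-3)] assms(5))
  finally show ?thesis .
qed

lemma tl3_lin:
  assumes "module k M" "module k N" "X \<in> carrier T3"
    "!!a b c. a \<in> carrier H ==> b \<in> carrier H ==> c \<in> carrier H ==> is_linear k M N (\<lambda>x. F x a b c)"
  shows "is_linear k M N (\<lambda>x. tlift3 N (F x) X)"
  unfolding tlift3_def
  by (intro two_modules.tlift_lin[OF m3 assms(1-3)] two_modules.tlift_lin[OF m2 assms(1-2)] assms(4))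

lemma bilin_tl3:
  assumes M: "module k M" and F: "trilin M F"
  shows "bilin k T2 H M (\<lambda>Y c. tlift M (\<lambda>a b. F a b c) Y)"
  by (intro bilinI two_modules.tlift_linear[OF m2 M] two_modules.tlift_lin[OF m2 modH M] trilin_lin[OF F] lin_id) simp_all

lemma tl3_linear:
  assumes M: "module k M" and F: "trilin M F"
  shows "is_linear k T3 M (tlift3 M F)"
  using two_modules.tlift_linear[OF m3 M bilin_tl3[OF M F]] by (simp add: tlift3_def[abs_def])

lemma tl3_pure:
  assumes M: "module k M" and F: "trilin M F" and "a \<in> carrier H" "b \<in> carrier H" "c \<in> carrier H"
  shows "tlift3 M F (tpure k T2 H (tpure k H H a b) c) = F a b c"
proof -
  have "bilin k H H M (\<lambda>a b. F a b c)" by (intro bilinI trilin_lin[OF F] lin_id assms)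
  then show ?thesis
    unfolding tlift3_def using assms by (simp add: two_modules.tlift_pure[OF m3 M bilin_tl3[OF M F]] two_modules.tlift_pure[OF m2 M])
qed

lemma bilin_tl4:
  assumes M: "module k M" and F: "quadlin M F"
  shows "bilin k T3 H M (\<lambda>Y d. tlift3 M (\<lambda>a b c. F a b c d) Y)"
  by (intro bilinI tl3_linear[OF M] trilinI tl3_lin[OF modH M] quadlin_lin[OF F] lin_id) simp_all

lemma tl4_linear:
  assumes M: "module k M" and F: "quadlin M F"
  shows "is_linear k T4 M (tlift4 M F)"
  using two_modules.tlift_linear[OF m4 M bilin_tl4[OF M F]] by (simp add: tlift4_def[abs_def])

lemma tl4_pure:
  assumes M: "module k M" and F: "quadlin M F" and "a \<in> carrier H" "b \<in> carrier H" "c \<in> carrier H" "d \<in> carrier H"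
  shows "tlift4 M F (tpure k T3 H (tpure k T2 H (tpure k H H a b) c) d) = F a b c d"
proof -
  have "trilin M (\<lambda>a b c. F a b c d)" by (intro trilinI quadlin_lin[OF F] lin_id assms)
  then show ?thesis
    unfolding tlift4_def using assms by (simp add: two_modules.tlift_pure[OF m4 M bilin_tl4[OF M F]] tl3_pure[OF M])
qed

lemma swap22:
  assumes "module k M" "X \<in> carrier T2" "Y \<in> carrier T2"
    "!!a b a' b'. a \<in> carrier H ==> b \<in> carrier H ==> a' \<in> carrier H ==> b' \<in> carrier H ==> F a b a' b' \<in> carrier M"
  shows "tlift M (\<lambda>a b. tlift M (F a b) Y) X = tlift M (\<lambda>a' b'. tlift M (\<lambda>a b. F a b a' b') X) Y"
  by (rule tlift_swap[OF m2 m2 assms(1-3)]) (rule assms(4))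

lemma swap23:
  assumes M: "module k M" and X: "X \<in> carrier T2" and Y: "Y \<in> carrier T3"
    and F: "!!a b a' b' c'. a \<in> carrier H ==> b \<in> carrier H ==> a' \<in> carrier H ==> b' \<in> carrier H ==> c' \<in> carrier H ==> F a b a' b' c' \<in> carrier M"
  shows "tlift M (\<lambda>a b. tlift3 M (F a b) Y) X = tlift3 M (\<lambda>a' b' c'. tlift M (\<lambda>a b. F a b a' b' c') X) Y"
proof -
  have "tlift M (\<lambda>a b. tlift3 M (F a b) Y) X = tlift M (\<lambda>Z c'. tlift M (\<lambda>a b. tlift M (\<lambda>a' b'. F a b a' b' c') Z) X) Y"
    unfolding tlift3_def
    by (rule tlift_swap[OF m2 m3 M X Y]) (intro two_modules.tlift_closed[OF m2 M] F)
  also have "\<dots> = tlift3 M (\<lambda>a' b' c'. tlift M (\<lambda>a b. F a b a' b' c') X) Y"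
    unfolding tlift3_def
    by (intro two_modules.tlift_cong[OF m3 Y] swap22 M X F)
  finally show ?thesis .
qed

lemma swap33:
  assumes M: "module k M" and X: "X \<in> carrier T3" and Y: "Y \<in> carrier T3"
    and F: "!!a b c a' b' c'. a \<in> carrier H ==> b \<in> carrier H ==> c \<in> carrier H ==> a' \<in> carrier H ==> b' \<in> carrier H ==> c' \<in> carrier H ==> F a b c a' b' c' \<in> carrier M"
  shows "tlift3 M (\<lambda>a b c. tlift3 M (F a b c) Y) X = tlift3 M (\<lambda>a' b' c'. tlift3 M (\<lambda>a b c. F a b c a' b' c') X) Y"
proof -
  have "tlift3 M (\<lambda>a b c. tlift3 M (F a b c) Y) X = tlift M (\<lambda>Z c. tlift M (\<lambda>Z' c'. tlift M (\<lambda>a' b'. tlift M (\<lambda>a b. F a b c a' b' c') Z) Z') Y) X"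
    unfolding tlift3_def[of M _ X]
    by (intro two_modules.tlift_cong[OF m3 X]) (subst swap23[OF M _ Y], (simp add: F)+, simp add: tlift3_def)
  also have "\<dots> = tlift M (\<lambda>Z' c'. tlift M (\<lambda>Z c. tlift M (\<lambda>a' b'. tlift M (\<lambda>a b. F a b c a' b' c') Z) Z') X) Y"
    by (rule tlift_swap[OF m3 m3 M X Y]) (intro two_modules.tlift_closed[OF m2 M] F)
  also have "\<dots> = tlift3 M (\<lambda>a' b' c'. tlift3 M (\<lambda>a b c. F a b c a' b' c') X) Y"
    unfolding tlift3_def
    by (intro two_modules.tlift_cong[OF m3 Y] tlift_swap[OF m3 m2 M X]) (assumption, intro two_modules.tlift_closed[OF m2 M] F)
  finally show ?thesis .
qed

lemma tl3_mult_aux: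
  assumes M: "module k M" and F: "trilin M F" and X: "X \<in> carrier T3" and Y: "Y \<in> carrier T3"
  shows "tlift3 M F (X \<otimes>\<^bsub>T3\<^esub> Y) =
    tlift3 M (\<lambda>a b c. tlift3 M (\<lambda>a' b' c'. F (a \<otimes> a') (b \<otimes> b') (c \<otimes> c')) Y) X"
proof -
  note c = trilin_closed[OF F]
  have "tlift3 M F (X \<otimes>\<^bsub>T3\<^esub> Y) = tlift M (\<lambda>P c. tlift M (\<lambda>P' c'. tlift M (\<lambda>a b. F a b (c \<otimes> c')) (P \<otimes>\<^bsub>T2\<^esub> P')) Y) X"
    unfolding tlift3_def by (rule two_algebras.tlift_mult[OF t3 M bilin_tl3[OF M F] X Y])
  also have "\<dots> = tlift M (\<lambda>P c. tlift M (\<lambda>P' c'. tlift M (\<lambda>a b. tlift M (\<lambda>a' b'. F (a \<otimes> a') (b \<otimes> b') (c \<otimes> c')) P') P) Y) X"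
    by (intro two_modules.tlift_cong[OF m3 X] two_modules.tlift_cong[OF m3 Y] two_algebras.tlift_mult[OF t2 M] bilinI trilin_lin[OF F] lin_id)
      simp_all
  also have "\<dots> = tlift3 M (\<lambda>a b c. tlift3 M (\<lambda>a' b' c'. F (a \<otimes> a') (b \<otimes> b') (c \<otimes> c')) Y) X"
    unfolding tlift3_def
    by (rule two_modules.tlift_cong[OF m3 X], rule HOL.sym, rule tlift_swap[OF m2 m3 M _ Y])
      (simp_all add: c two_modules.tlift_closed[OF m2 M])
  finally show ?thesis .
qed

text \<open>The sum over the right-hand factor is put outermost. A product
  \<open>x \<otimes> a\<close> acts as \<open>a\<close> followed by \<open>x\<close>, so this is the
  nesting that results from composing morphisms.\<close>

lemma tl3_mult:
  assumes M: "module k M" and F: "trilin M F" and X: "X \<in> carrier T3" and Y: "Y \<in> carrier T3"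
  shows "tlift3 M F (X \<otimes>\<^bsub>T3\<^esub> Y) =
    tlift3 M (\<lambda>a' b' c'. tlift3 M (\<lambda>a b c. F (a \<otimes> a') (b \<otimes> b') (c \<otimes> c')) X) Y"
  unfolding tl3_mult_aux[OF assms] by (rule swap33[OF M X Y]) (simp add: trilin_closed[OF F])

text \<open>Sweedler sums over \<Delta>(h), \<open>R\<close>, \<phi> and the inverse of \<phi>, with
  summands in \<open>M\<close>. They get names of their own so that congruence, linearity and
  exchange rules can be attached to them.\<close>

definition swD where "swD M h F = tlift M F (cop H h)"
definition swR where "swR M F = tlift M F (Rmat H)"
definition swP where "swP M F = tlift3 M F (coassoc H)"
definition swPi where "swPi M F = tlift3 M F (coassoc_inv H)"

lemma cop_linear: "is_linear k H T2 (cop H)" and cop_hom: "cop H \<in> ring_hom H T2"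
  using qb by (simp_all add: is_quasi_bialgebra_def H2_def)

lemma cop_closed [simp]: "h \<in> carrier H ==> cop H h \<in> carrier T2"
  by (rule lin_closed[OF cop_linear])

lemma R_unit: "Rmat H \<in> Units T2"
  using qt by (simp add: is_quasitriangular_def H2_def)
lemma R_closed [simp]: "Rmat H \<in> carrier T2"
  using R_unit by (rule T2.Units_closed)
lemma P_unit: "coassoc H \<in> Units T3"
  using qb by (simp add: is_quasi_bialgebra_def H2_def H3_def)
lemma P_closed [simp]: "coassoc H \<in> carrier T3"
  using P_unit by (rule T3.Units_closed)
lemma Pi_inv: "coassoc_inv H = inv\<^bsub>T3\<^esub> (coassoc H)"
  by (simp add: coassoc_inv_def H2_def H3_def)
lemma Pi_closed [simp]: "coassoc_inv H \<in> carrier T3"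
  unfolding Pi_inv using P_unit by (rule T3.Units_inv_closed)

lemma swD_closed [simp]:
  "module k M ==> h \<in> carrier H ==> (!!a b. a \<in> carrier H ==> b \<in> carrier H ==> F a b \<in> carrier M) ==> swD M h F \<in> carrier M"
  unfolding swD_def by (rule two_modules.tlift_closed[OF m2]) auto
lemma swR_closed [simp]:
  "module k M ==> (!!a b. a \<in> carrier H ==> b \<in> carrier H ==> F a b \<in> carrier M) ==> swR M F \<in> carrier M"
  unfolding swR_def by (rule two_modules.tlift_closed[OF m2]) auto
lemma swP_closed [simp]:
  "module k M ==> (!!a b c. a \<in> carrier H ==> b \<in> carrier H ==> c \<in> carrier H ==> F a b c \<in> carrier M) ==> swP M F \<in> carrier M"
  unfolding swP_def by (rule tl3_closed) auto
lemma swPi_closed [simp]: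
  "module k M ==> (!!a b c. a \<in> carrier H ==> b \<in> carrier H ==> c \<in> carrier H ==> F a b c \<in> carrier M) ==> swPi M F \<in> carrier M"
  unfolding swPi_def by (rule tl3_closed) auto

text \<open>As congruence rules, this lemma and the next three let the simplifier work below a sum
  with the summation variables known to lie in the carrier of \<open>H\<close>.\<close>

lemma swD_cong [cong]:
  "h = h' ==> h' \<in> carrier H ==> (!!a b. a \<in> carrier H ==> b \<in> carrier H ==> F a b = F' a b) ==> swD M h F = swD M h' F'"
  unfolding swD_def by (simp, rule two_modules.tlift_cong[OF m2]) auto
lemma swR_cong [cong]:
  "(!!a b. a \<in> carrier H ==> b \<in> carrier H ==> F a b = F' a b) ==> swR M F = swR M F'"
  unfolding swR_def by (rule two_modules.tlift_cong[OF m2]) auto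
lemma swP_cong [cong]:
  "(!!a b c. a \<in> carrier H ==> b \<in> carrier H ==> c \<in> carrier H ==> F a b c = F' a b c) ==> swP M F = swP M F'"
  unfolding swP_def by (rule tl3_cong) auto
lemma swPi_cong [cong]:
  "(!!a b c. a \<in> carrier H ==> b \<in> carrier H ==> c \<in> carrier H ==> F a b c = F' a b c) ==> swPi M F = swPi M F'"
  unfolding swPi_def by (rule tl3_cong) auto

lemma lin_swD:
  "is_linear k M N f ==> module k M ==> module k N ==> h \<in> carrier H ==> (!!a b. a \<in> carrier H ==> b \<in> carrier H ==> F a b \<in> carrier M) ==>
    f (swD M h F) = swD N h (\<lambda>a b. f (F a b))"
  unfolding swD_def by (rule two_modules.lin_tlift[OF m2]) auto
lemma lin_swR:
  "is_linear k M N f ==> module k M ==> module k N ==> (!!a b. a \<in> carrier H ==> b \<in> carrier H ==> F a b \<in> carrier M) ==>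
    f (swR M F) = swR N (\<lambda>a b. f (F a b))"
  unfolding swR_def by (rule two_modules.lin_tlift[OF m2]) auto
lemma lin_swP:
  "is_linear k M N f ==> module k M ==> module k N ==> (!!a b c. a \<in> carrier H ==> b \<in> carrier H ==> c \<in> carrier H ==> F a b c \<in> carrier M) ==>
    f (swP M F) = swP N (\<lambda>a b c. f (F a b c))"
  unfolding swP_def by (rule lin_tl3) auto
lemma lin_swPi:
  "is_linear k M N f ==> module k M ==> module k N ==> (!!a b c. a \<in> carrier H ==> b \<in> carrier H ==> c \<in> carrier H ==> F a b c \<in> carrier M) ==>
    f (swPi M F) = swPi N (\<lambda>a b c. f (F a b c))"
  unfolding swPi_def by (rule lin_tl3) auto

lemma swD_lin [lin_intros]:
  "module k M ==> module k N ==> h \<in> carrier H ==> (!!a b. a \<in> carrier H ==> b \<in> carrier H ==> is_linear k M N (\<lambda>x. F x a b)) ==>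
    is_linear k M N (\<lambda>x. swD N h (F x))"
  unfolding swD_def by (rule two_modules.tlift_lin[OF m2]) auto
lemma swR_lin [lin_intros]:
  "module k M ==> module k N ==> (!!a b. a \<in> carrier H ==> b \<in> carrier H ==> is_linear k M N (\<lambda>x. F x a b)) ==>
    is_linear k M N (\<lambda>x. swR N (F x))"
  unfolding swR_def by (rule two_modules.tlift_lin[OF m2]) auto
lemma swP_lin [lin_intros]:
  "module k M ==> module k N ==> (!!a b c. a \<in> carrier H ==> b \<in> carrier H ==> c \<in> carrier H ==> is_linear k M N (\<lambda>x. F x a b c)) ==>
    is_linear k M N (\<lambda>x. swP N (F x))"
  unfolding swP_def by (rule tl3_lin) auto
lemma swPi_lin [lin_intros]:
  "module k M ==> module k N ==> (!!a b c. a \<in> carrier H ==> b \<in> carrier H ==> c \<in> carrier H ==> is_linear k M N (\<lambda>x. F x a b c)) ==>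
    is_linear k M N (\<lambda>x. swPi N (F x))"
  unfolding swPi_def by (rule tl3_lin) auto
text \<open>Here the comultiplied element itself varies. The representative of its coproduct varies
  with it, so \<open>F\<close> has to be bilinear, whereas in the rules above only the summand
  changes.\<close>

lemma swD_arg_lin:
  assumes "bilin k H H M F" "module k M" "is_linear k U H f"
  shows "is_linear k U M (\<lambda>x. swD M (f x) F)"
  unfolding swD_def
  by (rule lin_comp[OF lin_comp[OF assms(3) cop_linear] two_modules.tlift_linear[OF m2 assms(2,1)]])

lemmas swap_defs = swD_def swR_def swP_def swPi_def

lemma swap_D_D: "module k M ==> h \<in> carrier H ==> h' \<in> carrier H ==>
    (!!a b a' b'. a \<in> carrier H ==> b \<in> carrier H ==> a' \<in> carrier H ==> b' \<in> carrier H ==> F a b a' b' \<in> carrier M) ==>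
    swD M h (\<lambda>a b. swD M h' (F a b)) = swD M h' (\<lambda>a' b'. swD M h (\<lambda>a b. F a b a' b'))"
  unfolding swap_defs by (rule swap22) auto
lemma swap_R_R: "module k M ==>
    (!!a b a' b'. a \<in> carrier H ==> b \<in> carrier H ==> a' \<in> carrier H ==> b' \<in> carrier H ==> F a b a' b' \<in> carrier M) ==>
    swR M (\<lambda>a b. swR M (F a b)) = swR M (\<lambda>a' b'. swR M (\<lambda>a b. F a b a' b'))"
  unfolding swap_defs by (rule swap22) auto
lemma swap_D_P: "module k M ==> h \<in> carrier H ==>
    (!!a b a' b' c'. a \<in> carrier H ==> b \<in> carrier H ==> a' \<in> carrier H ==> b' \<in> carrier H ==> c' \<in> carrier H ==> F a b a' b' c' \<in> carrier M) ==>
    swD M h (\<lambda>a b. swP M (F a b)) = swP M (\<lambda>a' b' c'. swD M h (\<lambda>a b. F a b a' b' c'))"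
  unfolding swap_defs by (rule swap23) auto
lemma swap_D_Pi: "module k M ==> h \<in> carrier H ==>
    (!!a b a' b' c'. a \<in> carrier H ==> b \<in> carrier H ==> a' \<in> carrier H ==> b' \<in> carrier H ==> c' \<in> carrier H ==> F a b a' b' c' \<in> carrier M) ==>
    swD M h (\<lambda>a b. swPi M (F a b)) = swPi M (\<lambda>a' b' c'. swD M h (\<lambda>a b. F a b a' b' c'))"
  unfolding swap_defs by (rule swap23) auto
lemma swap_P_Pi: "module k M ==>
    (!!a b c a' b' c'. a \<in> carrier H ==> b \<in> carrier H ==> c \<in> carrier H ==> a' \<in> carrier H ==> b' \<in> carrier H ==> c' \<in> carrier H ==> F a b c a' b' c' \<in> carrier M) ==>
    swP M (\<lambda>a b c. swPi M (F a b c)) = swPi M (\<lambda>a' b' c'. swP M (\<lambda>a b c. F a b c a' b' c'))"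
  unfolding swap_defs by (rule swap33) auto
lemma swap_P_P: "module k M ==>
    (!!a b c a' b' c'. a \<in> carrier H ==> b \<in> carrier H ==> c \<in> carrier H ==> a' \<in> carrier H ==> b' \<in> carrier H ==> c' \<in> carrier H ==> F a b c a' b' c' \<in> carrier M) ==>
    swP M (\<lambda>a b c. swP M (F a b c)) = swP M (\<lambda>a' b' c'. swP M (\<lambda>a b c. F a b c a' b' c'))"
  unfolding swap_defs by (rule swap33) auto

section \<open>Comultiplication, counit and quasi-coassociativity\<close>

lemma cop_one: "cop H \<one> = tpure k H H \<one> \<one>"
  using ring_hom_one[OF cop_hom] by (simp add: two_algebras.tens_one[OF t2])

lemma cop_mult: "g \<in> carrier H ==> h \<in> carrier H ==> cop H (g \<otimes> h) = cop H g \<otimes>\<^bsub>T2\<^esub> cop H h"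
  by (rule ring_hom_mult[OF cop_hom])

lemma swD_one: "module k M ==> bilin k H H M F ==> swD M \<one> F = F \<one> \<one>"
  by (simp add: swD_def cop_one two_modules.tlift_pure[OF m2])

text \<open>\<Delta> is an algebra map. The right factor is again summed outermost, as in
  \<open>tl3_mult\<close>.\<close>

lemma swD_mult:
  assumes "module k M" "bilin k H H M F" "g \<in> carrier H" "h \<in> carrier H"
  shows "swD M (g \<otimes> h) F = swD M h (\<lambda>h1 h2. swD M g (\<lambda>g1 g2. F (g1 \<otimes> h1) (g2 \<otimes> h2)))"
proof -
  have "swD M (g \<otimes> h) F = swD M g (\<lambda>g1 g2. swD M h (\<lambda>h1 h2. F (g1 \<otimes> h1) (g2 \<otimes> h2)))"
    using assms by (simp add: swD_def cop_mult two_algebras.tlift_mult[OF t2])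
  also have "\<dots> = swD M h (\<lambda>h1 h2. swD M g (\<lambda>g1 g2. F (g1 \<otimes> h1) (g2 \<otimes> h2)))"
    by (rule swap_D_D) (simp_all add: assms bilin_closed[OF assms(2)])
  finally show ?thesis .
qed

lemma cou_closed [simp]: "h \<in> carrier H ==> cou H h \<in> carrier k"
  and cou_one [simp]: "cou H \<one> = \<one>\<^bsub>k\<^esub>"
  and cou_mult: "g \<in> carrier H ==> h \<in> carrier H ==> cou H (g \<otimes> h) = cou H g \<otimes>\<^bsub>k\<^esub> cou H h"
  and cou_add: "g \<in> carrier H ==> h \<in> carrier H ==> cou H (g \<oplus> h) = cou H g \<oplus>\<^bsub>k\<^esub> cou H h"
  and cou_smult: "c \<in> carrier k ==> h \<in> carrier H ==> cou H (c \<odot> h) = c \<otimes>\<^bsub>k\<^esub> cou H h"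
  using qb by (auto simp: is_quasi_bialgebra_def ring_hom_def)

lemma lin_cou [lin_intros]:
  assumes M: "module k M" and f: "is_linear k U H f" and m: "m \<in> carrier M"
  shows "is_linear k U M (\<lambda>x. cou H (f x) \<odot>\<^bsub>M\<^esub> m)"
proof -
  interpret M: module k M by fact
  show ?thesis
    by (intro linI) (simp_all add: lin_closed[OF f] lin_add[OF f] lin_smult[OF f] m cou_add cou_smult M.smult_l_distr M.smult_assoc1)
qed

lemma swD_counit_left:
  assumes M: "module k M" and h: "h \<in> carrier H" and G: "is_linear k H M G"
  shows "swD M h (\<lambda>a b. cou H a \<odot>\<^bsub>M\<^esub> G b) = G h"
proof -
  interpret M: module k M by fact
  have "G h = G (tlift H (\<lambda>a b. cou H a \<odot> b) (cop H h))"
    using qb h by (simp add: is_quasi_bialgebra_def)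
  also have "\<dots> = swD M h (\<lambda>a b. cou H a \<odot>\<^bsub>M\<^esub> G b)"
    using h by (simp add: lin_swD[OF G] M lin_smult[OF G] flip: swD_def)
  finally show ?thesis by simp
qed

lemma swD_counit_right:
  assumes M: "module k M" and h: "h \<in> carrier H" and G: "is_linear k H M G"
  shows "swD M h (\<lambda>a b. cou H b \<odot>\<^bsub>M\<^esub> G a) = G h"
proof -
  interpret M: module k M by fact
  have "G h = G (tlift H (\<lambda>a b. cou H b \<odot> a) (cop H h))"
    using qb h by (simp add: is_quasi_bialgebra_def)
  also have "\<dots> = swD M h (\<lambda>a b. cou H b \<odot>\<^bsub>M\<^esub> G a)"
    using h by (simp add: lin_swD[OF G] M lin_smult[OF G] flip: swD_def)
  finally show ?thesis by simp
qed

lemma one3: "\<one>\<^bsub>T3\<^esub> = tpure k T2 H (tpure k H H \<one> \<one>) \<one>"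
  by (simp add: two_algebras.tens_one[OF t3] two_algebras.tens_one[OF t2])

lemma P_Pi:
  assumes M: "module k M" and F: "trilin M F"
  shows "swPi M (\<lambda>a b c. swP M (\<lambda>x y z. F (x \<otimes> a) (y \<otimes> b) (z \<otimes> c))) = F \<one> \<one> \<one>"
proof -
  have "coassoc H \<otimes>\<^bsub>T3\<^esub> coassoc_inv H = \<one>\<^bsub>T3\<^esub>" unfolding Pi_inv by (rule T3.Units_r_inv[OF P_unit])
  then have "tlift3 M F (coassoc H \<otimes>\<^bsub>T3\<^esub> coassoc_inv H) = F \<one> \<one> \<one>" by (simp add: one3 tl3_pure[OF M F])
  then show ?thesis by (simp add: tl3_mult[OF M F] swP_def swPi_def)
qed

lemma Pi_P:
  assumes M: "module k M" and F: "trilin M F"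
  shows "swP M (\<lambda>a b c. swPi M (\<lambda>x y z. F (x \<otimes> a) (y \<otimes> b) (z \<otimes> c))) = F \<one> \<one> \<one>"
proof -
  have "coassoc_inv H \<otimes>\<^bsub>T3\<^esub> coassoc H = \<one>\<^bsub>T3\<^esub>" unfolding Pi_inv by (rule T3.Units_l_inv[OF P_unit])
  then have "tlift3 M F (coassoc_inv H \<otimes>\<^bsub>T3\<^esub> coassoc H) = F \<one> \<one> \<one>" by (simp add: one3 tl3_pure[OF M F])
  then show ?thesis by (simp add: tl3_mult[OF M F] swP_def swPi_def)
qed

abbreviation "e3 a b c \<equiv> tpure k T2 H (tpure k H H a b) c"
abbreviation "e4 a b c d \<equiv> tpure k T3 H (e3 a b c) d"

definition "copl h = swD T3 h (\<lambda>a b. swD T3 a (\<lambda>a1 a2. e3 a1 a2 b))"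
definition "copr h = swD T3 h (\<lambda>a b. swD T3 b (\<lambda>b1 b2. e3 a b1 b2))"

lemma copl_closed [simp]: "h \<in> carrier H ==> copl h \<in> carrier T3"
  and copr_closed [simp]: "h \<in> carrier H ==> copr h \<in> carrier T3"
  by (simp_all add: copl_def copr_def)

lemma tl3_copl:
  assumes M: "module k M" and F: "trilin M F" and h: "h \<in> carrier H"
  shows "tlift3 M F (copl h) = swD M h (\<lambda>a b. swD M a (\<lambda>a1 a2. F a1 a2 b))"
  unfolding copl_def using h by (simp add: lin_swD[OF tl3_linear[OF M F]] tl3_pure[OF M F] M)

lemma tl3_copr:
  assumes M: "module k M" and F: "trilin M F" and h: "h \<in> carrier H"
  shows "tlift3 M F (copr h) = swD M h (\<lambda>a b. swD M b (\<lambda>b1 b2. F a b1 b2))"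
  unfolding copr_def using h by (simp add: lin_swD[OF tl3_linear[OF M F]] tl3_pure[OF M F] M)

lemma coassoc_eq:
  assumes h: "h \<in> carrier H"
  shows "copr h \<otimes>\<^bsub>T3\<^esub> coassoc H = coassoc H \<otimes>\<^bsub>T3\<^esub> copl h"
    and "coassoc_inv H \<otimes>\<^bsub>T3\<^esub> copr h = copl h \<otimes>\<^bsub>T3\<^esub> coassoc_inv H"
proof -
  have e: "copr h = coassoc H \<otimes>\<^bsub>T3\<^esub> copl h \<otimes>\<^bsub>T3\<^esub> coassoc_inv H"
    unfolding copl_def copr_def swD_def using qb h by (simp add: is_quasi_bialgebra_def Hn_defs)
  show "copr h \<otimes>\<^bsub>T3\<^esub> coassoc H = coassoc H \<otimes>\<^bsub>T3\<^esub> copl h"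
    unfolding e Pi_inv using h P_unit by (simp add: T3.m_assoc T3.Units_l_inv)
  show "coassoc_inv H \<otimes>\<^bsub>T3\<^esub> copr h = copl h \<otimes>\<^bsub>T3\<^esub> coassoc_inv H"
    unfolding e Pi_inv using h P_unit by (simp add: T3.Units_l_inv flip: T3.m_assoc)
qed

text \<open>Quasi-coassociativity is multiplied by \<phi> on the right, so that no inverse is left,
  and then read through \<open>F\<close>. The companion below is multiplied by the inverse of \<phi>
  on the left instead.\<close>

lemma coassoc_sw:
  assumes M: "module k M" and F: "trilin M F" and h: "h \<in> carrier H"
  shows "swP M (\<lambda>x y z. swD M h (\<lambda>h1 h2. swD M h2 (\<lambda>b c. F (h1 \<otimes> x) (b \<otimes> y) (c \<otimes> z)))) =
    swD M h (\<lambda>h1 h2. swD M h1 (\<lambda>a b. swP M (\<lambda>x y z. F (x \<otimes> a) (y \<otimes> b) (z \<otimes> h2))))"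
proof -
  note F' = trilin_lin[OF F]
  have "tlift3 M F (copr h \<otimes>\<^bsub>T3\<^esub> coassoc H) = tlift3 M F (coassoc H \<otimes>\<^bsub>T3\<^esub> copl h)" by (simp only: coassoc_eq[OF h])
  moreover have "trilin M (\<lambda>a b c. swP M (\<lambda>x y z. F (x \<otimes> a) (y \<otimes> b) (z \<otimes> c)))"
    by (intro trilinI lin_intros F') (simp_all add: M)
  moreover have "trilin M (\<lambda>a b c. F (a \<otimes> x) (b \<otimes> y) (c \<otimes> z))"
    if "x \<in> carrier H" "y \<in> carrier H" "z \<in> carrier H" for x y z
    by (intro trilinI lin_intros F') (use that in \<open>simp_all add: M\<close>)
  ultimately show ?thesis
    using h by (simp add: tl3_mult[OF M F] tl3_copr[OF M] tl3_copl[OF M] flip: swP_def)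
qed

lemma coassoc_inv_sw:
  assumes M: "module k M" and F: "trilin M F" and h: "h \<in> carrier H"
  shows "swD M h (\<lambda>h1 h2. swD M h2 (\<lambda>b c. swPi M (\<lambda>x y z. F (x \<otimes> h1) (y \<otimes> b) (z \<otimes> c)))) =
    swPi M (\<lambda>x y z. swD M h (\<lambda>h1 h2. swD M h1 (\<lambda>a b. F (a \<otimes> x) (b \<otimes> y) (h2 \<otimes> z))))"
proof -
  note F' = trilin_lin[OF F]
  have "tlift3 M F (coassoc_inv H \<otimes>\<^bsub>T3\<^esub> copr h) = tlift3 M F (copl h \<otimes>\<^bsub>T3\<^esub> coassoc_inv H)" by (simp only: coassoc_eq[OF h])
  moreover have "trilin M (\<lambda>a b c. swPi M (\<lambda>x y z. F (x \<otimes> a) (y \<otimes> b) (z \<otimes> c)))"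
    by (intro trilinI lin_intros F') (simp_all add: M)
  moreover have "trilin M (\<lambda>a b c. F (a \<otimes> x) (b \<otimes> y) (c \<otimes> z))"
    if "x \<in> carrier H" "y \<in> carrier H" "z \<in> carrier H" for x y z
    by (intro trilinI lin_intros F') (use that in \<open>simp_all add: M\<close>)
  ultimately show ?thesis
    using h by (simp add: tl3_mult[OF M F] tl3_copr[OF M] tl3_copl[OF M] flip: swPi_def)
qed

lemmas [lin_intros] = swD_arg_lin bilinI trilinI quadlinI

lemma swD_smult:
  assumes M: "module k M" and c: "c \<in> carrier k" "h \<in> carrier H" and F: "!!a b. a \<in> carrier H ==> b \<in> carrier H ==> F a b \<in> carrier M"
  shows "swD M h (\<lambda>a b. c \<odot>\<^bsub>M\<^esub> F a b) = c \<odot>\<^bsub>M\<^esub> swD M h F"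
  using lin_swD[OF lin_smul[OF M lin_id] M M, of c h F] c F by simp

lemma swP_smult:
  assumes M: "module k M" and c: "c \<in> carrier k" and F: "!!a b d. a \<in> carrier H ==> b \<in> carrier H ==> d \<in> carrier H ==> F a b d \<in> carrier M"
  shows "swP M (\<lambda>a b d. c \<odot>\<^bsub>M\<^esub> F a b d) = c \<odot>\<^bsub>M\<^esub> swP M F"
  using lin_swP[OF lin_smul[OF M lin_id] M M, of c F] c F by simp

lemma swPi_smult:
  assumes M: "module k M" and c: "c \<in> carrier k" and F: "!!a b d. a \<in> carrier H ==> b \<in> carrier H ==> d \<in> carrier H ==> F a b d \<in> carrier M"
  shows "swPi M (\<lambda>a b d. c \<odot>\<^bsub>M\<^esub> F a b d) = c \<odot>\<^bsub>M\<^esub> swPi M F"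
  using lin_swPi[OF lin_smul[OF M lin_id] M M, of c F] c F by simp

lemma swR_smult:
  assumes M: "module k M" and c: "c \<in> carrier k" and F: "!!a b. a \<in> carrier H ==> b \<in> carrier H ==> F a b \<in> carrier M"
  shows "swR M (\<lambda>a b. c \<odot>\<^bsub>M\<^esub> F a b) = c \<odot>\<^bsub>M\<^esub> swR M F"
  using lin_swR[OF lin_smul[OF M lin_id] M M, of c F] c F by simp

section \<open>The pentagon in the fourth tensor power\<close>

lemma e4_mult:
  assumes "a \<in> carrier H" "b \<in> carrier H" "c \<in> carrier H" "d \<in> carrier H"
    "a' \<in> carrier H" "b' \<in> carrier H" "c' \<in> carrier H" "d' \<in> carrier H"
  shows "e4 a b c d \<otimes>\<^bsub>T4\<^esub> e4 a' b' c' d' = e4 (a \<otimes> a') (b \<otimes> b') (c \<otimes> c') (d \<otimes> d')"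
  using assms by (simp add: two_algebras.tens_mult_pure[OF t4] two_algebras.tens_mult_pure[OF t3] two_algebras.tens_mult_pure[OF t2])

lemma e3_mult:
  assumes "a \<in> carrier H" "b \<in> carrier H" "c \<in> carrier H" "a' \<in> carrier H" "b' \<in> carrier H" "c' \<in> carrier H"
  shows "e3 a b c \<otimes>\<^bsub>T3\<^esub> e3 a' b' c' = e3 (a \<otimes> a') (b \<otimes> b') (c \<otimes> c')"
  using assms by (simp add: two_algebras.tens_mult_pure[OF t3] two_algebras.tens_mult_pure[OF t2])

lemma one4: "\<one>\<^bsub>T4\<^esub> = e4 \<one> \<one> \<one> \<one>"
  by (simp add: two_algebras.tens_one[OF t4] one3)

text \<open>Unital algebra maps from the third to the fourth tensor power of \<open>H\<close>, given
  on pure tensors. The five ways in which \<phi> enters the pentagon are of this kind, and such a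
  map sends the inverse of \<phi> to the inverse of the image of \<phi>.\<close>

definition hom4 where
  "hom4 G \<longleftrightarrow> trilin T4 G \<and>
    (\<forall>a\<in>carrier H. \<forall>b\<in>carrier H. \<forall>c\<in>carrier H. \<forall>a'\<in>carrier H. \<forall>b'\<in>carrier H. \<forall>c'\<in>carrier H.
      G a b c \<otimes>\<^bsub>T4\<^esub> G a' b' c' = G (a \<otimes> a') (b \<otimes> b') (c \<otimes> c')) \<and>
    G \<one> \<one> \<one> = \<one>\<^bsub>T4\<^esub>"

lemma hom4_inv:
  assumes "hom4 G"
  shows "swP T4 G \<otimes>\<^bsub>T4\<^esub> swPi T4 G = \<one>\<^bsub>T4\<^esub>" "swPi T4 G \<otimes>\<^bsub>T4\<^esub> swP T4 G = \<one>\<^bsub>T4\<^esub>"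
proof -
  have G: "trilin T4 G" and m: "!!a b c a' b' c'. a \<in> carrier H ==> b \<in> carrier H ==> c \<in> carrier H ==> a' \<in> carrier H ==> b' \<in> carrier H ==> c' \<in> carrier H ==>
      G a b c \<otimes>\<^bsub>T4\<^esub> G a' b' c' = G (a \<otimes> a') (b \<otimes> b') (c \<otimes> c')"
    and o: "G \<one> \<one> \<one> = \<one>\<^bsub>T4\<^esub>" using assms by (auto simp: hom4_def)
  note c = trilin_closed[OF G]
  have l: "is_linear k T4 T4 (\<lambda>x. y \<otimes>\<^bsub>T4\<^esub> x)" "is_linear k T4 T4 (\<lambda>x. x \<otimes>\<^bsub>T4\<^esub> y)" if "y \<in> carrier T4" for y
    using that by (auto intro: lin_intros)
  have "swP T4 G \<otimes>\<^bsub>T4\<^esub> swPi T4 G = swPi T4 (\<lambda>a b c. swP T4 G \<otimes>\<^bsub>T4\<^esub> G a b c)" (is "?l = _")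
    by (rule lin_swPi[OF l(1)]) (simp_all add: c)
  also have "\<dots> = swPi T4 (\<lambda>a b c. swP T4 (\<lambda>x y z. G x y z \<otimes>\<^bsub>T4\<^esub> G a b c))"
    by (rule swPi_cong, rule lin_swP[OF l(2)]) (simp_all add: c)
  also have "\<dots> = G \<one> \<one> \<one>" using P_Pi[OF mod4 G] by (simp add: m)
  finally show "?l = \<one>\<^bsub>T4\<^esub>" by (simp only: o)
  have "swPi T4 G \<otimes>\<^bsub>T4\<^esub> swP T4 G = swP T4 (\<lambda>a b c. swPi T4 G \<otimes>\<^bsub>T4\<^esub> G a b c)" (is "?l = _")
    by (rule lin_swP[OF l(1)]) (simp_all add: c)
  also have "\<dots> = swP T4 (\<lambda>a b c. swPi T4 (\<lambda>x y z. G x y z \<otimes>\<^bsub>T4\<^esub> G a b c))"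
    by (rule swP_cong, rule lin_swPi[OF l(2)]) (simp_all add: c)
  also have "\<dots> = G \<one> \<one> \<one>" using Pi_P[OF mod4 G] by (simp add: m)
  finally show "?l = \<one>\<^bsub>T4\<^esub>" by (simp only: o)
qed

definition "cop1 a b c = swD T4 a (\<lambda>x y. e4 x y b c)"
definition "cop2 a b c = swD T4 b (\<lambda>x y. e4 a x y c)"
definition "cop3 a b c = swD T4 c (\<lambda>x y. e4 a b x y)"
definition "lone a b c = e4 \<one> a b c"
definition "rone a b c = e4 a b c \<one>"
lemmas face_defs = cop1_def cop2_def cop3_def lone_def rone_def

lemma trilin_faces: "trilin T4 cop1" "trilin T4 cop2" "trilin T4 cop3" "trilin T4 lone" "trilin T4 rone"
  unfolding face_defs[abs_def] by (intro lin_intros; simp)+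

lemma swD_hom_aux:
  assumes G: "!!a b. a \<in> carrier H ==> b \<in> carrier H ==> F a b \<in> carrier T4"
    "!!a b. a \<in> carrier H ==> b \<in> carrier H ==> F' a b \<in> carrier T4"
    "bilin k H H T4 F''"
    "!!a b a' b'. a \<in> carrier H ==> b \<in> carrier H ==> a' \<in> carrier H ==> b' \<in> carrier H ==>
       F a b \<otimes>\<^bsub>T4\<^esub> F' a' b' = F'' (a \<otimes> a') (b \<otimes> b')"
    and h: "h \<in> carrier H" "h' \<in> carrier H"
  shows "swD T4 h F \<otimes>\<^bsub>T4\<^esub> swD T4 h' F' = swD T4 (h \<otimes> h') F''"
proof -
  have l: "is_linear k T4 T4 (\<lambda>x. y \<otimes>\<^bsub>T4\<^esub> x)" "is_linear k T4 T4 (\<lambda>x. x \<otimes>\<^bsub>T4\<^esub> y)" if "y \<in> carrier T4" for y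
    using that by (auto intro: lin_intros)
  have "swD T4 h F \<otimes>\<^bsub>T4\<^esub> swD T4 h' F' = swD T4 h' (\<lambda>a' b'. swD T4 h F \<otimes>\<^bsub>T4\<^esub> F' a' b')"
    by (rule lin_swD[OF l(1)]) (simp_all add: G(1,2) h)
  also have "\<dots> = swD T4 h' (\<lambda>a' b'. swD T4 h (\<lambda>a b. F a b \<otimes>\<^bsub>T4\<^esub> F' a' b'))"
    by (rule swD_cong[OF HOL.refl h(2)], rule lin_swD[OF l(2)]) (simp_all add: G(1,2) h)
  also have "\<dots> = swD T4 (h \<otimes> h') F''" using h by (simp add: G(4) swD_mult[OF mod4 G(3)])
  finally show ?thesis .
qed

lemma faces_mult:
  assumes h: "a \<in> carrier H" "b \<in> carrier H" "c \<in> carrier H" "a' \<in> carrier H" "b' \<in> carrier H" "c' \<in> carrier H"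
  shows "cop1 a b c \<otimes>\<^bsub>T4\<^esub> cop1 a' b' c' = cop1 (a \<otimes> a') (b \<otimes> b') (c \<otimes> c')"
    and "cop2 a b c \<otimes>\<^bsub>T4\<^esub> cop2 a' b' c' = cop2 (a \<otimes> a') (b \<otimes> b') (c \<otimes> c')"
    and "cop3 a b c \<otimes>\<^bsub>T4\<^esub> cop3 a' b' c' = cop3 (a \<otimes> a') (b \<otimes> b') (c \<otimes> c')"
    and "lone a b c \<otimes>\<^bsub>T4\<^esub> lone a' b' c' = lone (a \<otimes> a') (b \<otimes> b') (c \<otimes> c')"
    and "rone a b c \<otimes>\<^bsub>T4\<^esub> rone a' b' c' = rone (a \<otimes> a') (b \<otimes> b') (c \<otimes> c')"
proof -
  show "cop1 a b c \<otimes>\<^bsub>T4\<^esub> cop1 a' b' c' = cop1 (a \<otimes> a') (b \<otimes> b') (c \<otimes> c')"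
    unfolding cop1_def by (rule swD_hom_aux) (use h in \<open>simp_all add: e4_mult, (intro lin_intros; simp)?\<close>)
  show "cop2 a b c \<otimes>\<^bsub>T4\<^esub> cop2 a' b' c' = cop2 (a \<otimes> a') (b \<otimes> b') (c \<otimes> c')"
    unfolding cop2_def by (rule swD_hom_aux) (use h in \<open>simp_all add: e4_mult, (intro lin_intros; simp)?\<close>)
  show "cop3 a b c \<otimes>\<^bsub>T4\<^esub> cop3 a' b' c' = cop3 (a \<otimes> a') (b \<otimes> b') (c \<otimes> c')"
    unfolding cop3_def by (rule swD_hom_aux) (use h in \<open>simp_all add: e4_mult, (intro lin_intros; simp)?\<close>)
qed (use h in \<open>simp_all add: lone_def rone_def e4_mult\<close>)

lemma faces_one:
  "cop1 \<one> \<one> \<one> = \<one>\<^bsub>T4\<^esub>" "cop2 \<one> \<one> \<one> = \<one>\<^bsub>T4\<^esub>" "cop3 \<one> \<one> \<one> = \<one>\<^bsub>T4\<^esub>"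
  "lone \<one> \<one> \<one> = \<one>\<^bsub>T4\<^esub>" "rone \<one> \<one> \<one> = \<one>\<^bsub>T4\<^esub>"
  unfolding one4 face_defs by (rule swD_one HOL.refl, simp?, (intro lin_intros; simp)?)+

lemma hom4_faces: "hom4 cop1" "hom4 cop2" "hom4 cop3" "hom4 lone" "hom4 rone"
  unfolding hom4_def by (intro conjI ballI trilin_faces faces_mult faces_one; assumption)+

lemma faces_closed [simp]:
  assumes "a \<in> carrier H" "b \<in> carrier H" "c \<in> carrier H"
  shows "cop1 a b c \<in> carrier T4" "cop2 a b c \<in> carrier T4" "cop3 a b c \<in> carrier T4" "lone a b c \<in> carrier T4" "rone a b c \<in> carrier T4"
  using assms trilin_faces trilin_closed by metis+

lemma lin_mult4:
  assumes "y \<in> carrier T4"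
  shows "is_linear k T4 T4 (\<lambda>x. y \<otimes>\<^bsub>T4\<^esub> x)" "is_linear k T4 T4 (\<lambda>x. x \<otimes>\<^bsub>T4\<^esub> y)"
  using assms by (auto intro: lin_intros)

lemma mulR4:
  "X \<in> carrier T4 ==> (!!a b c. a \<in> carrier H ==> b \<in> carrier H ==> c \<in> carrier H ==> F a b c \<in> carrier T4) ==>
    X \<otimes>\<^bsub>T4\<^esub> swP T4 F = swP T4 (\<lambda>a b c. X \<otimes>\<^bsub>T4\<^esub> F a b c)"
  "X \<in> carrier T4 ==> (!!a b c. a \<in> carrier H ==> b \<in> carrier H ==> c \<in> carrier H ==> F a b c \<in> carrier T4) ==>
    X \<otimes>\<^bsub>T4\<^esub> swPi T4 F = swPi T4 (\<lambda>a b c. X \<otimes>\<^bsub>T4\<^esub> F a b c)"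
  "X \<in> carrier T4 ==> h \<in> carrier H ==> (!!a b. a \<in> carrier H ==> b \<in> carrier H ==> F' a b \<in> carrier T4) ==>
    X \<otimes>\<^bsub>T4\<^esub> swD T4 h F' = swD T4 h (\<lambda>a b. X \<otimes>\<^bsub>T4\<^esub> F' a b)"
  by (simp_all add: lin_swP[OF lin_mult4(1)] lin_swPi[OF lin_mult4(1)] lin_swD[OF lin_mult4(1)])

lemma mulL4:
  "X \<in> carrier T4 ==> (!!a b c. a \<in> carrier H ==> b \<in> carrier H ==> c \<in> carrier H ==> F a b c \<in> carrier T4) ==>
    swP T4 F \<otimes>\<^bsub>T4\<^esub> X = swP T4 (\<lambda>a b c. F a b c \<otimes>\<^bsub>T4\<^esub> X)"
  "X \<in> carrier T4 ==> (!!a b c. a \<in> carrier H ==> b \<in> carrier H ==> c \<in> carrier H ==> F a b c \<in> carrier T4) ==>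
    swPi T4 F \<otimes>\<^bsub>T4\<^esub> X = swPi T4 (\<lambda>a b c. F a b c \<otimes>\<^bsub>T4\<^esub> X)"
  "X \<in> carrier T4 ==> h \<in> carrier H ==> (!!a b. a \<in> carrier H ==> b \<in> carrier H ==> F' a b \<in> carrier T4) ==>
    swD T4 h F' \<otimes>\<^bsub>T4\<^esub> X = swD T4 h (\<lambda>a b. F' a b \<otimes>\<^bsub>T4\<^esub> X)"
  by (simp_all add: lin_swP[OF lin_mult4(2)] lin_swPi[OF lin_mult4(2)] lin_swD[OF lin_mult4(2)])

lemma tl4_sw:
  assumes M: "module k M" and F: "quadlin M F"
  shows "(!!a b c. a \<in> carrier H ==> b \<in> carrier H ==> c \<in> carrier H ==> G a b c \<in> carrier T4) ==> tlift4 M F (swP T4 G) = swP M (\<lambda>a b c. tlift4 M F (G a b c))"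
    "(!!a b c. a \<in> carrier H ==> b \<in> carrier H ==> c \<in> carrier H ==> G a b c \<in> carrier T4) ==> tlift4 M F (swPi T4 G) = swPi M (\<lambda>a b c. tlift4 M F (G a b c))"
    "h \<in> carrier H ==> (!!a b. a \<in> carrier H ==> b \<in> carrier H ==> G' a b \<in> carrier T4) ==> tlift4 M F (swD T4 h G') = swD M h (\<lambda>a b. tlift4 M F (G' a b))"
  by (simp_all add: lin_swP[OF tl4_linear[OF M F] mod4 M] lin_swPi[OF tl4_linear[OF M F] mod4 M] lin_swD[OF tl4_linear[OF M F] mod4 M])

lemma pentagon_tens:
  "swP T4 cop3 \<otimes>\<^bsub>T4\<^esub> swP T4 cop1 = swP T4 lone \<otimes>\<^bsub>T4\<^esub> (swP T4 cop2 \<otimes>\<^bsub>T4\<^esub> swP T4 rone)"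
proof -
  have "swP T4 cop3 \<otimes>\<^bsub>T4\<^esub> swP T4 cop1 = swP T4 lone \<otimes>\<^bsub>T4\<^esub> swP T4 cop2 \<otimes>\<^bsub>T4\<^esub> swP T4 rone"
    unfolding face_defs[abs_def] swP_def swD_def using qb by (simp add: is_quasi_bialgebra_def Hn_defs)
  then show ?thesis by (simp add: T4.m_assoc)
qed

text \<open>The pentagon solved for the two products that occur when currying and evaluation are
  composed. The first form yields that evaluating \<zeta>(f) gives back \<open>f\<close>, the second
  that currying \<open>ev\<close> gives the identity.\<close>

lemma pentagon_inv_tens:
  "swP T4 cop1 \<otimes>\<^bsub>T4\<^esub> swPi T4 rone = (swPi T4 cop3 \<otimes>\<^bsub>T4\<^esub> swP T4 lone) \<otimes>\<^bsub>T4\<^esub> swP T4 cop2"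
  "swP T4 rone \<otimes>\<^bsub>T4\<^esub> swPi T4 cop1 = (swPi T4 cop2 \<otimes>\<^bsub>T4\<^esub> swPi T4 lone) \<otimes>\<^bsub>T4\<^esub> swP T4 cop3"
proof -
  have c: "swP T4 G \<in> carrier T4 \<and> swPi T4 G \<in> carrier T4" if "hom4 G" for G
    using that trilin_closed[of T4 G] by (simp add: hom4_def)
  define X1 X2 Y1 Y2 Y3 where d: "X1 = swP T4 cop3" "X2 = swP T4 cop1" "Y1 = swP T4 lone" "Y2 = swP T4 cop2" "Y3 = swP T4 rone"
  define X1' X2' Y1' Y2' Y3' where d': "X1' = swPi T4 cop3" "X2' = swPi T4 cop1" "Y1' = swPi T4 lone" "Y2' = swPi T4 cop2" "Y3' = swPi T4 rone"
  have cl: "X1 \<in> carrier T4" "X2 \<in> carrier T4" "Y1 \<in> carrier T4" "Y2 \<in> carrier T4" "Y3 \<in> carrier T4"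
    "X1' \<in> carrier T4" "X2' \<in> carrier T4" "Y1' \<in> carrier T4" "Y2' \<in> carrier T4" "Y3' \<in> carrier T4"
    unfolding d d' using c[OF hom4_faces(1)] c[OF hom4_faces(2)] c[OF hom4_faces(3)] c[OF hom4_faces(4)] c[OF hom4_faces(5)] by simp_all
  note i = hom4_inv[OF hom4_faces(1), folded d d'] hom4_inv[OF hom4_faces(2), folded d d'] hom4_inv[OF hom4_faces(3), folded d d']
    hom4_inv[OF hom4_faces(4), folded d d'] hom4_inv[OF hom4_faces(5), folded d d']
  note p = pentagon_tens[folded d]
  have i2: "p \<otimes>\<^bsub>T4\<^esub> (q \<otimes>\<^bsub>T4\<^esub> x) = x" if "p \<otimes>\<^bsub>T4\<^esub> q = \<one>\<^bsub>T4\<^esub>" "p \<in> carrier T4" "q \<in> carrier T4" "x \<in> carrier T4" for p q x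
    using that by (simp flip: T4.m_assoc)
  have "X2 \<otimes>\<^bsub>T4\<^esub> Y3' = X1' \<otimes>\<^bsub>T4\<^esub> ((X1 \<otimes>\<^bsub>T4\<^esub> X2) \<otimes>\<^bsub>T4\<^esub> Y3')"
    using cl i by (simp add: T4.m_assoc i2)
  also have "\<dots> = (X1' \<otimes>\<^bsub>T4\<^esub> Y1) \<otimes>\<^bsub>T4\<^esub> Y2"
    unfolding p using cl i by (simp add: T4.m_assoc)
  finally show "swP T4 cop1 \<otimes>\<^bsub>T4\<^esub> swPi T4 rone = (swPi T4 cop3 \<otimes>\<^bsub>T4\<^esub> swP T4 lone) \<otimes>\<^bsub>T4\<^esub> swP T4 cop2"
    unfolding d d' .
  have "Y3 \<otimes>\<^bsub>T4\<^esub> X2' = Y2' \<otimes>\<^bsub>T4\<^esub> (Y1' \<otimes>\<^bsub>T4\<^esub> (Y1 \<otimes>\<^bsub>T4\<^esub> (Y2 \<otimes>\<^bsub>T4\<^esub> Y3) \<otimes>\<^bsub>T4\<^esub> X2'))"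
    using cl i by (simp add: T4.m_assoc i2)
  also have "\<dots> = (Y2' \<otimes>\<^bsub>T4\<^esub> Y1') \<otimes>\<^bsub>T4\<^esub> X1"
    unfolding p[symmetric] using cl i by (simp add: T4.m_assoc)
  finally show "swP T4 rone \<otimes>\<^bsub>T4\<^esub> swPi T4 cop1 = (swPi T4 cop2 \<otimes>\<^bsub>T4\<^esub> swPi T4 lone) \<otimes>\<^bsub>T4\<^esub> swP T4 cop3"
    unfolding d d' .
qed

lemma pentagon_sw:
  assumes M: "module k M" and F: "quadlin M F"
  shows "swP M (\<lambda>a b c. swD M a (\<lambda>a1 a2. swP M (\<lambda>x y z. swD M z (\<lambda>z1 z2.
      F (x \<otimes> a1) (y \<otimes> a2) (z1 \<otimes> b) (z2 \<otimes> c))))) =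
    swP M (\<lambda>a b c. swP M (\<lambda>p q r. swD M q (\<lambda>q1 q2. swP M (\<lambda>x y z.
      F (p \<otimes> a) (x \<otimes> q1 \<otimes> b) (y \<otimes> q2 \<otimes> c) (z \<otimes> r)))))"
proof -
  have p: "swP T4 cop3 \<otimes>\<^bsub>T4\<^esub> swP T4 cop1 = (swP T4 lone \<otimes>\<^bsub>T4\<^esub> swP T4 cop2) \<otimes>\<^bsub>T4\<^esub> swP T4 rone"
    unfolding pentagon_tens by (simp add: T4.m_assoc)
  have "swP T4 cop3 \<otimes>\<^bsub>T4\<^esub> swP T4 cop1 = swP T4 (\<lambda>a b c. swD T4 a (\<lambda>a1 a2. swP T4 (\<lambda>x y z. swD T4 z (\<lambda>z1 z2.
      e4 (x \<otimes> a1) (y \<otimes> a2) (z1 \<otimes> b) (z2 \<otimes> c)))))"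
    unfolding face_defs[abs_def] by (simp add: mulR4, simp add: mulL4 e4_mult)
  moreover have "(swP T4 lone \<otimes>\<^bsub>T4\<^esub> swP T4 cop2) \<otimes>\<^bsub>T4\<^esub> swP T4 rone = swP T4 (\<lambda>a b c. swP T4 (\<lambda>p q r. swD T4 q (\<lambda>q1 q2. swP T4 (\<lambda>x y z.
      e4 (p \<otimes> a) (x \<otimes> q1 \<otimes> b) (y \<otimes> q2 \<otimes> c) (z \<otimes> r)))))"
    unfolding face_defs[abs_def] by (simp add: mulR4, simp add: mulL4 e4_mult)
  ultimately show ?thesis
    using arg_cong[OF p, of "tlift4 M F"] by (simp add: tl4_sw[OF M F] tl4_pure[OF M F])
qed

lemma pentagon_inv_sw:
  assumes M: "module k M" and F: "quadlin M F"
  shows "swPi M (\<lambda>a b c. swP M (\<lambda>x y z. swD M x (\<lambda>x1 x2.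
      F (x1 \<otimes> a) (x2 \<otimes> b) (y \<otimes> c) z))) =
    swP M (\<lambda>p q r. swD M q (\<lambda>q1 q2. swP M (\<lambda>x y z. swPi M (\<lambda>a b c. swD M c (\<lambda>c1 c2.
      F (a \<otimes> p) (b \<otimes> x \<otimes> q1) (c1 \<otimes> y \<otimes> q2) (c2 \<otimes> z \<otimes> r))))))" (is ?A)
    and "swPi M (\<lambda>x y z. swD M x (\<lambda>x1 x2. swP M (\<lambda>a b c.
      F (a \<otimes> x1) (b \<otimes> x2) (c \<otimes> y) z))) =
    swP M (\<lambda>p q r. swD M r (\<lambda>r1 r2. swPi M (\<lambda>x y z. swPi M (\<lambda>a b c. swD M b (\<lambda>b1 b2.
      F (a \<otimes> p) (b1 \<otimes> x \<otimes> q) (b2 \<otimes> y \<otimes> r1) (c \<otimes> z \<otimes> r2))))))" (is ?B)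
proof -
  note p = pentagon_inv_tens
  have "swP T4 cop1 \<otimes>\<^bsub>T4\<^esub> swPi T4 rone = swPi T4 (\<lambda>a b c. swP T4 (\<lambda>x y z. swD T4 x (\<lambda>x1 x2.
      e4 (x1 \<otimes> a) (x2 \<otimes> b) (y \<otimes> c) z)))"
    unfolding face_defs[abs_def] by (simp add: mulR4, simp add: mulL4 e4_mult)
  moreover have "(swPi T4 cop3 \<otimes>\<^bsub>T4\<^esub> swP T4 lone) \<otimes>\<^bsub>T4\<^esub> swP T4 cop2 = swP T4 (\<lambda>p q r. swD T4 q (\<lambda>q1 q2. swP T4 (\<lambda>x y z. swPi T4 (\<lambda>a b c. swD T4 c (\<lambda>c1 c2.
      e4 (a \<otimes> p) (b \<otimes> x \<otimes> q1) (c1 \<otimes> y \<otimes> q2) (c2 \<otimes> z \<otimes> r))))))"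
    unfolding face_defs[abs_def] by (simp add: mulR4, simp add: mulL4 e4_mult)
  ultimately show ?A
    using arg_cong[OF p(1), of "tlift4 M F"] by (simp add: tl4_sw[OF M F] tl4_pure[OF M F])
  have "swP T4 rone \<otimes>\<^bsub>T4\<^esub> swPi T4 cop1 = swPi T4 (\<lambda>x y z. swD T4 x (\<lambda>x1 x2. swP T4 (\<lambda>a b c.
      e4 (a \<otimes> x1) (b \<otimes> x2) (c \<otimes> y) z)))"
    unfolding face_defs[abs_def] by (simp add: mulR4, simp add: mulL4 e4_mult)
  moreover have "(swPi T4 cop2 \<otimes>\<^bsub>T4\<^esub> swPi T4 lone) \<otimes>\<^bsub>T4\<^esub> swP T4 cop3 = swP T4 (\<lambda>p q r. swD T4 r (\<lambda>r1 r2. swPi T4 (\<lambda>x y z. swPi T4 (\<lambda>a b c. swD T4 b (\<lambda>b1 b2.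
      e4 (a \<otimes> p) (b1 \<otimes> x \<otimes> q) (b2 \<otimes> y \<otimes> r1) (c \<otimes> z \<otimes> r2))))))"
  proof -
    have b1: "swPi T4 cop2 \<otimes>\<^bsub>T4\<^esub> swPi T4 lone = swPi T4 (\<lambda>x y z. swPi T4 (\<lambda>a b c. swD T4 b (\<lambda>b1 b2.
      e4 a (b1 \<otimes> x) (b2 \<otimes> y) (c \<otimes> z))))"
      unfolding face_defs[abs_def] by (simp add: mulR4, simp add: mulL4 e4_mult)
    have b2: "swPi T4 (\<lambda>x y z. swPi T4 (\<lambda>a b c. swD T4 b (\<lambda>b1 b2. e4 a (b1 \<otimes> x) (b2 \<otimes> y) (c \<otimes> z)))) \<otimes>\<^bsub>T4\<^esub> e4 p q r1 r2 =
      swPi T4 (\<lambda>x y z. swPi T4 (\<lambda>a b c. swD T4 b (\<lambda>b1 b2. e4 (a \<otimes> p) (b1 \<otimes> x \<otimes> q) (b2 \<otimes> y \<otimes> r1) (c \<otimes> z \<otimes> r2))))"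
      if "p \<in> carrier H" "q \<in> carrier H" "r1 \<in> carrier H" "r2 \<in> carrier H" for p q r1 r2
    proof -
      have "swPi T4 (\<lambda>x y z. swPi T4 (\<lambda>a b c. swD T4 b (\<lambda>b1 b2. e4 a (b1 \<otimes> x) (b2 \<otimes> y) (c \<otimes> z)))) \<otimes>\<^bsub>T4\<^esub> e4 p q r1 r2 =
        swPi T4 (\<lambda>x y z. swPi T4 (\<lambda>a b c. swD T4 b (\<lambda>b1 b2. e4 a (b1 \<otimes> x) (b2 \<otimes> y) (c \<otimes> z))) \<otimes>\<^bsub>T4\<^esub> e4 p q r1 r2)"
        by (rule mulL4(2)) (use that in simp_all)
      also have "\<dots> = swPi T4 (\<lambda>x y z. swPi T4 (\<lambda>a b c. swD T4 b (\<lambda>b1 b2. e4 a (b1 \<otimes> x) (b2 \<otimes> y) (c \<otimes> z)) \<otimes>\<^bsub>T4\<^esub> e4 p q r1 r2))"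
        by (rule swPi_cong, rule mulL4(2)) (use that in simp_all)
      finally show ?thesis using that by (simp add: mulL4(3) e4_mult)
    qed
    show ?thesis unfolding b1 cop3_def[abs_def] by (simp add: mulR4 b2)
  qed
  ultimately show ?B
    using arg_cong[OF p(2), of "tlift4 M F"] by (simp add: tl4_sw[OF M F] tl4_pure[OF M F])
qed

subsection \<open>Counits\<close>

text \<open>The normalization of \<phi> that is required as an axiom, with \<epsilon> in the middle
  slot. The other two are derived from it and the pentagon.\<close>

lemma P_counit_mid:
  assumes M: "module k M" and K: "bilin k H H M K"
  shows "swP M (\<lambda>a b c. cou H b \<odot>\<^bsub>M\<^esub> K a c) = K \<one> \<one>"
proof -
  note L = two_modules.tlift_linear[OF m2 M K]
  have "swP T2 (\<lambda>a b c. tpure k H H (cou H b \<odot> a) c) = tpure k H H \<one> \<one>"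
    unfolding swP_def using qb by (simp add: is_quasi_bialgebra_def Hn_defs two_algebras.tens_one[OF t2])
  then have "tlift M K (swP T2 (\<lambda>a b c. tpure k H H (cou H b \<odot> a) c)) = K \<one> \<one>"
    by (simp add: two_modules.tlift_pure[OF m2 M K])
  then show ?thesis
    by (simp add: lin_swP[OF L] M two_modules.tlift_pure[OF m2 M K] lin_smult[OF bilin_left[OF K]])
qed

text \<open>With \<epsilon> in the third slot of the pentagon, the axiom for the middle slot removes
  one factor on each side, and \<open>\<phi> = \<phi> ((id \<otimes> id \<otimes>
  \<epsilon>)(\<phi>) \<otimes> 1)\<close> remains. Then \<phi> is cancelled.\<close>

lemma P_counit_right:
  assumes M: "module k M" and N: "bilin k H H M N"
  shows "swP M (\<lambda>a b c. cou H c \<odot>\<^bsub>M\<^esub> N a b) = N \<one> \<one>"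
proof -
  interpret M: module k M by fact
  have *: "swP M K = swP M (\<lambda>a b c. swP M (\<lambda>p q r. cou H c \<odot>\<^bsub>M\<^esub> K (p \<otimes> a) (q \<otimes> b) r))"
    if K: "trilin M K" for K
  proof -
    note K' = trilin_lin[OF K] and c = trilin_closed[OF K]
    let ?F = "\<lambda>a b c d. cou H c \<odot>\<^bsub>M\<^esub> K a b d"
    have F: "quadlin M ?F"
      by (intro lin_intros K') (simp_all add: M c)
    have L: "swP M (\<lambda>a b c. swD M a (\<lambda>a1 a2. swP M (\<lambda>x y z. swD M z (\<lambda>z1 z2.
      ?F (x \<otimes> a1) (y \<otimes> a2) (z1 \<otimes> b) (z2 \<otimes> c))))) = swP M K"
    proof -
      have 1: "swD M z (\<lambda>z1 z2. ?F (x \<otimes> a1) (y \<otimes> a2) (z1 \<otimes> b) (z2 \<otimes> c)) =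
          cou H b \<odot>\<^bsub>M\<^esub> K (x \<otimes> a1) (y \<otimes> a2) (z \<otimes> c)"
        if h: "x \<in> carrier H" "y \<in> carrier H" "z \<in> carrier H" "a1 \<in> carrier H" "a2 \<in> carrier H" "b \<in> carrier H" "c \<in> carrier H"
        for x y z a1 a2 b c
      proof -
        have "swD M z (\<lambda>z1 z2. ?F (x \<otimes> a1) (y \<otimes> a2) (z1 \<otimes> b) (z2 \<otimes> c)) =
          swD M z (\<lambda>z1 z2. cou H z1 \<odot>\<^bsub>M\<^esub> (cou H b \<odot>\<^bsub>M\<^esub> K (x \<otimes> a1) (y \<otimes> a2) (z2 \<otimes> c)))"
          using h by (simp add: cou_mult M.smult_assoc1 c)
        also have "\<dots> = cou H b \<odot>\<^bsub>M\<^esub> K (x \<otimes> a1) (y \<otimes> a2) (z \<otimes> c)"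
          using h by (intro swD_counit_left[OF M] lin_intros K') (simp_all add: M)
        finally show ?thesis .
      qed
      have 2: "swP M (\<lambda>x y z. cou H b \<odot>\<^bsub>M\<^esub> K (x \<otimes> a1) (y \<otimes> a2) (z \<otimes> c)) =
          cou H b \<odot>\<^bsub>M\<^esub> swP M (\<lambda>x y z. K (x \<otimes> a1) (y \<otimes> a2) (z \<otimes> c))"
        if "a1 \<in> carrier H" "a2 \<in> carrier H" "b \<in> carrier H" "c \<in> carrier H" for a1 a2 b c
        using that by (intro swP_smult M) (simp_all add: c)
      have 3: "swD M a (\<lambda>a1 a2. cou H b \<odot>\<^bsub>M\<^esub> swP M (\<lambda>x y z. K (x \<otimes> a1) (y \<otimes> a2) (z \<otimes> c))) =
        cou H b \<odot>\<^bsub>M\<^esub> swD M a (\<lambda>a1 a2. swP M (\<lambda>x y z. K (x \<otimes> a1) (y \<otimes> a2) (z \<otimes> c)))"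
        if "a \<in> carrier H" "b \<in> carrier H" "c \<in> carrier H" for a b c
        using that by (intro swD_smult M) (simp_all add: c M)
      have "swP M (\<lambda>a b c. cou H b \<odot>\<^bsub>M\<^esub> swD M a (\<lambda>a1 a2. swP M (\<lambda>x y z. K (x \<otimes> a1) (y \<otimes> a2) (z \<otimes> c)))) =
        swD M \<one> (\<lambda>a1 a2. swP M (\<lambda>x y z. K (x \<otimes> a1) (y \<otimes> a2) (z \<otimes> \<one>)))"
        by (rule P_counit_mid[OF M]) (intro lin_intros K'; simp add: M)
      also have "\<dots> = swP M (\<lambda>x y z. K (x \<otimes> \<one>) (y \<otimes> \<one>) (z \<otimes> \<one>))"
        by (rule swD_one[OF M]) (intro lin_intros K'; simp add: M)
      finally show ?thesis by (simp add: 1 2 3)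
    qed
    have R: "swP M (\<lambda>a b c. swP M (\<lambda>p q r. swD M q (\<lambda>q1 q2. swP M (\<lambda>x y z.
      ?F (p \<otimes> a) (x \<otimes> q1 \<otimes> b) (y \<otimes> q2 \<otimes> c) (z \<otimes> r))))) =
      swP M (\<lambda>a b c. swP M (\<lambda>p q r. cou H c \<odot>\<^bsub>M\<^esub> K (p \<otimes> a) (q \<otimes> b) r))"
    proof -
      have 1: "swP M (\<lambda>x y z. ?F (p \<otimes> a) (x \<otimes> q1 \<otimes> b) (y \<otimes> q2 \<otimes> c) (z \<otimes> r)) =
        cou H q2 \<odot>\<^bsub>M\<^esub> (cou H c \<odot>\<^bsub>M\<^esub> K (p \<otimes> a) (q1 \<otimes> b) r)"
        if h: "a \<in> carrier H" "b \<in> carrier H" "c \<in> carrier H" "p \<in> carrier H" "r \<in> carrier H" "q1 \<in> carrier H" "q2 \<in> carrier H"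
        for a b c p r q1 q2
      proof -
        have "swP M (\<lambda>x y z. ?F (p \<otimes> a) (x \<otimes> q1 \<otimes> b) (y \<otimes> q2 \<otimes> c) (z \<otimes> r)) =
          swP M (\<lambda>x y z. cou H y \<odot>\<^bsub>M\<^esub> (cou H q2 \<odot>\<^bsub>M\<^esub> (cou H c \<odot>\<^bsub>M\<^esub> K (p \<otimes> a) (x \<otimes> q1 \<otimes> b) (z \<otimes> r))))"
          using h by (simp add: cou_mult M.smult_assoc1 c modH.R.m_assoc)
        also have "\<dots> = cou H q2 \<odot>\<^bsub>M\<^esub> (cou H c \<odot>\<^bsub>M\<^esub> K (p \<otimes> a) (\<one> \<otimes> q1 \<otimes> b) (\<one> \<otimes> r))"
          using h by (intro P_counit_mid[OF M] lin_intros K') (simp_all add: M)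
        finally show ?thesis using h by simp
      qed
      have 2: "swD M q (\<lambda>q1 q2. cou H q2 \<odot>\<^bsub>M\<^esub> (cou H c \<odot>\<^bsub>M\<^esub> K (p \<otimes> a) (q1 \<otimes> b) r)) =
        cou H c \<odot>\<^bsub>M\<^esub> K (p \<otimes> a) (q \<otimes> b) r"
        if h: "a \<in> carrier H" "b \<in> carrier H" "c \<in> carrier H" "p \<in> carrier H" "r \<in> carrier H" "q \<in> carrier H"
        for a b c p r q
        using h by (intro swD_counit_right[OF M] lin_intros K') (simp_all add: M)
      show ?thesis by (simp add: 1 2)
    qed
    show ?thesis using pentagon_sw[OF M F] unfolding L R .
  qed
  note N' = bilin_lin[OF N] and Nc = bilin_closed[OF N]
  let ?G = "\<lambda>a b c. cou H c \<odot>\<^bsub>M\<^esub> N a b"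
  have G: "trilin M ?G" by (intro lin_intros N') (simp_all add: M Nc)
  note G' = trilin_lin[OF G]
  \<comment> \<open>Multiplication by the inverse of \<phi> on the left cancels the factor \<phi>
    that both sides of the preceding identity begin with.\<close>
  let ?K = "\<lambda>a b c. swPi M (\<lambda>x y z. ?G (x \<otimes> a) (y \<otimes> b) (z \<otimes> c))"
  have K: "trilin M ?K" by (intro lin_intros N') (simp_all add: M Nc)
  have "N \<one> \<one> = swP M ?K"
    using Pi_P[OF M G] by (simp add: Nc)
  also have "\<dots> = swP M (\<lambda>a b c. swP M (\<lambda>p q r. cou H c \<odot>\<^bsub>M\<^esub> ?K (p \<otimes> a) (q \<otimes> b) r))"
    by (rule *[OF K])
  also have "\<dots> = swP M (\<lambda>a b c. cou H c \<odot>\<^bsub>M\<^esub> swP M (\<lambda>p q r. ?K (p \<otimes> a) (q \<otimes> b) r))"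
    by (intro swP_cong swP_smult M) (simp_all add: M Nc)
  also have "\<dots> = swP M (\<lambda>a b c. cou H c \<odot>\<^bsub>M\<^esub> N a b)"
  proof (rule swP_cong)
    fix a b c assume h: "a \<in> carrier H" "b \<in> carrier H" "c \<in> carrier H"
    have "trilin M (\<lambda>x y z. ?G (x \<otimes> a) (y \<otimes> b) z)" by (intro lin_intros N') (simp_all add: M Nc h)
    from Pi_P[OF M this] show "cou H c \<odot>\<^bsub>M\<^esub> swP M (\<lambda>p q r. ?K (p \<otimes> a) (q \<otimes> b) r) = cou H c \<odot>\<^bsub>M\<^esub> N a b"
      using h by (simp add: modH.R.m_assoc H.m_assoc Nc)
  qed
  finally show ?thesis ..
qed

text \<open>With \<epsilon> in the second slot the pentagon becomes \<open>\<phi> = (1 \<otimes>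
  (\<epsilon> \<otimes> id \<otimes> id)(\<phi>)) \<phi>\<close>.\<close>

lemma P_counit_left:
  assumes M: "module k M" and N: "bilin k H H M N"
  shows "swP M (\<lambda>a b c. cou H a \<odot>\<^bsub>M\<^esub> N b c) = N \<one> \<one>"
proof -
  interpret M: module k M by fact
  have *: "swP M K = swP M (\<lambda>p q r. swP M (\<lambda>x y z. cou H x \<odot>\<^bsub>M\<^esub> K p (y \<otimes> q) (z \<otimes> r)))"
    if K: "trilin M K" for K
  proof -
    note K' = trilin_lin[OF K] and c = trilin_closed[OF K]
    let ?F = "\<lambda>a b c d. cou H b \<odot>\<^bsub>M\<^esub> K a c d"
    have F: "quadlin M ?F"
      by (intro lin_intros K') (simp_all add: M c)
    have L: "swP M (\<lambda>a b c. swD M a (\<lambda>a1 a2. swP M (\<lambda>x y z. swD M z (\<lambda>z1 z2.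
      ?F (x \<otimes> a1) (y \<otimes> a2) (z1 \<otimes> b) (z2 \<otimes> c))))) = swP M K"
    proof -
      have 1: "swP M (\<lambda>x y z. swD M z (\<lambda>z1 z2. ?F (x \<otimes> a1) (y \<otimes> a2) (z1 \<otimes> b) (z2 \<otimes> c))) =
          cou H a2 \<odot>\<^bsub>M\<^esub> K a1 b c"
        if h: "a1 \<in> carrier H" "a2 \<in> carrier H" "b \<in> carrier H" "c \<in> carrier H"
        for a1 a2 b c
      proof -
        have "swP M (\<lambda>x y z. swD M z (\<lambda>z1 z2. ?F (x \<otimes> a1) (y \<otimes> a2) (z1 \<otimes> b) (z2 \<otimes> c))) =
          swP M (\<lambda>x y z. cou H y \<odot>\<^bsub>M\<^esub> (cou H a2 \<odot>\<^bsub>M\<^esub> swD M z (\<lambda>z1 z2. K (x \<otimes> a1) (z1 \<otimes> b) (z2 \<otimes> c))))"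
          using h by (simp add: cou_mult M.smult_assoc1 c swD_smult M)
        also have "\<dots> = cou H a2 \<odot>\<^bsub>M\<^esub> swD M \<one> (\<lambda>z1 z2. K (\<one> \<otimes> a1) (z1 \<otimes> b) (z2 \<otimes> c))"
          using h by (intro P_counit_mid[OF M] lin_intros K') (simp_all add: M)
        also have "swD M \<one> (\<lambda>z1 z2. K (\<one> \<otimes> a1) (z1 \<otimes> b) (z2 \<otimes> c)) = K (\<one> \<otimes> a1) (\<one> \<otimes> b) (\<one> \<otimes> c)"
          using h by (intro swD_one[OF M] lin_intros K') (simp_all add: M)
        finally show ?thesis using h by simp
      qed
      have 2: "swD M a (\<lambda>a1 a2. cou H a2 \<odot>\<^bsub>M\<^esub> K a1 b c) = K a b c"
        if "a \<in> carrier H" "b \<in> carrier H" "c \<in> carrier H" for a b c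
        using that by (intro swD_counit_right[OF M] lin_intros K') (simp_all add: M)
      show ?thesis by (simp add: 1 2)
    qed
    have R: "swP M (\<lambda>a b c. swP M (\<lambda>p q r. swD M q (\<lambda>q1 q2. swP M (\<lambda>x y z.
      ?F (p \<otimes> a) (x \<otimes> q1 \<otimes> b) (y \<otimes> q2 \<otimes> c) (z \<otimes> r))))) =
      swP M (\<lambda>p q r. swP M (\<lambda>x y z. cou H x \<odot>\<^bsub>M\<^esub> K p (y \<otimes> q) (z \<otimes> r)))"
    proof -
      have 1: "swD M q (\<lambda>q1 q2. swP M (\<lambda>x y z. ?F (p \<otimes> a) (x \<otimes> q1 \<otimes> b) (y \<otimes> q2 \<otimes> c) (z \<otimes> r))) =
        cou H b \<odot>\<^bsub>M\<^esub> swP M (\<lambda>x y z. cou H x \<odot>\<^bsub>M\<^esub> K (p \<otimes> a) (y \<otimes> q \<otimes> c) (z \<otimes> r))"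
        if h: "a \<in> carrier H" "b \<in> carrier H" "c \<in> carrier H" "p \<in> carrier H" "q \<in> carrier H" "r \<in> carrier H"
        for a b c p q r
      proof -
        have s: "cou H q1 \<odot>\<^bsub>M\<^esub> (cou H b \<odot>\<^bsub>M\<^esub> swP M (\<lambda>x y z. cou H x \<odot>\<^bsub>M\<^esub> K (p \<otimes> a) (y \<otimes> q2 \<otimes> c) (z \<otimes> r))) =
           swP M (\<lambda>x y z. cou H q1 \<odot>\<^bsub>M\<^esub> (cou H b \<odot>\<^bsub>M\<^esub> (cou H x \<odot>\<^bsub>M\<^esub> K (p \<otimes> a) (y \<otimes> q2 \<otimes> c) (z \<otimes> r))))"
          if "q1 \<in> carrier H" "q2 \<in> carrier H" for q1 q2
          using h that by (simp add: swP_smult M c)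
        have "swD M q (\<lambda>q1 q2. swP M (\<lambda>x y z. ?F (p \<otimes> a) (x \<otimes> q1 \<otimes> b) (y \<otimes> q2 \<otimes> c) (z \<otimes> r))) =
          swD M q (\<lambda>q1 q2. cou H q1 \<odot>\<^bsub>M\<^esub> (cou H b \<odot>\<^bsub>M\<^esub> swP M (\<lambda>x y z. cou H x \<odot>\<^bsub>M\<^esub> K (p \<otimes> a) (y \<otimes> q2 \<otimes> c) (z \<otimes> r))))"
          using h by (simp add: s cou_mult c modH.R.m_ac flip: M.smult_assoc1)
        also have "\<dots> = cou H b \<odot>\<^bsub>M\<^esub> swP M (\<lambda>x y z. cou H x \<odot>\<^bsub>M\<^esub> K (p \<otimes> a) (y \<otimes> q \<otimes> c) (z \<otimes> r))"
          using h by (intro swD_counit_left[OF M] lin_intros K') (simp_all add: M)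
        finally show ?thesis .
      qed
      have 2: "swP M (\<lambda>p q r. cou H b \<odot>\<^bsub>M\<^esub> swP M (\<lambda>x y z. cou H x \<odot>\<^bsub>M\<^esub> K (p \<otimes> a) (y \<otimes> q \<otimes> c) (z \<otimes> r))) =
        cou H b \<odot>\<^bsub>M\<^esub> swP M (\<lambda>p q r. swP M (\<lambda>x y z. cou H x \<odot>\<^bsub>M\<^esub> K (p \<otimes> a) (y \<otimes> q \<otimes> c) (z \<otimes> r)))"
        if h: "a \<in> carrier H" "b \<in> carrier H" "c \<in> carrier H" for a b c
        using h by (intro swP_smult M) (simp_all add: M c)
      have "swP M (\<lambda>a b c. cou H b \<odot>\<^bsub>M\<^esub> swP M (\<lambda>p q r. swP M (\<lambda>x y z. cou H x \<odot>\<^bsub>M\<^esub> K (p \<otimes> a) (y \<otimes> q \<otimes> c) (z \<otimes> r)))) =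
        swP M (\<lambda>p q r. swP M (\<lambda>x y z. cou H x \<odot>\<^bsub>M\<^esub> K (p \<otimes> \<one>) (y \<otimes> q \<otimes> \<one>) (z \<otimes> r)))"
        by (rule P_counit_mid[OF M]) (intro lin_intros K'; simp add: M)
      then show ?thesis by (simp add: 1 2)
    qed
    show ?thesis using pentagon_sw[OF M F] unfolding L R .
  qed
  note N' = bilin_lin[OF N] and Nc = bilin_closed[OF N]
  let ?G = "\<lambda>a b c. cou H a \<odot>\<^bsub>M\<^esub> N b c"
  have G: "trilin M ?G" by (intro lin_intros N') (simp_all add: M Nc)
  note G' = trilin_lin[OF G]
  \<comment> \<open>Here the common factor \<phi> stands on the right, so its inverse is multiplied
    from the right.\<close>
  let ?K = "\<lambda>a b c. swPi M (\<lambda>x y z. ?G (a \<otimes> x) (b \<otimes> y) (c \<otimes> z))"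
  have K: "trilin M ?K" by (intro lin_intros N') (simp_all add: M Nc)
  have PK: "swP M (\<lambda>a b c. swPi M (\<lambda>x y z. F (a \<otimes> x) (b \<otimes> y) (c \<otimes> z))) = F \<one> \<one> \<one>" if F: "trilin M F" for F
    unfolding P_Pi[OF M F, symmetric] by (rule swap_P_Pi[OF M]) (simp add: trilin_closed[OF F])
  have "N \<one> \<one> = swP M ?K"
    using PK[OF G] by (simp add: Nc)
  also have "\<dots> = swP M (\<lambda>p q r. swP M (\<lambda>x y z. cou H x \<odot>\<^bsub>M\<^esub> ?K p (y \<otimes> q) (z \<otimes> r)))"
    by (rule *[OF K])
  also have "\<dots> = swP M (\<lambda>x y z. swP M (\<lambda>p q r. cou H x \<odot>\<^bsub>M\<^esub> ?K p (y \<otimes> q) (z \<otimes> r)))"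
    by (rule swap_P_P[OF M]) (simp add: M Nc)
  also have "\<dots> = swP M (\<lambda>x y z. cou H x \<odot>\<^bsub>M\<^esub> swP M (\<lambda>p q r. ?K p (y \<otimes> q) (z \<otimes> r)))"
    by (intro swP_cong swP_smult M) (simp_all add: M Nc)
  also have "\<dots> = swP M (\<lambda>a b c. cou H a \<odot>\<^bsub>M\<^esub> N b c)"
  proof (rule swP_cong)
    fix x y z assume h: "x \<in> carrier H" "y \<in> carrier H" "z \<in> carrier H"
    have "trilin M (\<lambda>a b c. ?G a (y \<otimes> b) (z \<otimes> c))" by (intro lin_intros N') (simp_all add: M Nc h)
    from PK[OF this] show "cou H x \<odot>\<^bsub>M\<^esub> swP M (\<lambda>p q r. ?K p (y \<otimes> q) (z \<otimes> r)) = cou H x \<odot>\<^bsub>M\<^esub> N y z"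
      using h by (simp add: H.m_assoc Nc)
  qed
  finally show ?thesis ..
qed

text \<open>\<epsilon> in one slot is multiplicative, so a normalization of \<phi> passes to its
  inverse: it is inserted next to each summand, and \<open>P_Pi\<close> collapses the product. The
  outer slots below are treated alike.\<close>

lemma Pi_counit_mid:
  assumes M: "module k M" and N: "bilin k H H M N"
  shows "swPi M (\<lambda>a b c. cou H b \<odot>\<^bsub>M\<^esub> N a c) = N \<one> \<one>"
proof -
  interpret M: module k M by fact
  note N' = bilin_lin[OF N] and Nc = bilin_closed[OF N]
  let ?G = "\<lambda>a b c. cou H b \<odot>\<^bsub>M\<^esub> N a c"
  have G: "trilin M ?G" by (intro lin_intros N') (simp_all add: M Nc)
  have "swPi M ?G = swPi M (\<lambda>a b c. swP M (\<lambda>x y z. cou H y \<odot>\<^bsub>M\<^esub> (cou H b \<odot>\<^bsub>M\<^esub> N (x \<otimes> a) (z \<otimes> c))))"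
  proof (rule swPi_cong)
    fix a b c assume h: "a \<in> carrier H" "b \<in> carrier H" "c \<in> carrier H"
    have "bilin k H H M (\<lambda>x z. cou H b \<odot>\<^bsub>M\<^esub> N (x \<otimes> a) (z \<otimes> c))" by (intro lin_intros N') (simp_all add: M h)
    from P_counit_mid[OF M this] show "?G a b c = swP M (\<lambda>x y z. cou H y \<odot>\<^bsub>M\<^esub> (cou H b \<odot>\<^bsub>M\<^esub> N (x \<otimes> a) (z \<otimes> c)))"
      using h by simp
  qed
  also have "\<dots> = ?G \<one> \<one> \<one>"
    unfolding P_Pi[OF M G, symmetric] by (simp add: cou_mult M.smult_assoc1 Nc)
  finally show ?thesis by (simp add: Nc)
qed

lemma Pi_counit_right:
  assumes M: "module k M" and N: "bilin k H H M N"
  shows "swPi M (\<lambda>a b c. cou H c \<odot>\<^bsub>M\<^esub> N a b) = N \<one> \<one>"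
proof -
  interpret M: module k M by fact
  note N' = bilin_lin[OF N] and Nc = bilin_closed[OF N]
  let ?G = "\<lambda>a b c. cou H c \<odot>\<^bsub>M\<^esub> N a b"
  have G: "trilin M ?G" by (intro lin_intros N') (simp_all add: M Nc)
  have "swPi M ?G = swPi M (\<lambda>a b c. swP M (\<lambda>x y z. cou H z \<odot>\<^bsub>M\<^esub> (cou H c \<odot>\<^bsub>M\<^esub> N (x \<otimes> a) (y \<otimes> b))))"
  proof (rule swPi_cong)
    fix a b c assume h: "a \<in> carrier H" "b \<in> carrier H" "c \<in> carrier H"
    have "bilin k H H M (\<lambda>x z. cou H c \<odot>\<^bsub>M\<^esub> N (x \<otimes> a) (z \<otimes> b))" by (intro lin_intros N') (simp_all add: M h)
    from P_counit_right[OF M this] show "?G a b c = swP M (\<lambda>x y z. cou H z \<odot>\<^bsub>M\<^esub> (cou H c \<odot>\<^bsub>M\<^esub> N (x \<otimes> a) (y \<otimes> b)))"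
      using h by simp
  qed
  also have "\<dots> = ?G \<one> \<one> \<one>"
    unfolding P_Pi[OF M G, symmetric] by (simp add: cou_mult M.smult_assoc1 Nc)
  finally show ?thesis by (simp add: Nc)
qed

lemma Pi_counit_left:
  assumes M: "module k M" and N: "bilin k H H M N"
  shows "swPi M (\<lambda>a b c. cou H a \<odot>\<^bsub>M\<^esub> N b c) = N \<one> \<one>"
proof -
  interpret M: module k M by fact
  note N' = bilin_lin[OF N] and Nc = bilin_closed[OF N]
  let ?G = "\<lambda>a b c. cou H a \<odot>\<^bsub>M\<^esub> N b c"
  have G: "trilin M ?G" by (intro lin_intros N') (simp_all add: M Nc)
  have "swPi M ?G = swPi M (\<lambda>a b c. swP M (\<lambda>x y z. cou H x \<odot>\<^bsub>M\<^esub> (cou H a \<odot>\<^bsub>M\<^esub> N (y \<otimes> b) (z \<otimes> c))))"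
  proof (rule swPi_cong)
    fix a b c assume h: "a \<in> carrier H" "b \<in> carrier H" "c \<in> carrier H"
    have "bilin k H H M (\<lambda>x z. cou H a \<odot>\<^bsub>M\<^esub> N (x \<otimes> b) (z \<otimes> c))" by (intro lin_intros N') (simp_all add: M h)
    from P_counit_left[OF M this] show "?G a b c = swP M (\<lambda>x y z. cou H x \<odot>\<^bsub>M\<^esub> (cou H a \<odot>\<^bsub>M\<^esub> N (y \<otimes> b) (z \<otimes> c)))"
      using h by simp
  qed
  also have "\<dots> = ?G \<one> \<one> \<one>"
    unfolding P_Pi[OF M G, symmetric] by (simp add: cou_mult M.smult_assoc1 Nc)
  finally show ?thesis by (simp add: Nc)
qed

subsection \<open>The antipode\<close>

lemma anti_linear: "is_linear k H H (antip H)"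
  and anti_one [simp]: "antip H \<one> = \<one>"
  and anti_mult: "x \<in> carrier H ==> y \<in> carrier H ==> antip H (x \<otimes> y) = antip H y \<otimes> antip H x"
  and alpha_closed [simp]: "qalpha H \<in> carrier H"
  and beta_closed [simp]: "qbeta H \<in> carrier H"
  using qh by (simp_all add: is_quasi_hopf_def)

lemma anti_closed [simp]: "x \<in> carrier H ==> antip H x \<in> carrier H"
  by (rule lin_closed[OF anti_linear])

lemma lin_antip [lin_intros]: "is_linear k U H f ==> is_linear k U H (\<lambda>x. antip H (f x))"
  by (rule lin_comp[OF _ anti_linear])

lemma anti_alpha:
  assumes M: "module k M" and G: "is_linear k H M G" and h: "h \<in> carrier H"
  shows "swD M h (\<lambda>a b. G (antip H a \<otimes> qalpha H \<otimes> b)) = cou H h \<odot>\<^bsub>M\<^esub> G (qalpha H)"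
proof -
  have "G (swD H h (\<lambda>a b. antip H a \<otimes> qalpha H \<otimes> b)) = G (cou H h \<odot> qalpha H)"
    unfolding swD_def using qh h by (simp add: is_quasi_hopf_def)
  then show ?thesis using h by (simp add: lin_swD[OF G] M lin_smult[OF G])
qed

lemma anti_beta:
  assumes M: "module k M" and G: "is_linear k H M G" and h: "h \<in> carrier H"
  shows "swD M h (\<lambda>a b. G (a \<otimes> qbeta H \<otimes> antip H b)) = cou H h \<odot>\<^bsub>M\<^esub> G (qbeta H)"
proof -
  have "G (swD H h (\<lambda>a b. a \<otimes> qbeta H \<otimes> antip H b)) = G (cou H h \<odot> qbeta H)"
    unfolding swD_def using qh h by (simp add: is_quasi_hopf_def)
  then show ?thesis using h by (simp add: lin_swD[OF G] M lin_smult[OF G])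
qed

lemma zigzag_P:
  assumes M: "module k M" and G: "is_linear k H M G"
  shows "swP M (\<lambda>a b c. G (a \<otimes> qbeta H \<otimes> antip H b \<otimes> qalpha H \<otimes> c)) = G \<one>"
proof -
  have "G (swP H (\<lambda>a b c. a \<otimes> qbeta H \<otimes> antip H b \<otimes> qalpha H \<otimes> c)) = G \<one>"
    unfolding swP_def using qh by (simp add: is_quasi_hopf_def)
  then show ?thesis by (simp add: lin_swP[OF G] M)
qed

lemma zigzag_Pi:
  assumes M: "module k M" and G: "is_linear k H M G"
  shows "swPi M (\<lambda>a b c. G (antip H a \<otimes> qalpha H \<otimes> b \<otimes> qbeta H \<otimes> antip H c)) = G \<one>"
proof -
  have "G (swPi H (\<lambda>a b c. antip H a \<otimes> qalpha H \<otimes> b \<otimes> qbeta H \<otimes> antip H c)) = G \<one>"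
    unfolding swPi_def using qh by (simp add: is_quasi_hopf_def)
  then show ?thesis by (simp add: lin_swPi[OF G] M)
qed

text \<open>The identity in \<open>H\<close> behind \<open>ev_zeta\<close>. The map
  \<open>?F\<close> contracts the last three legs of the first inverted pentagon with \<beta> and
  \<alpha>. Legs that are comultiplied are then removed by the antipode axioms, and a zigzag axiom
  takes care of the rest.\<close>

lemma zeta_ev_sw:
  assumes M: "module k M" and G: "bilin k H H M G"
  shows "swPi M (\<lambda>a b c. swP M (\<lambda>x y z. swD M x (\<lambda>x1 x2.
      G (x1 \<otimes> a) (x2 \<otimes> b \<otimes> qbeta H \<otimes> antip H (y \<otimes> c) \<otimes> qalpha H \<otimes> z)))) = G \<one> \<one>"
proof -
  interpret M: module k M by fact
  note G' = bilin_lin[OF G] and Gc = bilin_closed[OF G]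
  let ?S = "antip H" and ?al = "qalpha H" and ?be = "qbeta H"
  let ?F = "\<lambda>a b c d. G a (b \<otimes> ?be \<otimes> ?S c \<otimes> ?al \<otimes> d)"
  have F: "quadlin M ?F" by (intro lin_intros G') simp_all
  \<comment> \<open>The third leg of the inverse of \<phi> is comultiplied and closes around
    \<alpha>. This leaves its counit, and the whole factor is normalized away.\<close>
  have A: "swPi M (\<lambda>a b c. swD M c (\<lambda>c1 c2. ?F (a \<otimes> p) (b \<otimes> x \<otimes> q1) (c1 \<otimes> y \<otimes> q2) (c2 \<otimes> z \<otimes> r))) =
      G p (x \<otimes> (q1 \<otimes> ?be \<otimes> ?S q2) \<otimes> ?S y \<otimes> ?al \<otimes> z \<otimes> r)"
    if h: "p \<in> carrier H" "r \<in> carrier H" "q1 \<in> carrier H" "q2 \<in> carrier H" "x \<in> carrier H" "y \<in> carrier H" "z \<in> carrier H" for p r q1 q2 x y z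
  proof -
    let ?g = "\<lambda>a b u. G (a \<otimes> p) (b \<otimes> (x \<otimes> (q1 \<otimes> (?be \<otimes> (?S q2 \<otimes> (?S y \<otimes> (u \<otimes> (z \<otimes> r))))))))"
    have "swD M c (\<lambda>c1 c2. ?F (a \<otimes> p) (b \<otimes> x \<otimes> q1) (c1 \<otimes> y \<otimes> q2) (c2 \<otimes> z \<otimes> r)) = cou H c \<odot>\<^bsub>M\<^esub> ?g a b ?al"
      if hh: "a \<in> carrier H" "b \<in> carrier H" "c \<in> carrier H" for a b c
    proof -
      have "swD M c (\<lambda>c1 c2. ?F (a \<otimes> p) (b \<otimes> x \<otimes> q1) (c1 \<otimes> y \<otimes> q2) (c2 \<otimes> z \<otimes> r)) =
        swD M c (\<lambda>c1 c2. ?g a b (?S c1 \<otimes> ?al \<otimes> c2))"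
        using h hh by (simp add: H.m_assoc anti_mult)
      also have "\<dots> = cou H c \<odot>\<^bsub>M\<^esub> ?g a b ?al"
        using h hh by (intro anti_alpha[OF M] lin_intros G') simp_all
      finally show ?thesis .
    qed
    then have "swPi M (\<lambda>a b c. swD M c (\<lambda>c1 c2. ?F (a \<otimes> p) (b \<otimes> x \<otimes> q1) (c1 \<otimes> y \<otimes> q2) (c2 \<otimes> z \<otimes> r))) =
      swPi M (\<lambda>a b c. cou H c \<odot>\<^bsub>M\<^esub> ?g a b ?al)" by simp
    also have "\<dots> = ?g \<one> \<one> ?al"
      using h by (intro Pi_counit_right[OF M] lin_intros G') simp_all
    finally show ?thesis using h by (simp add: H.m_assoc)
  qed
  \<comment> \<open>The comultiplied \<open>q\<close> closes around \<beta>; what remains of the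
    middle \<phi> is the zigzag \<open>x \<beta> S(y) \<alpha> z\<close>.\<close>
  have B: "swD M q (\<lambda>q1 q2. swP M (\<lambda>x y z. G p (x \<otimes> (q1 \<otimes> ?be \<otimes> ?S q2) \<otimes> ?S y \<otimes> ?al \<otimes> z \<otimes> r))) =
    cou H q \<odot>\<^bsub>M\<^esub> G p r" if h: "p \<in> carrier H" "q \<in> carrier H" "r \<in> carrier H" for p q r
  proof -
    have "swD M q (\<lambda>q1 q2. swP M (\<lambda>x y z. G p (x \<otimes> (q1 \<otimes> ?be \<otimes> ?S q2) \<otimes> ?S y \<otimes> ?al \<otimes> z \<otimes> r))) =
      swP M (\<lambda>x y z. swD M q (\<lambda>q1 q2. G p (x \<otimes> (q1 \<otimes> ?be \<otimes> ?S q2) \<otimes> ?S y \<otimes> ?al \<otimes> z \<otimes> r)))"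
      by (rule swap_D_P[OF M]) (use h in \<open>simp_all add: Gc\<close>)
    also have "\<dots> = swP M (\<lambda>x y z. cou H q \<odot>\<^bsub>M\<^esub> G p (x \<otimes> ?be \<otimes> ?S y \<otimes> ?al \<otimes> z \<otimes> r))"
      by (rule swP_cong, rule anti_beta[OF M, where G = "\<lambda>u. G p (_ \<otimes> u \<otimes> _ \<otimes> _ \<otimes> _ \<otimes> _)"])
        ((intro lin_intros G')?; use h in simp)+
    also have "\<dots> = cou H q \<odot>\<^bsub>M\<^esub> swP M (\<lambda>x y z. G p (x \<otimes> ?be \<otimes> ?S y \<otimes> ?al \<otimes> z \<otimes> r))"
      by (rule swP_smult[OF M]) (use h in \<open>simp_all add: Gc\<close>)
    also have "swP M (\<lambda>x y z. G p (x \<otimes> ?be \<otimes> ?S y \<otimes> ?al \<otimes> z \<otimes> r)) = G p (\<one> \<otimes> r)"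
      by (rule zigzag_P[OF M]) (intro lin_intros G'; use h in simp)
    finally show ?thesis using h by simp
  qed
  have D: "swP M (\<lambda>p q r. cou H q \<odot>\<^bsub>M\<^esub> G p r) = G \<one> \<one>" by (rule P_counit_mid[OF M G])
  show ?thesis
    using pentagon_inv_sw(1)[OF M F] by (simp add: A B D)
qed

text \<open>The identity in \<open>H\<close> behind \<open>ev_expand\<close>, from the second
  inverted pentagon. Now \<alpha> stands in front of \<beta>, so the zigzag axiom for the inverse of
  \<phi> is the one that remains.\<close>

lemma ev_zeta_sw:
  assumes M: "module k M" and G: "bilin k H H M G"
  shows "swPi M (\<lambda>x y z. swD M x (\<lambda>x1 x2. swP M (\<lambda>a b c.
      G (a \<otimes> x1) (antip H (b \<otimes> x2) \<otimes> qalpha H \<otimes> (c \<otimes> y) \<otimes> qbeta H \<otimes> antip H z)))) = G \<one> \<one>"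
proof -
  interpret M: module k M by fact
  note G' = bilin_lin[OF G] and Gc = bilin_closed[OF G]
  let ?S = "antip H" and ?al = "qalpha H" and ?be = "qbeta H"
  let ?F = "\<lambda>a b c d. G a (?S b \<otimes> ?al \<otimes> c \<otimes> ?be \<otimes> ?S d)"
  have F: "quadlin M ?F" by (intro lin_intros G') simp_all
  have A: "swPi M (\<lambda>a b c. swD M b (\<lambda>b1 b2. ?F (a \<otimes> p) (b1 \<otimes> x \<otimes> q) (b2 \<otimes> y \<otimes> r1) (c \<otimes> z \<otimes> r2))) =
      G p (?S q \<otimes> ?S x \<otimes> ?al \<otimes> y \<otimes> (r1 \<otimes> ?be \<otimes> ?S r2) \<otimes> ?S z)"
    if h: "p \<in> carrier H" "q \<in> carrier H" "r1 \<in> carrier H" "r2 \<in> carrier H" "x \<in> carrier H" "y \<in> carrier H" "z \<in> carrier H" for p q r1 r2 x y z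
  proof -
    let ?g = "\<lambda>a c u. G (a \<otimes> p) (?S q \<otimes> (?S x \<otimes> (u \<otimes> (y \<otimes> (r1 \<otimes> (?be \<otimes> (?S r2 \<otimes> (?S z \<otimes> ?S c))))))))"
    have "swD M b (\<lambda>b1 b2. ?F (a \<otimes> p) (b1 \<otimes> x \<otimes> q) (b2 \<otimes> y \<otimes> r1) (c \<otimes> z \<otimes> r2)) = cou H b \<odot>\<^bsub>M\<^esub> ?g a c ?al"
      if hh: "a \<in> carrier H" "b \<in> carrier H" "c \<in> carrier H" for a b c
    proof -
      have "swD M b (\<lambda>b1 b2. ?F (a \<otimes> p) (b1 \<otimes> x \<otimes> q) (b2 \<otimes> y \<otimes> r1) (c \<otimes> z \<otimes> r2)) =
        swD M b (\<lambda>c1 c2. ?g a c (?S c1 \<otimes> ?al \<otimes> c2))"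
        using h hh by (simp add: H.m_assoc anti_mult)
      also have "\<dots> = cou H b \<odot>\<^bsub>M\<^esub> ?g a c ?al"
        using h hh by (intro anti_alpha[OF M] lin_intros G') simp_all
      finally show ?thesis .
    qed
    then have "swPi M (\<lambda>a b c. swD M b (\<lambda>b1 b2. ?F (a \<otimes> p) (b1 \<otimes> x \<otimes> q) (b2 \<otimes> y \<otimes> r1) (c \<otimes> z \<otimes> r2))) =
      swPi M (\<lambda>a b c. cou H b \<odot>\<^bsub>M\<^esub> ?g a c ?al)" by simp
    also have "\<dots> = ?g \<one> \<one> ?al"
      using h by (intro Pi_counit_mid[OF M] lin_intros G') simp_all
    finally show ?thesis using h by (simp add: H.m_assoc)
  qed
  have B: "swD M r (\<lambda>r1 r2. swPi M (\<lambda>x y z. G p (?S q \<otimes> ?S x \<otimes> ?al \<otimes> y \<otimes> (r1 \<otimes> ?be \<otimes> ?S r2) \<otimes> ?S z))) =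
    cou H r \<odot>\<^bsub>M\<^esub> G p (?S q)" if h: "p \<in> carrier H" "q \<in> carrier H" "r \<in> carrier H" for p q r
  proof -
    have "swD M r (\<lambda>r1 r2. swPi M (\<lambda>x y z. G p (?S q \<otimes> ?S x \<otimes> ?al \<otimes> y \<otimes> (r1 \<otimes> ?be \<otimes> ?S r2) \<otimes> ?S z))) =
      swPi M (\<lambda>x y z. swD M r (\<lambda>r1 r2. G p (?S q \<otimes> ?S x \<otimes> ?al \<otimes> y \<otimes> (r1 \<otimes> ?be \<otimes> ?S r2) \<otimes> ?S z)))"
      by (rule swap_D_Pi[OF M]) (use h in \<open>simp_all add: Gc\<close>)
    also have "\<dots> = swPi M (\<lambda>x y z. cou H r \<odot>\<^bsub>M\<^esub> G p (?S q \<otimes> ?S x \<otimes> ?al \<otimes> y \<otimes> ?be \<otimes> ?S z))"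
      by (rule swPi_cong, rule anti_beta[OF M, where G = "\<lambda>u. G p (_ \<otimes> _ \<otimes> _ \<otimes> _ \<otimes> u \<otimes> _)"])
        ((intro lin_intros G')?; use h in simp)+
    also have "\<dots> = swPi M (\<lambda>x y z. cou H r \<odot>\<^bsub>M\<^esub> G p (?S q \<otimes> (?S x \<otimes> ?al \<otimes> y \<otimes> ?be \<otimes> ?S z)))"
      using h by (simp add: H.m_assoc)
    also have "\<dots> = cou H r \<odot>\<^bsub>M\<^esub> swPi M (\<lambda>x y z. G p (?S q \<otimes> (?S x \<otimes> ?al \<otimes> y \<otimes> ?be \<otimes> ?S z)))"
      by (rule swPi_smult[OF M]) (use h in \<open>simp_all add: Gc\<close>)
    also have "swPi M (\<lambda>x y z. G p (?S q \<otimes> (?S x \<otimes> ?al \<otimes> y \<otimes> ?be \<otimes> ?S z))) = G p (?S q \<otimes> \<one>)"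
      by (rule zigzag_Pi[OF M, where G = "\<lambda>u. G p (?S q \<otimes> u)"]) (intro lin_intros G'; use h in simp)
    finally show ?thesis using h by simp
  qed
  have D: "swP M (\<lambda>p q r. cou H r \<odot>\<^bsub>M\<^esub> G p (?S q)) = G \<one> (?S \<one>)"
    by (rule P_counit_right[OF M]) (intro lin_intros G'; simp)
  have E: "swP M (\<lambda>p q r. swD M r (\<lambda>r1 r2. swPi M (\<lambda>x y z. swPi M (\<lambda>a b c. swD M b (\<lambda>b1 b2.
      ?F (a \<otimes> p) (b1 \<otimes> x \<otimes> q) (b2 \<otimes> y \<otimes> r1) (c \<otimes> z \<otimes> r2)))))) =
    swP M (\<lambda>p q r. swD M r (\<lambda>r1 r2. swPi M (\<lambda>x y z. G p (?S q \<otimes> ?S x \<otimes> ?al \<otimes> y \<otimes> (r1 \<otimes> ?be \<otimes> ?S r2) \<otimes> ?S z))))"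
    by (intro swP_cong swD_cong HOL.refl swPi_cong A)
  show ?thesis
    using pentagon_inv_sw(2)[OF M F] unfolding E by (simp add: B D)
qed

subsection \<open>The R-matrix\<close>

lemma tl2_mult:
  assumes M: "module k M" and F: "bilin k H H M F" and X: "X \<in> carrier T2" and Y: "Y \<in> carrier T2"
  shows "tlift M F (X \<otimes>\<^bsub>T2\<^esub> Y) = tlift M (\<lambda>a' b'. tlift M (\<lambda>a b. F (a \<otimes> a') (b \<otimes> b')) X) Y"
  unfolding two_algebras.tlift_mult[OF t2 assms] by (rule swap22[OF M X Y]) (simp add: bilin_closed[OF F])

definition flp where "flp X = tlift T2 (\<lambda>a b. tpure k H H b a) X"

lemma bilin_flp: "bilin k H H T2 (\<lambda>a b. tpure k H H b a)"
  by (intro lin_intros) simp_all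

lemma flp_closed [simp]: "X \<in> carrier T2 ==> flp X \<in> carrier T2"
  unfolding flp_def by (rule two_modules.tlift_closed[OF m2]) simp_all

lemma tlift_flp:
  assumes M: "module k M" and F: "bilin k H H M F" and X: "X \<in> carrier T2"
  shows "tlift M F (flp X) = tlift M (\<lambda>a b. F b a) X"
proof -
  have "tlift M F (flp X) = tlift M (\<lambda>a b. tlift M F (tpure k H H b a)) X"
    unfolding flp_def by (rule two_modules.lin_tlift[OF m2 mod2 M two_modules.tlift_linear[OF m2 M F] X]) simp
  also have "\<dots> = tlift M (\<lambda>a b. F b a) X"
    by (rule two_modules.tlift_cong[OF m2 X]) (simp add: two_modules.tlift_pure[OF m2 M F])
  finally show ?thesis .
qed

lemma flp_mult:
  assumes X: "X \<in> carrier T2" and Y: "Y \<in> carrier T2"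
  shows "flp (X \<otimes>\<^bsub>T2\<^esub> Y) = flp X \<otimes>\<^bsub>T2\<^esub> flp Y"
proof -
  note F = two_modules.bilin_tpure[OF m2]
  have "flp X \<otimes>\<^bsub>T2\<^esub> flp Y = tlift T2 (tpure k H H) (flp X \<otimes>\<^bsub>T2\<^esub> flp Y)"
    using X Y by (simp add: two_modules.tlift_tpure[OF m2])
  also have "\<dots> = tlift T2 (\<lambda>a' b'. tlift T2 (\<lambda>a b. tpure k H H (a \<otimes> a') (b \<otimes> b')) (flp X)) (flp Y)"
    by (rule tl2_mult[OF mod2 F]) (simp_all add: X Y)
  also have "\<dots> = tlift T2 (\<lambda>b' a'. tlift T2 (\<lambda>a b. tpure k H H (a \<otimes> a') (b \<otimes> b')) (flp X)) Y"
    by (rule tlift_flp[OF mod2 _ Y], intro lin_intros two_modules.tlift_lin[OF m2]) (simp_all add: X)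
  also have "\<dots> = tlift T2 (\<lambda>b' a'. tlift T2 (\<lambda>b a. tpure k H H (a \<otimes> a') (b \<otimes> b')) X) Y"
    by (rule two_modules.tlift_cong[OF m2 Y], rule tlift_flp[OF mod2 _ X], intro lin_intros) simp_all
  also have "\<dots> = flp (X \<otimes>\<^bsub>T2\<^esub> Y)"
    unfolding flp_def by (rule tl2_mult[OF mod2 bilin_flp X Y, symmetric])
  finally show ?thesis ..
qed

lemma one2: "\<one>\<^bsub>T2\<^esub> = tpure k H H \<one> \<one>"
  by (simp add: two_algebras.tens_one[OF t2])

lemma flp_one: "flp \<one>\<^bsub>T2\<^esub> = \<one>\<^bsub>T2\<^esub>"
  unfolding one2 flp_def by (rule two_modules.tlift_pure[OF m2 mod2 bilin_flp]) simp_all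

text \<open>\<open>inv\<close> is a genuine inverse only on units, so this is what allows the
  triangularity condition to be read as two equations. The flip is an algebra map and hence
  preserves units.\<close>

lemma flp_R_unit: "flp (Rmat H) \<in> Units T2"
proof -
  let ?R = "Rmat H" and ?I = "inv\<^bsub>T2\<^esub> (Rmat H)"
  have I: "?I \<in> carrier T2" using R_unit by (rule T2.Units_inv_closed)
  have "flp ?R \<otimes>\<^bsub>T2\<^esub> flp ?I = \<one>\<^bsub>T2\<^esub>" "flp ?I \<otimes>\<^bsub>T2\<^esub> flp ?R = \<one>\<^bsub>T2\<^esub>"
    using R_unit I by (simp_all add: T2.Units_r_inv T2.Units_l_inv flp_one flip: flp_mult)
  then show ?thesis using I unfolding Units_def by (auto intro!: bexI[of _ "flp ?I"])
qed

lemma R_flp: "Rmat H \<otimes>\<^bsub>T2\<^esub> flp (Rmat H) = \<one>\<^bsub>T2\<^esub>" "flp (Rmat H) \<otimes>\<^bsub>T2\<^esub> Rmat H = \<one>\<^bsub>T2\<^esub>"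
proof -
  have "Rmat H = inv\<^bsub>T2\<^esub> (flp (Rmat H))"
    using tri by (simp add: is_triangular_def flip2_def flp_def Hn_defs)
  then show "Rmat H \<otimes>\<^bsub>T2\<^esub> flp (Rmat H) = \<one>\<^bsub>T2\<^esub>" "flp (Rmat H) \<otimes>\<^bsub>T2\<^esub> Rmat H = \<one>\<^bsub>T2\<^esub>"
    using T2.Units_l_inv[OF flp_R_unit] T2.Units_r_inv[OF flp_R_unit] by metis+
qed

text \<open>\<open>R\<^sub>2\<^sub>1 R = 1\<close> and \<open>R R\<^sub>2\<^sub>1 = 1\<close>, read
  through \<open>F\<close>. The first gives the symmetry of the braiding, the second serves to
  cancel \<open>R\<close>.\<close>

lemma RR_sw:
  assumes M: "module k M" and F: "bilin k H H M F"
  shows "swR M (\<lambda>r s. swR M (\<lambda>r' s'. F (s' \<otimes> r) (r' \<otimes> s))) = F \<one> \<one>"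
    and "swR M (\<lambda>r s. swR M (\<lambda>r' s'. F (r' \<otimes> s) (s' \<otimes> r))) = F \<one> \<one>"
proof -
  note F' = bilin_lin[OF F]
  have o: "tlift M F \<one>\<^bsub>T2\<^esub> = F \<one> \<one>" by (simp add: one2 two_modules.tlift_pure[OF m2 M F])
  have b: "bilin k H H M (\<lambda>a b. F (a \<otimes> r) (b \<otimes> s))" if "r \<in> carrier H" "s \<in> carrier H" for r s
    by (intro lin_intros F') (use that in simp_all)
  show "swR M (\<lambda>r s. swR M (\<lambda>r' s'. F (s' \<otimes> r) (r' \<otimes> s))) = F \<one> \<one>"
    unfolding swR_def o[symmetric] R_flp(2)[symmetric] tl2_mult[OF M F flp_closed[OF R_closed] R_closed]
    by (rule two_modules.tlift_cong[OF m2 R_closed]) (simp add: tlift_flp[OF M b])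
  have b': "bilin k H H M (\<lambda>a' b'. swR M (\<lambda>a b. F (a \<otimes> a') (b \<otimes> b')))"
    by (intro lin_intros F') (simp_all add: M)
  show "swR M (\<lambda>r s. swR M (\<lambda>r' s'. F (r' \<otimes> s) (s' \<otimes> r))) = F \<one> \<one>"
    unfolding o[symmetric] R_flp(1)[symmetric] tl2_mult[OF M F R_closed flp_closed[OF R_closed]]
    by (simp add: tlift_flp[OF M b'] flip: swR_def)
qed

text \<open>The relation \<open>\<Delta>\<^sup>o\<^sup>p(h) R = R \<Delta>(h)\<close> with both legs
  exchanged, because the braiding lets the second leg of \<open>R\<close> act on the factor that
  comes to stand in front.\<close>

lemma R_cop_sw:
  assumes M: "module k M" and F: "bilin k H H M F" and h: "h \<in> carrier H"
  shows "swR M (\<lambda>r s. swD M h (\<lambda>h1 h2. F (h1 \<otimes> s) (h2 \<otimes> r))) = swD M h (\<lambda>h1 h2. swR M (\<lambda>r s. F (s \<otimes> h2) (r \<otimes> h1)))"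
proof -
  note F' = bilin_lin[OF F]
  have e: "flp (cop H h) = Rmat H \<otimes>\<^bsub>T2\<^esub> cop H h \<otimes>\<^bsub>T2\<^esub> inv\<^bsub>T2\<^esub> (Rmat H)"
    using qt h by (simp add: is_quasitriangular_def flip2_def flp_def Hn_defs)
  have e': "flp (cop H h) \<otimes>\<^bsub>T2\<^esub> Rmat H = Rmat H \<otimes>\<^bsub>T2\<^esub> cop H h"
    unfolding e using h R_unit by (simp add: T2.m_assoc T2.Units_l_inv)
  let ?F = "\<lambda>a b. F b a"
  have bF: "bilin k H H M ?F" by (intro lin_intros F') simp_all
  have b: "bilin k H H M (\<lambda>a b. F (b \<otimes> s) (a \<otimes> r))" if "r \<in> carrier H" "s \<in> carrier H" for r s
    by (intro lin_intros F') (use that in simp_all)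
  have "tlift M ?F (flp (cop H h) \<otimes>\<^bsub>T2\<^esub> Rmat H) = swR M (\<lambda>r s. swD M h (\<lambda>h1 h2. F (h1 \<otimes> s) (h2 \<otimes> r)))"
    unfolding swR_def swD_def using h
    by (simp only: tl2_mult[OF M bF] flp_closed cop_closed R_closed)
      (rule two_modules.tlift_cong[OF m2 R_closed], simp add: tlift_flp[OF M b])
  moreover have "tlift M ?F (Rmat H \<otimes>\<^bsub>T2\<^esub> cop H h) = swD M h (\<lambda>h1 h2. swR M (\<lambda>r s. F (s \<otimes> h2) (r \<otimes> h1)))"
    unfolding swR_def swD_def using h
    by (simp only: tl2_mult[OF M bF] cop_closed R_closed)
  ultimately show ?thesis by (simp only: e')
qed

lemma lin_mult3:
  assumes "y \<in> carrier T3"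
  shows "is_linear k T3 T3 (\<lambda>x. y \<otimes>\<^bsub>T3\<^esub> x)" "is_linear k T3 T3 (\<lambda>x. x \<otimes>\<^bsub>T3\<^esub> y)"
  using assms by (auto intro: lin_intros)

lemma mulR3:
  "X \<in> carrier T3 ==> (!!a b c. a \<in> carrier H ==> b \<in> carrier H ==> c \<in> carrier H ==> F a b c \<in> carrier T3) ==>
    X \<otimes>\<^bsub>T3\<^esub> swP T3 F = swP T3 (\<lambda>a b c. X \<otimes>\<^bsub>T3\<^esub> F a b c)"
  "X \<in> carrier T3 ==> (!!a b c. a \<in> carrier H ==> b \<in> carrier H ==> c \<in> carrier H ==> F a b c \<in> carrier T3) ==>
    X \<otimes>\<^bsub>T3\<^esub> swPi T3 F = swPi T3 (\<lambda>a b c. X \<otimes>\<^bsub>T3\<^esub> F a b c)"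
  "X \<in> carrier T3 ==> (!!a b. a \<in> carrier H ==> b \<in> carrier H ==> F' a b \<in> carrier T3) ==>
    X \<otimes>\<^bsub>T3\<^esub> swR T3 F' = swR T3 (\<lambda>a b. X \<otimes>\<^bsub>T3\<^esub> F' a b)"
  by (simp_all add: lin_swP[OF lin_mult3(1)] lin_swPi[OF lin_mult3(1)] lin_swR[OF lin_mult3(1)])

lemma mulL3:
  "X \<in> carrier T3 ==> (!!a b c. a \<in> carrier H ==> b \<in> carrier H ==> c \<in> carrier H ==> F a b c \<in> carrier T3) ==>
    swP T3 F \<otimes>\<^bsub>T3\<^esub> X = swP T3 (\<lambda>a b c. F a b c \<otimes>\<^bsub>T3\<^esub> X)"
  "X \<in> carrier T3 ==> (!!a b c. a \<in> carrier H ==> b \<in> carrier H ==> c \<in> carrier H ==> F a b c \<in> carrier T3) ==>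
    swPi T3 F \<otimes>\<^bsub>T3\<^esub> X = swPi T3 (\<lambda>a b c. F a b c \<otimes>\<^bsub>T3\<^esub> X)"
  "X \<in> carrier T3 ==> (!!a b. a \<in> carrier H ==> b \<in> carrier H ==> F' a b \<in> carrier T3) ==>
    swR T3 F' \<otimes>\<^bsub>T3\<^esub> X = swR T3 (\<lambda>a b. F' a b \<otimes>\<^bsub>T3\<^esub> X)"
  by (simp_all add: lin_swP[OF lin_mult3(2)] lin_swPi[OF lin_mult3(2)] lin_swR[OF lin_mult3(2)])

text \<open>Recovers a tensor as the sum of its own pure parts. The bare factors \<phi> and its
  inverse in the hexagons are written as Sweedler sums in this way, so that products with them can
  be expanded.\<close>

lemma tl3_e3:
  assumes X: "X \<in> carrier T3" shows "tlift3 T3 e3 X = X"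
proof -
  have "tlift3 T3 e3 X = tlift T3 (tpure k T2 H) X"
    unfolding tlift3_def
  proof (rule two_modules.tlift_cong[OF m3 X])
    fix Y c assume Y: "Y \<in> carrier T2" and c: "c \<in> carrier H"
    show "tlift T3 (\<lambda>a b. e3 a b c) Y = tpure k T2 H Y c"
    proof (rule two_modules.tens_linear_ext[OF m2 mod3 two_modules.tlift_linear[OF m2 mod3] _ _ Y])
      show b: "bilin k H H T3 (\<lambda>a b. e3 a b c)" by (intro lin_intros) (simp_all add: c)
      show "is_linear k T2 T3 (\<lambda>Y. tpure k T2 H Y c)" by (intro lin_intros) (simp_all add: c)
      show "tlift T3 (\<lambda>a b. e3 a b c) (tpure k H H v w) = e3 v w c" if "v \<in> carrier H" "w \<in> carrier H" for v w
        using that by (simp add: two_modules.tlift_pure[OF m2 mod3 b])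
    qed
  qed
  also have "\<dots> = X" by (rule two_modules.tlift_tpure[OF m3 X])
  finally show ?thesis .
qed

lemma coassoc_e3: "coassoc H = swP T3 e3" "coassoc_inv H = swPi T3 e3"
  unfolding swP_def swPi_def by (simp_all add: tl3_e3)

lemma tl3_sw:
  assumes M: "module k M" and F: "trilin M F"
  shows "(!!a b c. a \<in> carrier H ==> b \<in> carrier H ==> c \<in> carrier H ==> G a b c \<in> carrier T3) ==> tlift3 M F (swP T3 G) = swP M (\<lambda>a b c. tlift3 M F (G a b c))"
    "(!!a b c. a \<in> carrier H ==> b \<in> carrier H ==> c \<in> carrier H ==> G a b c \<in> carrier T3) ==> tlift3 M F (swPi T3 G) = swPi M (\<lambda>a b c. tlift3 M F (G a b c))"
    "h \<in> carrier H ==> (!!a b. a \<in> carrier H ==> b \<in> carrier H ==> G' a b \<in> carrier T3) ==> tlift3 M F (swD T3 h G') = swD M h (\<lambda>a b. tlift3 M F (G' a b))"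
    "(!!a b. a \<in> carrier H ==> b \<in> carrier H ==> G' a b \<in> carrier T3) ==> tlift3 M F (swR T3 G') = swR M (\<lambda>a b. tlift3 M F (G' a b))"
  by (simp_all add: lin_swP[OF tl3_linear[OF M F] mod3 M] lin_swPi[OF tl3_linear[OF M F] mod3 M] lin_swD[OF tl3_linear[OF M F] mod3 M] lin_swR[OF tl3_linear[OF M F] mod3 M])

lemma hexagon_left_sw:
  assumes M: "module k M" and F: "trilin M F"
  shows "swR M (\<lambda>r s. swD M r (\<lambda>r1 r2. F r1 r2 s)) =
    swP M (\<lambda>x y z. swR M (\<lambda>r' s'. swPi M (\<lambda>a' b' c'. swR M (\<lambda>r s. swP M (\<lambda>a b c.
      F (b \<otimes> r \<otimes> a' \<otimes> x) (c \<otimes> c' \<otimes> r' \<otimes> y) (a \<otimes> s \<otimes> b' \<otimes> s' \<otimes> z))))))"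
proof -
  \<comment> \<open>The right-hand side of the hexagon has five factors. \<open>Q1\<close> to
    \<open>Q5\<close> are its partial products from the left, each expanded into a single nested
    sum.\<close>
  define Q1 where "Q1 = swP T3 (\<lambda>a b c. e3 b c a)"
  define Q2 where "Q2 = swR T3 (\<lambda>r s. swP T3 (\<lambda>a b c. e3 (b \<otimes> r) c (a \<otimes> s)))"
  define Q3 where "Q3 = swPi T3 (\<lambda>a' b' c'. swR T3 (\<lambda>r s. swP T3 (\<lambda>a b c. e3 (b \<otimes> r \<otimes> a') (c \<otimes> c') (a \<otimes> s \<otimes> b'))))"
  define Q4 where "Q4 = swR T3 (\<lambda>r' s'. swPi T3 (\<lambda>a' b' c'. swR T3 (\<lambda>r s. swP T3 (\<lambda>a b c. e3 (b \<otimes> r \<otimes> a') (c \<otimes> c' \<otimes> r') (a \<otimes> s \<otimes> b' \<otimes> s')))))"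
  define Q5 where "Q5 = swP T3 (\<lambda>x y z. swR T3 (\<lambda>r' s'. swPi T3 (\<lambda>a' b' c'. swR T3 (\<lambda>r s. swP T3 (\<lambda>a b c.
      e3 (b \<otimes> r \<otimes> a' \<otimes> x) (c \<otimes> c' \<otimes> r' \<otimes> y) (a \<otimes> s \<otimes> b' \<otimes> s' \<otimes> z))))))"
  have cl: "Q1 \<in> carrier T3" "Q2 \<in> carrier T3" "Q3 \<in> carrier T3" "Q4 \<in> carrier T3" by (simp_all add: Q1_def Q2_def Q3_def Q4_def)
  have 1: "Q1 \<otimes>\<^bsub>T3\<^esub> swR T3 (\<lambda>r s. e3 r \<one> s) = Q2"
  proof -
    have "Q1 \<otimes>\<^bsub>T3\<^esub> swR T3 (\<lambda>r s. e3 r \<one> s) = swR T3 (\<lambda>r s. Q1 \<otimes>\<^bsub>T3\<^esub> e3 r \<one> s)" by (simp add: mulR3 cl)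
    then show ?thesis by (simp add: Q1_def Q2_def mulL3 e3_mult)
  qed
  have 2: "Q2 \<otimes>\<^bsub>T3\<^esub> swPi T3 (\<lambda>a b c. e3 a c b) = Q3"
  proof -
    have "Q2 \<otimes>\<^bsub>T3\<^esub> swPi T3 (\<lambda>a b c. e3 a c b) = swPi T3 (\<lambda>a b c. Q2 \<otimes>\<^bsub>T3\<^esub> e3 a c b)" by (simp add: mulR3 cl)
    then show ?thesis by (simp add: Q2_def Q3_def mulL3 e3_mult)
  qed
  have 3: "Q3 \<otimes>\<^bsub>T3\<^esub> swR T3 (\<lambda>r s. e3 \<one> r s) = Q4"
  proof -
    have "Q3 \<otimes>\<^bsub>T3\<^esub> swR T3 (\<lambda>r s. e3 \<one> r s) = swR T3 (\<lambda>r s. Q3 \<otimes>\<^bsub>T3\<^esub> e3 \<one> r s)" by (simp add: mulR3 cl)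
    then show ?thesis by (simp add: Q3_def Q4_def mulL3 e3_mult)
  qed
  have 4: "Q4 \<otimes>\<^bsub>T3\<^esub> swP T3 e3 = Q5"
  proof -
    have "Q4 \<otimes>\<^bsub>T3\<^esub> swP T3 e3 = swP T3 (\<lambda>x y z. Q4 \<otimes>\<^bsub>T3\<^esub> e3 x y z)" by (simp add: mulR3 cl)
    then show ?thesis by (simp add: Q4_def Q5_def mulL3 e3_mult)
  qed
  have "swR T3 (\<lambda>r s. swD T3 r (\<lambda>r1 r2. e3 r1 r2 s)) = Q5"
    unfolding 1[symmetric] 2[symmetric] 3[symmetric] 4[symmetric] coassoc_e3(1)[symmetric] unfolding Q1_def swR_def swD_def swP_def swPi_def
    using qt by (simp add: is_quasitriangular_def Hn_defs)
  from arg_cong[OF this, of "tlift3 M F"] show ?thesis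
    unfolding Q5_def by (simp add: tl3_sw[OF M F] tl3_pure[OF M F])
qed

lemma hexagon_right_sw:
  assumes M: "module k M" and F: "trilin M F"
  shows "swR M (\<lambda>r s. swD M s (\<lambda>s1 s2. F r s1 s2)) =
    swPi M (\<lambda>x y z. swR M (\<lambda>r' s'. swP M (\<lambda>a' b' c'. swR M (\<lambda>r s. swPi M (\<lambda>a b c.
      F (c \<otimes> r \<otimes> b' \<otimes> r' \<otimes> x) (a \<otimes> a' \<otimes> s' \<otimes> y) (b \<otimes> s \<otimes> c' \<otimes> z))))))"
proof -
  define Q1 where "Q1 = swPi T3 (\<lambda>a b c. e3 c a b)"
  define Q2 where "Q2 = swR T3 (\<lambda>r s. swPi T3 (\<lambda>a b c. e3 (c \<otimes> r) a (b \<otimes> s)))"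
  define Q3 where "Q3 = swP T3 (\<lambda>a' b' c'. swR T3 (\<lambda>r s. swPi T3 (\<lambda>a b c. e3 (c \<otimes> r \<otimes> b') (a \<otimes> a') (b \<otimes> s \<otimes> c'))))"
  define Q4 where "Q4 = swR T3 (\<lambda>r' s'. swP T3 (\<lambda>a' b' c'. swR T3 (\<lambda>r s. swPi T3 (\<lambda>a b c. e3 (c \<otimes> r \<otimes> b' \<otimes> r') (a \<otimes> a' \<otimes> s') (b \<otimes> s \<otimes> c')))))"
  define Q5 where "Q5 = swPi T3 (\<lambda>x y z. swR T3 (\<lambda>r' s'. swP T3 (\<lambda>a' b' c'. swR T3 (\<lambda>r s. swPi T3 (\<lambda>a b c.
      e3 (c \<otimes> r \<otimes> b' \<otimes> r' \<otimes> x) (a \<otimes> a' \<otimes> s' \<otimes> y) (b \<otimes> s \<otimes> c' \<otimes> z))))))"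
  have cl: "Q1 \<in> carrier T3" "Q2 \<in> carrier T3" "Q3 \<in> carrier T3" "Q4 \<in> carrier T3" by (simp_all add: Q1_def Q2_def Q3_def Q4_def)
  have 1: "Q1 \<otimes>\<^bsub>T3\<^esub> swR T3 (\<lambda>r s. e3 r \<one> s) = Q2"
  proof -
    have "Q1 \<otimes>\<^bsub>T3\<^esub> swR T3 (\<lambda>r s. e3 r \<one> s) = swR T3 (\<lambda>r s. Q1 \<otimes>\<^bsub>T3\<^esub> e3 r \<one> s)" by (simp add: mulR3 cl)
    then show ?thesis by (simp add: Q1_def Q2_def mulL3 e3_mult)
  qed
  have 2: "Q2 \<otimes>\<^bsub>T3\<^esub> swP T3 (\<lambda>a b c. e3 b a c) = Q3"
  proof -
    have "Q2 \<otimes>\<^bsub>T3\<^esub> swP T3 (\<lambda>a b c. e3 b a c) = swP T3 (\<lambda>a b c. Q2 \<otimes>\<^bsub>T3\<^esub> e3 b a c)" by (simp add: mulR3 cl)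
    then show ?thesis by (simp add: Q2_def Q3_def mulL3 e3_mult)
  qed
  have 3: "Q3 \<otimes>\<^bsub>T3\<^esub> swR T3 (\<lambda>r s. e3 r s \<one>) = Q4"
  proof -
    have "Q3 \<otimes>\<^bsub>T3\<^esub> swR T3 (\<lambda>r s. e3 r s \<one>) = swR T3 (\<lambda>r s. Q3 \<otimes>\<^bsub>T3\<^esub> e3 r s \<one>)" by (simp add: mulR3 cl)
    then show ?thesis by (simp add: Q3_def Q4_def mulL3 e3_mult)
  qed
  have 4: "Q4 \<otimes>\<^bsub>T3\<^esub> swPi T3 e3 = Q5"
  proof -
    have "Q4 \<otimes>\<^bsub>T3\<^esub> swPi T3 e3 = swPi T3 (\<lambda>x y z. Q4 \<otimes>\<^bsub>T3\<^esub> e3 x y z)" by (simp add: mulR3 cl)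
    then show ?thesis by (simp add: Q4_def Q5_def mulL3 e3_mult)
  qed
  have "swR T3 (\<lambda>r s. swD T3 s (\<lambda>s1 s2. e3 r s1 s2)) = Q5"
    unfolding 1[symmetric] 2[symmetric] 3[symmetric] 4[symmetric] coassoc_e3(2)[symmetric] unfolding Q1_def swR_def swD_def swP_def swPi_def
    using qt by (simp add: is_quasitriangular_def Hn_defs)
  from arg_cong[OF this, of "tlift3 M F"] show ?thesis
    unfolding Q5_def by (simp add: tl3_sw[OF M F] tl3_pure[OF M F])
qed

text \<open>With \<epsilon> in the first slot of the first hexagon every \<phi> is normalized away,
  and \<open>R = (1 \<otimes> (\<epsilon> \<otimes> id)(R)) R\<close> remains. Triangularity is then
  used to cancel \<open>R\<close>.\<close>

lemma R_counit_left:
  assumes M: "module k M" and G: "is_linear k H M G"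
  shows "swR M (\<lambda>r s. cou H r \<odot>\<^bsub>M\<^esub> G s) = G \<one>"
proof -
  interpret M: module k M by fact
  have *: "swR M N = swR M (\<lambda>r' s'. swR M (\<lambda>r s. cou H r \<odot>\<^bsub>M\<^esub> N r' (s \<otimes> s')))" if N: "bilin k H H M N" for N
  proof -
    note N' = bilin_lin[OF N] and Nc = bilin_closed[OF N]
    let ?F = "\<lambda>a b c. cou H a \<odot>\<^bsub>M\<^esub> N b c"
    have F: "trilin M ?F" by (intro lin_intros N') (simp_all add: M Nc)
    have L: "swR M (\<lambda>r s. swD M r (\<lambda>r1 r2. ?F r1 r2 s)) = swR M N"
    proof (rule swR_cong)
      fix r s assume h: "r \<in> carrier H" "s \<in> carrier H"
      show "swD M r (\<lambda>r1 r2. ?F r1 r2 s) = N r s"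
        by (rule swD_counit_left[OF M h(1), of "\<lambda>r. N r s"]) (intro lin_intros N' h)
    qed
    \<comment> \<open>In \<open>\<phi>\<^sub>3\<^sub>1\<^sub>2\<close> the leg that reaches the
      first slot is the middle one, so the axiom itself applies. For the other two associators it is
      the first leg, which needs the derived normalizations.\<close>
    have A: "swP M (\<lambda>a b c. ?F (b \<otimes> r \<otimes> a' \<otimes> x) (c \<otimes> c' \<otimes> r' \<otimes> y) (a \<otimes> s \<otimes> b' \<otimes> s' \<otimes> z)) =
      cou H a' \<odot>\<^bsub>M\<^esub> (cou H x \<odot>\<^bsub>M\<^esub> (cou H r \<odot>\<^bsub>M\<^esub> N (c' \<otimes> r' \<otimes> y) (s \<otimes> b' \<otimes> s' \<otimes> z)))"
      if h: "x \<in> carrier H" "y \<in> carrier H" "z \<in> carrier H" "r' \<in> carrier H" "s' \<in> carrier H" "a' \<in> carrier H" "b' \<in> carrier H" "c' \<in> carrier H"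
        "r \<in> carrier H" "s \<in> carrier H" for x y z r' s' a' b' c' r s
    proof -
      let ?N = "\<lambda>a c. cou H a' \<odot>\<^bsub>M\<^esub> (cou H x \<odot>\<^bsub>M\<^esub> (cou H r \<odot>\<^bsub>M\<^esub> N (c \<otimes> c' \<otimes> r' \<otimes> y) (a \<otimes> s \<otimes> b' \<otimes> s' \<otimes> z)))"
      have "swP M (\<lambda>a b c. ?F (b \<otimes> r \<otimes> a' \<otimes> x) (c \<otimes> c' \<otimes> r' \<otimes> y) (a \<otimes> s \<otimes> b' \<otimes> s' \<otimes> z)) =
        swP M (\<lambda>a b c. cou H b \<odot>\<^bsub>M\<^esub> ?N a c)"
        using h by (simp add: cou_mult Nc modH.R.m_ac flip: M.smult_assoc1)
      also have "\<dots> = ?N \<one> \<one>"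
        by (rule P_counit_mid[OF M]) (intro lin_intros N'; simp add: h M)
      finally show ?thesis using h by simp
    qed
    have B: "swPi M (\<lambda>a' b' c'. swR M (\<lambda>r s. cou H a' \<odot>\<^bsub>M\<^esub> (cou H x \<odot>\<^bsub>M\<^esub> (cou H r \<odot>\<^bsub>M\<^esub> N (c' \<otimes> r' \<otimes> y) (s \<otimes> b' \<otimes> s' \<otimes> z))))) =
      cou H x \<odot>\<^bsub>M\<^esub> swR M (\<lambda>r s. cou H r \<odot>\<^bsub>M\<^esub> N (r' \<otimes> y) (s \<otimes> s' \<otimes> z))"
      if h: "x \<in> carrier H" "y \<in> carrier H" "z \<in> carrier H" "r' \<in> carrier H" "s' \<in> carrier H" for x y z r' s'
    proof -
      let ?N = "\<lambda>b' c'. cou H x \<odot>\<^bsub>M\<^esub> swR M (\<lambda>r s. cou H r \<odot>\<^bsub>M\<^esub> N (c' \<otimes> r' \<otimes> y) (s \<otimes> b' \<otimes> s' \<otimes> z))"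
      have "swPi M (\<lambda>a' b' c'. swR M (\<lambda>r s. cou H a' \<odot>\<^bsub>M\<^esub> (cou H x \<odot>\<^bsub>M\<^esub> (cou H r \<odot>\<^bsub>M\<^esub> N (c' \<otimes> r' \<otimes> y) (s \<otimes> b' \<otimes> s' \<otimes> z))))) =
        swPi M (\<lambda>a' b' c'. cou H a' \<odot>\<^bsub>M\<^esub> ?N b' c')"
        using h by (simp add: swR_smult M Nc)
      also have "\<dots> = ?N \<one> \<one>"
        by (rule Pi_counit_left[OF M]) (intro lin_intros N'; simp add: h M)
      finally show ?thesis using h by simp
    qed
    have C: "swP M (\<lambda>x y z. swR M (\<lambda>r' s'. cou H x \<odot>\<^bsub>M\<^esub> swR M (\<lambda>r s. cou H r \<odot>\<^bsub>M\<^esub> N (r' \<otimes> y) (s \<otimes> s' \<otimes> z)))) =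
      swR M (\<lambda>r' s'. swR M (\<lambda>r s. cou H r \<odot>\<^bsub>M\<^esub> N r' (s \<otimes> s')))"
    proof -
      let ?N = "\<lambda>y z. swR M (\<lambda>r' s'. swR M (\<lambda>r s. cou H r \<odot>\<^bsub>M\<^esub> N (r' \<otimes> y) (s \<otimes> s' \<otimes> z)))"
      have "swP M (\<lambda>x y z. swR M (\<lambda>r' s'. cou H x \<odot>\<^bsub>M\<^esub> swR M (\<lambda>r s. cou H r \<odot>\<^bsub>M\<^esub> N (r' \<otimes> y) (s \<otimes> s' \<otimes> z)))) =
        swP M (\<lambda>x y z. cou H x \<odot>\<^bsub>M\<^esub> ?N y z)"
        by (rule swP_cong, rule swR_smult[OF M]) (simp_all add: M Nc)
      also have "\<dots> = ?N \<one> \<one>"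
        by (rule P_counit_left[OF M]) (intro lin_intros N'; simp add: M)
      finally show ?thesis by simp
    qed
    show ?thesis
      using hexagon_left_sw[OF M F] unfolding L by (simp add: A B C)
  qed
  note G' = lin_comp[OF _ G]
  have Gc: "G x \<in> carrier M" if "x \<in> carrier H" for x by (rule lin_closed[OF G that])
  let ?F = "\<lambda>a b. cou H a \<odot>\<^bsub>M\<^esub> G b"
  have F: "bilin k H H M ?F" by (intro lin_intros G') (simp_all add: M Gc)
  \<comment> \<open>\<open>?N\<close> multiplies by \<open>R\<^sub>2\<^sub>1\<close> on the right,
    which cancels the right-hand factor \<open>R\<close> on both sides.\<close>
  let ?N = "\<lambda>p q. swR M (\<lambda>r s. ?F (p \<otimes> s) (q \<otimes> r))"
  have N: "bilin k H H M ?N" by (intro lin_intros G') (simp_all add: M Gc)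
  have sw: "swR M (\<lambda>r s. swR M (\<lambda>r' s'. K (r \<otimes> s') (s \<otimes> r'))) = K \<one> \<one>" if K: "bilin k H H M K" for K
    unfolding RR_sw(2)[OF M K, symmetric] by (rule swap_R_R[OF M]) (simp add: bilin_closed[OF K])
  have "G \<one> = swR M ?N" using sw[OF F] by (simp add: Gc)
  also have "\<dots> = swR M (\<lambda>r' s'. swR M (\<lambda>r s. cou H r \<odot>\<^bsub>M\<^esub> ?N r' (s \<otimes> s')))" by (rule *[OF N])
  also have "\<dots> = swR M (\<lambda>r s. swR M (\<lambda>r' s'. cou H r \<odot>\<^bsub>M\<^esub> ?N r' (s \<otimes> s')))"
    by (rule swap_R_R[OF M]) (simp add: M Gc)
  also have "\<dots> = swR M (\<lambda>r s. cou H r \<odot>\<^bsub>M\<^esub> swR M (\<lambda>r' s'. ?N r' (s \<otimes> s')))"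
    by (rule swR_cong, rule swR_smult[OF M]) (simp_all add: M Gc)
  also have "\<dots> = swR M (\<lambda>r s. cou H r \<odot>\<^bsub>M\<^esub> G s)"
  proof (rule swR_cong)
    fix r s assume h: "r \<in> carrier H" "s \<in> carrier H"
    have b: "bilin k H H M (\<lambda>a b. ?F a (s \<otimes> b))" by (intro lin_intros G') (simp_all add: M Gc h)
    show "cou H r \<odot>\<^bsub>M\<^esub> swR M (\<lambda>r' s'. ?N r' (s \<otimes> s')) = cou H r \<odot>\<^bsub>M\<^esub> G s"
      using sw[OF b] h by (simp add: H.m_assoc Gc)
  qed
  finally show ?thesis ..
qed

end

section \<open>Bounded graded modules\<close>

lemma finsum_single:
  assumes "abelian_group M" "finite D" "i \<in> D" "f i \<in> carrier M" "!!j. j \<in> D ==> j \<noteq> i ==> f j = \<zero>\<^bsub>M\<^esub>"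
  shows "finsum M f D = f i"
proof -
  interpret M: abelian_group M by fact
  have c: "f \<in> D \<rightarrow> carrier M" using assms(4,5) by (metis M.zero_closed Pi_I)
  have "finsum M f {i} = finsum M f D"
    by (rule M.add.finprod_mono_neutral_cong_left) (use assms c in auto)
  then show ?thesis using assms(4) by simp
qed

lemma finsum_superset:
  assumes "abelian_group M" "finite B" "A \<subseteq> B" "!!i. i \<in> B - A ==> f i = \<zero>\<^bsub>M\<^esub>" "f \<in> B \<rightarrow> carrier M"
  shows "finsum M f A = finsum M f B"
proof -
  interpret M: abelian_group M by fact
  show ?thesis by (rule M.add.finprod_mono_neutral_cong_left) (use assms in auto)
qed

lemma finsum_all_zero:
  assumes "abelian_group M" "!!i. i \<in> D ==> f i = \<zero>\<^bsub>M\<^esub>"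
  shows "finsum M f D = \<zero>\<^bsub>M\<^esub>"
proof -
  interpret M: abelian_group M by fact
  show ?thesis by (rule M.add.finprod_one_eqI) (rule assms(2))
qed

lemma finsum_in:
  assumes "abelian_group M" "S \<subseteq> carrier M" "\<zero>\<^bsub>M\<^esub> \<in> S" "!!x y. x \<in> S ==> y \<in> S ==> x \<oplus>\<^bsub>M\<^esub> y \<in> S"
    "!!i. i \<in> D ==> f i \<in> S"
  shows "finsum M f D \<in> S"
proof (cases "finite D")
  case False then show ?thesis using assms(3) by (simp add: finsum_def finprod_def)
next
  case True
  interpret M: abelian_group M by fact
  from True show ?thesis using assms(5)
  proof (induction D)
    case empty then show ?case using assms(3) by simp
  next
    case (insert i D)
    then have "f \<in> D \<rightarrow> carrier M" "f i \<in> carrier M" using assms(2) by auto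
    then show ?case using insert by (simp add: assms(4))
  qed
qed

lemma tlift_in:
  assumes "two_modules k V W" "X \<in> carrier (tens k V W)" "\<zero>\<^bsub>M\<^esub> \<in> S" "!!x y. x \<in> S ==> y \<in> S ==> x \<oplus>\<^bsub>M\<^esub> y \<in> S"
    "!!v w. v \<in> carrier V ==> w \<in> carrier W ==> b v w \<in> S"
  shows "tlift M b X \<in> S"
proof -
  have "psum M b xs \<in> S" if "set xs \<subseteq> carrier V \<times> carrier W" for xs
    using that by (induction xs) (auto intro!: assms(3-5))
  then show ?thesis unfolding tlift_psum using two_modules.trep_carrier[OF assms(1,2)] by blast
qed

lemma module_cong:
  assumes "module k V" "carrier W = carrier V" "add W = add V" "zero W = zero V" "smult W = smult V"
  shows "module k W"
proof -
  interpret V: module k V by fact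
  have n: "\<exists>y\<in>carrier V. y \<oplus>\<^bsub>V\<^esub> x = \<zero>\<^bsub>V\<^esub>" if "x \<in> carrier V" for x
    using that V.M.l_neg by blast
  show ?thesis
    by (rule moduleI[OF V.R.is_cring abelian_groupI])
      (simp_all add: assms(2-5) V.smult_l_distr V.smult_r_distr V.smult_assoc1 V.M.a_ac n)
qed

lemma submodule_zero: "module k V ==> submodule S k V ==> \<zero>\<^bsub>V\<^esub> \<in> S"
  using subgroup.one_closed[of S "add_monoid V"] by (simp add: submodule_def)

lemma submodule_add: "module k V ==> submodule S k V ==> x \<in> S ==> y \<in> S ==> x \<oplus>\<^bsub>V\<^esub> y \<in> S"
  by (rule module.submoduleE(5))

lemma submodule_subset: "module k V ==> submodule S k V ==> x \<in> S ==> x \<in> carrier V"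
  by (rule subsetD[OF module.submoduleE(1)])

lemma submoduleI':
  assumes V: "module k V" and "S \<subseteq> carrier V" "\<zero>\<^bsub>V\<^esub> \<in> S" "!!x y. x \<in> S ==> y \<in> S ==> x \<oplus>\<^bsub>V\<^esub> y \<in> S"
    "!!c x. c \<in> carrier k ==> x \<in> S ==> c \<odot>\<^bsub>V\<^esub> x \<in> S"
  shows "submodule S k V"
proof -
  interpret V: module k V by fact
  show ?thesis
  proof (rule V.submoduleI)
    fix x assume x: "x \<in> S"
    have "(\<ominus>\<^bsub>k\<^esub> \<one>\<^bsub>k\<^esub>) \<odot>\<^bsub>V\<^esub> x = \<ominus>\<^bsub>V\<^esub> x"
      using x assms(2) by (subst V.smult_l_minus) auto
    then show "\<ominus>\<^bsub>V\<^esub> x \<in> S" using assms(5)[of "\<ominus>\<^bsub>k\<^esub> \<one>\<^bsub>k\<^esub>" x] x by simp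
  qed (use assms in auto)
qed

lemma lin_ksign:
  assumes "module k V" "module k W" "is_linear k V W f" "x \<in> carrier V"
  shows "f (ksign V j x) = ksign W j (f x)"
  using lin_neg[OF assms] by (simp add: ksign_def)

lemma ksign_closed [simp]: "module k V ==> x \<in> carrier V ==> ksign V j x \<in> carrier V"
  by (simp add: ksign_def module_def abelian_group.a_inv_closed)

lemma ksign_ksign:
  assumes "module k V" "x \<in> carrier V" shows "ksign V i (ksign V j x) = ksign V (i + j) x"
proof -
  interpret V: module k V by fact
  show ?thesis using assms(2) by (simp add: ksign_def)
qed

lemma ksign_lin [lin_intros]: "module k V ==> is_linear k U V f ==> is_linear k U V (\<lambda>x. ksign V j (f x))"
  by (cases "even j") (simp_all add: ksign_def lin_uminus)

lemma ksign_even: "even j ==> ksign V j x = x"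
  by (simp add: ksign_def)

context triangular_qhopf
begin

lemma swD_in:
  assumes "\<zero>\<^bsub>M\<^esub> \<in> S" "!!x y. x \<in> S ==> y \<in> S ==> x \<oplus>\<^bsub>M\<^esub> y \<in> S" "h \<in> carrier H"
    "!!a b. a \<in> carrier H ==> b \<in> carrier H ==> F a b \<in> S"
  shows "swD M h F \<in> S"
  unfolding swD_def by (rule tlift_in[OF m2]) (use assms in auto)

lemma swR_in:
  assumes "\<zero>\<^bsub>M\<^esub> \<in> S" "!!x y. x \<in> S ==> y \<in> S ==> x \<oplus>\<^bsub>M\<^esub> y \<in> S" 
    "!!a b. a \<in> carrier H ==> b \<in> carrier H ==> F a b \<in> S"
  shows "swR M F \<in> S"
  unfolding swR_def by (rule tlift_in[OF m2]) (use assms in auto)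

lemma tl3_in:
  assumes "\<zero>\<^bsub>M\<^esub> \<in> S" "!!x y. x \<in> S ==> y \<in> S ==> x \<oplus>\<^bsub>M\<^esub> y \<in> S" "X \<in> carrier T3"
    "!!a b c. a \<in> carrier H ==> b \<in> carrier H ==> c \<in> carrier H ==> F a b c \<in> S"
  shows "tlift3 M F X \<in> S"
  unfolding tlift3_def by (rule tlift_in[OF m3 assms(3)]; (rule tlift_in[OF m2])?) (use assms in auto)

lemma swP_in:
  assumes "\<zero>\<^bsub>M\<^esub> \<in> S" "!!x y. x \<in> S ==> y \<in> S ==> x \<oplus>\<^bsub>M\<^esub> y \<in> S" 
    "!!a b c. a \<in> carrier H ==> b \<in> carrier H ==> c \<in> carrier H ==> F a b c \<in> S"
  shows "swP M F \<in> S" "swPi M F \<in> S"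
  unfolding swP_def swPi_def by (rule tl3_in; (use assms in simp))+

lemma hmod_module [simp]: "is_hmod H V ==> module k V"
  and hmod_act_linear: "is_hmod H V ==> h \<in> carrier H ==> is_linear k V V (act V h)"
  and hmod_act_arg: "is_hmod H V ==> v \<in> carrier V ==> is_linear k H V (\<lambda>h. act V h v)"
  and act_one [simp]: "is_hmod H V ==> v \<in> carrier V ==> act V \<one> v = v"
  and act_mult: "is_hmod H V ==> g \<in> carrier H ==> h \<in> carrier H ==> v \<in> carrier V ==> act V (g \<otimes> h) v = act V g (act V h v)"
  and gr_submodule: "is_hmod H V ==> submodule (gr V n) k V"
  and degs_finite [simp]: "is_hmod H V ==> finite (degs V)"
  and act_gr: "is_hmod H V ==> h \<in> carrier H ==> v \<in> gr V n ==> act V h v \<in> gr V n"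
  and decomp_ex1: "is_hmod H V ==> v \<in> carrier V ==> \<exists>!c. is_decomp V v c"
  by (simp_all add: is_hmod_def)

lemma act_closed [simp]: "is_hmod H V ==> h \<in> carrier H ==> v \<in> carrier V ==> act V h v \<in> carrier V"
  by (rule lin_closed[OF hmod_act_linear])

lemma lin_act [lin_intros]: "is_hmod H V ==> is_linear k U V f ==> h \<in> carrier H ==> is_linear k U V (\<lambda>x. act V h (f x))"
  by (rule lin_comp[OF _ hmod_act_linear])

lemma lin_act_arg [lin_intros]: "is_hmod H V ==> is_linear k U H f ==> v \<in> carrier V ==> is_linear k U V (\<lambda>x. act V (f x) v)"
  by (rule lin_comp[OF _ hmod_act_arg])

lemma gr_closed: "is_hmod H V ==> v \<in> gr V n ==> v \<in> carrier V"
  by (rule submodule_subset[OF hmod_module gr_submodule])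

lemma gr_zero [simp]: "is_hmod H V ==> \<zero>\<^bsub>V\<^esub> \<in> gr V n"
  by (rule submodule_zero[OF hmod_module gr_submodule])

lemma gr_add: "is_hmod H V ==> v \<in> gr V n ==> w \<in> gr V n ==> v \<oplus>\<^bsub>V\<^esub> w \<in> gr V n"
  by (rule submodule_add[OF hmod_module gr_submodule])

lemma gr_smult: "is_hmod H V ==> c \<in> carrier k ==> v \<in> gr V n ==> c \<odot>\<^bsub>V\<^esub> v \<in> gr V n"
  by (rule submodule.smult_closed[OF gr_submodule])

lemma gr_neg: "is_hmod H V ==> v \<in> gr V n ==> \<ominus>\<^bsub>V\<^esub> v \<in> gr V n"
  by (rule module.submoduleE(3)[OF hmod_module gr_submodule])

lemma gr_ksign: "is_hmod H V ==> v \<in> gr V n ==> ksign V j v \<in> gr V n"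
  by (simp add: ksign_def gr_neg)

lemma gr_sw:
  assumes V: "is_hmod H V"
  shows "h \<in> carrier H ==> (!!a b. a \<in> carrier H ==> b \<in> carrier H ==> F a b \<in> gr V n) ==> swD V h F \<in> gr V n"
    and "(!!a b. a \<in> carrier H ==> b \<in> carrier H ==> F a b \<in> gr V n) ==> swR V F \<in> gr V n"
    and "(!!a b c. a \<in> carrier H ==> b \<in> carrier H ==> c \<in> carrier H ==> G a b c \<in> gr V n) ==> swP V G \<in> gr V n"
    and "(!!a b c. a \<in> carrier H ==> b \<in> carrier H ==> c \<in> carrier H ==> G a b c \<in> gr V n) ==> swPi V G \<in> gr V n"
  using V by (auto intro!: swD_in swR_in swP_in simp: gr_add)

lemma degs_gr: "is_hmod H V ==> v \<in> gr V n ==> n \<notin> degs V ==> v = \<zero>\<^bsub>V\<^esub>"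
  by (auto simp: degs_def)

text \<open>\<open>is_decomp\<close> sums over the support of \<open>c\<close>, which changes with
  \<open>c\<close>. Over a fixed finite set of degrees, decompositions can be added and
  compared.\<close>

lemma is_decomp_iff:
  assumes V: "is_hmod H V" and c: "!!n. c n \<in> gr V n" and D: "finite D" "degs V \<subseteq> D"
  shows "is_decomp V v c \<longleftrightarrow> v = finsum V c D"
proof -
  interpret V: module k V using V by simp
  have s: "{n. c n \<noteq> \<zero>\<^bsub>V\<^esub>} \<subseteq> D" using degs_gr[OF V c] D by blast
  have cl: "c \<in> D \<rightarrow> carrier V" using gr_closed[OF V c] by auto
  have "finsum V c {n. c n \<noteq> \<zero>\<^bsub>V\<^esub>} = finsum V c D"
    by (rule finsum_superset[OF V.M.abelian_group_axioms D(1) s _ cl]) auto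
  then show ?thesis using c finite_subset[OF s D(1)] by (simp add: is_decomp_def)
qed

lemma hcomp_decomp: "is_hmod H V ==> v \<in> carrier V ==> is_decomp V v (\<lambda>n. hcomp V n v)"
  unfolding hcomp_def by (rule theI'[OF decomp_ex1])

lemma hcomp_gr: "is_hmod H V ==> v \<in> carrier V ==> hcomp V n v \<in> gr V n"
  using hcomp_decomp[of V v] by (simp add: is_decomp_def)

lemma hcomp_closed [simp]: "is_hmod H V ==> v \<in> carrier V ==> hcomp V n v \<in> carrier V"
  by (rule gr_closed[OF _ hcomp_gr])

lemma hcomp_sum: "is_hmod H V ==> v \<in> carrier V ==> finsum V (\<lambda>n. hcomp V n v) (degs V) = v"
proof -
  assume V: "is_hmod H V" and v: "v \<in> carrier V"
  show ?thesis
    using hcomp_decomp[OF V v] is_decomp_iff[OF V hcomp_gr[OF V v] degs_finite[OF V] subset_refl, of v] by simp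
qed

lemma hcomp_unique:
  assumes V: "is_hmod H V" and v: "v \<in> carrier V" and c: "!!n. c n \<in> gr V n"
    and D: "finite D" "degs V \<subseteq> D" and e: "v = finsum V c D"
  shows "hcomp V n v = c n"
proof -
  have "is_decomp V v c" using is_decomp_iff[OF V c D] e by simp
  then have "(\<lambda>n. hcomp V n v) = c" using decomp_ex1[OF V v] hcomp_decomp[OF V v] by blast
  then show ?thesis by metis
qed

lemma hcomp_same: "is_hmod H V ==> v \<in> gr V n ==> hcomp V m v = (if m = n then v else \<zero>\<^bsub>V\<^esub>)"
proof -
  assume V: "is_hmod H V" and v: "v \<in> gr V n"
  interpret V: module k V using V by simp
  have "finsum V (\<lambda>m. if m = n then v else \<zero>\<^bsub>V\<^esub>) (insert n (degs V)) = v"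
    by (subst finsum_single[OF V.M.abelian_group_axioms, of _ n]) (use V v gr_closed in auto)
  then show ?thesis using V v gr_closed[OF V v]
    by (intro hcomp_unique[where D = "insert n (degs V)"]) auto
qed

lemma hcomp_linear:
  assumes V: "is_hmod H V" shows "is_linear k V V (hcomp V n)"
proof -
  interpret V: module k V using V by simp
  note g = hcomp_gr[OF V]
  show ?thesis
  proof (rule linI)
    fix x y assume h: "x \<in> carrier V" "y \<in> carrier V"
    have "finsum V (\<lambda>n. hcomp V n x \<oplus>\<^bsub>V\<^esub> hcomp V n y) (degs V) = finsum V (\<lambda>n. hcomp V n x) (degs V) \<oplus>\<^bsub>V\<^esub> finsum V (\<lambda>n. hcomp V n y) (degs V)"
      using h V by (intro V.M.finsum_addf) auto
    then have "x \<oplus>\<^bsub>V\<^esub> y = finsum V (\<lambda>n. hcomp V n x \<oplus>\<^bsub>V\<^esub> hcomp V n y) (degs V)" using h V by (simp add: hcomp_sum)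
    then show "hcomp V n (x \<oplus>\<^bsub>V\<^esub> y) = hcomp V n x \<oplus>\<^bsub>V\<^esub> hcomp V n y"
      using h V g by (intro hcomp_unique[where D = "degs V"]) (auto intro: gr_add)
  next
    fix c x assume h: "c \<in> carrier k" "x \<in> carrier V"
    have "c \<odot>\<^bsub>V\<^esub> finsum V (\<lambda>n. hcomp V n x) (degs V) = finsum V (\<lambda>n. c \<odot>\<^bsub>V\<^esub> hcomp V n x) (degs V)"
      using h V by (intro V.finsum_smult_ldistr) auto
    then have "c \<odot>\<^bsub>V\<^esub> x = finsum V (\<lambda>n. c \<odot>\<^bsub>V\<^esub> hcomp V n x) (degs V)" using h V by (simp add: hcomp_sum)
    then show "hcomp V n (c \<odot>\<^bsub>V\<^esub> x) = c \<odot>\<^bsub>V\<^esub> hcomp V n x"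
      using h V g by (intro hcomp_unique[where D = "degs V"]) (auto intro: gr_smult)
  qed (use V in simp)
qed

lemma lin_hcomp [lin_intros]: "is_hmod H V ==> is_linear k U V f ==> is_linear k U V (\<lambda>x. hcomp V n (f x))"
  by (rule lin_comp[OF _ hcomp_linear])

lemma hom_ext:
  assumes V: "is_hmod H V" and M: "module k M" and f: "is_linear k V M f" and g: "is_linear k V M g"
    and e: "!!n v. v \<in> gr V n ==> f v = g v" and v: "v \<in> carrier V"
  shows "f v = g v"
proof -
  have "f (finsum V (\<lambda>n. hcomp V n v) (degs V)) = g (finsum V (\<lambda>n. hcomp V n v) (degs V))"
    using V v by (simp add: lin_finsum[OF _ M f] lin_finsum[OF _ M g] e[OF hcomp_gr[OF V v]])
  then show ?thesis using V v by (simp add: hcomp_sum)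
qed

text \<open>Replaces unique existence of decompositions by a family of linear projections: the
  identity on their own degree, zero on the others, and summing to the identity. Uniqueness follows
  by applying a projection to a given decomposition.\<close>

lemma hmodI:
  assumes M: "module k V"
    and act: "!!h. h \<in> carrier H ==> is_linear k V V (act V h)" "!!v. v \<in> carrier V ==> is_linear k H V (\<lambda>h. act V h v)"
      "!!v. v \<in> carrier V ==> act V \<one> v = v"
      "!!g h v. g \<in> carrier H ==> h \<in> carrier H ==> v \<in> carrier V ==> act V (g \<otimes> h) v = act V g (act V h v)"
    and gr: "!!n. submodule (gr V n) k V" "!!n h v. h \<in> carrier H ==> v \<in> gr V n ==> act V h v \<in> gr V n"
    and D: "finite D"
    and p: "!!n. is_linear k V V (p n)" "!!n v. v \<in> carrier V ==> p n v \<in> gr V n"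
      "!!m n v. v \<in> gr V m ==> p n v = (if m = n then v else \<zero>\<^bsub>V\<^esub>)"
      "!!v. v \<in> carrier V ==> finsum V (\<lambda>n. p n v) D = v"
  shows "is_hmod H V"
proof -
  interpret V: module k V by fact
  have grc: "v \<in> carrier V" if "v \<in> gr V n" for v n using submodule_subset[OF M gr(1) that] .
  have gr0: "\<zero>\<^bsub>V\<^esub> \<in> gr V n" for n by (rule submodule_zero[OF M gr(1)])
  have out: "v = \<zero>\<^bsub>V\<^esub>" if "v \<in> gr V n" "n \<notin> D" for v n
  proof -
    have "finsum V (\<lambda>m. p m v) D = \<zero>\<^bsub>V\<^esub>"
      using that by (intro finsum_all_zero[OF V.M.abelian_group_axioms]) (auto simp: p(3)[OF that(1)])
    then show ?thesis using p(4)[OF grc[OF that(1)]] by simp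
  qed
  have "degs V \<subseteq> D" using out gr0 by (auto simp: degs_def)
  then have fin: "finite (degs V)" using D finite_subset by blast
  have ex: "\<exists>!c. is_decomp V v c" if v: "v \<in> carrier V" for v
  proof (rule ex1I[of _ "\<lambda>n. p n v"])
    have s: "{n. p n v \<noteq> \<zero>\<^bsub>V\<^esub>} \<subseteq> D" using out p(2)[OF v] by blast
    have "finsum V (\<lambda>n. p n v) {n. p n v \<noteq> \<zero>\<^bsub>V\<^esub>} = finsum V (\<lambda>n. p n v) D"
      by (rule finsum_superset[OF V.M.abelian_group_axioms D s]) (use grc[OF p(2)[OF v]] in auto)
    then show "is_decomp V v (\<lambda>n. p n v)"
      using p(2)[OF v] finite_subset[OF s D] p(4)[OF v] by (simp add: is_decomp_def)
  next
    fix c assume "is_decomp V v c"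
    then have c: "!!n. c n \<in> gr V n" "finite {n. c n \<noteq> \<zero>\<^bsub>V\<^esub>}" "v = finsum V c {n. c n \<noteq> \<zero>\<^bsub>V\<^esub>}"
      by (simp_all add: is_decomp_def)
    show "c = (\<lambda>n. p n v)"
    proof
      fix m
      \<comment> \<open>\<open>m\<close> is added so that the term of degree \<open>m\<close> is
        among the summands even when it vanishes.\<close>
      let ?S = "insert m {n. c n \<noteq> \<zero>\<^bsub>V\<^esub>}"
      have e: "v = finsum V c ?S"
        unfolding c(3)[symmetric] by (subst c(3), rule finsum_superset[OF V.M.abelian_group_axioms]) (use c grc in auto)
      have "p m v = finsum V (\<lambda>n. p m (c n)) ?S"
        by (subst e, rule lin_finsum[OF M M p(1)]) (use grc[OF c(1)] in auto)
      also have "\<dots> = p m (c m)"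
        by (rule finsum_single[OF V.M.abelian_group_axioms]) (use c p(3)[OF c(1)] grc[OF c(1)] in auto)
      also have "\<dots> = c m" using p(3)[OF c(1)] by simp
      finally show "c m = p m v" ..
    qed
  qed
  show ?thesis
    unfolding is_hmod_def by (intro conjI allI ballI M act gr ex fin)
qed

subsection \<open>Morphisms\<close>

lemma morI:
  "is_linear k V W f ==> (!!n v. v \<in> gr V n ==> f v \<in> gr W n) ==>
    (!!h v. h \<in> carrier H ==> v \<in> carrier V ==> f (act V h v) = act W h (f v)) ==> is_mor H V W f"
  by (auto simp: is_mor_def)

lemma mor_linear: "is_mor H V W f ==> is_linear k V W f"
  and mor_gr: "is_mor H V W f ==> v \<in> gr V n ==> f v \<in> gr W n"
  and mor_act: "is_mor H V W f ==> h \<in> carrier H ==> v \<in> carrier V ==> f (act V h v) = act W h (f v)"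
  by (auto simp: is_mor_def)

lemma mor_closed: "is_mor H V W f ==> v \<in> carrier V ==> f v \<in> carrier W"
  by (rule lin_closed[OF mor_linear])

lemma mor_id [simp]: "is_mor H V V (\<lambda>x. x)"
  by (auto simp: is_mor_def intro: lin_id)

lemma mor_comp: "is_mor H V W f ==> is_mor H W X g ==> is_mor H V X (\<lambda>x. g (f x))"
proof -
  assume f: "is_mor H V W f" and g: "is_mor H W X g"
  show ?thesis
    by (rule morI[OF lin_comp[OF mor_linear[OF f] mor_linear[OF g]]])
      (simp_all add: mor_gr[OF g] mor_gr[OF f] mor_act[OF f] mor_act[OF g] mor_closed[OF f])
qed

lemma mor_hcomp:
  assumes V: "is_hmod H V" and W: "is_hmod H W" and f: "is_mor H V W f" and v: "v \<in> carrier V"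
  shows "f (hcomp V n v) = hcomp W n (f v)"
proof (rule hom_ext[OF V _ _ _ _ v])
  show "is_linear k V W (\<lambda>v. f (hcomp V n v))" by (rule lin_comp[OF hcomp_linear[OF V] mor_linear[OF f]])
  show "is_linear k V W (\<lambda>v. hcomp W n (f v))" by (rule lin_hcomp[OF W mor_linear[OF f]])
  show "!!m v. v \<in> gr V m ==> f (hcomp V n v) = hcomp W n (f v)"
    using V W by (simp add: hcomp_same hcomp_same[OF W mor_gr[OF f]] lin_zero[OF _ _ mor_linear[OF f]])
qed (use W in simp)

subsection \<open>Tensor products of graded modules\<close>

abbreviation tensor_infix (infixr "**" 75) where "V ** W \<equiv> tensor H V W"

lemma tensor_sel [simp]:
  "carrier (V ** W) = carrier (tens k V W)" "add (V ** W) = add (tens k V W)" "zero (V ** W) = zero (tens k V W)"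
  "smult (V ** W) = smult (tens k V W)"
  by (simp_all add: tensor_def Let_def)

lemma module_tensor [simp]: "module k V ==> module k W ==> module k (V ** W)"
  by (rule module_cong[OF two_modules.tens_module]) (simp_all add: two_modules_def)

lemma linear_tensor_iff: "is_linear k (V ** W) M f \<longleftrightarrow> is_linear k (tens k V W) M f"
  "is_linear k M (V ** W) g \<longleftrightarrow> is_linear k M (tens k V W) g"
  by (simp_all add: is_linear_def)

declare tensor_sel [simp del]

lemma tp_closed [simp]: "module k V ==> module k W ==> v \<in> carrier V ==> w \<in> carrier W ==> tp H V W v w \<in> carrier (V ** W)"
  unfolding tp_def tensor_sel by (rule two_modules.tpure_closed) (simp_all add: two_modules_def)

lemma lin_tp_left [lin_intros]: "module k V ==> module k W ==> is_linear k U V f ==> w \<in> carrier W ==>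
    is_linear k U (V ** W) (\<lambda>x. tp H V W (f x) w)"
  unfolding tp_def linear_tensor_iff by (rule lin_tpure_left)

lemma lin_tp_right [lin_intros]: "module k V ==> module k W ==> is_linear k U W f ==> v \<in> carrier V ==>
    is_linear k U (V ** W) (\<lambda>x. tp H V W v (f x))"
  unfolding tp_def linear_tensor_iff by (rule lin_tpure_right)

lemma tensor_ext:
  assumes "module k V" "module k W" "module k M" "is_linear k (V ** W) M f" "is_linear k (V ** W) M g"
    "!!v w. v \<in> carrier V ==> w \<in> carrier W ==> f (tp H V W v w) = g (tp H V W v w)" "t \<in> carrier (V ** W)"
  shows "f t = g t"
  using assms unfolding linear_tensor_iff tensor_sel tp_def
  by (intro two_modules.tens_linear_ext[of k V W M f g t]) (simp_all add: two_modules_def)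

lemma tlift_tensor_linear:
  "module k V ==> module k W ==> module k M ==> bilin k V W M b ==> is_linear k (V ** W) M (tlift M b)"
  unfolding linear_tensor_iff by (rule two_modules.tlift_linear) (simp_all add: two_modules_def)

lemma tlift_tp:
  "module k V ==> module k W ==> module k M ==> bilin k V W M b ==> v \<in> carrier V ==> w \<in> carrier W ==> tlift M b (tp H V W v w) = b v w"
  unfolding tp_def by (rule two_modules.tlift_pure) (simp_all add: two_modules_def)

text \<open>\<open>braid\<close> has a closed formula only on homogeneous arguments, so equations
  that involve it are checked on pure tensors of homogeneous elements.\<close>

lemma tensor_ext_hom:
  assumes V: "is_hmod H V" and W: "is_hmod H W" and M: "module k M" and f: "is_linear k (V ** W) M f" and g: "is_linear k (V ** W) M g"
    and e: "!!m n v w. v \<in> gr V m ==> w \<in> gr W n ==> f (tp H V W v w) = g (tp H V W v w)" and t: "t \<in> carrier (V ** W)"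
  shows "f t = g t"
proof (rule tensor_ext[OF _ _ M f g _ t])
  fix v w assume v: "v \<in> carrier V" and w: "w \<in> carrier W"
  show "f (tp H V W v w) = g (tp H V W v w)"
  proof (rule hom_ext[OF V M _ _ _ v])
    show "is_linear k V M (\<lambda>v. f (tp H V W v w))" "is_linear k V M (\<lambda>v. g (tp H V W v w))"
      by (rule lin_comp[OF _ f] lin_comp[OF _ g], rule lin_tp_left[OF _ _ lin_id w]; use V W in simp)+
    fix n v assume v: "v \<in> gr V n"
    show "f (tp H V W v w) = g (tp H V W v w)"
    proof (rule hom_ext[OF W M _ _ _ w])
      show "is_linear k W M (\<lambda>w. f (tp H V W v w))" "is_linear k W M (\<lambda>w. g (tp H V W v w))"
        by (rule lin_comp[OF _ f] lin_comp[OF _ g], rule lin_tp_right[OF _ _ lin_id]; use V W gr_closed[OF V v] in simp)+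
    qed (rule e[OF v])
  qed
qed (use V W in simp_all)

lemma tensor_act:
  "act (V ** W) h X = swD (V ** W) h (\<lambda>h1 h2. tlift (V ** W) (\<lambda>v w. tp H V W (act V h1 v) (act W h2 w)) X)"
  by (simp add: tensor_def Let_def swD_def tlift_def tp_def)

lemma bilin_tp_act:
  assumes V: "is_hmod H V" and W: "is_hmod H W" and h: "h1 \<in> carrier H" "h2 \<in> carrier H"
  shows "bilin k V W (V ** W) (\<lambda>v w. tp H V W (act V h1 v) (act W h2 w))"
  by (intro lin_intros) (use assms in simp_all)

lemma act_tp:
  assumes V: "is_hmod H V" and W: "is_hmod H W" and h: "h \<in> carrier H" "v \<in> carrier V" "w \<in> carrier W"
  shows "act (V ** W) h (tp H V W v w) = swD (V ** W) h (\<lambda>h1 h2. tp H V W (act V h1 v) (act W h2 w))"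
  unfolding tensor_act using assms by (simp add: tlift_tp[OF _ _ _ bilin_tp_act])

lemma tensor_act_linear:
  assumes V: "is_hmod H V" and W: "is_hmod H W" and h: "h \<in> carrier H"
  shows "is_linear k (V ** W) (V ** W) (act (V ** W) h)"
  unfolding tensor_act[abs_def] by (intro swD_lin tlift_tensor_linear bilin_tp_act) (use assms in simp_all)

lemma tensor_gr: "gr (V ** W) n = {tclass k V W xs | xs. \<forall>(v, w)\<in>set xs. \<exists>l m. l + m = n \<and> v \<in> gr V l \<and> w \<in> gr W m}"
  by (simp add: tensor_def Let_def)

context
  fixes V and W
  assumes V: "is_hmod H V" and W: "is_hmod H W"
begin

interpretation TM: two_modules k V W by (rule two_modules.intro) (use V W in simp_all)

abbreviation (input) "VW \<equiv> (V ** W)"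

lemma tensor_gr_list: "(\<forall>(v, w)\<in>set xs. \<exists>l m. l + m = n \<and> v \<in> gr V l \<and> w \<in> gr W m) ==> set xs \<subseteq> carrier V \<times> carrier W"
  using gr_closed[OF V] gr_closed[OF W] by fastforce

lemma tp_gr: "v \<in> gr V l ==> w \<in> gr W m ==> l + m = n ==> tp H V W v w \<in> gr VW n"
  unfolding tensor_gr tp_def tpure_def by (rule CollectI, rule exI[of _ "[(v, w)]"]) auto

lemma tensor_gr_submodule: "submodule (gr VW n) k VW"
proof (rule submoduleI')
  show "module k VW" using V W by simp
  show "gr VW n \<subseteq> carrier VW"
    unfolding tensor_gr tensor_sel using tensor_gr_list TM.tens_carrierI by blast
  show "\<zero>\<^bsub>VW\<^esub> \<in> gr VW n"
    unfolding tensor_gr tensor_sel TM.tens_zero by (rule CollectI, rule exI[of _ "[]"]) simp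
  fix x y assume "x \<in> gr VW n" "y \<in> gr VW n"
  then obtain xs ys where xs: "x = tclass k V W xs" "\<forall>(v, w)\<in>set xs. \<exists>l m. l + m = n \<and> v \<in> gr V l \<and> w \<in> gr W m"
    and ys: "y = tclass k V W ys" "\<forall>(v, w)\<in>set ys. \<exists>l m. l + m = n \<and> v \<in> gr V l \<and> w \<in> gr W m"
    unfolding tensor_gr by blast
  show "x \<oplus>\<^bsub>VW\<^esub> y \<in> gr VW n"
    unfolding tensor_gr tensor_sel xs(1) ys(1) TM.tens_add_tclass[OF tensor_gr_list[OF xs(2)] tensor_gr_list[OF ys(2)]]
    by (rule CollectI, rule exI[of _ "xs @ ys"]) (use xs(2) ys(2) in \<open>simp add: ball_Un\<close>)
  fix c assume c: "c \<in> carrier k"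
  show "c \<odot>\<^bsub>VW\<^esub> x \<in> gr VW n"
    unfolding tensor_gr tensor_sel xs(1) TM.tens_smult_tclass[OF tensor_gr_list[OF xs(2)] c]
    by (rule CollectI, rule exI[of _ "map (\<lambda>(v, w). (c \<odot>\<^bsub>V\<^esub> v, w)) xs"]) (use xs(2) gr_smult[OF V c] in fastforce)
qed

lemma tensor_gr_induct [consumes 1, case_names zero add]:
  assumes "X \<in> gr VW n" and "P \<zero>\<^bsub>VW\<^esub>"
    and "!!l m v w X. l + m = n ==> v \<in> gr V l ==> w \<in> gr W m ==> X \<in> carrier VW ==> P X ==> P (tp H V W v w \<oplus>\<^bsub>VW\<^esub> X)"
  shows "P X"
proof -
  obtain xs where xs: "X = tclass k V W xs" "\<forall>(v, w)\<in>set xs. \<exists>l m. l + m = n \<and> v \<in> gr V l \<and> w \<in> gr W m"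
    using assms(1) unfolding tensor_gr by blast
  have "P (tclass k V W xs)" using xs(2)
  proof (induction xs)
    case Nil show ?case using assms(2) unfolding tensor_sel TM.tens_zero .
  next
    case (Cons p xs)
    obtain v w where p: "p = (v, w)" by force
    then obtain l m where lm: "l + m = n" "v \<in> gr V l" "w \<in> gr W m" using Cons.prems by auto
    have xs: "\<forall>(v, w)\<in>set xs. \<exists>l m. l + m = n \<and> v \<in> gr V l \<and> w \<in> gr W m" using Cons.prems by simp
    have "tclass k V W (p # xs) = tp H V W v w \<oplus>\<^bsub>VW\<^esub> tclass k V W xs"
      unfolding p tp_def tensor_sel
      by (rule TM.tclass_Cons[OF gr_closed[OF V lm(2)] gr_closed[OF W lm(3)] tensor_gr_list[OF xs]])
    moreover have "tclass k V W xs \<in> carrier VW" unfolding tensor_sel by (rule TM.tens_carrierI[OF tensor_gr_list[OF xs]])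
    ultimately show ?case using assms(3)[OF lm _ Cons.IH[OF xs]] by metis
  qed
  with xs show ?thesis by metis
qed

lemma tensor_gr_lin:
  assumes M: "module k M" and f: "is_linear k VW M f" and S: "submodule S k M"
    and e: "!!l m v w. l + m = n ==> v \<in> gr V l ==> w \<in> gr W m ==> f (tp H V W v w) \<in> S" and X: "X \<in> gr VW n"
  shows "f X \<in> S"
  using X
proof (induction rule: tensor_gr_induct)
  case zero then show ?case using lin_zero[OF _ M f] V W submodule_zero[OF M S] by simp
next
  case (add l m v w X)
  have "tp H V W v w \<in> carrier VW" using V W gr_closed[OF V add(2)] gr_closed[OF W add(3)] by simp
  then show ?case using add e[OF add(1-3)] lin_add[OF f] submodule_add[OF M S] by simp
qed

text \<open>The component of degree \<open>n\<close>. A sum over the degrees of \<open>V\<close>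
  alone is enough, because the degree in \<open>W\<close> is then forced to be
  \<open>n - l\<close>.\<close>

definition tensor_proj where
  "tensor_proj n X = finsum VW (\<lambda>l. tlift VW (\<lambda>v w. tp H V W (hcomp V l v) (hcomp W (n - l) w)) X) (degs V)"

lemma tensor_proj_bilin: "bilin k V W VW (\<lambda>v w. tp H V W (hcomp V l v) (hcomp W m w))"
  by (intro lin_intros) (use V W in simp_all)

lemma tensor_proj_linear: "is_linear k VW VW (tensor_proj n)"
  unfolding tensor_proj_def[abs_def]
  by (intro lin_finsum_fun tlift_tensor_linear tensor_proj_bilin) (use V W in simp_all)

lemma tensor_proj_tp:
  assumes v: "v \<in> gr V l" and w: "w \<in> gr W m"
  shows "tensor_proj n (tp H V W v w) = (if l + m = n then tp H V W v w else \<zero>\<^bsub>VW\<^esub>)"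
proof -
  have mV: "module k V" and mW: "module k W" and mT: "module k VW" using V W by simp_all
  interpret VWm: module k VW by (rule mT)
  note vc = gr_closed[OF V v] and wc = gr_closed[OF W w]
  have z1: "tp H V W \<zero>\<^bsub>V\<^esub> y = \<zero>\<^bsub>VW\<^esub>" if "y \<in> carrier W" for y
    by (rule lin_zero[OF mV mT lin_tp_left[OF mV mW lin_id that]])
  have z2: "tp H V W y \<zero>\<^bsub>W\<^esub> = \<zero>\<^bsub>VW\<^esub>" if "y \<in> carrier V" for y
    by (rule lin_zero[OF mW mT lin_tp_right[OF mV mW lin_id that]])
  let ?f = "\<lambda>j. tp H V W (hcomp V j v) (hcomp W (n - j) w)"
  have e: "tensor_proj n (tp H V W v w) = finsum VW ?f (degs V)"
    unfolding tensor_proj_def using vc wc by (simp add: tlift_tp[OF mV mW mT tensor_proj_bilin])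
  show ?thesis
  proof (cases "l \<in> degs V")
    case True
    have "finsum VW ?f (degs V) = ?f l"
      by (rule finsum_single[OF VWm.M.abelian_group_axioms]) (use V W v w vc wc True in \<open>simp_all add: hcomp_same z1\<close>)
    also have "\<dots> = (if l + m = n then tp H V W v w else \<zero>\<^bsub>VW\<^esub>)"
      using z2[OF vc] by (simp add: hcomp_same[OF V v] hcomp_same[OF W w])
    finally show ?thesis using e by simp
  next
    case False
    then have "v = \<zero>\<^bsub>V\<^esub>" using degs_gr[OF V v] by simp
    moreover have "finsum VW ?f (degs V) = \<zero>\<^bsub>VW\<^esub>"
    proof (rule finsum_all_zero[OF VWm.M.abelian_group_axioms])
      fix j assume "j \<in> degs V"
      then have "j \<noteq> l" using False by auto
      then show "tp H V W (hcomp V j v) (hcomp W (n - j) w) = \<zero>\<^bsub>VW\<^esub>" using W wc by (simp add: hcomp_same[OF V v] z1)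
    qed
    ultimately show ?thesis using e z1[OF wc] by simp
  qed
qed

lemma hmod_tensor_aux: "is_hmod H VW"
proof (rule hmodI[where p = tensor_proj and D = "(\<lambda>(l, m). l + m) ` (degs V \<times> degs W)"])
  have mV: "module k V" and mW: "module k W" using V W by simp_all
  show mT: "module k VW" using V W by simp
  interpret VWm: module k VW by (rule mT)
  show lact: "is_linear k VW VW (act VW h)" if "h \<in> carrier H" for h by (rule tensor_act_linear[OF V W that])
  show "is_linear k H VW (\<lambda>h. act VW h X)" if X: "X \<in> carrier VW" for X
    unfolding tensor_act
  proof (rule swD_arg_lin[OF bilinI mT lin_id])
    show "is_linear k H VW (\<lambda>h1. tlift VW (\<lambda>v w. tp H V W (act V h1 v) (act W h2 w)) X)" if "h2 \<in> carrier H" for h2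
      by (rule TM.tlift_lin[OF modH mT X[unfolded tensor_sel]]) (intro lin_intros; use V W that in simp)
    show "is_linear k H VW (\<lambda>h2. tlift VW (\<lambda>v w. tp H V W (act V h1 v) (act W h2 w)) X)" if "h1 \<in> carrier H" for h1
      by (rule TM.tlift_lin[OF modH mT X[unfolded tensor_sel]]) (intro lin_intros; use V W that in simp)
  qed
  show "act VW \<one> X = X" if X: "X \<in> carrier VW" for X
  proof (rule tensor_ext[OF mV mW mT lact lin_id _ X])
    fix v w assume vw: "v \<in> carrier V" "w \<in> carrier W"
    have b: "bilin k H H VW (\<lambda>h1 h2. tp H V W (act V h1 v) (act W h2 w))" by (intro lin_intros) (use V W vw in simp_all)
    show "act VW \<one> (tp H V W v w) = tp H V W v w" using V W vw by (simp add: act_tp swD_one[OF mT b])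
  qed simp
  show "act VW (g \<otimes> h) X = act VW g (act VW h X)" if g: "g \<in> carrier H" and h: "h \<in> carrier H" and X: "X \<in> carrier VW" for g h X
  proof (rule tensor_ext[OF mV mW mT lact lin_comp[OF lact lact] _ X])
    fix v w assume vw: "v \<in> carrier V" "w \<in> carrier W"
    have b: "bilin k H H VW (\<lambda>h1 h2. tp H V W (act V h1 v) (act W h2 w))" by (intro lin_intros) (use V W vw in simp_all)
    show "act VW (g \<otimes> h) (tp H V W v w) = act VW g (act VW h (tp H V W v w))"
      using V W vw g h by (simp add: act_tp swD_mult[OF mT b] act_mult lin_swD[OF lact[OF g] mT mT])
  qed (use g h in simp_all)
  show sub: "submodule (gr VW n) k VW" for n by (rule tensor_gr_submodule)
  show "act VW h X \<in> gr VW n" if h: "h \<in> carrier H" and X: "X \<in> gr VW n" for n h X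
  proof (rule tensor_gr_lin[OF mT lact[OF h] sub _ X])
    fix l m v w assume lm: "l + m = n" "v \<in> gr V l" "w \<in> gr W m"
    have "swD VW h (\<lambda>h1 h2. tp H V W (act V h1 v) (act W h2 w)) \<in> gr VW n"
      by (rule swD_in[OF submodule_zero[OF mT sub] submodule_add[OF mT sub] h]) (auto intro: tp_gr[OF act_gr[OF V _ lm(2)] act_gr[OF W _ lm(3)] lm(1)])
    then show "act VW h (tp H V W v w) \<in> gr VW n" using V W h gr_closed[OF V lm(2)] gr_closed[OF W lm(3)] by (simp add: act_tp)
  qed
  show "finite ((\<lambda>(l, m). l + m) ` (degs V \<times> degs W))" using V W by simp
  show lp: "is_linear k VW VW (tensor_proj n)" for n by (rule tensor_proj_linear)
  show "tensor_proj n X \<in> gr VW n" if X: "X \<in> carrier VW" for n X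
    unfolding tensor_proj_def
  proof (rule finsum_in[OF VWm.M.abelian_group_axioms])
    show "gr VW n \<subseteq> carrier VW" using submodule_subset[OF mT sub] by blast
    fix l
    show "tlift VW (\<lambda>v w. tp H V W (hcomp V l v) (hcomp W (n - l) w)) X \<in> gr VW n"
      by (rule tlift_in[OF TM.two_modules_axioms X[unfolded tensor_sel] submodule_zero[OF mT sub] submodule_add[OF mT sub]])
        (simp_all add: tp_gr[OF hcomp_gr[OF V] hcomp_gr[OF W]])
  qed (use submodule_zero[OF mT sub] submodule_add[OF mT sub] in simp_all)
  show "tensor_proj n X = (if m = n then X else \<zero>\<^bsub>VW\<^esub>)" if X: "X \<in> gr VW m" for m n X
    using X
  proof (induction rule: tensor_gr_induct)
    case zero show ?case using lin_zero[OF mT mT lp] by simp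
  next
    case (add l j v w X)
    have "tp H V W v w \<in> carrier VW" using V W gr_closed[OF V add(2)] gr_closed[OF W add(3)] by simp
    then show ?case using add by (simp add: lin_add[OF lp] tensor_proj_tp)
  qed
  show "finsum VW (\<lambda>n. tensor_proj n X) ((\<lambda>(l, m). l + m) ` (degs V \<times> degs W)) = X" if X: "X \<in> carrier VW" for X
  proof (rule tensor_ext_hom[OF V W mT lin_finsum_fun[OF mT mT lp] lin_id _ X])
    fix l m v w assume v: "v \<in> gr V l" and w: "w \<in> gr W m"
    let ?D = "(\<lambda>(l, m). l + m) ` (degs V \<times> degs W)"
    have vc: "tp H V W v w \<in> carrier VW" using V W gr_closed[OF V v] gr_closed[OF W w] by simp
    show "finsum VW (\<lambda>n. tensor_proj n (tp H V W v w)) ?D = tp H V W v w"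
    proof (cases "l \<in> degs V \<and> m \<in> degs W")
      case True
      then have "l + m \<in> ?D" by force
      then have "finsum VW (\<lambda>n. tensor_proj n (tp H V W v w)) ?D = tensor_proj (l + m) (tp H V W v w)"
        by (intro finsum_single[OF VWm.M.abelian_group_axioms]) (use V W vc in \<open>simp_all add: tensor_proj_tp[OF v w]\<close>)
      then show ?thesis by (simp add: tensor_proj_tp[OF v w])
    next
      case False
      then have "v = \<zero>\<^bsub>V\<^esub> \<or> w = \<zero>\<^bsub>W\<^esub>" using degs_gr[OF V v] degs_gr[OF W w] by auto
      then have "tp H V W v w = \<zero>\<^bsub>VW\<^esub>"
        using lin_zero[OF mV mT lin_tp_left[OF mV mW lin_id gr_closed[OF W w]]] lin_zero[OF mW mT lin_tp_right[OF mV mW lin_id gr_closed[OF V v]]]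
        by auto
      then show ?thesis by (simp add: lin_zero[OF mT mT lp] VWm.M.finsum_zero)
    qed
  qed
qed

end

lemma hmod_tensor [simp]: "is_hmod H V ==> is_hmod H W ==> is_hmod H (V ** W)"
  by (rule hmod_tensor_aux)

lemma mor_linear' [simp]: "is_mor H X Y f ==> is_linear k X Y f"
  by (rule mor_linear)

lemma tensor_tlift_param:
  assumes "module k V" "module k W" "module k U" "module k M" "Y \<in> carrier (V ** W)"
    "!!v w. v \<in> carrier V ==> w \<in> carrier W ==> is_linear k U M (\<lambda>x. F x v w)"
  shows "is_linear k U M (\<lambda>x. tlift M (F x) Y)"
  by (rule two_modules.tlift_lin[of k V W]) (use assms in \<open>simp_all add: two_modules_def tensor_sel\<close>)

lemma tensor_tlift_cong:
  assumes "module k V" "module k W" "Y \<in> carrier (V ** W)"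
    "!!v w. v \<in> carrier V ==> w \<in> carrier W ==> F v w = F' v w"
  shows "tlift M F Y = tlift M F' Y"
  by (rule two_modules.tlift_cong[of k V W]) (use assms in \<open>simp_all add: two_modules_def tensor_sel\<close>)

lemma tensor3_ext:
  assumes U: "module k U" and V: "module k V" and W: "module k W" and M: "module k M"
    and f: "is_linear k ((U ** V) ** W) M f" and g: "is_linear k ((U ** V) ** W) M g"
    and e: "!!u v w. u \<in> carrier U ==> v \<in> carrier V ==> w \<in> carrier W ==>
      f (tp H (U ** V) W (tp H U V u v) w) = g (tp H (U ** V) W (tp H U V u v) w)"
    and t: "t \<in> carrier ((U ** V) ** W)"
  shows "f t = g t"
proof (rule tensor_ext[OF module_tensor[OF U V] W M f g _ t])
  fix Y w assume Y: "Y \<in> carrier (U ** V)" and w: "w \<in> carrier W"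
  note l = lin_tp_left[OF module_tensor[OF U V] W lin_id w]
  show "f (tp H (U ** V) W Y w) = g (tp H (U ** V) W Y w)"
    by (rule tensor_ext[OF U V M lin_comp[OF l f] lin_comp[OF l g] e[OF _ _ w] Y])
qed

lemma tensor3r_ext:
  assumes U: "module k U" and V: "module k V" and W: "module k W" and M: "module k M"
    and f: "is_linear k (U ** V ** W) M f" and g: "is_linear k (U ** V ** W) M g"
    and e: "!!u v w. u \<in> carrier U ==> v \<in> carrier V ==> w \<in> carrier W ==>
      f (tp H U (V ** W) u (tp H V W v w)) = g (tp H U (V ** W) u (tp H V W v w))"
    and t: "t \<in> carrier (U ** V ** W)"
  shows "f t = g t"
proof (rule tensor_ext[OF U module_tensor[OF V W] M f g _ t])
  fix u Y assume Y: "Y \<in> carrier (V ** W)" and u: "u \<in> carrier U"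
  note l = lin_tp_right[OF U module_tensor[OF V W] lin_id u]
  show "f (tp H U (V ** W) u Y) = g (tp H U (V ** W) u Y)"
    by (rule tensor_ext[OF V W M lin_comp[OF l f] lin_comp[OF l g] e[OF u] Y])
qed

lemma mor_tensorI:
  assumes V: "is_hmod H V" and W: "is_hmod H W" and X: "is_hmod H X" and f: "is_linear k (V ** W) X f"
    and g: "!!m n v w. v \<in> gr V m ==> w \<in> gr W n ==> f (tp H V W v w) \<in> gr X (m + n)"
    and a: "!!h v w. h \<in> carrier H ==> v \<in> carrier V ==> w \<in> carrier W ==>
      swD X h (\<lambda>h1 h2. f (tp H V W (act V h1 v) (act W h2 w))) = act X h (f (tp H V W v w))"
  shows "is_mor H (V ** W) X f"
proof (rule morI[OF f])
  show "f t \<in> gr X n" if "t \<in> gr (V ** W) n" for n t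
    by (rule tensor_gr_lin[OF V W _ f gr_submodule[OF X] _ that]) (use X g in auto)
  show "f (act (V ** W) h t) = act X h (f t)" if h: "h \<in> carrier H" and t: "t \<in> carrier (V ** W)" for h t
  proof (rule tensor_ext[OF _ _ _ lin_comp[OF tensor_act_linear[OF V W h] f] lin_comp[OF f hmod_act_linear[OF X h]] _ t])
    fix v w assume vw: "v \<in> carrier V" "w \<in> carrier W"
    show "f (act (V ** W) h (tp H V W v w)) = act X h (f (tp H V W v w))"
      using V W X h vw by (simp add: act_tp lin_swD[OF f] a)
  qed (use V W X in simp_all)
qed

subsection \<open>Whiskering\<close>

lemma tmap_bilin:
  "module k V ==> module k W ==> is_linear k X V f ==> is_linear k Y W g ==> bilin k X Y (V ** W) (\<lambda>x y. tp H V W (f x) (g y))"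
  by (intro bilinI lin_tp_left lin_tp_right) (simp_all add: lin_closed)

lemma tmap_linear:
  "module k V ==> module k W ==> module k X ==> module k Y ==> is_linear k X V f ==> is_linear k Y W g ==>
    is_linear k (X ** Y) (V ** W) (tmap H V W f g)"
  unfolding tmap_def by (intro tlift_tensor_linear tmap_bilin module_tensor)

lemma tmap_tp:
  "module k V ==> module k W ==> module k X ==> module k Y ==> is_linear k X V f ==> is_linear k Y W g ==>
    x \<in> carrier X ==> y \<in> carrier Y ==> tmap H V W f g (tp H X Y x y) = tp H V W (f x) (g y)"
  unfolding tmap_def by (simp add: tlift_tp[OF _ _ _ tmap_bilin])

lemma mor_tmap:
  assumes "is_hmod H V" "is_hmod H W" "is_hmod H X" "is_hmod H Y" and f: "is_mor H X V f" and g: "is_mor H Y W g"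
  shows "is_mor H (X ** Y) (V ** W) (tmap H V W f g)"
proof -
  have l: "is_linear k (X ** Y) (V ** W) (tmap H V W f g)" by (rule tmap_linear) (use assms in simp_all)
  show ?thesis
  proof (rule mor_tensorI[OF assms(3,4) _ l])
    show "tmap H V W f g (tp H X Y x y) \<in> gr (V ** W) (m + n)" if "x \<in> gr X m" "y \<in> gr Y n" for m n x y
      using assms gr_closed[OF assms(3) that(1)] gr_closed[OF assms(4) that(2)]
      by (simp add: tmap_tp tp_gr[OF assms(1,2) mor_gr[OF f that(1)] mor_gr[OF g that(2)]])
    show "swD (V ** W) h (\<lambda>h1 h2. tmap H V W f g (tp H X Y (act X h1 v) (act Y h2 w))) = act (V ** W) h (tmap H V W f g (tp H X Y v w))"
      if "h \<in> carrier H" "v \<in> carrier X" "w \<in> carrier Y" for h v w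
      using that assms(1-4) f g by (simp add: tmap_tp act_tp mor_closed[OF f] mor_closed[OF g] mor_act[OF f] mor_act[OF g])
  qed (use assms in simp)
qed

text \<open>Explicit source and target objects let the side conditions of rewrite rules be checked by the simplifier.\<close>

definition lw where "lw P X Y f = tmap H P Y (\<lambda>p. p) f"
definition rw where "rw X Y Z f = tmap H Y Z f (\<lambda>z. z)"

context
  fixes P and X and Y
  assumes P: "is_hmod H P" and X: "is_hmod H X" and Y: "is_hmod H Y"
begin

lemma lw_linear: "is_linear k X Y f ==> is_linear k (P ** X) (P ** Y) (lw P X Y f)"
  unfolding lw_def using P X Y by (simp add: tmap_linear lin_id)

lemma rw_linear: "is_linear k X Y f ==> is_linear k (X ** P) (Y ** P) (rw X Y P f)"
  unfolding rw_def using P X Y by (simp add: tmap_linear lin_id)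

lemma lw_tp: "is_linear k X Y f ==> p \<in> carrier P ==> x \<in> carrier X ==> lw P X Y f (tp H P X p x) = tp H P Y p (f x)"
  unfolding lw_def using P X Y by (simp add: tmap_tp lin_id)

lemma rw_tp: "is_linear k X Y f ==> p \<in> carrier P ==> x \<in> carrier X ==> rw X Y P f (tp H X P x p) = tp H Y P (f x) p"
  unfolding rw_def using P X Y by (simp add: tmap_tp lin_id)

lemma lw_closed: "is_linear k X Y f ==> t \<in> carrier (P ** X) ==> lw P X Y f t \<in> carrier (P ** Y)"
  by (rule lin_closed[OF lw_linear])

lemma rw_closed: "is_linear k X Y f ==> t \<in> carrier (X ** P) ==> rw X Y P f t \<in> carrier (Y ** P)"
  by (rule lin_closed[OF rw_linear])

lemma mor_lw: "is_mor H X Y f ==> is_mor H (P ** X) (P ** Y) (lw P X Y f)"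
  unfolding lw_def using P X Y by (simp add: mor_tmap)

lemma mor_rw: "is_mor H X Y f ==> is_mor H (X ** P) (Y ** P) (rw X Y P f)"
  unfolding rw_def using P X Y by (simp add: mor_tmap)

lemma lw_cong: "(!!x. x \<in> carrier X ==> f x = g x) ==> t \<in> carrier (P ** X) ==> lw P X Y f t = lw P X Y g t"
  unfolding lw_def tmap_def by (rule tensor_tlift_cong[of P X]) (use P X in simp_all)

lemma rw_cong: "(!!x. x \<in> carrier X ==> f x = g x) ==> t \<in> carrier (X ** P) ==> rw X Y P f t = rw X Y P g t"
  unfolding rw_def tmap_def by (rule tensor_tlift_cong[of X P]) (use P X in simp_all)

end

lemmas [simp] = lw_tp rw_tp lw_closed rw_closed mor_lw mor_rw lw_linear rw_linear lin_id

lemma lw_id [simp]: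
  assumes P: "is_hmod H P" and X: "is_hmod H X" and t: "t \<in> carrier (P ** X)"
  shows "lw P X X (\<lambda>x. x) t = t"
  by (rule tensor_ext[OF _ _ _ lw_linear lin_id _ t]) (use P X in simp_all)

lemma rw_id [simp]:
  assumes P: "is_hmod H P" and X: "is_hmod H X" and t: "t \<in> carrier (X ** P)"
  shows "rw X X P (\<lambda>x. x) t = t"
  by (rule tensor_ext[OF _ _ _ rw_linear lin_id _ t]) (use P X in simp_all)

lemma lw_lw:
  assumes "is_hmod H P" "is_hmod H X" "is_hmod H Y" "is_hmod H Z" and f: "is_linear k X Y f" and g: "is_linear k Y Z g" and t: "t \<in> carrier (P ** X)"
  shows "lw P Y Z g (lw P X Y f t) = lw P X Z (\<lambda>x. g (f x)) t"
  by (rule tensor_ext[OF _ _ _ lin_comp[OF lw_linear lw_linear] lw_linear _ t])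
    (use assms lin_comp[OF f g] in \<open>simp_all add: lin_closed[OF f]\<close>)

lemma rw_rw:
  assumes "is_hmod H P" "is_hmod H X" "is_hmod H Y" "is_hmod H Z" and f: "is_linear k X Y f" and g: "is_linear k Y Z g" and t: "t \<in> carrier (X ** P)"
  shows "rw Y Z P g (rw X Y P f t) = rw X Z P (\<lambda>x. g (f x)) t"
  by (rule tensor_ext[OF _ _ _ lin_comp[OF rw_linear rw_linear] rw_linear _ t])
    (use assms lin_comp[OF f g] in \<open>simp_all add: lin_closed[OF f]\<close>)

lemma lw_rw:
  assumes "is_hmod H X" "is_hmod H X'" "is_hmod H Y" "is_hmod H Y'" and f: "is_linear k X X' f" and g: "is_linear k Y Y' g" and t: "t \<in> carrier (X ** Y)"
  shows "lw X' Y Y' g (rw X X' Y f t) = rw X X' Y' f (lw X Y Y' g t)"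
  by (rule tensor_ext[OF _ _ _ lin_comp[OF rw_linear lw_linear] lin_comp[OF lw_linear rw_linear] _ t])
    (use assms in \<open>simp_all add: lin_closed[OF f] lin_closed[OF g]\<close>)

lemma tmap_lw_rw:
  assumes "is_hmod H X" "is_hmod H X'" "is_hmod H Y" "is_hmod H Y'" and f: "is_linear k X X' f" and g: "is_linear k Y Y' g" and t: "t \<in> carrier (X ** Y)"
  shows "tmap H X' Y' f g t = lw X' Y Y' g (rw X X' Y f t)"
  by (rule tensor_ext[OF _ _ _ tmap_linear lin_comp[OF rw_linear lw_linear] _ t])
    (use assms in \<open>simp_all add: lin_closed[OF f] lin_closed[OF g] tmap_tp\<close>)

subsection \<open>The associator\<close>

text \<open>Sweedler sums and signs are moved outwards through linear operations, so that a
  computation with elements ends in one nested sum to which an axiom in its Sweedler form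
  applies.\<close>

lemmas push_tp =
  lin_swD[OF lin_tp_left[OF _ _ lin_id]] lin_swR[OF lin_tp_left[OF _ _ lin_id]] lin_swP[OF lin_tp_left[OF _ _ lin_id]] lin_swPi[OF lin_tp_left[OF _ _ lin_id]]
  lin_swD[OF lin_tp_right[OF _ _ lin_id]] lin_swR[OF lin_tp_right[OF _ _ lin_id]] lin_swP[OF lin_tp_right[OF _ _ lin_id]] lin_swPi[OF lin_tp_right[OF _ _ lin_id]]
  lin_ksign[OF _ _ lin_tp_left[OF _ _ lin_id]] lin_ksign[OF _ _ lin_tp_right[OF _ _ lin_id]]

lemmas push_act = lin_swD[OF hmod_act_linear] lin_swR[OF hmod_act_linear] lin_swP[OF hmod_act_linear] lin_swPi[OF hmod_act_linear] lin_ksign[OF _ _ hmod_act_linear]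

lemmas push_w =
  lin_swD[OF lw_linear] lin_swR[OF lw_linear] lin_swP[OF lw_linear] lin_swPi[OF lw_linear] lin_ksign[OF _ _ lw_linear]
  lin_swD[OF rw_linear] lin_swR[OF rw_linear] lin_swP[OF rw_linear] lin_swPi[OF rw_linear] lin_ksign[OF _ _ rw_linear]

context
  fixes U and V and W
  assumes U: "is_hmod H U" and V: "is_hmod H V" and W: "is_hmod H W"
begin

private abbreviation (input) "L3 \<equiv> ((U ** V) ** W)"
private abbreviation (input) "R3 \<equiv> (U ** V ** W)"
private abbreviation (input) "pr u v w \<equiv> tp H U (V ** W) u (tp H V W v w)"
private abbreviation (input) "pl u v w \<equiv> tp H (U ** V) W (tp H U V u v) w"

private lemma m: "module k U" "module k V" "module k W" "module k L3" "module k R3" "is_hmod H L3" "is_hmod H R3"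
  using U V W by simp_all

context notes [simp] = m begin

lemma Assoc_aux:
  "Assoc H U V W = tlift R3 (\<lambda>Y w. tlift R3 (\<lambda>u v. swP R3 (\<lambda>a b c. pr (act U a u) (act V b v) (act W c w))) Y)"
  by (simp add: Assoc_def Let_def fun_eq_iff tlift3_def swP_def)

lemma Assoc_inv_aux:
  "Assoc_inv H U V W = tlift L3 (\<lambda>u. tlift L3 (\<lambda>v w. swPi L3 (\<lambda>a b c. pl (act U a u) (act V b v) (act W c w))))"
  by (simp add: Assoc_inv_def Let_def swPi_def)

lemma pr_lin:
  "bilin k U V R3 (\<lambda>u v. swP R3 (\<lambda>a b c. pr (act U a u) (act V b v) (act W c w)))" if "w \<in> carrier W" for w
  by (intro lin_intros) (use U V W that in simp_all)

lemma pr_lin3: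
  "is_linear k W R3 (\<lambda>w. swP R3 (\<lambda>a b c. pr (act U a u) (act V b v) (act W c w)))" if "u \<in> carrier U" "v \<in> carrier V" for u v
  by (intro lin_intros) (use U V W that in simp_all)

lemma pl_lin:
  "bilin k V W L3 (\<lambda>v w. swPi L3 (\<lambda>a b c. pl (act U a u) (act V b v) (act W c w)))" if "u \<in> carrier U" for u
  by (intro lin_intros) (use U V W that in simp_all)

lemma pl_lin3:
  "is_linear k U L3 (\<lambda>u. swPi L3 (\<lambda>a b c. pl (act U a u) (act V b v) (act W c w)))" if "w \<in> carrier W" "v \<in> carrier V" for w v
  by (intro lin_intros) (use U V W that in simp_all)

lemma Assoc_bilin: "bilin k (U ** V) W R3 (\<lambda>Y w. tlift R3 (\<lambda>u v. swP R3 (\<lambda>a b c. pr (act U a u) (act V b v) (act W c w))) Y)"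
  by (intro bilinI tlift_tensor_linear tensor_tlift_param[of U V] pr_lin pr_lin3) simp_all

lemma Assoc_inv_bilin: "bilin k U (V ** W) L3 (\<lambda>u. tlift L3 (\<lambda>v w. swPi L3 (\<lambda>a b c. pl (act U a u) (act V b v) (act W c w))))"
  by (intro bilinI tlift_tensor_linear tensor_tlift_param[of V W] pl_lin pl_lin3) simp_all

lemma Assoc_linear: "is_linear k L3 R3 (Assoc H U V W)"
  unfolding Assoc_aux by (intro tlift_tensor_linear Assoc_bilin) simp_all

lemma Assoc_inv_linear: "is_linear k R3 L3 (Assoc_inv H U V W)"
  unfolding Assoc_inv_aux by (intro tlift_tensor_linear Assoc_inv_bilin) simp_all

lemma Assoc_tp:
  "u \<in> carrier U ==> v \<in> carrier V ==> w \<in> carrier W ==>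
    Assoc H U V W (pl u v w) = swP R3 (\<lambda>a b c. pr (act U a u) (act V b v) (act W c w))"
  unfolding Assoc_aux by (simp add: tlift_tp[OF _ _ _ Assoc_bilin] tlift_tp[OF _ _ _ pr_lin])

lemma Assoc_inv_tp:
  "u \<in> carrier U ==> v \<in> carrier V ==> w \<in> carrier W ==>
    Assoc_inv H U V W (pr u v w) = swPi L3 (\<lambda>a b c. pl (act U a u) (act V b v) (act W c w))"
  unfolding Assoc_inv_aux by (simp add: tlift_tp[OF _ _ _ Assoc_inv_bilin] tlift_tp[OF _ _ _ pl_lin])

lemma Assoc_closed: "t \<in> carrier L3 ==> Assoc H U V W t \<in> carrier R3"
  by (rule lin_closed[OF Assoc_linear])

lemma Assoc_inv_closed: "t \<in> carrier R3 ==> Assoc_inv H U V W t \<in> carrier L3"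
  by (rule lin_closed[OF Assoc_inv_linear])

lemma trilin_pr: "u \<in> carrier U ==> v \<in> carrier V ==> w \<in> carrier W ==> trilin R3 (\<lambda>a b c. pr (act U a u) (act V b v) (act W c w))"
  by (intro lin_intros) (use U V W in simp_all)

lemma trilin_pl: "u \<in> carrier U ==> v \<in> carrier V ==> w \<in> carrier W ==> trilin L3 (\<lambda>a b c. pl (act U a u) (act V b v) (act W c w))"
  by (intro lin_intros) (use U V W in simp_all)

lemma Assoc_Assoc_inv: 
  assumes t: "t \<in> carrier R3" shows "Assoc H U V W (Assoc_inv H U V W t) = t"
proof (rule tensor3r_ext[OF _ _ _ _ lin_comp[OF Assoc_inv_linear Assoc_linear] lin_id _ t])
  fix u v w assume h: "u \<in> carrier U" "v \<in> carrier V" "w \<in> carrier W"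
  show "Assoc H U V W (Assoc_inv H U V W (pr u v w)) = pr u v w"
    using h U V W P_Pi[OF _ trilin_pr[OF h]]
    by (simp add: Assoc_inv_tp lin_swPi[OF Assoc_linear] Assoc_tp act_mult)
qed simp_all

lemma Assoc_inv_Assoc: 
  assumes t: "t \<in> carrier L3" shows "Assoc_inv H U V W (Assoc H U V W t) = t"
proof (rule tensor3_ext[OF _ _ _ _ lin_comp[OF Assoc_linear Assoc_inv_linear] lin_id _ t])
  fix u v w assume h: "u \<in> carrier U" "v \<in> carrier V" "w \<in> carrier W"
  show "Assoc_inv H U V W (Assoc H U V W (pl u v w)) = pl u v w"
    using h U V W Pi_P[OF _ trilin_pl[OF h]]
    by (simp add: Assoc_tp lin_swP[OF Assoc_inv_linear] Assoc_inv_tp act_mult)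
qed simp_all

lemma mor_Assoc: "is_mor H L3 R3 (Assoc H U V W)"
proof (rule morI[OF Assoc_linear])
  fix n t assume "t \<in> gr L3 n"
  then show "Assoc H U V W t \<in> gr R3 n"
  proof (rule tensor_gr_lin[OF hmod_tensor[OF U V] W m(5) Assoc_linear gr_submodule[OF m(7)], rotated])
    fix l j Y w assume l: "l + j = n" "Y \<in> gr (U ** V) l" and w: "w \<in> gr W j"
    show "Assoc H U V W (tp H (U ** V) W Y w) \<in> gr R3 n"
      using l(2)
    proof (rule tensor_gr_lin[OF U V m(5) lin_comp[OF _ Assoc_linear] gr_submodule[OF m(7)], rotated 2])
      show "is_linear k (U ** V) L3 (\<lambda>Y. tp H (U ** V) W Y w)"
        using U V W gr_closed[OF W w] by (intro lin_tp_left lin_id) simp_all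
      fix p q u v assume h: "p + q = l" "u \<in> gr U p" "v \<in> gr V q"
      have "pr (act U a u) (act V b v) (act W c w) \<in> gr R3 n" if "a \<in> carrier H" "b \<in> carrier H" "c \<in> carrier H" for a b c
        by (rule tp_gr[OF U hmod_tensor[OF V W] act_gr[OF U that(1) h(2)] tp_gr[OF V W act_gr[OF V that(2) h(3)] act_gr[OF W that(3) w] HOL.refl]])
          (use l(1) h(1) in simp)
      then show "Assoc H U V W (pl u v w) \<in> gr R3 n"
        using gr_closed[OF U h(2)] gr_closed[OF V h(3)] gr_closed[OF W w] by (simp add: Assoc_tp gr_sw[OF m(7)])
    qed
  qed
next
  fix h t assume h: "h \<in> carrier H" and t: "t \<in> carrier L3"
  show "Assoc H U V W (act L3 h t) = act R3 h (Assoc H U V W t)"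
  proof (rule tensor3_ext[OF _ _ _ _ lin_comp[OF hmod_act_linear[OF m(6) h] Assoc_linear] lin_comp[OF Assoc_linear hmod_act_linear[OF m(7) h]] _ t])
    fix u v w assume uvw: "u \<in> carrier U" "v \<in> carrier V" "w \<in> carrier W"
    have "Assoc H U V W (act L3 h (pl u v w)) =
      swD R3 h (\<lambda>h1 h2. swD R3 h1 (\<lambda>a b. swP R3 (\<lambda>x y z. pr (act U x (act U a u)) (act V y (act V b v)) (act W z (act W h2 w)))))" (is "?l = _")
      using h uvw U V W by (simp add: act_tp push_tp lin_swD[OF Assoc_linear] Assoc_tp)
    also have "\<dots> = swP R3 (\<lambda>x y z. swD R3 h (\<lambda>h1 h2. swD R3 h2 (\<lambda>b c. pr (act U h1 (act U x u)) (act V b (act V y v)) (act W c (act W z w)))))"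
      using coassoc_sw[OF _ trilin_pr[OF uvw] h] uvw h U V W by (simp add: act_mult)
    also have "\<dots> = act R3 h (Assoc H U V W (pl u v w))"
      using h uvw U V W by (simp add: act_tp push_tp push_act Assoc_tp)
    finally show "?l = act R3 h (Assoc H U V W (pl u v w))" .
  qed simp_all
qed

lemma mor_Assoc_inv: "is_mor H R3 L3 (Assoc_inv H U V W)"
proof (rule morI[OF Assoc_inv_linear])
  fix n t assume "t \<in> gr R3 n"
  then show "Assoc_inv H U V W t \<in> gr L3 n"
  proof (rule tensor_gr_lin[OF U hmod_tensor[OF V W] m(4) Assoc_inv_linear gr_submodule[OF m(6)], rotated])
    fix j l u Y assume l: "j + l = n" "u \<in> gr U j" "Y \<in> gr (V ** W) l" 
    show "Assoc_inv H U V W (tp H U (V ** W) u Y) \<in> gr L3 n"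
      using l(3)
    proof (rule tensor_gr_lin[OF V W m(4) lin_comp[OF _ Assoc_inv_linear] gr_submodule[OF m(6)], rotated 2])
      show "is_linear k (V ** W) R3 (\<lambda>Y. tp H U (V ** W) u Y)"
        using U V W gr_closed[OF U l(2)] by (intro lin_tp_right lin_id) simp_all
      fix p q v w assume h: "p + q = l" "v \<in> gr V p" "w \<in> gr W q"
      have "pl (act U a u) (act V b v) (act W c w) \<in> gr L3 n" if "a \<in> carrier H" "b \<in> carrier H" "c \<in> carrier H" for a b c
        by (rule tp_gr[OF hmod_tensor[OF U V] W tp_gr[OF U V act_gr[OF U that(1) l(2)] act_gr[OF V that(2) h(2)] HOL.refl] act_gr[OF W that(3) h(3)]])
          (use l(1) h(1) in simp)
      then show "Assoc_inv H U V W (pr u v w) \<in> gr L3 n"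
        using gr_closed[OF U l(2)] gr_closed[OF V h(2)] gr_closed[OF W h(3)] by (simp add: Assoc_inv_tp gr_sw[OF m(6)])
    qed
  qed
next
  fix h t assume h: "h \<in> carrier H" and t: "t \<in> carrier R3"
  \<comment> \<open>Writing the argument as \<open>Assoc\<close> of \<open>?s\<close> lets
    equivariance of the inverse be inherited from \<open>Assoc\<close>.\<close>
  let ?s = "Assoc_inv H U V W t"
  have s: "?s \<in> carrier L3" by (rule Assoc_inv_closed[OF t])
  have "Assoc_inv H U V W (act R3 h t) = Assoc_inv H U V W (act R3 h (Assoc H U V W ?s))" (is "?l = _")
    using t by (simp add: Assoc_Assoc_inv)
  also have "\<dots> = Assoc_inv H U V W (Assoc H U V W (act L3 h ?s))" using h s by (simp add: mor_act[OF mor_Assoc])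
  also have "\<dots> = act L3 h ?s" using h s act_closed[OF m(6)] by (simp add: Assoc_inv_Assoc)
  finally show "?l = act L3 h ?s" .
qed

end

end

lemmas [simp] = Assoc_linear Assoc_inv_linear Assoc_closed Assoc_inv_closed Assoc_Assoc_inv Assoc_inv_Assoc mor_Assoc mor_Assoc_inv

lemmas push_Assoc =
  lin_swD[OF Assoc_linear] lin_swR[OF Assoc_linear] lin_swP[OF Assoc_linear] lin_swPi[OF Assoc_linear] lin_ksign[OF _ _ Assoc_linear]
  lin_swD[OF Assoc_inv_linear] lin_swR[OF Assoc_inv_linear] lin_swP[OF Assoc_inv_linear] lin_swPi[OF Assoc_inv_linear] lin_ksign[OF _ _ Assoc_inv_linear]

lemma Assoc_nat:
  assumes U: "is_hmod H U" and V: "is_hmod H V" and W: "is_hmod H W" and U': "is_hmod H U'" and V': "is_hmod H V'" and W': "is_hmod H W'"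
  shows "is_mor H U U' f ==> t \<in> carrier ((U ** V) ** W) ==>
      Assoc H U' V W (rw (U ** V) (U' ** V) W (rw U U' V f) t) = rw U U' (V ** W) f (Assoc H U V W t)"
    and "is_mor H V V' g ==> t \<in> carrier ((U ** V) ** W) ==>
      Assoc H U V' W (rw (U ** V) (U ** V') W (lw U V V' g) t) = lw U (V ** W) (V' ** W) (rw V V' W g) (Assoc H U V W t)"
    and "is_mor H W W' h ==> t \<in> carrier ((U ** V) ** W) ==>
      Assoc H U V W' (lw (U ** V) W W' h t) = lw U (V ** W) (V ** W') (lw V W W' h) (Assoc H U V W t)"
proof -
  assume f: "is_mor H U U' f" and t: "t \<in> carrier ((U ** V) ** W)"
  show "Assoc H U' V W (rw (U ** V) (U' ** V) W (rw U U' V f) t) = rw U U' (V ** W) f (Assoc H U V W t)"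
    by (rule tensor3_ext[OF _ _ _ _ lin_comp[OF rw_linear Assoc_linear] lin_comp[OF Assoc_linear rw_linear] _ t])
      (use U V W U' f in \<open>simp_all add: Assoc_tp push_w mor_closed[OF f] mor_act[OF f]\<close>)
next
  assume f: "is_mor H V V' g" and t: "t \<in> carrier ((U ** V) ** W)"
  show "Assoc H U V' W (rw (U ** V) (U ** V') W (lw U V V' g) t) = lw U (V ** W) (V' ** W) (rw V V' W g) (Assoc H U V W t)"
    by (rule tensor3_ext[OF _ _ _ _ lin_comp[OF rw_linear Assoc_linear] lin_comp[OF Assoc_linear lw_linear] _ t])
      (use U V W V' f in \<open>simp_all add: Assoc_tp push_w mor_closed[OF f] mor_act[OF f]\<close>)
next
  assume f: "is_mor H W W' h" and t: "t \<in> carrier ((U ** V) ** W)"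
  show "Assoc H U V W' (lw (U ** V) W W' h t) = lw U (V ** W) (V ** W') (lw V W W' h) (Assoc H U V W t)"
    by (rule tensor3_ext[OF _ _ _ _ lin_comp[OF lw_linear Assoc_linear] lin_comp[OF Assoc_linear lw_linear] _ t])
      (use U V W W' f in \<open>simp_all add: Assoc_tp push_w mor_closed[OF f] mor_act[OF f]\<close>)
qed

text \<open>On pure tensors the two sides are those of \<open>pentagon_sw\<close>. The factor
  \<open>U ** V\<close> is split in a second step, since \<open>tensor3_ext\<close> opens only the
  outer two brackets.\<close>

lemma Assoc_pentagon:
  assumes U: "is_hmod H U" and V: "is_hmod H V" and W: "is_hmod H W" and X: "is_hmod H X"
    and t: "t \<in> carrier (((U ** V) ** W) ** X)"
  shows "lw U ((V ** W) ** X) (V ** W ** X) (Assoc H V W X) (Assoc H U (V ** W) X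
      (rw ((U ** V) ** W) (U ** V ** W) X (Assoc H U V W) t)) =
    Assoc H U V (W ** X) (Assoc H (U ** V) W X t)"
proof (rule tensor3_ext[OF _ _ _ _ _ _ _ t])
  show "is_linear k (((U ** V) ** W) ** X) (U ** V ** W ** X)
     (\<lambda>t. lw U ((V ** W) ** X) (V ** W ** X) (Assoc H V W X) (Assoc H U (V ** W) X
      (rw ((U ** V) ** W) (U ** V ** W) X (Assoc H U V W) t)))"
    by (rule lin_comp[OF lin_comp[OF rw_linear Assoc_linear] lw_linear]) (use U V W X in simp_all)
  show "is_linear k (((U ** V) ** W) ** X) (U ** V ** W ** X)
    (\<lambda>t. Assoc H U V (W ** X) (Assoc H (U ** V) W X t))"
    by (rule lin_comp[OF Assoc_linear Assoc_linear]) (use U V W X in simp_all)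
  fix Y w x assume Y: "Y \<in> carrier (U ** V)" and w: "w \<in> carrier W" and x: "x \<in> carrier X"
  let ?tp = "\<lambda>Y. tp H ((U ** V) ** W) X (tp H (U ** V) W Y w) x"
  have l0: "is_linear k (U ** V) (((U ** V) ** W) ** X) ?tp"
    by (intro lin_intros) (use U V W X w x in simp_all)
  have l1: "is_linear k (U ** V) (U ** V ** W ** X)
     (\<lambda>Y. lw U ((V ** W) ** X) (V ** W ** X) (Assoc H V W X) (Assoc H U (V ** W) X
      (rw ((U ** V) ** W) (U ** V ** W) X (Assoc H U V W) (?tp Y))))"
    by (rule lin_comp[OF lin_comp[OF lin_comp[OF l0 rw_linear] Assoc_linear] lw_linear]) (use U V W X in simp_all)
  have l2: "is_linear k (U ** V) (U ** V ** W ** X)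
    (\<lambda>Y. Assoc H U V (W ** X) (Assoc H (U ** V) W X (?tp Y)))"
    by (rule lin_comp[OF lin_comp[OF l0 Assoc_linear] Assoc_linear]) (use U V W X in simp_all)
  show "lw U ((V ** W) ** X) (V ** W ** X) (Assoc H V W X) (Assoc H U (V ** W) X
      (rw ((U ** V) ** W) (U ** V ** W) X (Assoc H U V W) (?tp Y))) =
    Assoc H U V (W ** X) (Assoc H (U ** V) W X (?tp Y))"
  proof (rule tensor_ext[OF _ _ _ l1 l2 _ Y])
    fix u v assume u: "u \<in> carrier U" and v: "v \<in> carrier V"
    let ?T = "(U ** V ** W ** X)"
    let ?F = "\<lambda>a b c d. tp H U (V ** W ** X) (act U a u) (tp H V (W ** X) (act V b v) (tp H W X (act W c w) (act X d x)))"
    have F: "quadlin ?T ?F" by (intro lin_intros) (use U V W X u v w x in simp_all)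
    show "lw U ((V ** W) ** X) (V ** W ** X) (Assoc H V W X) (Assoc H U (V ** W) X
      (rw ((U ** V) ** W) (U ** V ** W) X (Assoc H U V W) (?tp (tp H U V u v)))) =
    Assoc H U V (W ** X) (Assoc H (U ** V) W X (?tp (tp H U V u v)))"
      using pentagon_sw[OF _ F] U V W X u v w x
      by (simp add: Assoc_tp push_w push_tp push_Assoc act_tp act_mult)
  qed (use U V W X in simp_all)
qed (use U V W X in simp_all)

lemmas [simp] = act_gr

lemma ksign_closed' [simp]: "module k M ==> x \<in> carrier M ==> ksign M j x \<in> carrier M"
  by (rule ksign_closed)

lemma ksign_ksign': "module k M ==> x \<in> carrier M ==> ksign M i (ksign M j x) = ksign M (i + j) x"
  by (rule ksign_ksign)

lemma mor_tensorI_hom: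
  assumes V: "is_hmod H V" and W: "is_hmod H W" and X: "is_hmod H X" and f: "is_linear k (V ** W) X f"
    and g: "!!m n v w. v \<in> gr V m ==> w \<in> gr W n ==> f (tp H V W v w) \<in> gr X (m + n)"
    and a: "!!h v w m n. h \<in> carrier H ==> v \<in> gr V m ==> w \<in> gr W n ==>
      swD X h (\<lambda>h1 h2. f (tp H V W (act V h1 v) (act W h2 w))) = act X h (f (tp H V W v w))"
  shows "is_mor H (V ** W) X f"
proof (rule morI[OF f])
  show "f t \<in> gr X n" if "t \<in> gr (V ** W) n" for n t
    by (rule tensor_gr_lin[OF V W _ f gr_submodule[OF X] _ that]) (use X g in auto)
  show "f (act (V ** W) h t) = act X h (f t)" if h: "h \<in> carrier H" and t: "t \<in> carrier (V ** W)" for h t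
  proof (rule tensor_ext_hom[OF V W _ lin_comp[OF tensor_act_linear[OF V W h] f] lin_comp[OF f hmod_act_linear[OF X h]] _ t])
    fix v w m n assume vw: "v \<in> gr V m" "w \<in> gr W n"
    show "f (act (V ** W) h (tp H V W v w)) = act X h (f (tp H V W v w))"
      using V W X h gr_closed[OF V vw(1)] gr_closed[OF W vw(2)] by (simp add: act_tp lin_swD[OF f] a[OF h vw])
  qed (use X in simp)
qed

lemma tensor3_ext_hom:
  assumes U: "is_hmod H U" and V: "is_hmod H V" and W: "is_hmod H W" and M: "module k M"
    and f: "is_linear k ((U ** V) ** W) M f" and g: "is_linear k ((U ** V) ** W) M g"
    and e: "!!l m n u v w. u \<in> gr U l ==> v \<in> gr V m ==> w \<in> gr W n ==>
      f (tp H (U ** V) W (tp H U V u v) w) = g (tp H (U ** V) W (tp H U V u v) w)"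
    and t: "t \<in> carrier ((U ** V) ** W)"
  shows "f t = g t"
proof (rule tensor_ext[OF _ _ M f g _ t])
  have mU: "module k (U ** V)" and mW: "module k W" using U V W by simp_all
  fix Y w assume Y: "Y \<in> carrier (U ** V)" and w: "w \<in> carrier W"
  note l' = lin_tp_right[OF mU mW lin_id Y]
  show "f (tp H (U ** V) W Y w) = g (tp H (U ** V) W Y w)"
  proof (rule hom_ext[OF W M lin_comp[OF l' f] lin_comp[OF l' g] _ w])
    fix n w assume w: "w \<in> gr W n"
    note l = lin_tp_left[OF mU mW lin_id gr_closed[OF W w]]
    show "f (tp H (U ** V) W Y w) = g (tp H (U ** V) W Y w)"
      by (rule tensor_ext_hom[OF U V M lin_comp[OF l f] lin_comp[OF l g] e[OF _ _ w] Y])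
  qed
qed (use U V W in simp_all)

lemma tensor3r_ext_hom:
  assumes U: "is_hmod H U" and V: "is_hmod H V" and W: "is_hmod H W" and M: "module k M"
    and f: "is_linear k (U ** V ** W) M f" and g: "is_linear k (U ** V ** W) M g"
    and e: "!!l m n u v w. u \<in> gr U l ==> v \<in> gr V m ==> w \<in> gr W n ==>
      f (tp H U (V ** W) u (tp H V W v w)) = g (tp H U (V ** W) u (tp H V W v w))"
    and t: "t \<in> carrier (U ** V ** W)"
  shows "f t = g t"
proof (rule tensor_ext[OF _ _ M f g _ t])
  have mU: "module k U" and mW: "module k (V ** W)" using U V W by simp_all
  fix u Y assume u: "u \<in> carrier U" and Y: "Y \<in> carrier (V ** W)"
  note l' = lin_tp_left[OF mU mW lin_id Y]
  show "f (tp H U (V ** W) u Y) = g (tp H U (V ** W) u Y)"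
  proof (rule hom_ext[OF U M lin_comp[OF l' f] lin_comp[OF l' g] _ u])
    fix n u assume u: "u \<in> gr U n"
    note l = lin_tp_right[OF mU mW lin_id gr_closed[OF U u]]
    show "f (tp H U (V ** W) u Y) = g (tp H U (V ** W) u Y)"
      by (rule tensor_ext_hom[OF V W M lin_comp[OF l f] lin_comp[OF l g] e[OF u] Y])
  qed
qed (use U V W in simp_all)

subsection \<open>The braiding\<close>

lemma sw_ksign:
  assumes M: "module k M"
  shows "h \<in> carrier H ==> (!!a b. a \<in> carrier H ==> b \<in> carrier H ==> F a b \<in> carrier M) ==> swD M h (\<lambda>a b. ksign M j (F a b)) = ksign M j (swD M h F)"
    "(!!a b. a \<in> carrier H ==> b \<in> carrier H ==> F a b \<in> carrier M) ==> swR M (\<lambda>a b. ksign M j (F a b)) = ksign M j (swR M F)"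
    "(!!a b c. a \<in> carrier H ==> b \<in> carrier H ==> c \<in> carrier H ==> G a b c \<in> carrier M) ==> swP M (\<lambda>a b c. ksign M j (G a b c)) = ksign M j (swP M G)"
    "(!!a b c. a \<in> carrier H ==> b \<in> carrier H ==> c \<in> carrier H ==> G a b c \<in> carrier M) ==> swPi M (\<lambda>a b c. ksign M j (G a b c)) = ksign M j (swPi M G)"
  using lin_swD[OF ksign_lin[OF M lin_id] M M, of h F] lin_swR[OF ksign_lin[OF M lin_id] M M, of F]
    lin_swP[OF ksign_lin[OF M lin_id] M M, of G] lin_swPi[OF ksign_lin[OF M lin_id] M M, of G] by simp_all

context
  fixes V and W
  assumes V: "is_hmod H V" and W: "is_hmod H W"
begin

text \<open>The braiding without its sign. It is bilinear in arbitrary arguments, whereas the sign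
  depends on the degrees.\<close>

definition "braid0 v w = swR (W ** V) (\<lambda>r s. tp H W V (act W s w) (act V r v))"

lemma bilin_braid0: "bilin k V W (W ** V) braid0"
  unfolding braid0_def[abs_def] by (intro lin_intros) (use V W in simp_all)

lemma braid_aux:
  "braid H V W = tlift (W ** V) (\<lambda>v w. finsum (W ** V) (\<lambda>p. ksign (W ** V) (fst p * snd p) (braid0 (hcomp V (fst p) v) (hcomp W (snd p) w))) (degs V \<times> degs W))"
  by (simp add: braid_def Let_def braid0_def swR_def case_prod_beta')

lemma braid_bilin: "bilin k V W (W ** V) (\<lambda>v w. finsum (W ** V) (\<lambda>p. ksign (W ** V) (fst p * snd p) (braid0 (hcomp V (fst p) v) (hcomp W (snd p) w))) (degs V \<times> degs W))"
  by (intro bilinI lin_finsum_fun ksign_lin bilin_linear_left[OF bilin_braid0] bilin_linear_right[OF bilin_braid0] hcomp_linear[OF V] hcomp_linear[OF W])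
    (use V W in simp_all)

lemma braid_linear: "is_linear k (V ** W) (W ** V) (braid H V W)"
  unfolding braid_aux by (intro tlift_tensor_linear braid_bilin) (use V W in simp_all)

lemma braid_closed: "t \<in> carrier (V ** W) ==> braid H V W t \<in> carrier (W ** V)"
  by (rule lin_closed[OF braid_linear])

text \<open>Of the sum over all pairs of degrees only the term at \<open>(m, n)\<close> can survive.
  If that pair is not among the degrees, then \<open>v\<close> or \<open>w\<close> vanishes and both
  sides are zero.\<close>

lemma braid_hom:
  assumes v: "v \<in> gr V m" and w: "w \<in> gr W n"
  shows "braid H V W (tp H V W v w) = ksign (W ** V) (m * n) (swR (W ** V) (\<lambda>r s. tp H W V (act W s w) (act V r v)))"
proof -
  have mV: "module k V" and mW: "module k W" and mT: "module k (W ** V)" using V W by simp_all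
  interpret T: module k "W ** V" by (rule mT)
  note vc = gr_closed[OF V v] and wc = gr_closed[OF W w]
  have z: "ksign (W ** V) j (braid0 \<zero>\<^bsub>V\<^esub> y) = \<zero>\<^bsub>W ** V\<^esub>" if "y \<in> carrier W" for y j
    using lin_zero[OF mV mT bilin_left[OF bilin_braid0 that]] by (simp add: ksign_def)
  have z': "ksign (W ** V) j (braid0 y \<zero>\<^bsub>W\<^esub>) = \<zero>\<^bsub>W ** V\<^esub>" if "y \<in> carrier V" for y j
    using lin_zero[OF mW mT bilin_right[OF bilin_braid0 that]] by (simp add: ksign_def)
  let ?f = "\<lambda>p. ksign (W ** V) (fst p * snd p) (braid0 (hcomp V (fst p) v) (hcomp W (snd p) w))"
  have e: "braid H V W (tp H V W v w) = finsum (W ** V) ?f (degs V \<times> degs W)"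
    unfolding braid_aux using vc wc by (simp add: tlift_tp[OF mV mW mT braid_bilin])
  have f0: "?f p = \<zero>\<^bsub>W ** V\<^esub>" if "p \<noteq> (m, n)" for p
  proof (cases "fst p = m")
    case True
    then have "snd p \<noteq> n" using that by (cases p) auto
    then show ?thesis using z' V vc by (simp add: hcomp_same[OF W w])
  next
    case False
    then show ?thesis using z W wc by (simp add: hcomp_same[OF V v])
  qed
  have f1: "?f (m, n) = ksign (W ** V) (m * n) (braid0 v w)" by (simp add: hcomp_same[OF V v] hcomp_same[OF W w])
  have "finsum (W ** V) ?f (degs V \<times> degs W) = ?f (m, n)"
  proof (cases "(m, n) \<in> degs V \<times> degs W")
    case True
    show ?thesis
      by (rule finsum_single[OF T.M.abelian_group_axioms _ True])
        (use V W vc wc f0 bilin_closed[OF bilin_braid0] in \<open>simp_all add: f1\<close>)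
  next
    case False
    then have "v = \<zero>\<^bsub>V\<^esub> \<or> w = \<zero>\<^bsub>W\<^esub>" using degs_gr[OF V v] degs_gr[OF W w] by auto
    then have "?f (m, n) = \<zero>\<^bsub>W ** V\<^esub>" unfolding f1 using z[OF wc] z'[OF vc] by auto
    moreover have "finsum (W ** V) ?f (degs V \<times> degs W) = \<zero>\<^bsub>W ** V\<^esub>"
      by (rule finsum_all_zero[OF T.M.abelian_group_axioms]) (use False f0 in metis)
    ultimately show ?thesis by simp
  qed
  then show ?thesis unfolding e f1 by (simp add: braid0_def)
qed

text \<open>Checked on homogeneous elements: the action of \<open>H\<close> preserves degrees and
  hence the sign, and what remains is \<open>R_cop_sw\<close>.\<close>

lemma mor_braid: "is_mor H (V ** W) (W ** V) (braid H V W)"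
proof (rule mor_tensorI_hom[OF V W _ braid_linear])
  show WV: "is_hmod H (W ** V)" using V W by simp
  fix m n v w assume v: "v \<in> gr V m" and w: "w \<in> gr W n"
  note vc = gr_closed[OF V v] and wc = gr_closed[OF W w]
  have "tp H W V (act W s w) (act V r v) \<in> gr (W ** V) (m + n)" if "r \<in> carrier H" "s \<in> carrier H" for r s
    by (rule tp_gr[OF W V act_gr[OF W that(2) w] act_gr[OF V that(1) v]]) simp
  then show "braid H V W (tp H V W v w) \<in> gr (W ** V) (m + n)"
    by (simp add: braid_hom[OF v w] gr_ksign[OF WV] gr_sw[OF WV])
  fix h assume h: "h \<in> carrier H"
  let ?T = "W ** V"
  have b: "bilin k H H ?T (\<lambda>a b. tp H W V (act W a w) (act V b v))" by (intro lin_intros) (use V W vc wc in simp_all)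
  have "swD ?T h (\<lambda>h1 h2. braid H V W (tp H V W (act V h1 v) (act W h2 w))) =
    ksign ?T (m * n) (swD ?T h (\<lambda>h1 h2. swR ?T (\<lambda>r s. tp H W V (act W (s \<otimes> h2) w) (act V (r \<otimes> h1) v))))" (is "?l = _")
    using V W v w vc wc h by (simp add: braid_hom[of _ m _ n] sw_ksign act_mult)
  also have "\<dots> = ksign ?T (m * n) (swR ?T (\<lambda>r s. swD ?T h (\<lambda>h1 h2. tp H W V (act W (h1 \<otimes> s) w) (act V (h2 \<otimes> r) v))))"
    using R_cop_sw[OF _ b h] V W by simp
  also have "\<dots> = act ?T h (braid H V W (tp H V W v w))"
    using V W v w vc wc h by (simp add: braid_hom[of _ m _ n] push_act act_tp act_mult)
  finally show "?l = act ?T h (braid H V W (tp H V W v w))" .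
qed

end

lemmas [simp] = braid_linear braid_closed mor_braid

lemmas push_braid = lin_swD[OF braid_linear] lin_swR[OF braid_linear] lin_swP[OF braid_linear] lin_swPi[OF braid_linear] lin_ksign[OF _ _ braid_linear]

text \<open>A morphism preserves degrees, so the sign does not change, and it is equivariant, so it
  passes through the action of \<open>R\<close>.\<close>

lemma braid_nat_left:
  assumes X: "is_hmod H X" and X': "is_hmod H X'" and Y: "is_hmod H Y" and f: "is_mor H X X' f" and t: "t \<in> carrier (X ** Y)"
  shows "braid H X' Y (rw X X' Y f t) = lw Y X X' f (braid H X Y t)"
proof (rule tensor_ext_hom[OF X Y _ lin_comp[OF rw_linear braid_linear] lin_comp[OF braid_linear lw_linear] _ t])
  fix v w m n assume v: "v \<in> gr X m" and w: "w \<in> gr Y n"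
  note vc = gr_closed[OF X v] and wc = gr_closed[OF Y w]
  show "braid H X' Y (rw X X' Y f (tp H X Y v w)) = lw Y X X' f (braid H X Y (tp H X Y v w))"
    using X X' Y f v w vc wc mor_gr[OF f v] mor_closed[OF f]
    by (simp add: braid_hom[of _ _ _ m _ n] push_w mor_act[OF f])
qed (use X X' Y f in simp_all)

lemma braid_nat_right:
  assumes X: "is_hmod H X" and Y': "is_hmod H Y'" and Y: "is_hmod H Y" and f: "is_mor H Y Y' f" and t: "t \<in> carrier (X ** Y)"
  shows "braid H X Y' (lw X Y Y' f t) = rw Y Y' X f (braid H X Y t)"
proof (rule tensor_ext_hom[OF X Y _ lin_comp[OF lw_linear braid_linear] lin_comp[OF braid_linear rw_linear] _ t])
  fix v w m n assume v: "v \<in> gr X m" and w: "w \<in> gr Y n"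
  note vc = gr_closed[OF X v] and wc = gr_closed[OF Y w]
  show "braid H X Y' (lw X Y Y' f (tp H X Y v w)) = rw Y Y' X f (braid H X Y (tp H X Y v w))"
    using X Y' Y f v w vc wc mor_gr[OF f w] mor_closed[OF f]
    by (simp add: braid_hom[of _ _ _ m _ n] push_w mor_act[OF f])
qed (use X Y' Y f in simp_all)

text \<open>The two copies of \<open>R\<close> are collapsed by triangularity, and the total sign
  exponent \<open>m n + n m\<close> is even.\<close>

lemma braid_braid [simp]:
  assumes V: "is_hmod H V" and W: "is_hmod H W" and t: "t \<in> carrier (V ** W)"
  shows "braid H W V (braid H V W t) = t"
proof (rule tensor_ext_hom[OF V W _ lin_comp[OF braid_linear braid_linear] lin_id _ t])
  fix v w m n assume v: "v \<in> gr V m" and w: "w \<in> gr W n"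
  note vc = gr_closed[OF V v] and wc = gr_closed[OF W w]
  let ?T = "V ** W"
  have b: "bilin k H H ?T (\<lambda>a b. tp H V W (act V a v) (act W b w))" by (intro lin_intros) (use V W vc wc in simp_all)
  have "braid H W V (braid H V W (tp H V W v w)) = ksign ?T (m * n) (ksign ?T (n * m)
    (swR ?T (\<lambda>r s. swR ?T (\<lambda>r' s'. tp H V W (act V (s' \<otimes> r) v) (act W (r' \<otimes> s) w)))))" (is "?l = _")
    using V W v w vc wc by (simp add: braid_hom[of _ _ _ m _ n] braid_hom[of _ _ _ n _ m] push_braid sw_ksign act_mult)
  also have "\<dots> = tp H V W v w"
    using RR_sw(1)[OF _ b] V W vc wc by (simp add: ksign_ksign' ksign_even)
  finally show "?l = tp H V W v w" .
qed (use V W in simp_all)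

text \<open>On homogeneous pure tensors this is the hexagon for \<open>R\<close>; the signs agree
  because \<open>v \<otimes> w\<close> has degree \<open>p + q\<close>.\<close>

lemma hexagon_left:
  assumes V: "is_hmod H V" and W: "is_hmod H W" and X: "is_hmod H X" and t: "t \<in> carrier ((V ** W) ** X)"
  shows "Assoc H X V W (rw (V ** X) (X ** V) W (braid H V X) (Assoc_inv H V X W
      (lw V (W ** X) (X ** W) (braid H W X) (Assoc H V W X t)))) = braid H (V ** W) X t"
proof (rule tensor3_ext_hom[OF V W X _ lin_comp[OF lin_comp[OF lin_comp[OF lin_comp[OF Assoc_linear lw_linear] Assoc_inv_linear] rw_linear] Assoc_linear] braid_linear _ t])
  fix v w x p q r assume v: "v \<in> gr V p" and w: "w \<in> gr W q" and x: "x \<in> gr X r"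
  note c = gr_closed[OF V v] gr_closed[OF W w] gr_closed[OF X x]
  let ?T = "X ** V ** W" and ?t = "tp H (V ** W) X (tp H V W v w) x"
  let ?F = "\<lambda>a b d. tp H X (V ** W) (act X d x) (tp H V W (act V a v) (act W b w))"
  have F: "trilin ?T ?F" by (intro lin_intros) (use V W X c in simp_all)
  have "Assoc H X V W (rw (V ** X) (X ** V) W (braid H V X) (Assoc_inv H V X W
      (lw V (W ** X) (X ** W) (braid H W X) (Assoc H V W X ?t)))) =
    ksign ?T (q * r) (ksign ?T (p * r) (swP ?T (\<lambda>x y z. swR ?T (\<lambda>r' s'. swPi ?T (\<lambda>a' b' c'. swR ?T (\<lambda>r s. swP ?T (\<lambda>a b c.
      ?F (b \<otimes> r \<otimes> a' \<otimes> x) (c \<otimes> c' \<otimes> r' \<otimes> y) (a \<otimes> s \<otimes> b' \<otimes> s' \<otimes> z))))))))" (is "?l = _")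
    using V W X v w x c
    by (simp add: Assoc_tp Assoc_inv_tp push_w push_tp push_Assoc act_mult sw_ksign
        braid_hom[of W X _ q _ r] braid_hom[of V X _ p _ r])
  also have "\<dots> = ksign ?T ((p + q) * r) (swR ?T (\<lambda>r s. swD ?T r (\<lambda>r1 r2. ?F r1 r2 s)))"
    unfolding hexagon_left_sw[OF module_tensor[OF hmod_module[OF X] hmod_module[OF hmod_tensor[OF V W]]] F]
    using V W X c by (simp add: ksign_ksign' algebra_simps)
  also have "\<dots> = braid H (V ** W) X ?t"
    using V W X v w x c by (simp add: braid_hom[of "V ** W" X _ "p + q" _ r] tp_gr act_tp push_tp)
  finally show "?l = braid H (V ** W) X ?t" .
qed (use V W X in simp_all)

lemma hexagon_right:
  assumes V: "is_hmod H V" and W: "is_hmod H W" and X: "is_hmod H X" and t: "t \<in> carrier (V ** W ** X)"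
  shows "Assoc_inv H W X V (lw W (V ** X) (X ** V) (braid H V X) (Assoc H W V X
      (rw (V ** W) (W ** V) X (braid H V W) (Assoc_inv H V W X t)))) = braid H V (W ** X) t"
proof (rule tensor3r_ext_hom[OF V W X _ lin_comp[OF lin_comp[OF lin_comp[OF lin_comp[OF Assoc_inv_linear rw_linear] Assoc_linear] lw_linear] Assoc_inv_linear] braid_linear _ t])
  fix v w x p q r assume v: "v \<in> gr V p" and w: "w \<in> gr W q" and x: "x \<in> gr X r"
  note c = gr_closed[OF V v] gr_closed[OF W w] gr_closed[OF X x]
  let ?T = "(W ** X) ** V" and ?t = "tp H V (W ** X) v (tp H W X w x)"
  let ?F = "\<lambda>a b d. tp H (W ** X) V (tp H W X (act W b w) (act X d x)) (act V a v)"
  have F: "trilin ?T ?F" by (intro lin_intros) (use V W X c in simp_all)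
  have "Assoc_inv H W X V (lw W (V ** X) (X ** V) (braid H V X) (Assoc H W V X
      (rw (V ** W) (W ** V) X (braid H V W) (Assoc_inv H V W X ?t)))) =
    ksign ?T (p * q) (ksign ?T (p * r) (swPi ?T (\<lambda>x y z. swR ?T (\<lambda>r' s'. swP ?T (\<lambda>a' b' c'. swR ?T (\<lambda>r s. swPi ?T (\<lambda>a b c.
      ?F (c \<otimes> r \<otimes> b' \<otimes> r' \<otimes> x) (a \<otimes> a' \<otimes> s' \<otimes> y) (b \<otimes> s \<otimes> c' \<otimes> z))))))))" (is "?l = _")
    using V W X v w x c
    by (simp add: Assoc_tp Assoc_inv_tp push_w push_tp push_Assoc act_mult sw_ksign
        braid_hom[of V W _ p _ q] braid_hom[of V X _ p _ r])
  also have "\<dots> = ksign ?T (p * (q + r)) (swR ?T (\<lambda>r s. swD ?T s (\<lambda>s1 s2. ?F r s1 s2)))"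
    unfolding hexagon_right_sw[OF module_tensor[OF hmod_module[OF hmod_tensor[OF W X]] hmod_module[OF V]] F]
    using V W X c by (simp add: ksign_ksign' algebra_simps)
  also have "\<dots> = braid H V (W ** X) ?t"
    using V W X v w x c by (simp add: braid_hom[of V "W ** X" _ p _ "q + r"] tp_gr act_tp push_tp)
  finally show "?l = braid H V (W ** X) ?t" .
qed (use V W X in simp_all)

lemma Assoc_inv_nat:
  assumes U: "is_hmod H U" and V: "is_hmod H V" and W: "is_hmod H W" and U': "is_hmod H U'" and V': "is_hmod H V'" and W': "is_hmod H W'"
    and t: "t \<in> carrier (U ** V ** W)"
  shows "is_mor H U U' f ==>
      Assoc_inv H U' V W (rw U U' (V ** W) f t) = rw (U ** V) (U' ** V) W (rw U U' V f) (Assoc_inv H U V W t)"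
    and "is_mor H V V' g ==>
      Assoc_inv H U V' W (lw U (V ** W) (V' ** W) (rw V V' W g) t) = rw (U ** V) (U ** V') W (lw U V V' g) (Assoc_inv H U V W t)"
    and "is_mor H W W' h ==>
      Assoc_inv H U V W' (lw U (V ** W) (V ** W') (lw V W W' h) t) = lw (U ** V) W W' h (Assoc_inv H U V W t)"
proof -
  have s: "Assoc_inv H U V W t \<in> carrier ((U ** V) ** W)" using U V W t by simp
  note n = Assoc_nat[OF U V W U' V' W']
  show "Assoc_inv H U' V W (rw U U' (V ** W) f t) = rw (U ** V) (U' ** V) W (rw U U' V f) (Assoc_inv H U V W t)" if f: "is_mor H U U' f"
    using arg_cong[OF n(1)[OF f s], of "Assoc_inv H U' V W"] U V W U' t f by simp
  show "Assoc_inv H U V' W (lw U (V ** W) (V' ** W) (rw V V' W g) t) = rw (U ** V) (U ** V') W (lw U V V' g) (Assoc_inv H U V W t)" if f: "is_mor H V V' g"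
    using arg_cong[OF n(2)[OF f s], of "Assoc_inv H U V' W"] U V W V' t f by simp
  show "Assoc_inv H U V W' (lw U (V ** W) (V ** W') (lw V W W' h) t) = lw (U ** V) W W' h (Assoc_inv H U V W t)" if f: "is_mor H W W' h"
    using arg_cong[OF n(3)[OF f s], of "Assoc_inv H U V W'"] U V W W' t f by simp
qed

subsection \<open>Exchanging adjacent factors of right-nested products\<close>

text \<open>Products with several factors are kept right-nested from here on, and \<open>sig\<close>
  is the exchange of the first two factors in that form. Much of the coherence used later is
  expressed through it.\<close>

definition sig where
  "sig X Y Z t = Assoc H Y X Z (rw (X ** Y) (Y ** X) Z (braid H X Y) (Assoc_inv H X Y Z t))"

context
  fixes X and Y and Z
  assumes X: "is_hmod H X" and Y: "is_hmod H Y" and Z: "is_hmod H Z"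
begin

lemma mor_sig: "is_mor H (X ** Y ** Z) (Y ** X ** Z) (sig X Y Z)"
  unfolding sig_def[abs_def] by (rule mor_comp[OF mor_comp[OF mor_Assoc_inv mor_rw] mor_Assoc]) (use X Y Z in simp_all)

lemma sig_closed: "t \<in> carrier (X ** Y ** Z) ==> sig X Y Z t \<in> carrier (Y ** X ** Z)"
  by (rule mor_closed[OF mor_sig])

lemma sig_Assoc: "t \<in> carrier ((X ** Y) ** Z) ==> sig X Y Z (Assoc H X Y Z t) = Assoc H Y X Z (rw (X ** Y) (Y ** X) Z (braid H X Y) t)"
  using X Y Z by (simp add: sig_def)

lemma sig_nat1:
  assumes X': "is_hmod H X'" and f: "is_mor H X X' f" and t: "t \<in> carrier (X ** Y ** Z)"
  shows "sig X' Y Z (rw X X' (Y ** Z) f t) = lw Y (X ** Z) (X' ** Z) (rw X X' Z f) (sig X Y Z t)"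
proof -
  let ?s = "Assoc_inv H X Y Z t"
  have s: "?s \<in> carrier ((X ** Y) ** Z)" using X Y Z t by simp
  have "sig X' Y Z (rw X X' (Y ** Z) f t) = Assoc H Y X' Z (rw (X' ** Y) (Y ** X') Z (braid H X' Y) (rw (X ** Y) (X' ** Y) Z (rw X X' Y f) ?s))"
    using X Y Z X' f t by (simp add: sig_def Assoc_inv_nat(1)[of X Y Z X' Y Z])
  also have "rw (X' ** Y) (Y ** X') Z (braid H X' Y) (rw (X ** Y) (X' ** Y) Z (rw X X' Y f) ?s) =
    rw (Y ** X) (Y ** X') Z (lw Y X X' f) (rw (X ** Y) (Y ** X) Z (braid H X Y) ?s)"
    using X Y Z X' f s by (simp add: rw_rw braid_nat_left[OF X X' Y f] cong: rw_cong)
  finally show ?thesis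
    using X Y Z X' f s by (simp add: Assoc_nat(2)[of Y X Z Y X' Z] sig_def)
qed

lemma sig_nat2:
  assumes Y': "is_hmod H Y'" and f: "is_mor H Y Y' f" and t: "t \<in> carrier (X ** Y ** Z)"
  shows "sig X Y' Z (lw X (Y ** Z) (Y' ** Z) (rw Y Y' Z f) t) = rw Y Y' (X ** Z) f (sig X Y Z t)"
proof -
  let ?s = "Assoc_inv H X Y Z t"
  have s: "?s \<in> carrier ((X ** Y) ** Z)" using X Y Z t by simp
  have "sig X Y' Z (lw X (Y ** Z) (Y' ** Z) (rw Y Y' Z f) t) = Assoc H Y' X Z (rw (X ** Y') (Y' ** X) Z (braid H X Y') (rw (X ** Y) (X ** Y') Z (lw X Y Y' f) ?s))"
    using X Y Z Y' f t by (simp add: sig_def Assoc_inv_nat(2)[of X Y Z X Y' Z])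
  also have "rw (X ** Y') (Y' ** X) Z (braid H X Y') (rw (X ** Y) (X ** Y') Z (lw X Y Y' f) ?s) =
    rw (Y ** X) (Y' ** X) Z (rw Y Y' X f) (rw (X ** Y) (Y ** X) Z (braid H X Y) ?s)"
    using X Y Z Y' f s by (simp add: rw_rw braid_nat_right[OF X Y' Y f] cong: rw_cong)
  finally show ?thesis
    using X Y Z Y' f s by (simp add: Assoc_nat(1)[of Y X Z Y' X Z] sig_def)
qed

lemma sig_nat3:
  assumes Z': "is_hmod H Z'" and f: "is_mor H Z Z' f" and t: "t \<in> carrier (X ** Y ** Z)"
  shows "sig X Y Z' (lw X (Y ** Z) (Y ** Z') (lw Y Z Z' f) t) = lw Y (X ** Z) (X ** Z') (lw X Z Z' f) (sig X Y Z t)"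
proof -
  let ?s = "Assoc_inv H X Y Z t"
  have s: "?s \<in> carrier ((X ** Y) ** Z)" using X Y Z t by simp
  have "sig X Y Z' (lw X (Y ** Z) (Y ** Z') (lw Y Z Z' f) t) = Assoc H Y X Z' (rw (X ** Y) (Y ** X) Z' (braid H X Y) (lw (X ** Y) Z Z' f ?s))"
    using X Y Z Z' f t by (simp add: sig_def Assoc_inv_nat(3)[of X Y Z X Y Z'])
  also have "rw (X ** Y) (Y ** X) Z' (braid H X Y) (lw (X ** Y) Z Z' f ?s) =
    lw (Y ** X) Z Z' f (rw (X ** Y) (Y ** X) Z (braid H X Y) ?s)"
    using X Y Z Z' f s by (simp add: lw_rw)
  finally show ?thesis
    using X Y Z Z' f s by (simp add: Assoc_nat(3)[of Y X Z Y X Z'] sig_def)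
qed

end

lemmas [simp] = mor_sig sig_closed

text \<open>Bringing \<open>V\<close> in front of \<open>P ** P'\<close> in one step or in two: this
  is the first hexagon with a spectator \<open>Z\<close>, translated into right-nested
  products.\<close>

lemma sig_comp_left:
  assumes P: "is_hmod H P" and P': "is_hmod H P'" and V: "is_hmod H V" and Z: "is_hmod H Z" and t: "t \<in> carrier (P ** P' ** V ** Z)"
  shows "lw V ((P ** P') ** Z) (P ** P' ** Z) (Assoc H P P' Z) (sig (P ** P') V Z (Assoc_inv H P P' (V ** Z) t)) =
    sig P V (P' ** Z) (lw P (P' ** V ** Z) (V ** P' ** Z) (sig P' V Z) t)"
proof -
  note o [simp] = P P' V Z
  \<comment> \<open>\<open>r\<close> is the fully left-nested form of \<open>t\<close>;
    \<open>r1\<close> to \<open>r4\<close> are the stages of the hexagon, each with \<open>Z\<close>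
    kept as last factor.\<close>
  define r where "r = Assoc_inv H (P ** P') V Z (Assoc_inv H P P' (V ** Z) t)"
  define r1 where "r1 = rw ((P ** P') ** V) (P ** P' ** V) Z (Assoc H P P' V) r"
  define r2 where "r2 = rw (P ** P' ** V) (P ** V ** P') Z (lw P (P' ** V) (V ** P') (braid H P' V)) r1"
  define r3 where "r3 = rw (P ** V ** P') ((P ** V) ** P') Z (Assoc_inv H P V P') r2"
  define r4 where "r4 = rw ((P ** V) ** P') ((V ** P) ** P') Z (rw (P ** V) (V ** P) P' (braid H P V)) r3"
  have c: "r \<in> carrier (((P ** P') ** V) ** Z)" "r1 \<in> carrier ((P ** P' ** V) ** Z)" "r2 \<in> carrier ((P ** V ** P') ** Z)"
    "r3 \<in> carrier (((P ** V) ** P') ** Z)" "r4 \<in> carrier (((V ** P) ** P') ** Z)"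
    using t by (simp_all add: r_def r1_def r2_def r3_def r4_def)
  have "rw ((P ** P') ** V) (V ** P ** P') Z (braid H (P ** P') V) r = rw ((P ** P') ** V) (V ** P ** P') Z
    (\<lambda>t. Assoc H V P P' (rw (P ** V) (V ** P) P' (braid H P V) (Assoc_inv H P V P' (lw P (P' ** V) (V ** P') (braid H P' V) (Assoc H P P' V t))))) r" (is "?l = _")
    by (rule rw_cong[OF _ _ _ hexagon_left[symmetric] c(1)]) simp_all
  also have "\<dots> = rw ((V ** P) ** P') (V ** P ** P') Z (Assoc H V P P') r4"
    unfolding r4_def r3_def r2_def r1_def using c(1) by (simp add: rw_rw lin_comp[OF Assoc_linear lw_linear] lin_comp[OF lin_comp[OF Assoc_linear lw_linear] Assoc_inv_linear]
      lin_comp[OF lin_comp[OF lin_comp[OF Assoc_linear lw_linear] Assoc_inv_linear] rw_linear])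
  finally have h: "?l = rw ((V ** P) ** P') (V ** P ** P') Z (Assoc H V P P') r4" .
  \<comment> \<open>The pentagons \<open>p1\<close> and \<open>p2\<close> translate the stages back
    into right-nested products. What happens between them is the braiding of \<open>P'\<close> with
    \<open>V\<close>.\<close>
  have p1: "lw P ((V ** P') ** Z) (V ** P' ** Z) (Assoc H V P' Z) (Assoc H P (V ** P') Z r2) = Assoc H P V (P' ** Z) (Assoc H (P ** V) P' Z r3)"
  proof -
    have "r2 = rw ((P ** V) ** P') (P ** V ** P') Z (Assoc H P V P') r3"
      unfolding r3_def using c(2,3) by (simp add: rw_rw cong: rw_cong)
    then show ?thesis using Assoc_pentagon[OF P V P' Z c(4)] by simp
  qed
  have p2: "lw P ((P' ** V) ** Z) (P' ** V ** Z) (Assoc H P' V Z) (Assoc H P (P' ** V) Z r1) = t"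
    using Assoc_pentagon[OF P P' V Z c(1)] t unfolding r1_def by (simp add: r_def)
  have p2': "Assoc H P (P' ** V) Z r1 = lw P (P' ** V ** Z) ((P' ** V) ** Z) (Assoc_inv H P' V Z) t"
    unfolding p2[symmetric] using c(2) by (simp add: lw_lw cong: lw_cong)
  have "lw V ((P ** P') ** Z) (P ** P' ** Z) (Assoc H P P' Z) (sig (P ** P') V Z (Assoc_inv H P P' (V ** Z) t)) =
    lw V ((P ** P') ** Z) (P ** P' ** Z) (Assoc H P P' Z) (Assoc H V (P ** P') Z (rw ((V ** P) ** P') (V ** P ** P') Z (Assoc H V P P') r4))"
    unfolding sig_def r_def[symmetric] h ..
  also have "\<dots> = Assoc H V P (P' ** Z) (Assoc H (V ** P) P' Z r4)"
    by (rule Assoc_pentagon[OF V P P' Z c(5)])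
  also have "Assoc H (V ** P) P' Z r4 = rw (P ** V) (V ** P) (P' ** Z) (braid H P V) (Assoc H (P ** V) P' Z r3)"
    unfolding r4_def using c(4) by (simp add: Assoc_nat(1)[of "P ** V" P' Z "V ** P" P' Z])
  also have "Assoc H (P ** V) P' Z r3 = Assoc_inv H P V (P' ** Z) (lw P ((V ** P') ** Z) (V ** P' ** Z) (Assoc H V P' Z) (Assoc H P (V ** P') Z r2))"
    unfolding p1 using c(4) by simp
  also have "Assoc H P (V ** P') Z r2 = lw P ((P' ** V) ** Z) ((V ** P') ** Z) (rw (P' ** V) (V ** P') Z (braid H P' V)) (lw P (P' ** V ** Z) ((P' ** V) ** Z) (Assoc_inv H P' V Z) t)"
    unfolding r2_def p2'[symmetric] using c(2) by (simp add: Assoc_nat(2)[of P "P' ** V" Z P "V ** P'" Z])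
  also have "lw P ((V ** P') ** Z) (V ** P' ** Z) (Assoc H V P' Z) \<dots> = lw P (P' ** V ** Z) (V ** P' ** Z) (sig P' V Z) t"
    using t by (simp add: lw_lw lin_comp[OF Assoc_inv_linear rw_linear] sig_def[abs_def])
  finally show ?thesis by (simp only: sig_def)
qed

text \<open>The counterpart for one factor \<open>X\<close> moved past a product
  \<open>P ** V\<close>, from the second hexagon.\<close>

lemma sig_comp_right:
  assumes X: "is_hmod H X" and P: "is_hmod H P" and V: "is_hmod H V" and Z: "is_hmod H Z" and t: "t \<in> carrier (X ** P ** V ** Z)"
  shows "Assoc H P V (X ** Z) (sig X (P ** V) Z (lw X (P ** V ** Z) ((P ** V) ** Z) (Assoc_inv H P V Z) t)) =
    lw P (X ** V ** Z) (V ** X ** Z) (sig X V Z) (sig X P (V ** Z) t)"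
proof -
  note o [simp] = X P V Z
  define s where "s = lw X (P ** V ** Z) ((P ** V) ** Z) (Assoc_inv H P V Z) t"
  \<comment> \<open>\<open>r\<close> to \<open>r5\<close> follow the second hexagon from
    \<open>X ** P ** V\<close> to \<open>(P ** V) ** X\<close>, with \<open>Z\<close> kept as last
    factor.\<close>
  define r where "r = Assoc_inv H X (P ** V) Z s"
  define r1 where "r1 = rw (X ** P ** V) ((X ** P) ** V) Z (Assoc_inv H X P V) r"
  define r2 where "r2 = rw ((X ** P) ** V) ((P ** X) ** V) Z (rw (X ** P) (P ** X) V (braid H X P)) r1"
  define r3 where "r3 = rw ((P ** X) ** V) (P ** X ** V) Z (Assoc H P X V) r2"
  define r4 where "r4 = rw (P ** X ** V) (P ** V ** X) Z (lw P (X ** V) (V ** X) (braid H X V)) r3"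
  define r5 where "r5 = rw (P ** V ** X) ((P ** V) ** X) Z (Assoc_inv H P V X) r4"
  have c: "s \<in> carrier (X ** (P ** V) ** Z)" "r \<in> carrier ((X ** P ** V) ** Z)" "r1 \<in> carrier (((X ** P) ** V) ** Z)" "r2 \<in> carrier (((P ** X) ** V) ** Z)"
    "r3 \<in> carrier ((P ** X ** V) ** Z)" "r4 \<in> carrier ((P ** V ** X) ** Z)" "r5 \<in> carrier (((P ** V) ** X) ** Z)"
    using t by (simp_all add: s_def r_def r1_def r2_def r3_def r4_def r5_def)
  have "rw (X ** P ** V) ((P ** V) ** X) Z (braid H X (P ** V)) r = rw (X ** P ** V) ((P ** V) ** X) Z
    (\<lambda>t. Assoc_inv H P V X (lw P (X ** V) (V ** X) (braid H X V) (Assoc H P X V (rw (X ** P) (P ** X) V (braid H X P) (Assoc_inv H X P V t))))) r" (is "?l = _")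
    by (rule rw_cong[OF _ _ _ hexagon_right[symmetric] c(2)]) simp_all
  also have "\<dots> = r5"
    unfolding r5_def r4_def r3_def r2_def r1_def using c(2) by (simp add: rw_rw lin_comp[OF Assoc_inv_linear rw_linear] lin_comp[OF lin_comp[OF Assoc_inv_linear rw_linear] Assoc_linear]
      lin_comp[OF lin_comp[OF lin_comp[OF Assoc_inv_linear rw_linear] Assoc_linear] lw_linear])
  finally have h: "?l = r5" .
  have e5: "rw ((P ** V) ** X) (P ** V ** X) Z (Assoc H P V X) r5 = r4"
    unfolding r5_def using c(6) by (simp add: rw_rw cong: rw_cong)
  have e1: "rw ((X ** P) ** V) (X ** P ** V) Z (Assoc H X P V) r1 = r"
    unfolding r1_def using c(2) by (simp add: rw_rw cong: rw_cong)
  \<comment> \<open>Three pentagons, for the orders \<open>P\<close>, \<open>V\<close>,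
    \<open>X\<close> and \<open>P\<close>, \<open>X\<close>, \<open>V\<close> and \<open>X\<close>,
    \<open>P\<close>, \<open>V\<close> of the factors in front of \<open>Z\<close>, turn the stages
    into right-nested form.\<close>
  have p1: "Assoc H P V (X ** Z) (Assoc H (P ** V) X Z r5) = lw P ((V ** X) ** Z) (V ** X ** Z) (Assoc H V X Z) (Assoc H P (V ** X) Z r4)"
    using Assoc_pentagon[OF P V X Z c(7)] unfolding e5 by simp
  have p2: "lw P ((X ** V) ** Z) (X ** V ** Z) (Assoc H X V Z) (Assoc H P (X ** V) Z r3) = Assoc H P X (V ** Z) (Assoc H (P ** X) V Z r2)"
    using Assoc_pentagon[OF P X V Z c(4)] unfolding r3_def[symmetric] by simp
  have p2': "Assoc H P (X ** V) Z r3 = lw P (X ** V ** Z) ((X ** V) ** Z) (Assoc_inv H X V Z) (Assoc H P X (V ** Z) (Assoc H (P ** X) V Z r2))"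
    unfolding p2[symmetric] using c(5) by (simp add: lw_lw cong: lw_cong)
  have p3: "Assoc H X P (V ** Z) (Assoc H (X ** P) V Z r1) = t"
  proof -
    have 1: "Assoc H X (P ** V) Z r = s" unfolding r_def using c(1) by simp
    have 2: "lw X ((P ** V) ** Z) (P ** V ** Z) (Assoc H P V Z) s = t" unfolding s_def using t by (simp add: lw_lw cong: lw_cong)
    show ?thesis using Assoc_pentagon[OF X P V Z c(3)] unfolding e1 1 2 by simp
  qed
  have p3': "Assoc H (X ** P) V Z r1 = Assoc_inv H X P (V ** Z) t"
    unfolding p3[symmetric] using c(3) by simp
  have "Assoc H P V (X ** Z) (sig X (P ** V) Z s) = Assoc H P V (X ** Z) (Assoc H (P ** V) X Z r5)"
    unfolding sig_def r_def[symmetric] h ..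
  also have "\<dots> = lw P ((V ** X) ** Z) (V ** X ** Z) (Assoc H V X Z) (Assoc H P (V ** X) Z r4)" by (rule p1)
  also have "Assoc H P (V ** X) Z r4 = lw P ((X ** V) ** Z) ((V ** X) ** Z) (rw (X ** V) (V ** X) Z (braid H X V)) (Assoc H P (X ** V) Z r3)"
    unfolding r4_def using c(5) by (simp add: Assoc_nat(2)[of P "X ** V" Z P "V ** X" Z])
  also have "lw P ((V ** X) ** Z) (V ** X ** Z) (Assoc H V X Z) \<dots> = lw P (X ** V ** Z) (V ** X ** Z) (sig X V Z) (Assoc H P X (V ** Z) (Assoc H (P ** X) V Z r2))"
    unfolding p2' using c(4) by (simp add: lw_lw lin_comp[OF Assoc_inv_linear rw_linear] sig_def[abs_def])
  also have "Assoc H (P ** X) V Z r2 = rw (X ** P) (P ** X) (V ** Z) (braid H X P) (Assoc H (X ** P) V Z r1)"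
    unfolding r2_def using c(3) by (simp add: Assoc_nat(1)[of "X ** P" V Z "P ** X" V Z])
  finally show ?thesis unfolding p3' s_def sig_def[of X P "V ** Z" t] .
qed

section \<open>Internal homomorphisms\<close>

context
  fixes V and W
  assumes V: "is_hmod H V" and W: "is_hmod H W"
begin

private lemma mV: "module k V" and mW: "module k W" using V W by simp_all
interpretation V: module k V by (rule mV)
interpretation W: module k W by (rule mW)

private abbreviation (input) "E \<equiv> ihom H V W"

lemma ihom_carrier: "L \<in> carrier E \<longleftrightarrow> L \<in> extensional (carrier V) \<and> is_linear k V W L"
  by (simp add: ihom_def)

lemma ihom_linear: "L \<in> carrier E ==> is_linear k V W L"
  by (simp add: ihom_carrier)

lemma ihom_closed: "L \<in> carrier E ==> v \<in> carrier V ==> L v \<in> carrier W"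
  by (rule lin_closed[OF ihom_linear])

lemma ihom_eqI: "L \<in> carrier E ==> L' \<in> carrier E ==> (!!v. v \<in> carrier V ==> L v = L' v) ==> L = L'"
  by (rule extensionalityI[of L "carrier V"]) (simp_all add: ihom_carrier)

lemma ihom_restrict: "is_linear k V W f ==> (\<lambda>v\<in>carrier V. f v) \<in> carrier E"
  unfolding ihom_carrier by (auto intro: lin_cong[OF _ mV])

lemma ihom_zero: "\<zero>\<^bsub>E\<^esub> = (\<lambda>v\<in>carrier V. \<zero>\<^bsub>W\<^esub>)"
  and ihom_add: "L \<oplus>\<^bsub>E\<^esub> L' = (\<lambda>v\<in>carrier V. L v \<oplus>\<^bsub>W\<^esub> L' v)"
  and ihom_smult: "c \<odot>\<^bsub>E\<^esub> L = (\<lambda>v\<in>carrier V. c \<odot>\<^bsub>W\<^esub> L v)"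
  by (simp_all add: ihom_def)

lemma ihom_module: "module k E"
proof (rule moduleI[OF module.axioms(1)[OF mV] abelian_groupI])
  have add: "L \<oplus>\<^bsub>E\<^esub> L' \<in> carrier E" if "L \<in> carrier E" "L' \<in> carrier E" for L L'
    unfolding ihom_add by (intro ihom_restrict lin_plus mW ihom_linear that)
  have z: "\<zero>\<^bsub>E\<^esub> \<in> carrier E" unfolding ihom_zero by (intro ihom_restrict lin_const0 mV mW)
  have sm: "c \<odot>\<^bsub>E\<^esub> L \<in> carrier E" if "c \<in> carrier k" "L \<in> carrier E" for c L
    unfolding ihom_smult by (intro ihom_restrict lin_smul mW ihom_linear that)
  note cl = add z sm ihom_closed
  show "L \<oplus>\<^bsub>E\<^esub> L' \<in> carrier E" if "L \<in> carrier E" "L' \<in> carrier E" for L L' by (rule add[OF that])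
  show "\<zero>\<^bsub>E\<^esub> \<in> carrier E" by (rule z)
  show "c \<odot>\<^bsub>E\<^esub> L \<in> carrier E" if "c \<in> carrier k" "L \<in> carrier E" for c L by (rule sm[OF that])
  show "L \<oplus>\<^bsub>E\<^esub> L' \<oplus>\<^bsub>E\<^esub> L'' = L \<oplus>\<^bsub>E\<^esub> (L' \<oplus>\<^bsub>E\<^esub> L'')" if "L \<in> carrier E" "L' \<in> carrier E" "L'' \<in> carrier E" for L L' L''
    by (rule ihom_eqI) (use that in \<open>simp_all add: cl, simp add: ihom_add W.M.a_assoc ihom_closed\<close>)
  show "L \<oplus>\<^bsub>E\<^esub> L' = L' \<oplus>\<^bsub>E\<^esub> L" if "L \<in> carrier E" "L' \<in> carrier E" for L L'
    by (rule ihom_eqI) (use that in \<open>simp_all add: cl, simp add: ihom_add W.M.a_comm ihom_closed\<close>)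
  show "\<zero>\<^bsub>E\<^esub> \<oplus>\<^bsub>E\<^esub> L = L" if "L \<in> carrier E" for L
    by (rule ihom_eqI) (use that in \<open>simp_all add: cl, simp add: ihom_add ihom_zero ihom_closed\<close>)
  show "\<exists>L'\<in>carrier E. L' \<oplus>\<^bsub>E\<^esub> L = \<zero>\<^bsub>E\<^esub>" if L: "L \<in> carrier E" for L
  proof (rule bexI)
    show n: "(\<lambda>v\<in>carrier V. \<ominus>\<^bsub>W\<^esub> L v) \<in> carrier E" by (intro ihom_restrict lin_uminus mW ihom_linear L)
    show "(\<lambda>v\<in>carrier V. \<ominus>\<^bsub>W\<^esub> L v) \<oplus>\<^bsub>E\<^esub> L = \<zero>\<^bsub>E\<^esub>"
      by (rule ihom_eqI[OF add[OF n L] z]) (simp add: ihom_add ihom_zero W.M.l_neg ihom_closed[OF L])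
  qed
  show "(a \<oplus>\<^bsub>k\<^esub> b) \<odot>\<^bsub>E\<^esub> L = a \<odot>\<^bsub>E\<^esub> L \<oplus>\<^bsub>E\<^esub> b \<odot>\<^bsub>E\<^esub> L" if "a \<in> carrier k" "b \<in> carrier k" "L \<in> carrier E" for a b L
    by (rule ihom_eqI) (use that in \<open>simp_all add: cl, simp add: ihom_add ihom_smult W.smult_l_distr ihom_closed\<close>)
  show "a \<odot>\<^bsub>E\<^esub> (L \<oplus>\<^bsub>E\<^esub> L') = a \<odot>\<^bsub>E\<^esub> L \<oplus>\<^bsub>E\<^esub> a \<odot>\<^bsub>E\<^esub> L'" if "a \<in> carrier k" "L \<in> carrier E" "L' \<in> carrier E" for a L L'
    by (rule ihom_eqI) (use that in \<open>simp_all add: cl, simp add: ihom_add ihom_smult W.smult_r_distr ihom_closed\<close>)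
  show "(a \<otimes>\<^bsub>k\<^esub> b) \<odot>\<^bsub>E\<^esub> L = a \<odot>\<^bsub>E\<^esub> (b \<odot>\<^bsub>E\<^esub> L)" if "a \<in> carrier k" "b \<in> carrier k" "L \<in> carrier E" for a b L
    by (rule ihom_eqI) (use that in \<open>simp_all add: cl, simp add: ihom_smult W.smult_assoc1 ihom_closed\<close>)
  show "\<one>\<^bsub>k\<^esub> \<odot>\<^bsub>E\<^esub> L = L" if "L \<in> carrier E" for L
    by (rule ihom_eqI) (use that in \<open>simp_all add: cl, simp add: ihom_smult ihom_closed\<close>)
qed

lemma lin_eval: "v \<in> carrier V ==> is_linear k E W (\<lambda>L. L v)"
  by (rule linI) (simp_all add: ihom_closed ihom_add ihom_smult)

lemma lin_into_ihom:
  assumes "!!u. u \<in> carrier U ==> f u \<in> carrier E" "!!v. v \<in> carrier V ==> is_linear k U W (\<lambda>u. f u v)" "module k U"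
  shows "is_linear k U E f"
proof -
  interpret U: module k U by fact
  interpret E: module k E by (rule ihom_module)
  show ?thesis
  proof (rule linI[OF assms(1)])
    show "f (x \<oplus>\<^bsub>U\<^esub> y) = f x \<oplus>\<^bsub>E\<^esub> f y" if "x \<in> carrier U" "y \<in> carrier U" for x y
      by (rule ihom_eqI) (use that assms(1) in \<open>simp_all, simp add: ihom_add lin_add[OF assms(2)]\<close>)
    show "f (c \<odot>\<^bsub>U\<^esub> x) = c \<odot>\<^bsub>E\<^esub> f x" if "c \<in> carrier k" "x \<in> carrier U" for c x
      by (rule ihom_eqI) (use that assms(1) in \<open>simp_all, simp add: ihom_smult lin_smult[OF assms(2)]\<close>)
  qed
qed

lemma lin_apply: "L \<in> carrier E ==> is_linear k U V f ==> is_linear k U W (\<lambda>x. L (f x))"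
  by (rule lin_comp[OF _ ihom_linear])

lemma ihom_act: "act E h L = (\<lambda>v\<in>carrier V. swD W h (\<lambda>h1 h2. act W h1 (L (act V (antip H h2) v))))"
  by (simp add: ihom_def swD_def)

lemma ihom_act_closed:
  assumes h: "h \<in> carrier H" and L: "L \<in> carrier E" shows "act E h L \<in> carrier E"
  unfolding ihom_act by (intro ihom_restrict swD_lin lin_act lin_apply[OF L] lin_id) (use V W h in simp_all)

lemma ihom_gr: "L \<in> gr E n \<longleftrightarrow> L \<in> carrier E \<and> (\<forall>m. \<forall>v\<in>gr V m. L v \<in> gr W (m + n))"
  by (auto simp: ihom_def)

lemma ihom_gr_submodule: "submodule (gr E n) k E"
proof (rule submoduleI'[OF ihom_module])
  interpret E: module k E by (rule ihom_module)
  show "gr E n \<subseteq> carrier E" by (auto simp: ihom_gr)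
  show "\<zero>\<^bsub>E\<^esub> \<in> gr E n" unfolding ihom_gr using W E.M.zero_closed by (auto simp: ihom_zero gr_closed[OF V])
  show "x \<oplus>\<^bsub>E\<^esub> y \<in> gr E n" if "x \<in> gr E n" "y \<in> gr E n" for x y
    using that unfolding ihom_gr by (auto simp: ihom_add[of x y] gr_closed[OF V] gr_add[OF W] intro: E.M.a_closed[unfolded ihom_add])
  show "c \<odot>\<^bsub>E\<^esub> x \<in> gr E n" if "c \<in> carrier k" "x \<in> gr E n" for c x
    using that unfolding ihom_gr by (auto simp: ihom_smult[of c x] gr_closed[OF V] gr_smult[OF W] intro: E.smult_closed[unfolded ihom_smult])
qed

text \<open>The component of \<open>L\<close> of degree \<open>n\<close>: on degree \<open>m\<close>
  it is the part of \<open>L\<close> that lands in degree \<open>m + n\<close>. As both modules are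
  bounded, finitely many \<open>n\<close> account for all of \<open>L\<close>.\<close>

definition ihom_proj where
  "ihom_proj n L = (\<lambda>v\<in>carrier V. finsum W (\<lambda>m. hcomp W (m + n) (L (hcomp V m v))) (degs V))"

lemma ihom_proj_closed: "L \<in> carrier E ==> ihom_proj n L \<in> carrier E"
  unfolding ihom_proj_def by (intro ihom_restrict lin_finsum_fun lin_hcomp lin_apply lin_id mV mW V W)

lemma ihom_proj_hom:
  assumes L: "L \<in> carrier E" and v: "v \<in> gr V m"
  shows "ihom_proj n L v = hcomp W (m + n) (L v)"
proof -
  have vc: "v \<in> carrier V" by (rule gr_closed[OF V v])
  have L0: "L \<zero>\<^bsub>V\<^esub> = \<zero>\<^bsub>W\<^esub>" by (rule lin_zero[OF mV mW ihom_linear[OF L]])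
  have h0: "hcomp W j \<zero>\<^bsub>W\<^esub> = \<zero>\<^bsub>W\<^esub>" for j by (rule lin_zero[OF mW mW hcomp_linear[OF W]])
  let ?f = "\<lambda>j. hcomp W (j + n) (L (hcomp V j v))"
  have e: "ihom_proj n L v = finsum W ?f (degs V)" using vc by (simp add: ihom_proj_def)
  show ?thesis
  proof (cases "m \<in> degs V")
    case True
    have "finsum W ?f (degs V) = ?f m"
      by (rule finsum_single[OF W.M.abelian_group_axioms _ True]) (use V W vc ihom_closed[OF L] in \<open>simp_all add: hcomp_same[OF V v] L0 h0\<close>)
    then show ?thesis using e by (simp add: hcomp_same[OF V v])
  next
    case False
    then have "v = \<zero>\<^bsub>V\<^esub>" using degs_gr[OF V v] by simp
    moreover have "finsum W ?f (degs V) = \<zero>\<^bsub>W\<^esub>"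
    proof (rule finsum_all_zero[OF W.M.abelian_group_axioms])
      fix j assume "j \<in> degs V"
      then have "j \<noteq> m" using False by auto
      then show "?f j = \<zero>\<^bsub>W\<^esub>" by (simp add: hcomp_same[OF V v] L0 h0)
    qed
    ultimately show ?thesis using e by (simp add: L0 h0)
  qed
qed

lemma hmod_ihom_aux: "is_hmod H E"
proof (rule hmodI[where p = ihom_proj and D = "(\<lambda>(l, m). l - m) ` (degs W \<times> degs V)"])
  interpret E: module k E by (rule ihom_module)
  show mE: "module k E" by (rule ihom_module)
  note ec = ihom_closed
  show "is_linear k E E (act E h)" if h: "h \<in> carrier H" for h
  proof (rule lin_into_ihom[OF ihom_act_closed[OF h] _ mE])
    fix v assume v: "v \<in> carrier V"
    have "is_linear k E W (\<lambda>L. swD W h (\<lambda>h1 h2. act W h1 (L (act V (antip H h2) v))))"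
      by (intro swD_lin lin_act lin_eval) (use mE mW V W h v in simp_all)
    then show "is_linear k E W (\<lambda>L. act E h L v)" using v by (simp add: ihom_act)
  qed
  show "is_linear k H E (\<lambda>h. act E h L)" if L: "L \<in> carrier E" for L
  proof (rule lin_into_ihom[OF ihom_act_closed[OF _ L] _ modH])
    fix v assume v: "v \<in> carrier V"
    have "is_linear k H W (\<lambda>h. swD W h (\<lambda>h1 h2. act W h1 (L (act V (antip H h2) v))))"
      by (rule swD_arg_lin[OF bilinI mW lin_id])
        (intro lin_act lin_act_arg lin_apply[OF L] lin_antip lin_id; use V W v ihom_closed[OF L] in simp)+
    then show "is_linear k H W (\<lambda>h. act E h L v)" using v by (simp add: ihom_act)
  qed
  have b: "bilin k H H W (\<lambda>h1 h2. act W h1 (L (act V (antip H h2) v)))" if "L \<in> carrier E" "v \<in> carrier V" for L v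
    by (intro bilinI lin_act lin_act_arg lin_apply[OF that(1)] lin_antip lin_id) (use V W that ihom_closed[OF that(1)] in simp_all)
  show "act E \<one> L = L" if L: "L \<in> carrier E" for L
    by (rule ihom_eqI[OF ihom_act_closed[OF _ L] L])
      (use V W ihom_closed[OF L] in \<open>simp_all add: ihom_act swD_one[OF mW b[OF L]]\<close>)
  show "act E (g \<otimes> h) L = act E g (act E h L)" if g: "g \<in> carrier H" and h: "h \<in> carrier H" and L: "L \<in> carrier E" for g h L
  proof (rule ihom_eqI[OF ihom_act_closed[OF _ L] ihom_act_closed[OF g ihom_act_closed[OF h L]]])
    fix v assume v: "v \<in> carrier V"
    have "act E (g \<otimes> h) L v = swD W h (\<lambda>h1 h2. swD W g (\<lambda>g1 g2. act W (g1 \<otimes> h1) (L (act V (antip H (g2 \<otimes> h2)) v))))" (is "?l = _")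
      using v g h by (simp add: ihom_act swD_mult[OF mW b[OF L v]])
    also have "\<dots> = swD W g (\<lambda>g1 g2. swD W h (\<lambda>h1 h2. act W (g1 \<otimes> h1) (L (act V (antip H (g2 \<otimes> h2)) v))))"
      by (rule swap_D_D[OF mW h g]) (use V W v ihom_closed[OF L] in simp)
    also have "\<dots> = act E g (act E h L) v"
      using v g h V W ihom_closed[OF L] by (simp add: ihom_act act_mult anti_mult push_act)
    finally show "?l = act E g (act E h L) v" .
  qed (use g h in simp)
  show "submodule (gr E n) k E" for n by (rule ihom_gr_submodule)
  show "act E h L \<in> gr E n" if h: "h \<in> carrier H" and L: "L \<in> gr E n" for h n L
  proof -
    have Lc: "L \<in> carrier E" and g: "!!m v. v \<in> gr V m ==> L v \<in> gr W (m + n)" using L by (auto simp: ihom_gr)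
    have "act E h L v \<in> gr W (m + n)" if v: "v \<in> gr V m" for m v
      using V W h v gr_closed[OF V v] by (simp add: ihom_act gr_sw(1)[OF W] g)
    then show ?thesis using ihom_act_closed[OF h Lc] by (auto simp: ihom_gr)
  qed
  show "finite ((\<lambda>(l, m). l - m) ` (degs W \<times> degs V))" using V W by simp
  show lp: "is_linear k E E (ihom_proj n)" for n
  proof (rule lin_into_ihom[OF ihom_proj_closed _ mE])
    fix v assume v: "v \<in> carrier V"
    have "is_linear k E W (\<lambda>L. finsum W (\<lambda>m. hcomp W (m + n) (L (hcomp V m v))) (degs V))"
      by (intro lin_finsum_fun lin_hcomp lin_eval mE mW W) (use V v in simp)
    then show "is_linear k E W (\<lambda>L. ihom_proj n L v)" using v by (simp add: ihom_proj_def)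
  qed
  show "ihom_proj n L \<in> gr E n" if L: "L \<in> carrier E" for n L
    unfolding ihom_gr using ihom_proj_closed[OF L] W V by (auto simp: ihom_proj_hom[OF L] ihom_closed[OF L] gr_closed intro!: hcomp_gr)
  show "ihom_proj n L = (if m = n then L else \<zero>\<^bsub>E\<^esub>)" if L: "L \<in> gr E m" for m n L
  proof -
    have Lc: "L \<in> carrier E" and g: "!!m' v. v \<in> gr V m' ==> L v \<in> gr W (m' + m)" using L by (auto simp: ihom_gr)
    show ?thesis
    proof (rule ihom_eqI[OF ihom_proj_closed[OF Lc]])
      show i: "(if m = n then L else \<zero>\<^bsub>E\<^esub>) \<in> carrier E" using Lc by simp
      fix v assume v: "v \<in> carrier V"
      show "ihom_proj n L v = (if m = n then L else \<zero>\<^bsub>E\<^esub>) v"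
      proof (rule hom_ext[OF V mW ihom_linear[OF ihom_proj_closed[OF Lc]] ihom_linear[OF i] _ v])
        fix j v assume v: "v \<in> gr V j"
        show "ihom_proj n L v = (if m = n then L else \<zero>\<^bsub>E\<^esub>) v"
          using gr_closed[OF V v] by (simp add: ihom_proj_hom[OF Lc v] hcomp_same[OF W g[OF v]] ihom_zero)
      qed
    qed
  qed
  show "finsum E (\<lambda>n. ihom_proj n L) ((\<lambda>(l, m). l - m) ` (degs W \<times> degs V)) = L" (is "finsum E _ ?D = L") if L: "L \<in> carrier E" for L
  proof (rule ihom_eqI)
    have pc: "(\<lambda>n. ihom_proj n L) \<in> ?D \<rightarrow> carrier E" using ihom_proj_closed[OF L] by simp
    show fc: "finsum E (\<lambda>n. ihom_proj n L) ?D \<in> carrier E" by (rule E.M.finsum_closed[OF pc])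
    show "L \<in> carrier E" by (rule L)
    fix v assume v: "v \<in> carrier V"
    show "finsum E (\<lambda>n. ihom_proj n L) ?D v = L v"
    proof (rule hom_ext[OF V mW ihom_linear[OF fc] ihom_linear[OF L] _ v])
      fix m v assume v: "v \<in> gr V m"
      have vc: "v \<in> carrier V" by (rule gr_closed[OF V v])
      have Lv: "L v \<in> carrier W" by (rule ihom_closed[OF L vc])
      have e: "finsum E (\<lambda>n. ihom_proj n L) ?D v = finsum W (\<lambda>n. hcomp W (m + n) (L v)) ?D"
        using lin_finsum[OF mE mW lin_eval[OF vc] pc] by (simp add: ihom_proj_hom[OF L v])
      show "finsum E (\<lambda>n. ihom_proj n L) ?D v = L v"
      proof (cases "m \<in> degs V")
        case True
        have inj: "inj_on (\<lambda>l. l - m) (degs W)" by (auto simp: inj_on_def)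
        \<comment> \<open>Only the degrees \<open>l - m\<close> with \<open>l\<close> a degree of
          \<open>W\<close> contribute. The other differences in \<open>?D\<close> ask for components
          of \<open>L v\<close> in degrees where \<open>W\<close> vanishes.\<close>
        have "finsum W (\<lambda>n. hcomp W (m + n) (L v)) ((\<lambda>l. l - m) ` degs W) = finsum W (\<lambda>n. hcomp W (m + n) (L v)) ?D"
        proof (rule finsum_superset[OF W.M.abelian_group_axioms])
          show "finite ?D" using V W by simp
          show "(\<lambda>l. l - m) ` degs W \<subseteq> ?D" using True by force
          show "hcomp W (m + n) (L v) = \<zero>\<^bsub>W\<^esub>" if "n \<in> ?D - (\<lambda>l. l - m) ` degs W" for n
          proof (rule degs_gr[OF W hcomp_gr[OF W Lv]])
            show "m + n \<notin> degs W"
            proof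
              assume "m + n \<in> degs W"
              then have "(m + n) - m \<in> (\<lambda>l. l - m) ` degs W" by (rule imageI)
              then show False using that by simp
            qed
          qed
        qed (use W Lv in simp)
        moreover have "finsum W (\<lambda>n. hcomp W (m + n) (L v)) ((\<lambda>l. l - m) ` degs W) = finsum W (\<lambda>l. hcomp W l (L v)) (degs W)"
          by (subst W.M.finsum_reindex[OF _ inj]) (use W Lv in simp_all)
        ultimately show ?thesis using e hcomp_sum[OF W Lv] by simp
      next
        case False
        then have "v = \<zero>\<^bsub>V\<^esub>" using degs_gr[OF V v] by simp
        then show ?thesis using lin_zero[OF mV mW ihom_linear[OF fc]] lin_zero[OF mV mW ihom_linear[OF L]] by simp
      qed
    qed
  qed
qed

end

lemma hmod_ihom [simp]: "is_hmod H V ==> is_hmod H W ==> is_hmod H (ihom H V W)"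
  by (rule hmod_ihom_aux)

lemma hmod_iend [simp]: "is_hmod H V ==> is_hmod H (iend H V)"
  by (simp add: iend_def)

section \<open>Evaluation and currying\<close>

context
  fixes V and W
  assumes V: "is_hmod H V" and W: "is_hmod H W"
begin

private lemma mdV: "module k V" and mdW: "module k W" and hE: "is_hmod H (ihom H V W)" using V W by simp_all

context notes [simp] = mdV mdW hE begin

private abbreviation (input) "EV \<equiv> ihom H V W"

lemma ev_aux: "ev H V W = tlift W (\<lambda>L v. swP W (\<lambda>a b c. act W a (L (act V (antip H b \<otimes> qalpha H \<otimes> c) v))))"
  by (simp add: ev_def zeta_inv_def swP_def)

lemma ev_bilin: "bilin k EV V W (\<lambda>L v. swP W (\<lambda>a b c. act W a (L (act V (antip H b \<otimes> qalpha H \<otimes> c) v))))"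
  by (intro bilinI swP_lin lin_act lin_eval lin_apply[OF V W] lin_id) (use V W in simp_all)

lemma ev_linear: "is_linear k (EV ** V) W (ev H V W)"
  unfolding ev_aux by (intro tlift_tensor_linear ev_bilin) simp_all

lemma ev_tp:
  "L \<in> carrier EV ==> v \<in> carrier V ==>
    ev H V W (tp H EV V L v) = swP W (\<lambda>a b c. act W a (L (act V (antip H b \<otimes> qalpha H \<otimes> c) v)))"
  unfolding ev_aux by (simp add: tlift_tp[OF _ _ _ ev_bilin])

lemma ev_closed: "t \<in> carrier (EV ** V) ==> ev H V W t \<in> carrier W"
  by (rule lin_closed[OF ev_linear])

lemma trilin_ev: "L \<in> carrier EV ==> v \<in> carrier V ==> trilin W (\<lambda>a b c. act W a (L (act V (antip H b \<otimes> qalpha H \<otimes> c) v)))"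
  by (intro trilinI lin_act lin_act_arg lin_apply[OF V W] lin_antip lin_mult_left lin_mult_right lin_id) (use V W in \<open>simp_all add: ihom_closed[OF V W]\<close>)

lemma ihom_act_app: "v \<in> carrier V ==> act EV h L v = swD W h (\<lambda>h1 h2. act W h1 (L (act V (antip H h2) v)))"
  using V W by (simp add: ihom_act)

text \<open>Letting \<open>h\<close> act on \<open>L\<close> and on \<open>v\<close> inserts three
  legs of the iterated coproduct. After quasi-coassociativity the last two meet as
  \<open>S(b) \<alpha> c\<close>, which contracts to \<epsilon> times \<alpha>, and the counit axiom
  leaves \<open>h\<close> acting on the value.\<close>

lemma mor_ev: "is_mor H (EV ** V) W (ev H V W)"
proof (rule mor_tensorI[OF hE V W ev_linear])
  show "ev H V W (tp H EV V L v) \<in> gr W (m + n)" if L: "L \<in> gr EV m" and v: "v \<in> gr V n" for m n L v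
  proof -
    have Lc: "L \<in> carrier EV" and g: "!!m' v. v \<in> gr V m' ==> L v \<in> gr W (m' + m)" using L by (auto simp: ihom_gr[OF V W])
    have "L (act V (antip H b \<otimes> qalpha H \<otimes> c) v) \<in> gr W (m + n)" if "b \<in> carrier H" "c \<in> carrier H" for b c
      using g[OF act_gr[OF V _ v]] that by (simp add: add.commute)
    then show ?thesis using Lc W gr_closed[OF V v] by (simp add: ev_tp gr_sw[OF W])
  qed
  fix h L v assume h: "h \<in> carrier H" and L: "L \<in> carrier EV" and v: "v \<in> carrier V"
  let ?F = "\<lambda>a b c. act W a (L (act V (antip H b \<otimes> qalpha H \<otimes> c) v))"
  note c [simp] = ihom_closed[OF V W L] V W
  note F = trilin_ev[OF L v]
  have "swD W h (\<lambda>h1 h2. ev H V W (tp H EV V (act EV h1 L) (act V h2 v))) =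
    swD W h (\<lambda>h1 h2. swP W (\<lambda>x y z. swD W h1 (\<lambda>a b. ?F (x \<otimes> a) (y \<otimes> b) (z \<otimes> h2))))" (is "?l = _")
    using h L v by (simp add: ev_tp ihom_act_closed ihom_act_app push_act act_mult anti_mult)
  also have "\<dots> = swD W h (\<lambda>h1 h2. swD W h1 (\<lambda>a b. swP W (\<lambda>x y z. ?F (x \<otimes> a) (y \<otimes> b) (z \<otimes> h2))))"
    by (intro swD_cong HOL.refl h swap_D_P[symmetric]) (use v in simp_all)
  also have "\<dots> = swP W (\<lambda>x y z. swD W h (\<lambda>h1 h2. swD W h2 (\<lambda>b c. ?F (h1 \<otimes> x) (b \<otimes> y) (c \<otimes> z))))"
    by (rule coassoc_sw[OF mdW F h, symmetric])
  also have "\<dots> = swP W (\<lambda>x y z. ?F (h \<otimes> x) y z)"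
  proof (rule swP_cong)
    fix x y z assume xyz: "x \<in> carrier H" "y \<in> carrier H" "z \<in> carrier H"
    have "swD W h (\<lambda>h1 h2. swD W h2 (\<lambda>b c. ?F (h1 \<otimes> x) (b \<otimes> y) (c \<otimes> z))) =
      swD W h (\<lambda>h1 h2. cou H h2 \<odot>\<^bsub>W\<^esub> ?F (h1 \<otimes> x) y z)" (is "?l = _")
    proof (rule swD_cong[OF HOL.refl h])
      fix h1 h2 assume hh: "h1 \<in> carrier H" "h2 \<in> carrier H"
      have "is_linear k H W (\<lambda>u. act W (h1 \<otimes> x) (L (act V (antip H y \<otimes> u \<otimes> z) v)))"
        by (intro lin_act lin_act_arg lin_apply[OF V W] lin_mult_left lin_mult_right lin_id) (use L v hh xyz in simp_all)
      from anti_alpha[OF mdW this hh(2)]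
      show "swD W h2 (\<lambda>b c. ?F (h1 \<otimes> x) (b \<otimes> y) (c \<otimes> z)) = cou H h2 \<odot>\<^bsub>W\<^esub> ?F (h1 \<otimes> x) y z"
        using hh xyz v by (simp add: anti_mult H.m_assoc)
    qed
    also have "\<dots> = ?F (h \<otimes> x) y z"
      by (rule swD_counit_right[OF mdW h], intro lin_act_arg lin_mult_left lin_mult_right lin_id) (use L v xyz in simp_all)
    finally show "?l = ?F (h \<otimes> x) y z" .
  qed
  also have "\<dots> = act W h (ev H V W (tp H EV V L v))"
    using h L v by (simp add: ev_tp push_act act_mult)
  finally show "?l = act W h (ev H V W (tp H EV V L v))" .
qed

text \<open>This is \<zeta>(ev) = id, taken at \<open>L\<close> and \<open>v\<close>: one half of
  the bijectivity of currying, the other half being \<open>ev_zeta\<close>. The sums over \<phi> and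
  its inverse collapse by \<open>ev_zeta_sw\<close>.\<close>

lemma ev_expand:
  assumes L: "L \<in> carrier EV" and v: "v \<in> carrier V"
  shows "swPi W (\<lambda>x y z. ev H V W (tp H EV V (act EV x L) (act V (y \<otimes> qbeta H \<otimes> antip H z) v))) = L v"
proof -
  note c [simp] = ihom_closed[OF V W L] V W
  let ?G = "\<lambda>a b. act W a (L (act V b v))"
  have G: "bilin k H H W ?G" by (intro bilinI lin_act lin_act_arg lin_apply[OF V W] lin_id) (use L v in simp_all)
  have "swPi W (\<lambda>x y z. ev H V W (tp H EV V (act EV x L) (act V (y \<otimes> qbeta H \<otimes> antip H z) v))) =
    swPi W (\<lambda>x y z. swP W (\<lambda>a b c. swD W x (\<lambda>x1 x2. ?G (a \<otimes> x1) (antip H (b \<otimes> x2) \<otimes> qalpha H \<otimes> (c \<otimes> y) \<otimes> qbeta H \<otimes> antip H z))))"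
    using L v by (simp add: ev_tp ihom_act_closed ihom_act_app push_act act_mult anti_mult)
  also have "\<dots> = swPi W (\<lambda>x y z. swD W x (\<lambda>x1 x2. swP W (\<lambda>a b c. ?G (a \<otimes> x1) (antip H (b \<otimes> x2) \<otimes> qalpha H \<otimes> (c \<otimes> y) \<otimes> qbeta H \<otimes> antip H z))))"
    by (intro swPi_cong swap_D_P[symmetric]) (use v in simp_all)
  also have "\<dots> = L v" unfolding ev_zeta_sw[OF mdW G] using v by simp
  finally show ?thesis .
qed

text \<open>All translates \<open>h \<triangleright> L\<close> are needed, since \<open>L\<close> is recovered from evaluations by the formula for \<open>\<zeta>\<close>.\<close>

lemma ihom_ev_ext:
  assumes L: "L \<in> carrier EV" and L': "L' \<in> carrier EV"
    and e: "!!h v. h \<in> carrier H ==> v \<in> carrier V ==> ev H V W (tp H EV V (act EV h L) v) = ev H V W (tp H EV V (act EV h L') v)"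
  shows "L = L'"
proof (rule ihom_eqI[OF V W L L'])
  fix v assume v: "v \<in> carrier V"
  show "L v = L' v"
    unfolding ev_expand[OF L v, symmetric] ev_expand[OF L' v, symmetric] by (rule swPi_cong, rule e) (use V v in simp_all)
qed

end

end

lemmas [simp] = ev_linear ev_closed mor_ev

context
  fixes X and V and W
  assumes X: "is_hmod H X" and V: "is_hmod H V" and W: "is_hmod H W"
begin

private abbreviation (input) "EZ \<equiv> ihom H V W"

lemma zeta_eq: "zeta H X V W f x = (\<lambda>v\<in>carrier V. swPi W (\<lambda>a b c. f (tp H X V (act X a x) (act V (b \<otimes> qbeta H \<otimes> antip H c) v))))"
  by (simp add: zeta_def swPi_def)

lemma zeta_app: "v \<in> carrier V ==> zeta H X V W f x v = swPi W (\<lambda>a b c. f (tp H X V (act X a x) (act V (b \<otimes> qbeta H \<otimes> antip H c) v)))"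
  by (simp add: zeta_eq)

lemma zeta_closed:
  assumes f: "is_linear k (X ** V) W f" and x: "x \<in> carrier X" shows "zeta H X V W f x \<in> carrier EZ"
  unfolding zeta_eq
  by (intro ihom_restrict swPi_lin lin_comp[OF _ f] lin_tp_right lin_act lin_id) (use X V W x in simp_all)

lemma zeta_linear:
  assumes f: "is_linear k (X ** V) W f" shows "is_linear k X EZ (zeta H X V W f)"
proof (rule lin_into_ihom[OF V W zeta_closed[OF f]])
  fix v assume v: "v \<in> carrier V"
  have "is_linear k X W (\<lambda>x. swPi W (\<lambda>a b c. f (tp H X V (act X a x) (act V (b \<otimes> qbeta H \<otimes> antip H c) v))))"
    by (intro swPi_lin lin_comp[OF _ f] lin_tp_left lin_act lin_id) (use X V W v in simp_all)
  then show "is_linear k X W (\<lambda>x. zeta H X V W f x v)" using v by (simp add: zeta_eq)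
qed (use X in simp_all)

text \<open>Dual to \<open>mor_ev\<close>: the comultiplied legs of \<open>h\<close> now meet around
  \<beta>, as \<open>b \<beta> S(c)\<close>, and contract to a counit.\<close>

lemma mor_zeta:
  assumes f: "is_mor H (X ** V) W f" shows "is_mor H X EZ (zeta H X V W f)"
proof (rule morI[OF zeta_linear[OF mor_linear[OF f]]])
  note f' = mor_linear[OF f] and fc [simp] = mor_closed[OF f]
  note [simp] = X V W
  show "zeta H X V W f x \<in> gr EZ n" if x: "x \<in> gr X n" for n x
    unfolding ihom_gr[OF V W]
  proof (intro conjI allI ballI)
    have xc: "x \<in> carrier X" by (rule gr_closed[OF X x])
    show "zeta H X V W f x \<in> carrier EZ" by (rule zeta_closed[OF f' xc])
    fix m v assume v: "v \<in> gr V m"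
    have "f (tp H X V (act X a x) (act V (b \<otimes> qbeta H \<otimes> antip H c) v)) \<in> gr W (m + n)" if "a \<in> carrier H" "b \<in> carrier H" "c \<in> carrier H" for a b c
      by (rule mor_gr[OF f tp_gr[OF X V act_gr[OF X _ x] act_gr[OF V _ v]]]) (use that in simp_all)
    then show "zeta H X V W f x v \<in> gr W (m + n)" using gr_closed[OF V v] by (simp add: zeta_eq gr_sw[OF W])
  qed
  show "zeta H X V W f (act X h x) = act EZ h (zeta H X V W f x)" if h: "h \<in> carrier H" and x: "x \<in> carrier X" for h x
  proof (rule ihom_eqI[OF V W zeta_closed[OF f'] ihom_act_closed[OF V W h zeta_closed[OF f' x]]])
    fix v assume v: "v \<in> carrier V"
    let ?F = "\<lambda>a b c. f (tp H X V (act X a x) (act V (b \<otimes> qbeta H \<otimes> antip H c) v))"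
    have F: "trilin W ?F"
      by (intro trilinI lin_comp[OF _ f'] lin_tp_left lin_tp_right lin_act_arg lin_mult_left lin_mult_right lin_antip lin_id) (use x v in simp_all)
    have "act EZ h (zeta H X V W f x) v = swD W h (\<lambda>h1 h2. swPi W (\<lambda>x y z. swD W h1 (\<lambda>a b. ?F (a \<otimes> x) (b \<otimes> y) (h2 \<otimes> z))))"
      using h x v by (simp add: ihom_act zeta_eq push_act mor_act[OF f, symmetric] act_tp lin_swD[OF f'] act_mult anti_mult)
    also have "\<dots> = swPi W (\<lambda>x y z. swD W h (\<lambda>h1 h2. swD W h1 (\<lambda>a b. ?F (a \<otimes> x) (b \<otimes> y) (h2 \<otimes> z))))"
      by (rule swap_D_Pi[OF _ h]) (use x v in simp_all)
    also have "\<dots> = swD W h (\<lambda>h1 h2. swD W h2 (\<lambda>b c. swPi W (\<lambda>x y z. ?F (x \<otimes> h1) (y \<otimes> b) (z \<otimes> c))))"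
      by (rule coassoc_inv_sw[OF _ F h, symmetric]) simp
    also have "\<dots> = swD W h (\<lambda>h1 h2. swPi W (\<lambda>x y z. swD W h2 (\<lambda>b c. ?F (x \<otimes> h1) (y \<otimes> b) (z \<otimes> c))))"
      by (intro swD_cong HOL.refl h swap_D_Pi) (use x v in simp_all)
    also have "\<dots> = swD W h (\<lambda>h1 h2. swPi W (\<lambda>x y z. cou H h2 \<odot>\<^bsub>W\<^esub> ?F (x \<otimes> h1) y z))"
    proof (intro swD_cong HOL.refl h swPi_cong)
      fix h1 h2 p q r assume a: "h1 \<in> carrier H" "h2 \<in> carrier H" "p \<in> carrier H" "q \<in> carrier H" "r \<in> carrier H"
      have "is_linear k H W (\<lambda>u. f (tp H X V (act X (p \<otimes> h1) x) (act V (q \<otimes> u \<otimes> antip H r) v)))"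
        by (intro lin_comp[OF _ f'] lin_tp_right lin_act_arg lin_mult_left lin_mult_right lin_id) (use x v a in simp_all)
      from anti_beta[OF _ this a(2)]
      show "swD W h2 (\<lambda>b c. ?F (p \<otimes> h1) (q \<otimes> b) (r \<otimes> c)) = cou H h2 \<odot>\<^bsub>W\<^esub> ?F (p \<otimes> h1) q r"
        using a x v by (simp add: anti_mult H.m_assoc)
    qed
    also have "\<dots> = swD W h (\<lambda>h1 h2. cou H h2 \<odot>\<^bsub>W\<^esub> swPi W (\<lambda>x y z. ?F (x \<otimes> h1) y z))"
      by (intro swD_cong HOL.refl h swPi_smult) (use x v in simp_all)
    also have "\<dots> = swPi W (\<lambda>x y z. ?F (x \<otimes> h) y z)"
      by (rule swD_counit_right[OF _ h], simp, intro swPi_lin lin_comp[OF _ f'] lin_tp_left lin_act_arg lin_mult_left lin_mult_right lin_id) (use x v in simp_all)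
    also have "\<dots> = zeta H X V W f (act X h x) v" using h x v by (simp add: zeta_eq act_mult)
    finally show "zeta H X V W f (act X h x) v = act EZ h (zeta H X V W f x) v" ..
  qed (use h x in simp_all)
qed

text \<open>The sum over the inverse of \<phi> that comes with \<zeta> and the sum over \<phi> that
  comes with \<open>ev\<close> cancel by \<open>zeta_ev_sw\<close>.\<close>

lemma ev_zeta:
  assumes f: "is_mor H (X ** V) W f" and t: "t \<in> carrier (X ** V)"
  shows "ev H V W (rw X EZ V (zeta H X V W f) t) = f t"
proof (rule tensor_ext[OF _ _ _ lin_comp[OF rw_linear ev_linear] mor_linear[OF f] _ t])
  note f' = mor_linear[OF f] and fc [simp] = mor_closed[OF f]
  note [simp] = X V W
  fix x v assume x: "x \<in> carrier X" and v: "v \<in> carrier V"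
  let ?G = "\<lambda>a b. f (tp H X V (act X a x) (act V b v))"
  have G: "bilin k H H W ?G"
    by (intro bilinI lin_comp[OF _ f'] lin_tp_left lin_tp_right lin_act_arg lin_id) (use x v in simp_all)
  have "ev H V W (rw X EZ V (zeta H X V W f) (tp H X V x v)) =
    swP W (\<lambda>x y z. swPi W (\<lambda>a b c. swD W x (\<lambda>x1 x2. ?G (x1 \<otimes> a) (x2 \<otimes> b \<otimes> qbeta H \<otimes> antip H (y \<otimes> c) \<otimes> qalpha H \<otimes> z))))" (is "?l = _")
    using x v by (simp add: zeta_linear[OF f'] zeta_closed[OF f'] ev_tp zeta_app push_act mor_act[OF f, symmetric] act_tp lin_swD[OF f'] act_mult anti_mult)
  also have "\<dots> = f (tp H X V x v)"
    using x v by (simp add: swap_P_Pi zeta_ev_sw[OF _ G])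
  finally show "?l = f (tp H X V x v)" .
qed (use X V W zeta_linear[OF mor_linear[OF f]] in simp_all)

text \<open>For morphisms, the translates demanded by \<open>ihom_ev_ext\<close> are values at
  translates of the argument, so it is enough to compare evaluations at all elements. Identities
  between operations on internal homs are proved through this.\<close>

lemma mor_ev_ext:
  assumes g: "is_mor H X EZ g" and g': "is_mor H X EZ g'"
    and e: "!!y v. y \<in> carrier X ==> v \<in> carrier V ==> ev H V W (tp H EZ V (g y) v) = ev H V W (tp H EZ V (g' y) v)" and x: "x \<in> carrier X"
  shows "g x = g' x"
  by (rule ihom_ev_ext[OF V W mor_closed[OF g x] mor_closed[OF g' x]])
    (use X x e in \<open>simp add: mor_act[OF g, symmetric] mor_act[OF g', symmetric]\<close>)

end

section \<open>Internal composition and internal tensor product\<close>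

context
  fixes V and W and X
  assumes V: "is_hmod H V" and W: "is_hmod H W" and X: "is_hmod H X"
begin

private abbreviation (input) "B \<equiv> ihom H W X"
private abbreviation (input) "C \<equiv> ihom H V W"

private lemma icomp_eq: "icomp H V W X = zeta H (B ** C) V X (\<lambda>t. ev H W X (lw B (C ** V) W (ev H V W) (Assoc H B C V t)))"
  by (simp add: icomp_def lw_def)

private lemma mor_aux: "is_mor H ((B ** C) ** V) X (\<lambda>t. ev H W X (lw B (C ** V) W (ev H V W) (Assoc H B C V t)))"
  by (rule mor_comp[OF mor_comp[OF mor_Assoc mor_lw] mor_ev]) (use V W X in simp_all)

lemma mor_icomp: "is_mor H (B ** C) (ihom H V X) (icomp H V W X)"
  unfolding icomp_eq by (rule mor_zeta[OF _ _ _ mor_aux]) (use V W X in simp_all)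

text \<open>The property that characterizes internal composition. Together with
  \<open>mor_ev_ext\<close> it stands in for the explicit formula from here on.\<close>

lemma ev_icomp:
  "t \<in> carrier ((B ** C) ** V) ==> ev H V X (rw (B ** C) (ihom H V X) V (icomp H V W X) t) = ev H W X (lw B (C ** V) W (ev H V W) (Assoc H B C V t))"
  unfolding icomp_eq by (rule ev_zeta[OF _ _ _ mor_aux]) (use V W X in simp_all)

end

lemmas [simp] = mor_icomp

context
  fixes V and W and X and Y
  assumes V: "is_hmod H V" and W: "is_hmod H W" and X: "is_hmod H X" and Y: "is_hmod H Y"
begin

private abbreviation (input) "P \<equiv> ihom H V W"
private abbreviation (input) "Q \<equiv> ihom H X Y"

text \<open>The three middle arrows of \<open>shuffle\<close> together are the exchange
  \<open>sig\<close> of \<open>Q\<close> with \<open>V\<close>.\<close>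

private lemma shuffle_eq:
  assumes t: "t \<in> carrier ((P ** Q) ** V ** X)"
  shows "shuffle H P Q V X t = Assoc_inv H P V (Q ** X) (lw P (Q ** V ** X) (V ** Q ** X) (sig Q V X) (Assoc H P Q (V ** X) t))"
proof -
  have s: "Assoc H P Q (V ** X) t \<in> carrier (P ** Q ** V ** X)" using V W X Y t by simp
  show ?thesis
    unfolding shuffle_def rw_def[of "Q ** V", symmetric] sig_def[abs_def]
      lw_def[of P "(V ** Q) ** X" _ "Assoc H V Q X", symmetric] lw_def[of P "(Q ** V) ** X" _ "rw _ _ _ _", symmetric] lw_def[of P "Q ** V ** X" _ "Assoc_inv H Q V X", symmetric]
    using V W X Y s by (simp add: lw_lw lin_comp[OF Assoc_inv_linear rw_linear])
qed

private lemma itensor_fun: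
  assumes t: "t \<in> carrier ((P ** Q) ** V ** X)"
  shows "tmap H W Y (ev H V W) (ev H X Y) (shuffle H P Q V X t) =
    lw W (Q ** X) Y (ev H X Y) (rw (P ** V) W (Q ** X) (ev H V W) (Assoc_inv H P V (Q ** X) (lw P (Q ** V ** X) (V ** Q ** X) (sig Q V X) (Assoc H P Q (V ** X) t))))"
  unfolding shuffle_eq[OF t] by (rule tmap_lw_rw) (use V W X Y t in simp_all)

private lemma mor_it:
  "is_mor H ((P ** Q) ** V ** X) (W ** Y) (\<lambda>t. lw W (Q ** X) Y (ev H X Y) (rw (P ** V) W (Q ** X) (ev H V W) (Assoc_inv H P V (Q ** X) (lw P (Q ** V ** X) (V ** Q ** X) (sig Q V X) (Assoc H P Q (V ** X) t)))))"
  by (rule mor_comp[OF mor_comp[OF mor_comp[OF mor_comp[OF mor_Assoc mor_lw] mor_Assoc_inv] mor_rw] mor_lw]) (use V W X Y in simp_all)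

text \<open>The arrow curried in the definition of \<open>itensor\<close> agrees with a composite of
  morphisms on the carrier, and the property of being a morphism is transferred along that
  equality.\<close>

private lemma mor_it_shuffle:
  "is_mor H ((P ** Q) ** V ** X) (W ** Y) (\<lambda>t. tmap H W Y (ev H V W) (ev H X Y) (shuffle H P Q V X t))"
proof (rule morI)
  have h: "is_hmod H ((P ** Q) ** V ** X)" using V W X Y by simp
  show "is_linear k ((P ** Q) ** V ** X) (W ** Y) (\<lambda>t. tmap H W Y (ev H V W) (ev H X Y) (shuffle H P Q V X t))"
    by (rule lin_cong[OF mor_linear[OF mor_it]]) (use h in \<open>simp_all only: itensor_fun hmod_module\<close>)
  show "tmap H W Y (ev H V W) (ev H X Y) (shuffle H P Q V X t) \<in> gr (W ** Y) n" if "t \<in> gr ((P ** Q) ** V ** X) n" for n t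
    unfolding itensor_fun[OF gr_closed[OF h that]] by (rule mor_gr[OF mor_it that])
  show "tmap H W Y (ev H V W) (ev H X Y) (shuffle H P Q V X (act ((P ** Q) ** V ** X) g t)) = act (W ** Y) g (tmap H W Y (ev H V W) (ev H X Y) (shuffle H P Q V X t))"
    if "g \<in> carrier H" "t \<in> carrier ((P ** Q) ** V ** X)" for g t
    unfolding itensor_fun[OF that(2)] itensor_fun[OF act_closed[OF h that]] by (rule mor_act[OF mor_it that])
qed

lemma mor_itensor: "is_mor H (P ** Q) (ihom H (V ** X) (W ** Y)) (itensor H V W X Y)"
  unfolding itensor_def by (rule mor_zeta[OF _ _ _ mor_it_shuffle]) (use V W X Y in simp_all)

lemma ev_itensor:
  assumes t: "t \<in> carrier ((P ** Q) ** V ** X)"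
  shows "ev H (V ** X) (W ** Y) (rw (P ** Q) (ihom H (V ** X) (W ** Y)) (V ** X) (itensor H V W X Y) t) =
    lw W (Q ** X) Y (ev H X Y) (rw (P ** V) W (Q ** X) (ev H V W) (Assoc_inv H P V (Q ** X) (lw P (Q ** V ** X) (V ** Q ** X) (sig Q V X) (Assoc H P Q (V ** X) t))))"
  unfolding itensor_def itensor_fun[OF t, symmetric] by (rule ev_zeta[OF _ _ _ mor_it_shuffle t]) (use V W X Y in simp_all)

end

lemmas [simp] = mor_itensor

section \<open>Units\<close>

text \<open>An invariant element of degree 0 of \<open>E\<close>, that is a morphism \<open>I \<rightarrow> E\<close>.\<close>

definition unital where
  "unital E u \<longleftrightarrow> u \<in> gr E 0 \<and> (\<forall>h\<in>carrier H. act E h u = cou H h \<odot>\<^bsub>E\<^esub> u)"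

context
  fixes E and V and u
  assumes E: "is_hmod H E" and V: "is_hmod H V" and u: "unital E u"
begin

private lemma u_closed: "u \<in> carrier E" by (rule gr_closed[OF E conjunct1[OF u[unfolded unital_def]]])
private lemma u_act: "h \<in> carrier H ==> act E h u = cou H h \<odot>\<^bsub>E\<^esub> u" using u by (simp add: unital_def)

context notes [simp] = u_closed u_act begin

private lemma tp_smult:
  "module k P ==> module k Q ==> c \<in> carrier k ==> x \<in> carrier P ==> y \<in> carrier Q ==> tp H P Q (c \<odot>\<^bsub>P\<^esub> x) y = c \<odot>\<^bsub>P ** Q\<^esub> tp H P Q x y"
  "module k P ==> module k Q ==> c \<in> carrier k ==> x \<in> carrier P ==> y \<in> carrier Q ==> tp H P Q x (c \<odot>\<^bsub>Q\<^esub> y) = c \<odot>\<^bsub>P ** Q\<^esub> tp H P Q x y"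
  by (rule lin_smult[OF lin_tp_left[OF _ _ lin_id]] lin_smult[OF lin_tp_right[OF _ _ lin_id]]; assumption)+

text \<open>\<open>(\<epsilon> \<otimes> id)(R) = 1\<close> removes the action of \<open>R\<close>,
  and degree 0 of \<open>u\<close> removes the sign.\<close>

lemma braid_unit: "v \<in> carrier V ==> braid H E V (tp H E V u v) = tp H V E v u"
proof (rule hom_ext[OF V _ lin_comp[OF lin_tp_right[OF _ _ lin_id] braid_linear] lin_tp_left[OF _ _ lin_id]])
  note [simp] = E V
  fix n v assume v: "v \<in> gr V n"
  have vc [simp]: "v \<in> carrier V" by (rule gr_closed[OF V v])
  have b: "is_linear k H (V ** E) (\<lambda>a. tp H V E (act V a v) u)" by (intro lin_intros) simp_all
  show "braid H E V (tp H E V u v) = tp H V E v u"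
    using R_counit_left[OF _ b] v u by (simp add: unital_def braid_hom[of E V u 0 v n] ksign_even tp_smult del: tensor_sel)
qed (use E V in simp_all)

context
  fixes W
  assumes W: "is_hmod H W"
begin

text \<open>The leg of \<phi> that meets \<open>u\<close> becomes a counit. Each position of the
  unit therefore calls for its own normalization of \<phi>: the middle one here, the left one
  below.\<close>

lemma Assoc_unit_mid: "v \<in> carrier V ==> w \<in> carrier W ==> Assoc H V E W (tp H (V ** E) W (tp H V E v u) w) = tp H V (E ** W) v (tp H E W u w)"
proof -
  assume v: "v \<in> carrier V" and w: "w \<in> carrier W"
  note [simp] = E V W v w
  have b: "bilin k H H (V ** E ** W) (\<lambda>a c. tp H V (E ** W) (act V a v) (tp H E W u (act W c w)))"
    by (intro lin_intros) simp_all
  show ?thesis using P_counit_mid[OF _ b] by (simp add: Assoc_tp tp_smult del: tensor_sel)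
qed

lemma Assoc_unit_left: "v \<in> carrier V ==> w \<in> carrier W ==> Assoc H E V W (tp H (E ** V) W (tp H E V u v) w) = tp H E (V ** W) u (tp H V W v w)"
proof -
  assume v: "v \<in> carrier V" and w: "w \<in> carrier W"
  note [simp] = E V W v w
  have b: "bilin k H H (E ** V ** W) (\<lambda>a c. tp H E (V ** W) u (tp H V W (act V a v) (act W c w)))"
    by (intro lin_intros) simp_all
  show ?thesis using P_counit_left[OF _ b] by (simp add: Assoc_tp tp_smult del: tensor_sel)
qed

lemma Assoc_inv_unit_left: "v \<in> carrier V ==> w \<in> carrier W ==> Assoc_inv H E V W (tp H E (V ** W) u (tp H V W v w)) = tp H (E ** V) W (tp H E V u v) w"
  using arg_cong[OF Assoc_unit_left, of v w "Assoc_inv H E V W"] E V W by simp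

end

end

end

text \<open>The antipode axiom for \<beta> is what makes the action of \<beta>, rather than the
  identity map, an invariant element of \<open>end(V)\<close>.\<close>

lemma unital_iunit:
  assumes V: "is_hmod H V" shows "unital (ihom H V V) (iunit H V)"
proof -
  have m [simp]: "module k V" using V by simp
  have c: "iunit H V \<in> carrier (ihom H V V)"
    unfolding iunit_def by (intro ihom_restrict lin_act lin_id) (use V in simp_all)
  have "iunit H V \<in> gr (ihom H V V) 0"
    using c V gr_closed[OF V] by (auto simp: ihom_gr iunit_def)
  moreover have "act (ihom H V V) h (iunit H V) = cou H h \<odot>\<^bsub>ihom H V V\<^esub> iunit H V" if h: "h \<in> carrier H" for h
  proof (rule ihom_eqI[OF V V ihom_act_closed[OF V V h c]])
    interpret E: module k "ihom H V V" by (rule ihom_module[OF V V])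
    show "cou H h \<odot>\<^bsub>ihom H V V\<^esub> iunit H V \<in> carrier (ihom H V V)" using h c by simp
    fix v assume v: "v \<in> carrier V"
    have "is_linear k H V (\<lambda>x. act V x v)" by (rule hmod_act_arg[OF V v])
    from anti_beta[OF m this h]
    show "act (ihom H V V) h (iunit H V) v = (cou H h \<odot>\<^bsub>ihom H V V\<^esub> iunit H V) v"
      using V v h by (simp add: ihom_act ihom_smult iunit_def act_mult)
  qed
  ultimately show ?thesis by (simp add: unital_def)
qed

lemma unital_closed: "is_hmod H E ==> unital E u ==> u \<in> carrier E"
  unfolding unital_def by (blast intro: gr_closed)

lemma iunit_closed [simp]: "is_hmod H V ==> iunit H V \<in> carrier (ihom H V V)"
  by (rule unital_closed[OF hmod_ihom unital_iunit])

text \<open>By the zigzag axiom for \<phi> the unit evaluates to the identity, although as a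
  function it is the action of \<beta>.\<close>

lemma ev_iunit [simp]:
  assumes V: "is_hmod H V" and v: "v \<in> carrier V"
  shows "ev H V V (tp H (ihom H V V) V (iunit H V) v) = v"
proof -
  have m: "module k V" using V by simp
  show ?thesis using zigzag_P[OF m hmod_act_arg[OF V v]] V v by (simp add: ev_tp) (simp add: iunit_def act_mult)
qed

section \<open>Actions on tensor products\<close>

text \<open>
  For a map \<open>e : P \<otimes> V \<rightarrow> V'\<close>, regarded as an action of \<open>P\<close>, the action on the left factor of \<open>V \<otimes> X\<close>
  is \<open>lft\<close>, and \<open>rgt\<close> is the action on the right factor of \<open>X \<otimes> V\<close>.
\<close>

definition lft where "lft P V V' X e t = rw (P ** V) V' X e (Assoc_inv H P V X t)"
definition rgt where "rgt P X V V' e t = lw X (P ** V) V' e (sig P X V t)"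

context
  fixes P and V and V' and X
  assumes o: "is_hmod H P" "is_hmod H V" "is_hmod H V'" "is_hmod H X"
begin

lemma mor_lft [simp]: "is_mor H (P ** V) V' e ==> is_mor H (P ** V ** X) (V' ** X) (lft P V V' X e)"
  unfolding lft_def[abs_def] by (rule mor_comp[OF mor_Assoc_inv mor_rw]) (use o in simp_all)

lemma mor_rgt [simp]: "is_mor H (P ** V) V' e ==> is_mor H (P ** X ** V) (X ** V') (rgt P X V V' e)"
  unfolding rgt_def[abs_def] by (rule mor_comp[OF mor_sig mor_lw]) (use o in simp_all)

lemma lft_linear [simp]: "is_linear k (P ** V) V' e ==> is_linear k (P ** V ** X) (V' ** X) (lft P V V' X e)"
  unfolding lft_def[abs_def] by (rule lin_comp[OF Assoc_inv_linear rw_linear]) (use o in simp_all)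

lemma rgt_linear [simp]: "is_linear k (P ** V) V' e ==> is_linear k (P ** X ** V) (X ** V') (rgt P X V V' e)"
  unfolding rgt_def[abs_def] by (rule lin_comp[OF mor_linear[OF mor_sig] lw_linear]) (use o in simp_all)

lemma lft_closed [simp]: "is_linear k (P ** V) V' e ==> t \<in> carrier (P ** V ** X) ==> lft P V V' X e t \<in> carrier (V' ** X)"
  by (rule lin_closed[OF lft_linear])

lemma rgt_closed [simp]: "is_linear k (P ** V) V' e ==> t \<in> carrier (P ** X ** V) ==> rgt P X V V' e t \<in> carrier (X ** V')"
  by (rule lin_closed[OF rgt_linear])

end

context
  fixes V and X
  assumes V: "is_hmod H V" and X: "is_hmod H X"
begin

private abbreviation (input) "PV \<equiv> ihom H V V"
private abbreviation (input) "QX \<equiv> ihom H X X"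

lemma ev_itensor_left:
  assumes L: "L \<in> carrier PV" and t: "t \<in> carrier (V ** X)"
  shows "ev H (V ** X) (V ** X) (tp H (ihom H (V ** X) (V ** X)) (V ** X) (itensor H V V X X (tp H PV QX L (iunit H X))) t) =
    lft PV V V X (ev H V V) (tp H PV (V ** X) L t)"
proof -
  note [simp] = V X L t
  note u = unital_iunit[OF X]
  let ?u = "iunit H X"
  \<comment> \<open>The unit of \<open>end(X)\<close> braids past \<open>V\<close> trivially and
    then evaluates to the identity on \<open>X\<close>, so the second factor of
    \<open>L \<circledast> 1\<close> leaves no trace.\<close>
  have s: "lw V (QX ** X) X (ev H X X) (sig QX V X (tp H QX (V ** X) ?u t)) = t"
  proof (rule tensor_ext[OF _ _ _ lin_comp[OF lin_comp[OF lin_tp_right[OF _ _ lin_id] mor_linear[OF mor_sig]] lw_linear] lin_id _ t])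
    fix v x assume v: "v \<in> carrier V" and x: "x \<in> carrier X"
    show "lw V (QX ** X) X (ev H X X) (sig QX V X (tp H QX (V ** X) ?u (tp H V X v x))) = tp H V X v x"
      using v x by (simp add: sig_def Assoc_inv_unit_left[OF _ _ u] braid_unit[OF _ _ u] Assoc_unit_mid[OF _ _ u])
  qed simp_all
  have "ev H (V ** X) (V ** X) (tp H (ihom H (V ** X) (V ** X)) (V ** X) (itensor H V V X X (tp H PV QX L ?u)) t) =
    lw V (QX ** X) X (ev H X X) (rw (PV ** V) V (QX ** X) (ev H V V) (Assoc_inv H PV V (QX ** X) (tp H PV (V ** QX ** X) L (sig QX V X (tp H QX (V ** X) ?u t)))))"
    using ev_itensor[OF V V X X, of "tp H (PV ** QX) (V ** X) (tp H PV QX L ?u) t"] by (simp add: Assoc_unit_mid[OF _ _ u])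
  also have "\<dots> = rw (PV ** V) V X (ev H V V) (Assoc_inv H PV V X (lw PV (V ** QX ** X) (V ** X) (lw V (QX ** X) X (ev H X X)) (tp H PV (V ** QX ** X) L (sig QX V X (tp H QX (V ** X) ?u t)))))"
    by (simp add: lw_rw Assoc_inv_nat(3)[of PV V "QX ** X" PV V X] del: lw_tp)
  also have "\<dots> = lft PV V V X (ev H V V) (tp H PV (V ** X) L t)"
    by (simp add: s lft_def)
  finally show ?thesis .
qed

lemma ev_itensor_right:
  assumes L: "L \<in> carrier QX" and t: "t \<in> carrier (V ** X)"
  shows "ev H (V ** X) (V ** X) (tp H (ihom H (V ** X) (V ** X)) (V ** X) (itensor H V V X X (tp H PV QX (iunit H V) L)) t) =
    rgt QX V X X (ev H X X) (tp H QX (V ** X) L t)"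
proof -
  note [simp] = V X L t
  note u = unital_iunit[OF V]
  let ?u = "iunit H V"
  \<comment> \<open>Here it is the unit of \<open>end(V)\<close> that evaluates to the identity.
    What remains is the exchange of \<open>L\<close> with \<open>V\<close>, and this is
    \<open>rgt\<close>.\<close>
  have s: "rw (PV ** V) V (QX ** X) (ev H V V) (Assoc_inv H PV V (QX ** X) (tp H PV (V ** QX ** X) ?u r)) = r" if r: "r \<in> carrier (V ** QX ** X)" for r
  proof (rule tensor_ext[OF _ _ _ lin_comp[OF lin_comp[OF lin_tp_right[OF _ _ lin_id] Assoc_inv_linear] rw_linear] lin_id _ r])
    fix v x assume v: "v \<in> carrier V" and x: "x \<in> carrier (QX ** X)"
    show "rw (PV ** V) V (QX ** X) (ev H V V) (Assoc_inv H PV V (QX ** X) (tp H PV (V ** QX ** X) ?u (tp H V (QX ** X) v x))) = tp H V (QX ** X) v x"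
      using v x by (simp add: Assoc_inv_unit_left[OF _ _ u])
  qed simp_all
  show ?thesis
    using ev_itensor[OF V V X X, of "tp H (PV ** QX) (V ** X) (tp H PV QX ?u L) t"] by (simp add: Assoc_unit_left[OF _ _ u] s rgt_def)
qed

end

context
  fixes P and P'
    and V and X and e and e'
  assumes o: "is_hmod H P" "is_hmod H P'" "is_hmod H V" "is_hmod H X"
    and e: "is_mor H (P ** V) V e" and e': "is_mor H (P' ** V) V e'"
begin

text \<open>On the left factor only rebracketing is involved, so a pentagon together with naturality
  is enough.\<close>

lemma lft_comp:
  assumes s: "s \<in> carrier ((P ** P') ** V ** X)"
  shows "lft (P ** P') V V X (\<lambda>s. e (lw P (P' ** V) V e' (Assoc H P P' V s))) s =
    lft P V V X e (lw P (P' ** V ** X) (V ** X) (lft P' V V X e') (Assoc H P P' (V ** X) s))"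
proof -
  note [simp] = o e e' s
  define r where "r = Assoc_inv H (P ** P') V X s"
  define r1 where "r1 = rw ((P ** P') ** V) (P ** P' ** V) X (Assoc H P P' V) r"
  have r [simp]: "r \<in> carrier (((P ** P') ** V) ** X)" "r1 \<in> carrier ((P ** P' ** V) ** X)" by (simp_all add: r_def r1_def)
  have p: "lw P ((P' ** V) ** X) (P' ** V ** X) (Assoc H P' V X) (Assoc H P (P' ** V) X r1) = Assoc H P P' (V ** X) s"
    using Assoc_pentagon[of P P' V X r] by (simp add: r1_def[symmetric]) (simp add: r_def)
  have p': "lw P (P' ** V ** X) ((P' ** V) ** X) (Assoc_inv H P' V X) (Assoc H P P' (V ** X) s) = Assoc H P (P' ** V) X r1"
    unfolding p[symmetric] by (simp add: lw_lw cong: lw_cong)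
  have "lw P (P' ** V ** X) (V ** X) (lft P' V V X e') (Assoc H P P' (V ** X) s) =
    lw P ((P' ** V) ** X) (V ** X) (rw (P' ** V) V X e') (Assoc H P (P' ** V) X r1)"
    unfolding p'[symmetric] by (simp add: lw_lw lft_def[abs_def])
  also have "\<dots> = Assoc H P V X (rw (P ** P' ** V) (P ** V) X (lw P (P' ** V) V e') r1)"
    by (simp add: Assoc_nat(2)[of P "P' ** V" X P V X])
  finally have "lft P V V X e (lw P (P' ** V ** X) (V ** X) (lft P' V V X e') (Assoc H P P' (V ** X) s)) =
    rw (P ** V) V X e (rw (P ** P' ** V) (P ** V) X (lw P (P' ** V) V e') r1)"
    by (simp add: lft_def)
  also have "\<dots> = lft (P ** P') V V X (\<lambda>s. e (lw P (P' ** V) V e' (Assoc H P P' V s))) s"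
    by (simp add: r1_def lft_def r_def[symmetric] rw_rw lin_comp[OF Assoc_linear lw_linear] lin_comp[OF lw_linear mor_linear[OF e]] lin_comp[OF lin_comp[OF Assoc_linear lw_linear] mor_linear[OF e]])
  finally show ?thesis ..
qed

text \<open>To act on the right factor \<open>P ** P'\<close> has to be moved past \<open>X\<close>,
  either as a whole or in two steps. This is \<open>sig_comp_left\<close>, hence a hexagon.\<close>

lemma rgt_comp:
  assumes s: "s \<in> carrier ((P ** P') ** X ** V)"
  shows "rgt (P ** P') X V V (\<lambda>s. e (lw P (P' ** V) V e' (Assoc H P P' V s))) s =
    rgt P X V V e (lw P (P' ** X ** V) (X ** V) (rgt P' X V V e') (Assoc H P P' (X ** V) s))"
proof -
  note [simp] = o e e' s
  define t where "t = Assoc H P P' (X ** V) s"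
  have t [simp]: "t \<in> carrier (P ** P' ** X ** V)" by (simp add: t_def)
  have st: "s = Assoc_inv H P P' (X ** V) t" by (simp add: t_def)
  have "rgt (P ** P') X V V (\<lambda>s. e (lw P (P' ** V) V e' (Assoc H P P' V s))) s =
    lw X (P ** V) V e (lw X (P ** P' ** V) (P ** V) (lw P (P' ** V) V e') (lw X ((P ** P') ** V) (P ** P' ** V) (Assoc H P P' V) (sig (P ** P') X V s)))"
    by (simp add: rgt_def lw_lw lin_comp[OF Assoc_linear lw_linear] lin_comp[OF lin_comp[OF Assoc_linear lw_linear] mor_linear[OF e]] lin_comp[OF lw_linear mor_linear[OF e]])
  also have "lw X ((P ** P') ** V) (P ** P' ** V) (Assoc H P P' V) (sig (P ** P') X V s) = sig P X (P' ** V) (lw P (P' ** X ** V) (X ** P' ** V) (sig P' X V) t)"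
    unfolding st by (rule sig_comp_left) simp_all
  also have "lw X (P ** P' ** V) (P ** V) (lw P (P' ** V) V e') \<dots> = sig P X V (lw P (P' ** X ** V) (X ** V) (rgt P' X V V e') t)"
    by (simp add: sig_nat3[of P X "P' ** V" V, symmetric] lw_lw rgt_def[abs_def])
  finally show ?thesis by (simp add: rgt_def t_def)
qed

end

text \<open>Moving \<open>Q\<close> past \<open>P ** V\<close> factors, by
  \<open>sig_comp_right\<close>, through the exchange of \<open>Q\<close> with \<open>P\<close>;
  after that exchange the two actions concern different factors. This is the source of the vanishing
  mixed brackets.\<close>

lemma rgt_lft:
  assumes P: "is_hmod H P" and Q: "is_hmod H Q" and V: "is_hmod H V" and V': "is_hmod H V'" and X: "is_hmod H X" and X': "is_hmod H X'"
    and e: "is_mor H (P ** V) V' e" and e': "is_mor H (Q ** X) X' e'" and t: "t \<in> carrier (Q ** P ** V ** X)"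
  shows "rgt Q V' X X' e' (lw Q (P ** V ** X) (V' ** X) (lft P V V' X e) t) =
    lft P V V' X' e (lw P (Q ** V ** X) (V ** X') (rgt Q V X X' e') (sig Q P (V ** X) t))"
proof -
  note [simp] = P Q V V' X X' e e' t
  \<comment> \<open>\<open>z\<close> keeps \<open>P ** V\<close> together, so that \<open>Q\<close>
    can pass both at once.\<close>
  define z where "z = lw Q (P ** V ** X) ((P ** V) ** X) (Assoc_inv H P V X) t"
  have z [simp]: "z \<in> carrier (Q ** (P ** V) ** X)" by (simp add: z_def)
  have "rgt Q V' X X' e' (lw Q (P ** V ** X) (V' ** X) (lft P V V' X e) t) =
    lw V' (Q ** X) X' e' (sig Q V' X (lw Q ((P ** V) ** X) (V' ** X) (rw (P ** V) V' X e) z))"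
    by (simp add: rgt_def lft_def[abs_def] z_def lw_lw)
  also have "\<dots> = lw V' (Q ** X) X' e' (rw (P ** V) V' (Q ** X) e (sig Q (P ** V) X z))"
    by (simp add: sig_nat2[of Q "P ** V" X V'])
  also have "\<dots> = rw (P ** V) V' X' e (lw (P ** V) (Q ** X) X' e' (sig Q (P ** V) X z))"
    by (simp add: lw_rw)
  also have "lw (P ** V) (Q ** X) X' e' (sig Q (P ** V) X z) =
    Assoc_inv H P V X' (Assoc H P V X' (lw (P ** V) (Q ** X) X' e' (sig Q (P ** V) X z)))" by simp
  also have "Assoc H P V X' (lw (P ** V) (Q ** X) X' e' (sig Q (P ** V) X z)) =
    lw P (V ** Q ** X) (V ** X') (lw V (Q ** X) X' e') (Assoc H P V (Q ** X) (sig Q (P ** V) X z))"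
    by (simp add: Assoc_nat(3)[of P V "Q ** X" P V X'])
  also have "Assoc H P V (Q ** X) (sig Q (P ** V) X z) = lw P (Q ** V ** X) (V ** Q ** X) (sig Q V X) (sig Q P (V ** X) t)"
    unfolding z_def by (rule sig_comp_right) simp_all
  finally show ?thesis by (simp add: lft_def[abs_def] lw_lw rgt_def[abs_def])
qed

lemma lft_rw:
  assumes "is_hmod H P" "is_hmod H P'" "is_hmod H V" "is_hmod H V'" "is_hmod H X" and c: "is_mor H P P' c" and e: "is_mor H (P' ** V) V' e"
    and s: "s \<in> carrier (P ** V ** X)"
  shows "lft P' V V' X e (rw P P' (V ** X) c s) = lft P V V' X (\<lambda>t. e (rw P P' V c t)) s"
  using assms by (simp add: lft_def Assoc_inv_nat(1)[of P V X P' V X] rw_rw)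

lemma rgt_rw:
  assumes "is_hmod H P" "is_hmod H P'" "is_hmod H V" "is_hmod H V'" "is_hmod H X" and c: "is_mor H P P' c" and e: "is_mor H (P' ** V) V' e"
    and s: "s \<in> carrier (P ** X ** V)"
  shows "rgt P' X V V' e (rw P P' (X ** V) c s) = rgt P X V V' (\<lambda>t. e (rw P P' V c t)) s"
  using assms by (simp add: rgt_def sig_nat1[of P X V P'] lw_lw)

lemma lft_cong:
  assumes "is_hmod H P" "is_hmod H V" "is_hmod H V'" "is_hmod H X" "s \<in> carrier (P ** V ** X)" "!!t. t \<in> carrier (P ** V) ==> e t = e' t"
  shows "lft P V V' X e s = lft P V V' X e' s"
  unfolding lft_def by (rule rw_cong) (use assms in simp_all)

lemma rgt_cong:
  assumes "is_hmod H P" "is_hmod H V" "is_hmod H V'" "is_hmod H X" "s \<in> carrier (P ** X ** V)" "!!t. t \<in> carrier (P ** V) ==> e t = e' t"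
  shows "rgt P X V V' e s = rgt P X V V' e' s"
  unfolding rgt_def by (rule lw_cong) (use assms in simp_all)

text \<open>Invariance of \<open>u\<close> turns one leg of the coproduct into a counit, and degree
  0 of \<open>u\<close> keeps degrees unchanged.\<close>

lemma mor_tp_unit:
  assumes P: "is_hmod H P" and E: "is_hmod H E" and u: "unital E u"
  shows "is_mor H P (P ** E) (\<lambda>p. tp H P E p u)" and "is_mor H P (E ** P) (\<lambda>p. tp H E P u p)"
proof -
  have uc [simp]: "u \<in> carrier E" by (rule unital_closed[OF E u])
  have ug: "u \<in> gr E 0" and ua: "!!h. h \<in> carrier H ==> act E h u = cou H h \<odot>\<^bsub>E\<^esub> u" using u by (simp_all add: unital_def)
  note [simp] = P E
  have s: "tp H P E p (c \<odot>\<^bsub>E\<^esub> u) = c \<odot>\<^bsub>P ** E\<^esub> tp H P E p u" "tp H E P (c \<odot>\<^bsub>E\<^esub> u) p = c \<odot>\<^bsub>E ** P\<^esub> tp H E P u p"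
    if "c \<in> carrier k" "p \<in> carrier P" for c p
    by (rule lin_smult[OF lin_tp_left[OF _ _ lin_id]] lin_smult[OF lin_tp_right[OF _ _ lin_id]]; use that in simp)+
  show "is_mor H P (P ** E) (\<lambda>p. tp H P E p u)"
  proof (rule morI)
    show "is_linear k P (P ** E) (\<lambda>p. tp H P E p u)" by (intro lin_intros) simp_all
    show "tp H P E p u \<in> gr (P ** E) n" if "p \<in> gr P n" for n p by (rule tp_gr[OF P E that ug]) simp
    fix h p assume h: "h \<in> carrier H" and p: "p \<in> carrier P"
    have "is_linear k H (P ** E) (\<lambda>a. tp H P E (act P a p) u)" by (intro lin_intros) (use p in simp_all)
    from swD_counit_right[OF _ h this]
    show "tp H P E (act P h p) u = act (P ** E) h (tp H P E p u)" using h p by (simp add: act_tp ua s del: tensor_sel)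
  qed
  show "is_mor H P (E ** P) (\<lambda>p. tp H E P u p)"
  proof (rule morI)
    show "is_linear k P (E ** P) (\<lambda>p. tp H E P u p)" by (intro lin_intros) simp_all
    show "tp H E P u p \<in> gr (E ** P) n" if "p \<in> gr P n" for n p by (rule tp_gr[OF E P ug that]) simp
    fix h p assume h: "h \<in> carrier H" and p: "p \<in> carrier P"
    have "is_linear k H (E ** P) (\<lambda>a. tp H E P u (act P a p))" by (intro lin_intros) (use p in simp_all)
    from swD_counit_left[OF _ h this]
    show "tp H E P u (act P h p) = act (E ** P) h (tp H E P u p)" using h p by (simp add: act_tp ua s del: tensor_sel)
  qed
qed

section \<open>Brackets\<close>

text \<open>The bracket as a map on all of \<open>end(V) \<otimes> end(V)\<close> instead of on
  pairs, since the braiding takes a pure tensor to a sum of such.\<close>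

definition bra where
  "bra V s = icomp H V V V s \<ominus>\<^bsub>ihom H V V\<^esub> icomp H V V V (braid H (ihom H V V) (ihom H V V) s)"

lemma ibracket_bra: "ibracket H V L L' = bra V (tp H (ihom H V V) (ihom H V V) L L')"
  by (simp add: ibracket_def bra_def Let_def iend_def)

lemma bra_linear [simp]:
  assumes V: "is_hmod H V" shows "is_linear k (ihom H V V ** ihom H V V) (ihom H V V) (bra V)"
  unfolding bra_def[abs_def] by (intro lin_diff lin_comp[OF braid_linear] mor_linear[OF mor_icomp]) (use V in simp_all)

lemma bra_closed [simp]: "is_hmod H V ==> s \<in> carrier (ihom H V V ** ihom H V V) ==> bra V s \<in> carrier (ihom H V V)"
  by (rule lin_closed[OF bra_linear])

text \<open>Two objects acting on \<open>T\<close> through morphisms into \<open>end(T)\<close> act,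
  after internal composition, one after the other. Identities in \<open>end(T)\<close> thereby
  become identities between actions.\<close>

lemma icomp_action:
  assumes P: "is_hmod H P" and P': "is_hmod H P'" and T: "is_hmod H T"
    and a: "is_mor H P (ihom H T T) a" and b: "is_mor H P' (ihom H T T) b"
    and \<alpha>: "!!s. s \<in> carrier (P ** T) ==> ev H T T (rw P (ihom H T T) T a s) = \<alpha> s"
    and \<beta>: "!!s. s \<in> carrier (P' ** T) ==> ev H T T (rw P' (ihom H T T) T b s) = \<beta> s"
    and y: "y \<in> carrier (P ** P')" and t: "t \<in> carrier T"
  shows "ev H T T (tp H (ihom H T T) T (icomp H T T T (tmap H (ihom H T T) (ihom H T T) a b y)) t) =
    \<alpha> (lw P (P' ** T) T \<beta> (Assoc H P P' T (tp H (P ** P') T y t)))"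
proof -
  let ?E = "ihom H T T"
  note [simp] = P P' T a b y t
  have bl: "is_linear k (P' ** T) T \<beta>"
    by (rule lin_cong[OF lin_comp[OF rw_linear ev_linear] _ \<beta>]) simp_all
  define s where "s = Assoc H P P' T (tp H (P ** P') T y t)"
  have s [simp]: "s \<in> carrier (P ** P' ** T)" by (simp add: s_def)
  have e: "tmap H ?E ?E a b y = lw ?E P' ?E b (rw P ?E P' a y)" by (rule tmap_lw_rw) simp_all
  have "ev H T T (tp H ?E T (icomp H T T T (tmap H ?E ?E a b y)) t) =
    ev H T T (lw ?E (?E ** T) T (ev H T T) (Assoc H ?E ?E T (tp H (?E ** ?E) T (lw ?E P' ?E b (rw P ?E P' a y)) t)))"
    unfolding e using ev_icomp[of T T T "tp H (?E ** ?E) T (lw ?E P' ?E b (rw P ?E P' a y)) t"] by simp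
  also have "tp H (?E ** ?E) T (lw ?E P' ?E b (rw P ?E P' a y)) t = rw (?E ** P') (?E ** ?E) T (lw ?E P' ?E b) (rw (P ** P') (?E ** P') T (rw P ?E P' a) (tp H (P ** P') T y t))"
    by simp
  also have "Assoc H ?E ?E T \<dots> = lw ?E (P' ** T) (?E ** T) (rw P' ?E T b) (rw P ?E (P' ** T) a s)"
    by (simp add: Assoc_nat(1)[of P P' T ?E P' T] Assoc_nat(2)[of ?E P' T ?E ?E T] s_def del: rw_tp)
  also have "lw ?E (?E ** T) T (ev H T T) \<dots> = lw ?E (P' ** T) T \<beta> (rw P ?E (P' ** T) a s)"
    by (simp add: lw_lw \<beta> cong: lw_cong)
  also have "\<dots> = rw P ?E T a (lw P (P' ** T) T \<beta> s)" using bl by (simp add: lw_rw)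
  also have "ev H T T \<dots> = \<alpha> (lw P (P' ** T) T \<beta> s)" using bl by (simp add: \<alpha>)
  finally show ?thesis unfolding s_def .
qed

definition inl where "inl V X L = itensor H V V X X (tp H (ihom H V V) (ihom H X X) L (iunit H X))"
definition inr where "inr V X M = itensor H V V X X (tp H (ihom H V V) (ihom H X X) (iunit H V) M)"

context
  fixes V and X
  assumes V: "is_hmod H V" and X: "is_hmod H X"
  notes [simp] = V X
begin

private abbreviation (input) "EA \<equiv> ihom H V V"
private abbreviation (input) "EB \<equiv> ihom H X X"
private abbreviation (input) "ET \<equiv> ihom H (V ** X) (V ** X)"

lemma mor_inl: "is_mor H EA ET (inl V X)"
  unfolding inl_def[abs_def] by (rule mor_comp[OF mor_tp_unit(1)[OF _ _ unital_iunit] mor_itensor]) simp_all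

lemma mor_inr: "is_mor H EB ET (inr V X)"
  unfolding inr_def[abs_def] by (rule mor_comp[OF mor_tp_unit(2)[OF _ _ unital_iunit] mor_itensor]) simp_all

lemmas [simp] = mor_inl mor_inr

lemma ev_inl: "s \<in> carrier (EA ** V ** X) ==> ev H (V ** X) (V ** X) (rw EA ET (V ** X) (inl V X) s) = lft EA V V X (ev H V V) s"
  by (rule tensor_ext[OF _ _ _ lin_comp[OF rw_linear ev_linear] lft_linear]) (simp_all add: inl_def[symmetric] ev_itensor_left[of V X, folded inl_def])

lemma ev_inr: "s \<in> carrier (EB ** V ** X) ==> ev H (V ** X) (V ** X) (rw EB ET (V ** X) (inr V X) s) = rgt EB V X X (ev H X X) s"
  by (rule tensor_ext[OF _ _ _ lin_comp[OF rw_linear ev_linear] rgt_linear]) (simp_all add: ev_itensor_right[of V X, folded inr_def])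

text \<open>Under evaluation both sides become actions on the left factor, and the claim turns into
  \<open>lft_comp\<close>. The next lemma does the same on the right factor with
  \<open>rgt_comp\<close>.\<close>

lemma inl_icomp:
  assumes y: "y \<in> carrier (EA ** EA)" shows "icomp H (V ** X) (V ** X) (V ** X) (tmap H ET ET (inl V X) (inl V X) y) = inl V X (icomp H V V V y)"
proof (rule mor_ev_ext[of _ "V ** X" "V ** X", OF _ _ _ mor_comp[OF mor_tmap mor_icomp] mor_comp[OF mor_icomp mor_inl] _ y])
  fix y t assume y [simp]: "y \<in> carrier (EA ** EA)" and t [simp]: "t \<in> carrier (V ** X)"
  let ?s = "tp H (EA ** EA) (V ** X) y t"
  have "ev H (V ** X) (V ** X) (tp H ET (V ** X) (inl V X (icomp H V V V y)) t) = lft EA V V X (ev H V V) (rw (EA ** EA) EA (V ** X) (icomp H V V V) ?s)"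
    using ev_inl[of "tp H EA (V ** X) (icomp H V V V y) t"] by (simp add: mor_closed[OF mor_icomp])
  also have "\<dots> = lft (EA ** EA) V V X (\<lambda>s. ev H V V (rw (EA ** EA) EA V (icomp H V V V) s)) ?s"
    by (rule lft_rw) simp_all
  also have "\<dots> = lft (EA ** EA) V V X (\<lambda>s. ev H V V (lw EA (EA ** V) V (ev H V V) (Assoc H EA EA V s))) ?s"
    by (rule lft_cong) (simp_all add: ev_icomp)
  also have "\<dots> = lft EA V V X (ev H V V) (lw EA (EA ** V ** X) (V ** X) (lft EA V V X (ev H V V)) (Assoc H EA EA (V ** X) ?s))"
    by (rule lft_comp) simp_all
  also have "\<dots> = ev H (V ** X) (V ** X) (tp H ET (V ** X) (icomp H (V ** X) (V ** X) (V ** X) (tmap H ET ET (inl V X) (inl V X) y)) t)"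
    by (rule icomp_action[symmetric]) (simp_all add: ev_inl)
  finally show "ev H (V ** X) (V ** X) (tp H ET (V ** X) (icomp H (V ** X) (V ** X) (V ** X) (tmap H ET ET (inl V X) (inl V X) y)) t) =
    ev H (V ** X) (V ** X) (tp H ET (V ** X) (inl V X (icomp H V V V y)) t)" ..
qed simp_all

lemma inr_icomp:
  assumes y: "y \<in> carrier (EB ** EB)" shows "icomp H (V ** X) (V ** X) (V ** X) (tmap H ET ET (inr V X) (inr V X) y) = inr V X (icomp H X X X y)"
proof (rule mor_ev_ext[of _ "V ** X" "V ** X", OF _ _ _ mor_comp[OF mor_tmap mor_icomp] mor_comp[OF mor_icomp mor_inr] _ y])
  fix y t assume y [simp]: "y \<in> carrier (EB ** EB)" and t [simp]: "t \<in> carrier (V ** X)"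
  let ?s = "tp H (EB ** EB) (V ** X) y t"
  have "ev H (V ** X) (V ** X) (tp H ET (V ** X) (inr V X (icomp H X X X y)) t) = rgt EB V X X (ev H X X) (rw (EB ** EB) EB (V ** X) (icomp H X X X) ?s)"
    using ev_inr[of "tp H EB (V ** X) (icomp H X X X y) t"] by (simp add: mor_closed[OF mor_icomp])
  also have "\<dots> = rgt (EB ** EB) V X X (\<lambda>s. ev H X X (rw (EB ** EB) EB X (icomp H X X X) s)) ?s"
    by (rule rgt_rw) simp_all
  also have "\<dots> = rgt (EB ** EB) V X X (\<lambda>s. ev H X X (lw EB (EB ** X) X (ev H X X) (Assoc H EB EB X s))) ?s"
    by (rule rgt_cong) (simp_all add: ev_icomp)
  also have "\<dots> = rgt EB V X X (ev H X X) (lw EB (EB ** V ** X) (V ** X) (rgt EB V X X (ev H X X)) (Assoc H EB EB (V ** X) ?s))"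
    by (rule rgt_comp) simp_all
  also have "\<dots> = ev H (V ** X) (V ** X) (tp H ET (V ** X) (icomp H (V ** X) (V ** X) (V ** X) (tmap H ET ET (inr V X) (inr V X) y)) t)"
    by (rule icomp_action[symmetric]) (simp_all add: ev_inr)
  finally show "ev H (V ** X) (V ** X) (tp H ET (V ** X) (icomp H (V ** X) (V ** X) (V ** X) (tmap H ET ET (inr V X) (inr V X) y)) t) =
    ev H (V ** X) (V ** X) (tp H ET (V ** X) (inr V X (icomp H X X X y)) t)" ..
qed simp_all

text \<open>Under evaluation this is \<open>rgt_lft\<close>; the exchange \<open>sig\<close> of the
  acting objects becomes their braiding.\<close>

lemma inr_inl_icomp:
  assumes y: "y \<in> carrier (EB ** EA)"
  shows "icomp H (V ** X) (V ** X) (V ** X) (tmap H ET ET (inr V X) (inl V X) y) = icomp H (V ** X) (V ** X) (V ** X) (tmap H ET ET (inl V X) (inr V X) (braid H EB EA y))"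
proof (rule mor_ev_ext[of _ "V ** X" "V ** X", OF _ _ _ mor_comp[OF mor_tmap mor_icomp] mor_comp[OF mor_comp[OF mor_braid mor_tmap] mor_icomp] _ y])
  fix y t assume y [simp]: "y \<in> carrier (EB ** EA)" and t [simp]: "t \<in> carrier (V ** X)"
  let ?s = "tp H (EB ** EA) (V ** X) y t"
  have "ev H (V ** X) (V ** X) (tp H ET (V ** X) (icomp H (V ** X) (V ** X) (V ** X) (tmap H ET ET (inr V X) (inl V X) y)) t) =
    rgt EB V X X (ev H X X) (lw EB (EA ** V ** X) (V ** X) (lft EA V V X (ev H V V)) (Assoc H EB EA (V ** X) ?s))" (is "?l = _")
    by (rule icomp_action) (simp_all add: ev_inr ev_inl)
  also have "\<dots> = lft EA V V X (ev H V V) (lw EA (EB ** V ** X) (V ** X) (rgt EB V X X (ev H X X)) (sig EB EA (V ** X) (Assoc H EB EA (V ** X) ?s)))"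
    by (rule rgt_lft) simp_all
  also have "sig EB EA (V ** X) (Assoc H EB EA (V ** X) ?s) = Assoc H EA EB (V ** X) (tp H (EA ** EB) (V ** X) (braid H EB EA y) t)"
    by (simp add: sig_Assoc)
  also have "lft EA V V X (ev H V V) (lw EA (EB ** V ** X) (V ** X) (rgt EB V X X (ev H X X)) \<dots>) =
    ev H (V ** X) (V ** X) (tp H ET (V ** X) (icomp H (V ** X) (V ** X) (V ** X) (tmap H ET ET (inl V X) (inr V X) (braid H EB EA y))) t)"
    by (rule icomp_action[symmetric]) (simp_all add: ev_inr ev_inl)
  finally show "?l =
    ev H (V ** X) (V ** X) (tp H ET (V ** X) (icomp H (V ** X) (V ** X) (V ** X) (tmap H ET ET (inl V X) (inr V X) (braid H EB EA y))) t)" .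
qed simp_all

end

section \<open>Brackets and the two embeddings of endomorphisms\<close>

lemma braid_tmap:
  assumes "is_hmod H A" "is_hmod H B" "is_hmod H A'" "is_hmod H B'" and a: "is_mor H A A' a" and b: "is_mor H B B' b" and y: "y \<in> carrier (A ** B)"
  shows "braid H A' B' (tmap H A' B' a b y) = tmap H B' A' b a (braid H A B y)"
proof -
  note l = mor_linear[OF a] mor_linear[OF b]
  have "braid H A' B' (tmap H A' B' a b y) = braid H A' B' (lw A' B B' b (rw A A' B a y))"
    using tmap_lw_rw[OF assms(1,3,2,4) l y] by simp
  also have "\<dots> = rw B B' A' b (braid H A' B (rw A A' B a y))"
    by (rule braid_nat_right[OF assms(3,4,2) b rw_closed[OF assms(2,1,3) l(1) y]])
  also have "braid H A' B (rw A A' B a y) = lw B A A' a (braid H A B y)"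
    by (rule braid_nat_left[OF assms(1,3,2) a y])
  also have "rw B B' A' b \<dots> = lw B' A A' a (rw B B' A b (braid H A B y))"
    by (rule lw_rw[OF assms(2,4,1,3) l(2,1) braid_closed[OF assms(1,2) y], symmetric])
  also have "\<dots> = tmap H B' A' b a (braid H A B y)"
    by (rule tmap_lw_rw[OF assms(2,4,1,3) l(2,1) braid_closed[OF assms(1,2) y], symmetric])
  finally show ?thesis .
qed

text \<open>Naturality of the braiding carries the second term of the bracket along, so
  compatibility with composition is enough.\<close>

lemma bra_mor:
  assumes V: "is_hmod H V" and T: "is_hmod H T" and g: "is_mor H (ihom H V V) (ihom H T T) g"
    and c: "!!y. y \<in> carrier (ihom H V V ** ihom H V V) ==> icomp H T T T (tmap H (ihom H T T) (ihom H T T) g g y) = g (icomp H V V V y)"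
    and y: "y \<in> carrier (ihom H V V ** ihom H V V)"
  shows "bra T (tmap H (ihom H T T) (ihom H T T) g g y) = g (bra V y)"
proof -
  note [simp] = V T g y
  have b: "braid H (ihom H V V) (ihom H V V) y \<in> carrier (ihom H V V ** ihom H V V)" by simp
  have i: "icomp H V V V r \<in> carrier (ihom H V V)" if "r \<in> carrier (ihom H V V ** ihom H V V)" for r
    by (rule mor_closed[OF mor_icomp that]) simp_all
  show ?thesis
    unfolding bra_def braid_tmap[OF hmod_ihom[OF V V] hmod_ihom[OF V V] hmod_ihom[OF T T] hmod_ihom[OF T T] g g y] c[OF y] c[OF b]
    by (rule lin_minus[OF _ _ mor_linear[OF g] i[OF y] i[OF b], symmetric]) simp_all
qed

lemma inl_bra:
  assumes V: "is_hmod H V" and X: "is_hmod H X" and y: "y \<in> carrier (ihom H V V ** ihom H V V)"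
  shows "bra (V ** X) (tmap H (ihom H (V ** X) (V ** X)) (ihom H (V ** X) (V ** X)) (inl V X) (inl V X) y) = inl V X (bra V y)"
  by (rule bra_mor[OF V hmod_tensor[OF V X] mor_inl[OF V X] inl_icomp[OF V X] y])

lemma inr_bra:
  assumes V: "is_hmod H V" and X: "is_hmod H X" and y: "y \<in> carrier (ihom H X X ** ihom H X X)"
  shows "bra (V ** X) (tmap H (ihom H (V ** X) (V ** X)) (ihom H (V ** X) (V ** X)) (inr V X) (inr V X) y) = inr V X (bra X y)"
  by (rule bra_mor[OF X hmod_tensor[OF V X] mor_inr[OF V X] inr_icomp[OF V X] y])

text \<open>The mixed brackets vanish only because the braiding is symmetric.\<close>

lemma bra_inl_inr:
  assumes V: "is_hmod H V" and X: "is_hmod H X"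
  shows "y \<in> carrier (ihom H V V ** ihom H X X) ==>
      bra (V ** X) (tmap H (ihom H (V ** X) (V ** X)) (ihom H (V ** X) (V ** X)) (inl V X) (inr V X) y) = \<zero>\<^bsub>ihom H (V ** X) (V ** X)\<^esub>"
    and "z \<in> carrier (ihom H X X ** ihom H V V) ==>
      bra (V ** X) (tmap H (ihom H (V ** X) (V ** X)) (ihom H (V ** X) (V ** X)) (inr V X) (inl V X) z) = \<zero>\<^bsub>ihom H (V ** X) (V ** X)\<^esub>"
proof -
  let ?T = "V ** X"
  let ?E = "ihom H ?T ?T"
  note [simp] = V X
  have mE: "module k ?E" by simp
  then interpret E: module k ?E .
  note i = mor_inl[OF V X] mor_inr[OF V X]
  note ic = mor_closed[OF mor_icomp[of ?T ?T ?T]]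
  show "bra ?T (tmap H ?E ?E (inl V X) (inr V X) y) = \<zero>\<^bsub>?E\<^esub>" if y: "y \<in> carrier (ihom H V V ** ihom H X X)"
  proof -
    have b: "braid H ?E ?E (tmap H ?E ?E (inl V X) (inr V X) y) = tmap H ?E ?E (inr V X) (inl V X) (braid H (ihom H V V) (ihom H X X) y)"
      by (rule braid_tmap[OF _ _ _ _ i y]) simp_all
    have c: "icomp H ?T ?T ?T (tmap H ?E ?E (inl V X) (inr V X) y) \<in> carrier ?E"
      by (rule ic[OF _ _ _ mor_closed[OF mor_tmap[OF _ _ _ _ i] y]]) simp_all
    show ?thesis unfolding bra_def b using y c by (simp add: inr_inl_icomp E.M.r_neg a_minus_def)
  qed
  show "bra ?T (tmap H ?E ?E (inr V X) (inl V X) z) = \<zero>\<^bsub>?E\<^esub>" if y: "z \<in> carrier (ihom H X X ** ihom H V V)"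
  proof -
    have b: "braid H ?E ?E (tmap H ?E ?E (inr V X) (inl V X) z) = tmap H ?E ?E (inl V X) (inr V X) (braid H (ihom H X X) (ihom H V V) z)"
      by (rule braid_tmap[OF _ _ _ _ i(2,1) y]) simp_all
    have c: "icomp H ?T ?T ?T (tmap H ?E ?E (inr V X) (inl V X) z) \<in> carrier ?E"
      by (rule ic[OF _ _ _ mor_closed[OF mor_tmap[OF _ _ _ _ i(2,1)] y]]) simp_all
    show ?thesis unfolding bra_def b using y c by (simp add: inr_inl_icomp[symmetric] E.M.r_neg a_minus_def)
  qed
qed

theorem ibracket_sum:
  assumes V: "is_hmod H V" and X: "is_hmod H X" and L: "L \<in> carrier (ihom H V V)" and M: "M \<in> carrier (ihom H X X)"
  shows "ibracket H (V ** X) (inl V X L \<oplus>\<^bsub>ihom H (V ** X) (V ** X)\<^esub> inr V X M) (inl V X L \<oplus>\<^bsub>ihom H (V ** X) (V ** X)\<^esub> inr V X M) =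
    inl V X (ibracket H V L L) \<oplus>\<^bsub>ihom H (V ** X) (V ** X)\<^esub> inr V X (ibracket H X M M)"
proof -
  let ?T = "V ** X"
  let ?E = "ihom H ?T ?T"
  note [simp] = V X L M
  have mE: "module k ?E" by simp
  then interpret E: module k ?E .
  note i = mor_inl[OF V X] mor_inr[OF V X]
  have a [simp]: "inl V X L \<in> carrier ?E" "inr V X M \<in> carrier ?E" by (simp_all add: mor_closed[OF i(1)] mor_closed[OF i(2)])
  have bl: "bilin k ?E ?E ?E (\<lambda>a b. bra ?T (tp H ?E ?E a b))"
    by (intro bilinI lin_comp[OF _ bra_linear] lin_tp_left lin_tp_right lin_id) simp_all
  \<comment> \<open>All four pairs are images of pure tensors over \<open>end(V)\<close> and
    \<open>end(X)\<close>, to which the rules for \<open>bra\<close> apply: two give the brackets of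
    \<open>L\<close> and \<open>M\<close>, two are mixed and vanish.\<close>
  have t: "tp H ?E ?E (inl V X L) (inl V X L) = tmap H ?E ?E (inl V X) (inl V X) (tp H (ihom H V V) (ihom H V V) L L)"
    "tp H ?E ?E (inl V X L) (inr V X M) = tmap H ?E ?E (inl V X) (inr V X) (tp H (ihom H V V) (ihom H X X) L M)"
    "tp H ?E ?E (inr V X M) (inl V X L) = tmap H ?E ?E (inr V X) (inl V X) (tp H (ihom H X X) (ihom H V V) M L)"
    "tp H ?E ?E (inr V X M) (inr V X M) = tmap H ?E ?E (inr V X) (inr V X) (tp H (ihom H X X) (ihom H X X) M M)"
    by (simp_all add: tmap_tp i)
  have s: "bra ?T (tp H ?E ?E (inl V X L \<oplus>\<^bsub>?E\<^esub> inr V X M) (inl V X L \<oplus>\<^bsub>?E\<^esub> inr V X M)) =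
    (bra ?T (tp H ?E ?E (inl V X L) (inl V X L)) \<oplus>\<^bsub>?E\<^esub> bra ?T (tp H ?E ?E (inr V X M) (inl V X L))) \<oplus>\<^bsub>?E\<^esub>
    (bra ?T (tp H ?E ?E (inl V X L) (inr V X M)) \<oplus>\<^bsub>?E\<^esub> bra ?T (tp H ?E ?E (inr V X M) (inr V X M)))"
    by (simp only: lin_add[OF bilin_right[OF bl]] lin_add[OF bilin_left[OF bl]] a E.M.a_closed)
  have c: "bra V (tp H (ihom H V V) (ihom H V V) L L) \<in> carrier (ihom H V V)" "bra X (tp H (ihom H X X) (ihom H X X) M M) \<in> carrier (ihom H X X)"
    by simp_all
  show ?thesis
    unfolding ibracket_bra s t inl_bra[OF V X tp_closed[OF hmod_module[OF hmod_ihom[OF V V]] hmod_module[OF hmod_ihom[OF V V]] L L]]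
      inr_bra[OF V X tp_closed[OF hmod_module[OF hmod_ihom[OF X X]] hmod_module[OF hmod_ihom[OF X X]] M M]]
    using mor_closed[OF i(1) c(1)] mor_closed[OF i(2) c(2)] by (simp add: bra_inl_inr)
qed

section \<open>Kernels, products and quotients\<close>

lemma mor_zero_closed: "is_hmod H V ==> \<zero>\<^bsub>V\<^esub> \<in> carrier V"
  by (rule gr_closed[OF _ gr_zero])

lemma module_zero_add: 
  assumes "module k V" shows "\<zero>\<^bsub>V\<^esub> \<in> carrier V" "\<zero>\<^bsub>V\<^esub> \<oplus>\<^bsub>V\<^esub> \<zero>\<^bsub>V\<^esub> = \<zero>\<^bsub>V\<^esub>" "c \<in> carrier k ==> c \<odot>\<^bsub>V\<^esub> \<zero>\<^bsub>V\<^esub> = \<zero>\<^bsub>V\<^esub>"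
proof -
  interpret V: module k V by fact
  show "\<zero>\<^bsub>V\<^esub> \<in> carrier V" "\<zero>\<^bsub>V\<^esub> \<oplus>\<^bsub>V\<^esub> \<zero>\<^bsub>V\<^esub> = \<zero>\<^bsub>V\<^esub>" "c \<in> carrier k ==> c \<odot>\<^bsub>V\<^esub> \<zero>\<^bsub>V\<^esub> = \<zero>\<^bsub>V\<^esub>"
    by simp_all
qed

text \<open>Transport of structure along a surjection \<open>q\<close> that is compatible with all
  operations. The last assumption makes homogeneous components descend, which is what turns the
  images of the graded pieces into a direct sum decomposition.\<close>

context
  fixes T and X and q
  assumes T: "is_hmod H T" and cX: "carrier X = q ` carrier T"
    and add: "!!x y. x \<in> carrier T ==> y \<in> carrier T ==> q x \<oplus>\<^bsub>X\<^esub> q y = q (x \<oplus>\<^bsub>T\<^esub> y)"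
    and sm: "!!c x. c \<in> carrier k ==> x \<in> carrier T ==> c \<odot>\<^bsub>X\<^esub> q x = q (c \<odot>\<^bsub>T\<^esub> x)"
    and z: "\<zero>\<^bsub>X\<^esub> = q \<zero>\<^bsub>T\<^esub>"
    and act: "!!h x. h \<in> carrier H ==> x \<in> carrier T ==> act X h (q x) = q (act T h x)"
    and gr: "!!n. gr X n = q ` gr T n"
    and hc: "!!n x y. x \<in> carrier T ==> y \<in> carrier T ==> q x = q y ==> q (hcomp T n x) = q (hcomp T n y)"
begin

private lemma mT: "module k T" using T by simp
interpretation T: module k T by (rule mT)

private lemma qc: "x \<in> carrier T ==> q x \<in> carrier X" by (simp add: cX)

private lemma qE: "X' \<in> carrier X ==> (!!x. x \<in> carrier T ==> X' = q x ==> P) ==> P" by (auto simp: cX)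

private lemma mX: "module k X"
proof (rule moduleI[OF module.axioms(1)[OF mT] abelian_groupI])
  show "a \<oplus>\<^bsub>X\<^esub> b \<in> carrier X" if "a \<in> carrier X" "b \<in> carrier X" for a b
    using that by (auto elim!: qE simp: add qc)
  show "\<zero>\<^bsub>X\<^esub> \<in> carrier X" by (simp add: z qc)
  show "c \<odot>\<^bsub>X\<^esub> a \<in> carrier X" if "c \<in> carrier k" "a \<in> carrier X" for a c
    using that by (auto elim!: qE simp: sm qc)
  show "a \<oplus>\<^bsub>X\<^esub> b \<oplus>\<^bsub>X\<^esub> c = a \<oplus>\<^bsub>X\<^esub> (b \<oplus>\<^bsub>X\<^esub> c)" if "a \<in> carrier X" "b \<in> carrier X" "c \<in> carrier X" for a b c
    using that by (auto elim!: qE simp: add qc T.M.a_assoc)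
  show "a \<oplus>\<^bsub>X\<^esub> b = b \<oplus>\<^bsub>X\<^esub> a" if "a \<in> carrier X" "b \<in> carrier X" for a b
    using that by (auto elim!: qE simp: add qc T.M.a_comm)
  show "\<zero>\<^bsub>X\<^esub> \<oplus>\<^bsub>X\<^esub> a = a" if "a \<in> carrier X" for a
    using that by (auto elim!: qE simp: add z)
  show "\<exists>b\<in>carrier X. b \<oplus>\<^bsub>X\<^esub> a = \<zero>\<^bsub>X\<^esub>" if a: "a \<in> carrier X" for a
  proof -
    from a obtain x where x: "x \<in> carrier T" "a = q x" by (rule qE)
    show ?thesis by (rule bexI[of _ "q (\<ominus>\<^bsub>T\<^esub> x)"]) (use x in \<open>simp_all add: add z qc T.M.l_neg\<close>)
  qed
  show "(a \<oplus>\<^bsub>k\<^esub> b) \<odot>\<^bsub>X\<^esub> c = a \<odot>\<^bsub>X\<^esub> c \<oplus>\<^bsub>X\<^esub> b \<odot>\<^bsub>X\<^esub> c" if "a \<in> carrier k" "b \<in> carrier k" "c \<in> carrier X" for a b c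
    using that by (auto elim!: qE simp: add sm T.smult_l_distr)
  show "a \<odot>\<^bsub>X\<^esub> (b \<oplus>\<^bsub>X\<^esub> c) = a \<odot>\<^bsub>X\<^esub> b \<oplus>\<^bsub>X\<^esub> a \<odot>\<^bsub>X\<^esub> c" if "a \<in> carrier k" "b \<in> carrier X" "c \<in> carrier X" for a b c
    using that by (auto elim!: qE simp: add sm T.smult_r_distr)
  show "(a \<otimes>\<^bsub>k\<^esub> b) \<odot>\<^bsub>X\<^esub> c = a \<odot>\<^bsub>X\<^esub> (b \<odot>\<^bsub>X\<^esub> c)" if "a \<in> carrier k" "b \<in> carrier k" "c \<in> carrier X" for a b c
    using that by (auto elim!: qE simp: sm T.smult_assoc1)
  show "\<one>\<^bsub>k\<^esub> \<odot>\<^bsub>X\<^esub> c = c" if "c \<in> carrier X" for c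
    using that by (auto elim!: qE simp: sm)
qed

private lemma q_linear: "is_linear k T X q"
  by (rule linI) (simp_all add: qc add sm)

private definition "pX n Y = q (hcomp T n (SOME x. x \<in> carrier T \<and> q x = Y))"

private lemma pX: assumes x: "x \<in> carrier T" shows "pX n (q x) = q (hcomp T n x)"
proof -
  have "(SOME y. y \<in> carrier T \<and> q y = q x) \<in> carrier T \<and> q (SOME y. y \<in> carrier T \<and> q y = q x) = q x"
    by (rule someI[of "\<lambda>y. y \<in> carrier T \<and> q y = q x" x]) (simp add: x)
  then show ?thesis unfolding pX_def using hc x by blast
qed

private lemma lin_q: 
  assumes "module k M" "!!x. x \<in> carrier T ==> f (q x) \<in> carrier M" "is_linear k T M (\<lambda>x. f (q x))" shows "is_linear k X M f"
  by (rule linI) (auto elim!: qE simp: assms(2) add sm lin_add[OF assms(3)] lin_smult[OF assms(3)])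

lemma hmod_image: "is_hmod H X"
proof (rule hmodI[where p = pX and D = "degs T"])
  show "module k X" by (rule mX)
  show "is_linear k X X (act X h)" if h: "h \<in> carrier H" for h
  proof (rule lin_q[OF mX])
    show "act X h (q x) \<in> carrier X" if "x \<in> carrier T" for x using h that T by (simp add: act qc)
    show "is_linear k T X (\<lambda>x. act X h (q x))"
      by (rule lin_cong[OF lin_comp[OF hmod_act_linear[OF T h] q_linear] mT]) (simp add: act h)
  qed
  show "is_linear k H X (\<lambda>h. act X h v)" if "v \<in> carrier X" for v
    using that
  proof (rule qE)
    fix x assume x: "x \<in> carrier T" and e: "v = q x"
    show ?thesis unfolding e by (rule lin_cong[OF lin_comp[OF hmod_act_arg[OF T x] q_linear] modH]) (simp add: act x)
  qed
  show "act X \<one> v = v" if "v \<in> carrier X" for v using that T by (auto elim!: qE simp: act)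
  show "act X (g \<otimes> h) v = act X g (act X h v)" if "g \<in> carrier H" "h \<in> carrier H" "v \<in> carrier X" for g h v
    using that T by (auto elim!: qE simp: act act_mult)
  have gq: "q x \<in> gr X n" if "x \<in> gr T n" for x n unfolding gr using that by (rule imageI)
  show "submodule (gr X n) k X" for n
  proof (rule submoduleI'[OF mX])
    show "gr X n \<subseteq> carrier X" unfolding gr using gr_closed[OF T] by (auto simp: qc)
    show "\<zero>\<^bsub>X\<^esub> \<in> gr X n" unfolding z by (rule gq) (use T in simp)
    show "x \<oplus>\<^bsub>X\<^esub> y \<in> gr X n" if "x \<in> gr X n" "y \<in> gr X n" for x y
      using that gr_closed[OF T] unfolding gr by (auto simp: add intro!: imageI gr_add[OF T])
    show "c \<odot>\<^bsub>X\<^esub> x \<in> gr X n" if "c \<in> carrier k" "x \<in> gr X n" for c x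
      using that gr_closed[OF T] unfolding gr by (auto simp: sm intro!: imageI gr_smult[OF T])
  qed
  show "act X h v \<in> gr X n" if "h \<in> carrier H" "v \<in> gr X n" for n h v
    using that gr_closed[OF T] T unfolding gr by (auto simp: act)
  show "finite (degs T)" using T by simp
  show "is_linear k X X (pX n)" for n
  proof (rule lin_q[OF mX])
    show "pX n (q x) \<in> carrier X" if "x \<in> carrier T" for x using that T by (simp add: pX qc)
    show "is_linear k T X (\<lambda>x. pX n (q x))"
      by (rule lin_cong[OF lin_comp[OF hcomp_linear[OF T] q_linear] mT]) (simp add: pX)
  qed
  show "pX n v \<in> gr X n" if "v \<in> carrier X" for n v
    using that hcomp_gr[OF T] by (auto elim!: qE simp: pX gq)
  show "pX n v = (if m = n then v else \<zero>\<^bsub>X\<^esub>)" if "v \<in> gr X m" for m n v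
    using that gr_closed[OF T] unfolding gr by (auto simp: pX hcomp_same[OF T] z)
  show "finsum X (\<lambda>n. pX n v) (degs T) = v" if "v \<in> carrier X" for v
    using that
  proof (rule qE)
    fix x assume x: "x \<in> carrier T" and e: "v = q x"
    have "q (finsum T (\<lambda>n. hcomp T n x) (degs T)) = finsum X (\<lambda>n. q (hcomp T n x)) (degs T)"
      by (rule lin_finsum[OF mT mX q_linear]) (use T x in simp)
    then show ?thesis unfolding e pX[OF x] hcomp_sum[OF T x] ..
  qed
qed

lemma mor_image: "is_mor H T X q"
  by (rule morI[OF q_linear]) (simp_all add: gr act)

end

text \<open>A morphism commutes with the projections to homogeneous components, so its kernel
  contains the components of each of its elements and is graded.\<close>

lemma hmod_ker:
  fixes V :: "('k, 'h, 'v) hmod"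
  assumes V: "is_hmod H V" and W: "is_hmod H W" and f: "is_mor H V W f"
  shows "is_hmod H (ker_obj V W f)" and "is_mor H (ker_obj V W f) V (\<lambda>x. x)"
    and "x \<in> carrier (ker_obj V W f) \<longleftrightarrow> x \<in> carrier V \<and> f x = \<zero>\<^bsub>W\<^esub>"
proof -
  let ?K = "ker_obj V W f"
  have sel: "add ?K = add V" "zero ?K = zero V" "smult ?K = smult V" "act ?K = act V" "gr ?K n = gr V n \<inter> carrier ?K" for n
    by (simp_all add: ker_obj_def)
  have c: "x \<in> carrier ?K \<longleftrightarrow> x \<in> carrier V \<and> f x = \<zero>\<^bsub>W\<^esub>" for x by (simp add: ker_obj_def a_kernel_def')
  have cV: "x \<in> carrier V" if "x \<in> carrier ?K" for x using that by (simp add: c)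
  have mV: "module k V" and mW: "module k W" using V W by simp_all
  interpret V: module k V by (rule mV)
  note fl = mor_linear[OF f]
  note w = module_zero_add[OF mW]
  have ca: "x \<oplus>\<^bsub>V\<^esub> y \<in> carrier ?K" if "x \<in> carrier ?K" "y \<in> carrier ?K" for x y
    using that w by (simp add: c lin_add[OF fl])
  have cz: "\<zero>\<^bsub>V\<^esub> \<in> carrier ?K" by (simp add: c lin_zero[OF mV mW fl])
  have cs: "a \<odot>\<^bsub>V\<^esub> x \<in> carrier ?K" if "a \<in> carrier k" "x \<in> carrier ?K" for a x
    using that w by (simp add: c lin_smult[OF fl])
  have cc: "act V h x \<in> carrier ?K" if "h \<in> carrier H" "x \<in> carrier ?K" for h x
    using that V W lin_zero[OF mW mW hmod_act_linear[OF W that(1)]] by (simp add: c mor_act[OF f])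
  have ch: "hcomp V n x \<in> carrier ?K" if "x \<in> carrier ?K" for n x
    using that V W lin_zero[OF mW mW hcomp_linear[OF W]] by (simp add: c mor_hcomp[OF V W f])
  have cn: "\<ominus>\<^bsub>V\<^esub> x \<in> carrier ?K" if "x \<in> carrier ?K" for x
  proof -
    interpret W: module k W by (rule mW)
    show ?thesis using that by (simp add: c lin_neg[OF mV mW fl])
  qed
  have mK: "module k ?K"
  proof (rule moduleI[OF module.axioms(1)[OF mV] abelian_groupI])
    show "\<exists>y\<in>carrier ?K. y \<oplus>\<^bsub>?K\<^esub> x = \<zero>\<^bsub>?K\<^esub>" if "x \<in> carrier ?K" for x
      by (rule bexI[of _ "\<ominus>\<^bsub>V\<^esub> x"]) (use that cn cV in \<open>simp_all add: sel V.M.l_neg\<close>)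
  qed (simp_all add: sel ca cz cs cV V.M.a_assoc V.M.a_comm V.M.a_lcomm V.smult_l_distr V.smult_r_distr V.smult_assoc1)
  have il: "is_linear k ?K V (\<lambda>x. x)" by (rule linI) (simp_all add: sel cV)
  have into: "is_linear k U ?K g" if "is_linear k U V g" "!!x. x \<in> carrier U ==> g x \<in> carrier ?K" for U :: "('k, 'u, 'z) module_scheme" and g
    by (rule linI) (simp_all add: sel that(2) lin_add[OF that(1)] lin_smult[OF that(1)])
  show K: "is_hmod H ?K"
  proof (rule hmodI[where p = "hcomp V" and D = "degs V", OF mK])
    show "is_linear k ?K ?K (act ?K h)" if h: "h \<in> carrier H" for h
      by (rule into) (use lin_comp[OF il hmod_act_linear[OF V h]] cc[OF h] in \<open>simp_all add: sel\<close>)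
    show "is_linear k H ?K (\<lambda>h. act ?K h v)" if v: "v \<in> carrier ?K" for v
      by (rule into) (use hmod_act_arg[OF V cV[OF v]] cc v in \<open>simp_all add: sel\<close>)
    show "submodule (gr ?K n) k ?K" for n
      by (rule submoduleI'[OF mK]) (use V in \<open>auto simp: sel ca cz cs gr_add gr_smult\<close>)
    show "is_linear k ?K ?K (hcomp V n)" for n
      by (rule into) (use lin_comp[OF il hcomp_linear[OF V]] ch in simp_all)
    show "finsum ?K (\<lambda>n. hcomp V n v) (degs V) = v" if v: "v \<in> carrier ?K" for v
      using lin_finsum[OF mK mV il, of "\<lambda>n. hcomp V n v" "degs V"] ch[OF v] hcomp_sum[OF V cV[OF v]] by simp
    show "hcomp V n v = (if m = n then v else \<zero>\<^bsub>?K\<^esub>)" if "v \<in> gr ?K m" for m n v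
      using that hcomp_same[OF V, of v m n] by (simp add: sel)
  qed (use V cV in \<open>simp_all add: sel act_mult cc ch hcomp_gr\<close>)
  show "is_mor H ?K V (\<lambda>x. x)" by (rule morI[OF il]) (simp_all add: sel)
  show "x \<in> carrier ?K \<longleftrightarrow> x \<in> carrier V \<and> f x = \<zero>\<^bsub>W\<^esub>" by (rule c)
qed

lemma hmod_prod:
  assumes V: "is_hmod H V" and W: "is_hmod H W"
  shows "is_hmod H (prod_obj V W)" and "is_mor H (prod_obj V W) V fst" and "is_mor H (prod_obj V W) W snd"
proof -
  let ?P = "prod_obj V W"
  have mV: "module k V" and mW: "module k W" using V W by simp_all
  interpret V: module k V by (rule mV)
  interpret W: module k W by (rule mW)
  have sel: "carrier ?P = carrier V \<times> carrier W" "(v, w) \<oplus>\<^bsub>?P\<^esub> (v', w') = (v \<oplus>\<^bsub>V\<^esub> v', w \<oplus>\<^bsub>W\<^esub> w')" "\<zero>\<^bsub>?P\<^esub> = (\<zero>\<^bsub>V\<^esub>, \<zero>\<^bsub>W\<^esub>)"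
    "c \<odot>\<^bsub>?P\<^esub> (v, w) = (c \<odot>\<^bsub>V\<^esub> v, c \<odot>\<^bsub>W\<^esub> w)" "act ?P h (v, w) = (act V h v, act W h w)" "gr ?P n = gr V n \<times> gr W n" for v w v' w' c h n
    by (simp_all add: prod_obj_def)
  have sel': "x \<oplus>\<^bsub>?P\<^esub> y = (fst x \<oplus>\<^bsub>V\<^esub> fst y, snd x \<oplus>\<^bsub>W\<^esub> snd y)" "c \<odot>\<^bsub>?P\<^esub> x = (c \<odot>\<^bsub>V\<^esub> fst x, c \<odot>\<^bsub>W\<^esub> snd x)" for x y c
    by (simp_all add: prod_obj_def case_prod_beta)
  have mP: "module k ?P"
  proof (rule moduleI[OF module.axioms(1)[OF mV] abelian_groupI])
    show "\<exists>y\<in>carrier ?P. y \<oplus>\<^bsub>?P\<^esub> x = \<zero>\<^bsub>?P\<^esub>" if "x \<in> carrier ?P" for x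
      by (rule bexI[of _ "(\<ominus>\<^bsub>V\<^esub> fst x, \<ominus>\<^bsub>W\<^esub> snd x)"]) (use that in \<open>auto simp: sel V.M.l_neg W.M.l_neg\<close>)
  qed (auto simp: sel V.M.a_assoc V.M.a_comm V.M.a_lcomm V.smult_l_distr V.smult_r_distr V.smult_assoc1 W.M.a_assoc W.M.a_comm W.M.a_lcomm W.smult_l_distr W.smult_r_distr W.smult_assoc1)
  have f: "is_linear k ?P V fst" by (rule linI) (auto simp: sel)
  have s: "is_linear k ?P W snd" by (rule linI) (auto simp: sel)
  have into: "is_linear k U ?P g" if "is_linear k U V (\<lambda>u. fst (g u))" "is_linear k U W (\<lambda>u. snd (g u))" for U :: "('k, 'u, 'z) module_scheme" and g
    by (rule linI) (use lin_closed[OF that(1)] lin_closed[OF that(2)] in \<open>simp_all add: sel(1) sel' mem_Times_iff prod_eq_iff lin_add[OF that(1)] lin_smult[OF that(1)] lin_add[OF that(2)] lin_smult[OF that(2)]\<close>)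
  have fa: "fst (act ?P h x) = act V h (fst x)" "snd (act ?P h x) = act W h (snd x)" for h x by (cases x, simp add: sel)+
  show P: "is_hmod H ?P"
  proof (rule hmodI[where p = "\<lambda>n x. (hcomp V n (fst x), hcomp W n (snd x))" and D = "degs V \<union> degs W", OF mP])
    show "is_linear k ?P ?P (act ?P h)" if h: "h \<in> carrier H" for h
      by (rule into) (simp_all add: fa lin_comp[OF f hmod_act_linear[OF V h]] lin_comp[OF s hmod_act_linear[OF W h]])
    show "is_linear k H ?P (\<lambda>h. act ?P h v)" if v: "v \<in> carrier ?P" for v
      by (rule into) (use v in \<open>auto simp: fa sel intro: hmod_act_arg[OF V] hmod_act_arg[OF W]\<close>)
    show "is_linear k ?P ?P (\<lambda>x. (hcomp V n (fst x), hcomp W n (snd x)))" for n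
      by (rule into) (simp_all add: lin_comp[OF f hcomp_linear[OF V]] lin_comp[OF s hcomp_linear[OF W]])
    show "submodule (gr ?P n) k ?P" for n
      by (rule submoduleI'[OF mP]) (use V W gr_closed[OF V] gr_closed[OF W] in \<open>auto simp: sel gr_add gr_smult\<close>)
    show "finsum ?P (\<lambda>n. (hcomp V n (fst v), hcomp W n (snd v))) (degs V \<union> degs W) = v" (is "?s = v") if v: "v \<in> carrier ?P" for v
    proof -
      have vc: "fst v \<in> carrier V" "snd v \<in> carrier W" using v by (auto simp: sel)
      have c: "(\<lambda>n. (hcomp V n (fst v), hcomp W n (snd v))) \<in> degs V \<union> degs W \<rightarrow> carrier ?P" using vc V W by (auto simp: sel)
      have "fst ?s = finsum V (\<lambda>n. hcomp V n (fst v)) (degs V \<union> degs W)" using lin_finsum[OF mP mV f c] by simp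
      also have "\<dots> = finsum V (\<lambda>n. hcomp V n (fst v)) (degs V)"
        by (rule finsum_superset[symmetric]) (use V W vc V.M.abelian_group_axioms degs_gr[OF V hcomp_gr[OF V vc(1)]] in auto)
      finally have 1: "fst ?s = fst v" using hcomp_sum[OF V vc(1)] by simp
      have "snd ?s = finsum W (\<lambda>n. hcomp W n (snd v)) (degs V \<union> degs W)" using lin_finsum[OF mP mW s c] by simp
      also have "\<dots> = finsum W (\<lambda>n. hcomp W n (snd v)) (degs W)"
        by (rule finsum_superset[symmetric]) (use V W vc W.M.abelian_group_axioms degs_gr[OF W hcomp_gr[OF W vc(2)]] in auto)
      finally have 2: "snd ?s = snd v" using hcomp_sum[OF W vc(2)] by simp
      show ?thesis using 1 2 by (rule prod_eqI)
    qed
    show "(hcomp V n (fst v), hcomp W n (snd v)) = (if m = n then v else \<zero>\<^bsub>?P\<^esub>)" if "v \<in> gr ?P m" for m n v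
      using that hcomp_same[OF V, of "fst v" m n] hcomp_same[OF W, of "snd v" m n] by (cases v) (auto simp: sel)
  qed (use V W in \<open>auto simp: sel act_mult hcomp_gr\<close>)
  show "is_mor H ?P V fst" by (rule morI[OF f]) (auto simp: sel fa)
  show "is_mor H ?P W snd" by (rule morI[OF s]) (auto simp: sel fa)
qed

lemma hmod_unit_obj: "is_hmod H (unit_obj H j)"
proof -
  let ?I = "unit_obj H j"
  have sel: "carrier ?I = carrier k" "add ?I = add k" "zero ?I = zero k" "smult ?I = mult k" "act ?I h c = cou H h \<otimes>\<^bsub>k\<^esub> c"
    "gr ?I n = (if n = j then carrier k else {\<zero>\<^bsub>k\<^esub>})" for h c n by (simp_all add: unit_obj_def)
  have m: "module k ?I"
    by (rule moduleI[OF module.axioms(1)[OF modH] abelian_groupI]) (auto simp: sel modH.R.a_assoc modH.R.a_comm modH.R.a_lcomm modH.R.l_distr modH.R.r_distr modH.R.m_assoc intro: modH.R.l_neg bexI[of _ "\<ominus>\<^bsub>k\<^esub> _"])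
  show ?thesis
  proof (rule hmodI[where p = "\<lambda>n c. if n = j then c else \<zero>\<^bsub>k\<^esub>" and D = "{j}", OF m])
    show "is_linear k ?I ?I (act ?I h)" if "h \<in> carrier H" for h
      by (rule linI) (use that in \<open>simp_all add: sel modH.R.r_distr modH.R.m_lcomm\<close>)
    show "is_linear k H ?I (\<lambda>h. act ?I h v)" if "v \<in> carrier ?I" for v
      by (rule linI) (use that in \<open>simp_all add: sel cou_add cou_smult modH.R.l_distr modH.R.m_assoc\<close>)
    show "submodule (gr ?I n) k ?I" for n
      by (rule submoduleI'[OF m]) (auto simp: sel)
    show "is_linear k ?I ?I (\<lambda>c. if n = j then c else \<zero>\<^bsub>k\<^esub>)" for n
      by (rule linI) (simp_all add: sel)
    interpret I: module k ?I by (rule m)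
    show "finsum ?I (\<lambda>n. if n = j then v else \<zero>\<^bsub>k\<^esub>) {j} = v" if "v \<in> carrier ?I" for v
      using that by (subst I.M.finsum_insert) (auto simp: sel I.M.r_zero[unfolded sel])
  qed (auto simp: sel cou_mult modH.R.m_assoc)
qed

section \<open>Leibniz rules\<close>

lemma lin_plus_mor: "is_hmod H V ==> is_linear k U V f ==> is_linear k U V g ==> is_linear k U V (\<lambda>x. f x \<oplus>\<^bsub>V\<^esub> g x)"
  by (intro lin_plus) simp_all

lemma rw_add:
  assumes o: "is_hmod H X" "is_hmod H Y" "is_hmod H P" and f: "is_linear k X Y f" and g: "is_linear k X Y g" and t: "t \<in> carrier (X ** P)"
  shows "rw X Y P (\<lambda>x. f x \<oplus>\<^bsub>Y\<^esub> g x) t = rw X Y P f t \<oplus>\<^bsub>Y ** P\<^esub> rw X Y P g t"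
proof (rule tensor_ext[OF _ _ _ rw_linear[OF o(3,1,2) lin_plus_mor[OF o(2) f g]] lin_plus_mor[OF hmod_tensor[OF o(2,3)] rw_linear[OF o(3,1,2) f] rw_linear[OF o(3,1,2) g]] _ t])
  fix x p assume "x \<in> carrier X" "p \<in> carrier P"
  then show "rw X Y P (\<lambda>x. f x \<oplus>\<^bsub>Y\<^esub> g x) (tp H X P x p) = rw X Y P f (tp H X P x p) \<oplus>\<^bsub>Y ** P\<^esub> rw X Y P g (tp H X P x p)"
    using o f g lin_plus_mor[OF o(2) f g] lin_add[OF lin_tp_left[OF _ _ lin_id], of Y P p "f x" "g x"]
    by (simp add: lin_closed[OF f] lin_closed[OF g] del: tensor_sel)
qed (use o in simp_all)

lemma lw_add:
  assumes o: "is_hmod H X" "is_hmod H Y" "is_hmod H P" and f: "is_linear k X Y f" and g: "is_linear k X Y g" and t: "t \<in> carrier (P ** X)"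
  shows "lw P X Y (\<lambda>x. f x \<oplus>\<^bsub>Y\<^esub> g x) t = lw P X Y f t \<oplus>\<^bsub>P ** Y\<^esub> lw P X Y g t"
proof (rule tensor_ext[OF _ _ _ lw_linear[OF o(3,1,2) lin_plus_mor[OF o(2) f g]] lin_plus_mor[OF hmod_tensor[OF o(3,2)] lw_linear[OF o(3,1,2) f] lw_linear[OF o(3,1,2) g]] _ t])
  fix p x assume "p \<in> carrier P" "x \<in> carrier X"
  then show "lw P X Y (\<lambda>x. f x \<oplus>\<^bsub>Y\<^esub> g x) (tp H P X p x) = lw P X Y f (tp H P X p x) \<oplus>\<^bsub>P ** Y\<^esub> lw P X Y g (tp H P X p x)"
    using o f g lin_plus_mor[OF o(2) f g] lin_add[OF lin_tp_right[OF _ _ lin_id], of P Y p "f x" "g x"]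
    by (simp add: lin_closed[OF f] lin_closed[OF g] del: tensor_sel)
qed (use o in simp_all)

text \<open>The hexagon for \<open>Y\<close> and \<open>C ** X\<close> begins with the braiding of
  \<open>Y\<close> with \<open>C\<close>. It undoes the exchange hidden in \<open>rgt\<close>,
  because the braiding is symmetric.\<close>

lemma braid_rgt:
  assumes C: "is_hmod H C" and X: "is_hmod H X" and X': "is_hmod H X'" and Y: "is_hmod H Y" and e: "is_mor H (C ** X) X' e" and s: "s \<in> carrier (C ** Y ** X)"
  shows "braid H Y X' (rgt C Y X X' e s) = lft C X X' Y e (lw C (Y ** X) (X ** Y) (braid H Y X) s)"
proof -
  note [simp] = C X X' Y e s
  define a where "a = Assoc_inv H C Y X s"
  have a [simp]: "a \<in> carrier ((C ** Y) ** X)" by (simp add: a_def)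
  have b: "rw (Y ** C) (C ** Y) X (braid H Y C) (rw (C ** Y) (Y ** C) X (braid H C Y) a) = a"
    by (simp add: rw_rw cong: rw_cong)
  have "braid H Y (C ** X) (sig C Y X s) = Assoc_inv H C X Y (lw C (Y ** X) (X ** Y) (braid H Y X) s)"
    using hexagon_right[of Y C X "sig C Y X s"] by (simp add: sig_def a_def[symmetric] b) (simp add: a_def)
  then show ?thesis
    by (simp add: rgt_def lft_def braid_nat_right[of Y X' "C ** X"])
qed

text \<open>\<open>braid_rgt\<close> read backwards, again by symmetry of the braiding.\<close>

lemma braid_lft:
  assumes C: "is_hmod H C" and X: "is_hmod H X" and X': "is_hmod H X'" and Y: "is_hmod H Y" and e: "is_mor H (C ** X) X' e" and s: "s \<in> carrier (C ** X ** Y)"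
  shows "braid H X' Y (lft C X X' Y e s) = rgt C Y X X' e (lw C (X ** Y) (Y ** X) (braid H X Y) s)"
proof -
  note [simp] = C X X' Y e s
  have "lw C (Y ** X) (X ** Y) (braid H Y X) (lw C (X ** Y) (Y ** X) (braid H X Y) s) = s" by (simp add: lw_lw cong: lw_cong)
  then have "lft C X X' Y e s = braid H Y X' (rgt C Y X X' e (lw C (X ** Y) (Y ** X) (braid H X Y) s))"
    by (simp add: braid_rgt)
  then show ?thesis by simp
qed

section \<open>Actions on a triple product and the associator\<close>

context
  fixes C and A and V and W
  assumes C: "is_hmod H C" and A: "is_hmod H A" and V: "is_hmod H V" and W: "is_hmod H W"
  notes [simp] = C A V W
begin

context
  fixes t assumes t: "t \<in> carrier (C ** (V ** A) ** W)"
  notes [simp] = t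
begin

private abbreviation (input) "as \<equiv> lw C ((V ** A) ** W) (V ** A ** W) (Assoc H V A W)"

text \<open>The fully left-nested form of \<open>t\<close>, to which the pentagon for
  \<open>C\<close>, \<open>V\<close>, \<open>A\<close>, \<open>W\<close> is applied.\<close>

private definition "u1 = rw (C ** V ** A) ((C ** V) ** A) W (Assoc_inv H C V A) (Assoc_inv H C (V ** A) W t)"

private lemma u1: "u1 \<in> carrier (((C ** V) ** A) ** W)" by (simp add: u1_def)

private lemma u1_Assoc: "Assoc_inv H C V (A ** W) (as t) = Assoc H (C ** V) A W u1"
proof -
  have "rw ((C ** V) ** A) (C ** V ** A) W (Assoc H C V A) u1 = Assoc_inv H C (V ** A) W t"
    unfolding u1_def by (simp add: rw_rw cong: rw_cong)
  then have "as t = Assoc H C V (A ** W) (Assoc H (C ** V) A W u1)"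
    using Assoc_pentagon[of C V A W u1] by (simp add: u1)
  then show ?thesis by (simp add: u1)
qed

text \<open>The associator respects the action of \<open>C\<close> on each of the three factors.
  This is the case of \<open>V\<close>. The cases of \<open>A\<close> and \<open>W\<close> follow;
  the former needs a further pentagon after \<open>C\<close> has been exchanged with
  \<open>V\<close>, the latter \<open>sig_comp_right\<close>.\<close>

lemma lft_Assoc:
  assumes e: "is_mor H (C ** V) V e"
  shows "lft C V V (A ** W) e (as t) = Assoc H V A W (lft C (V ** A) (V ** A) W (lft C V V A e) t)"
proof -
  note [simp] = e u1
  have "lft C (V ** A) (V ** A) W (lft C V V A e) t = rw ((C ** V) ** A) (V ** A) W (rw (C ** V) V A e) u1"
    by (simp add: lft_def[abs_def] u1_def rw_rw)
  then show ?thesis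
    by (simp add: Assoc_nat(1)[of "C ** V" A W V A W] lft_def[of C V V "A ** W"] u1_Assoc)
qed

lemma rgt_lft_Assoc:
  assumes e: "is_mor H (C ** A) A e"
  shows "rgt C V (A ** W) (A ** W) (lft C A A W e) (as t) = Assoc H V A W (lft C (V ** A) (V ** A) W (rgt C V A A e) t)"
proof -
  note [simp] = e u1
  \<comment> \<open>In \<open>u2\<close> the factor \<open>C\<close> has been moved past
    \<open>V\<close>; \<open>u3\<close> is the same element bracketed so that \<open>C ** A\<close>
    stands together.\<close>
  define u2 where "u2 = rw ((C ** V) ** A) ((V ** C) ** A) W (rw (C ** V) (V ** C) A (braid H C V)) u1"
  define u3 where "u3 = Assoc H V (C ** A) W (rw ((V ** C) ** A) (V ** C ** A) W (Assoc H V C A) u2)"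
  have u2 [simp]: "u2 \<in> carrier (((V ** C) ** A) ** W)" by (simp add: u2_def)
  have u3 [simp]: "u3 \<in> carrier (V ** (C ** A) ** W)" by (simp add: u3_def)
  have s: "rw ((V ** C) ** A) (V ** C ** A) W (Assoc H V C A) u2 = rw (C ** V ** A) (V ** C ** A) W (sig C V A) (Assoc_inv H C (V ** A) W t)"
    by (simp add: u2_def u1_def rw_rw sig_def[abs_def] lin_comp[OF Assoc_inv_linear rw_linear])
  have "lw V ((C ** A) ** W) (C ** A ** W) (Assoc H C A W) u3 = Assoc H V C (A ** W) (Assoc H (V ** C) A W u2)"
    unfolding u3_def by (rule Assoc_pentagon) simp_all
  also have "\<dots> = sig C V (A ** W) (as t)"
    by (simp add: u2_def Assoc_nat(1)[of "C ** V" A W "V ** C" A W] sig_def u1_Assoc)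
  finally have "rgt C V (A ** W) (A ** W) (lft C A A W e) (as t) = lw V (C ** A ** W) (A ** W) (lft C A A W e) (lw V ((C ** A) ** W) (C ** A ** W) (Assoc H C A W) u3)"
    by (simp add: rgt_def)
  also have "\<dots> = lw V ((C ** A) ** W) (A ** W) (rw (C ** A) A W e) u3"
    by (subst lw_lw) (simp_all add: lft_def cong: lw_cong)
  also have "\<dots> = Assoc H V A W (rw (V ** C ** A) (V ** A) W (lw V (C ** A) A e) (rw (C ** V ** A) (V ** C ** A) W (sig C V A) (Assoc_inv H C (V ** A) W t)))"
    by (simp add: u3_def Assoc_nat(2)[of V "C ** A" W V A W] s)
  also have "\<dots> = Assoc H V A W (lft C (V ** A) (V ** A) W (rgt C V A A e) t)"
    by (simp add: lft_def rgt_def[abs_def] rw_rw)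
  finally show ?thesis .
qed

lemma rgt_rgt_Assoc:
  assumes e: "is_mor H (C ** W) W e"
  shows "rgt C V (A ** W) (A ** W) (rgt C A W W e) (as t) = Assoc H V A W (rgt C (V ** A) W W e t)"
proof -
  note [simp] = e
  have "lw C (V ** A ** W) ((V ** A) ** W) (Assoc_inv H V A W) (as t) = t" by (simp add: lw_lw cong: lw_cong)
  then have r: "lw V (C ** A ** W) (A ** C ** W) (sig C A W) (sig C V (A ** W) (as t)) = Assoc H V A (C ** W) (sig C (V ** A) W t)"
    using sig_comp_right[of C V A W "as t"] by simp
  have "rgt C V (A ** W) (A ** W) (rgt C A W W e) (as t) = lw V (A ** C ** W) (A ** W) (lw A (C ** W) W e) (lw V (C ** A ** W) (A ** C ** W) (sig C A W) (sig C V (A ** W) (as t)))"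
    by (simp add: rgt_def[abs_def] lw_lw)
  also have "\<dots> = Assoc H V A W (rgt C (V ** A) W W e t)"
    unfolding r by (simp add: rgt_def Assoc_nat(3)[of V A "C ** W" V A W])
  finally show ?thesis .
qed

end

context
  fixes eV eA eW lV rV lW
  assumes e: "is_mor H (C ** V) V eV" "is_mor H (C ** A) A eA" "is_mor H (C ** W) W eW"
    and m: "is_mor H (A ** V) V lV" "is_mor H (V ** A) V rV" "is_mor H (A ** W) W lW"
    and sy: "!!t. t \<in> carrier (V ** A) ==> lV (braid H V A t) = rV t"
    and LV: "!!s. s \<in> carrier (C ** A ** V) ==> eV (lw C (A ** V) V lV s) = lV (lft C A A V eA s \<oplus>\<^bsub>A ** V\<^esub> rgt C A V V eV s)"
    and LW: "!!s. s \<in> carrier (C ** A ** W) ==> eW (lw C (A ** W) W lW s) = lW (lft C A A W eA s \<oplus>\<^bsub>A ** W\<^esub> rgt C A W W eW s)"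
  notes [simp] = e m
begin

text \<open>The left rule carried over along the braiding, which is compatible with the action of \<open>C\<close> by a hexagon.\<close>

lemma leibniz_right:
  assumes s: "s \<in> carrier (C ** V ** A)"
  shows "eV (lw C (V ** A) V rV s) = rV (lft C V V A eV s \<oplus>\<^bsub>V ** A\<^esub> rgt C V A A eA s)"
proof -
  note [simp] = s
  have VA: "module k (V ** A)" by simp
  then interpret VA: module k "V ** A" .
  let ?s = "lw C (V ** A) (A ** V) (braid H V A) s"
  have cl: "lft C V V A eV s \<in> carrier (V ** A)" "rgt C V A A eA s \<in> carrier (V ** A)" by simp_all
  have "lw C (V ** A) V rV s = lw C (V ** A) V (\<lambda>t. lV (braid H V A t)) s" by (rule lw_cong) (simp_all add: sy)
  also have "\<dots> = lw C (A ** V) V lV ?s" by (simp add: lw_lw)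
  finally have "eV (lw C (V ** A) V rV s) = lV (lft C A A V eA ?s \<oplus>\<^bsub>A ** V\<^esub> rgt C A V V eV ?s)" by (simp add: LV del: tensor_sel)
  also have "\<dots> = lV (braid H V A (rgt C V A A eA s) \<oplus>\<^bsub>A ** V\<^esub> braid H V A (lft C V V A eV s))"
    by (simp add: braid_lft[of C V V A eV] braid_rgt[of C A A V eA] del: tensor_sel)
  also have "\<dots> = lV (braid H V A (rgt C V A A eA s \<oplus>\<^bsub>V ** A\<^esub> lft C V V A eV s))"
    by (simp only: lin_add[OF braid_linear[OF V A] cl(2,1)])
  also have "\<dots> = rV (rgt C V A A eA s \<oplus>\<^bsub>V ** A\<^esub> lft C V V A eV s)"
    by (rule sy) (rule VA.M.a_closed[OF cl(2,1)])
  finally show ?thesis unfolding VA.M.a_comm[OF cl] .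
qed

text \<open>The map \<open>b\<close>, whose image is the submodule divided out, intertwines
  \<open>f\<close> with the sum of the actions of \<open>c\<close> on the three factors of
  \<open>(V ** A) ** W\<close>. So \<open>f (b r)\<close> is \<open>b\<close> of another
  element.\<close>

lemma leibniz_balanced:
  assumes c: "c \<in> carrier C" and r: "r \<in> carrier ((V ** A) ** W)"
  defines "f \<equiv> \<lambda>n. lft C V V W eV (tp H C (V ** W) c n) \<oplus>\<^bsub>V ** W\<^esub> rgt C V W W eW (tp H C (V ** W) c n)"
    and "b \<equiv> \<lambda>t. rw (V ** A) V W rV t \<ominus>\<^bsub>V ** W\<^esub> lw V (A ** W) W lW (Assoc H V A W t)"
  shows "f (b r) \<in> b ` carrier ((V ** A) ** W)"
proof -
  let ?R = "(V ** A) ** W" and ?T = "V ** W"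
  let ?a = "lw C ?R (V ** A ** W) (Assoc H V A W)"
  define t where "t = tp H C ?R c r"
  have t [simp]: "t \<in> carrier (C ** ?R)" using c r by (simp add: t_def del: tensor_sel)
  have mT: "module k ?T" and mR: "module k ?R" by simp_all
  interpret T: module k ?T by (rule mT)
  interpret R: module k ?R by (rule mR)
  \<comment> \<open>\<open>p1\<close>, \<open>p2\<close> and \<open>p3\<close> are the results of
    letting \<open>c\<close> act on the factor \<open>V\<close>, \<open>A\<close> and
    \<open>W\<close> of \<open>r\<close>, respectively.\<close>
  define p1 where "p1 = lft C (V ** A) (V ** A) W (lft C V V A eV) t"
  define p2 where "p2 = lft C (V ** A) (V ** A) W (rgt C V A A eA) t"
  define p3 where "p3 = rgt C (V ** A) W W eW t"
  have p [simp]: "p1 \<in> carrier ?R" "p2 \<in> carrier ?R" "p3 \<in> carrier ?R" by (simp_all add: p1_def p2_def p3_def)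
  have rl: "is_linear k ?R ?T (rw (V ** A) V W rV)" and ll: "is_linear k ?R ?T (\<lambda>t. lw V (A ** W) W lW (Assoc H V A W t))"
    by (simp, rule lin_comp[OF Assoc_linear lw_linear], simp_all)
  note lp = lin_plus_mor[OF _ lft_linear rgt_linear]
  \<comment> \<open>On the part with \<open>rV\<close> the action on the left factor splits by the
    Leibniz rule for \<open>rV\<close>; on the part with \<open>lW\<close> the action on the right
    factor splits by the rule for \<open>lW\<close>. The remaining two contributions pass through by
    naturality.\<close>
  have "lft C V V W eV (lw C ?R ?T (rw (V ** A) V W rV) t) = rw (C ** V ** A) V W (\<lambda>s. eV (lw C (V ** A) V rV s)) (Assoc_inv H C (V ** A) W t)" (is "?l = _")
    by (simp add: lft_def Assoc_inv_nat(2)[of C "V ** A" W C V W] rw_rw)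
  also have "\<dots> = rw (C ** V ** A) V W (\<lambda>s. rV (lft C V V A eV s \<oplus>\<^bsub>V ** A\<^esub> rgt C V A A eA s)) (Assoc_inv H C (V ** A) W t)"
    by (rule rw_cong[OF _ _ _ leibniz_right]) simp_all
  also have "\<dots> = rw (V ** A) V W rV (rw (C ** V ** A) (V ** A) W (\<lambda>s. lft C V V A eV s \<oplus>\<^bsub>V ** A\<^esub> rgt C V A A eA s) (Assoc_inv H C (V ** A) W t))"
    by (rule rw_rw[symmetric]) (simp_all add: lp del: tensor_sel)
  also have "\<dots> = rw (V ** A) V W rV (p1 \<oplus>\<^bsub>?R\<^esub> p2)"
    by (subst rw_add) (simp_all add: p1_def p2_def lft_def[of C "V ** A" "V ** A" W] del: tensor_sel)
  finally have 1: "?l = rw (V ** A) V W rV (p1 \<oplus>\<^bsub>?R\<^esub> p2)" .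
  have 2: "rgt C V W W eW (lw C ?R ?T (rw (V ** A) V W rV) t) = rw (V ** A) V W rV p3"
    by (simp add: rgt_def p3_def sig_nat2[of C "V ** A" W V] lw_rw)
  have 3: "lft C V V W eV (lw C (V ** A ** W) ?T (lw V (A ** W) W lW) (?a t)) = lw V (A ** W) W lW (Assoc H V A W p1)"
    unfolding p1_def lft_Assoc[OF t e(1), symmetric] by (simp add: lft_def Assoc_inv_nat(3)[of C V "A ** W" C V W] lw_rw)
  have "rgt C V W W eW (lw C (V ** A ** W) ?T (lw V (A ** W) W lW) t') = lw V (C ** A ** W) W (\<lambda>s. eW (lw C (A ** W) W lW s)) (sig C V (A ** W) t')" if t' [simp]: "t' \<in> carrier (C ** V ** A ** W)" for t'
    by (simp add: rgt_def sig_nat3[of C V "A ** W" W] lw_lw)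
  then have "rgt C V W W eW (lw C (V ** A ** W) ?T (lw V (A ** W) W lW) (?a t)) = lw V (C ** A ** W) W (\<lambda>s. eW (lw C (A ** W) W lW s)) (sig C V (A ** W) (?a t))" (is "?l = _")
    by simp
  also have "\<dots> = lw V (C ** A ** W) W (\<lambda>s. lW (lft C A A W eA s \<oplus>\<^bsub>A ** W\<^esub> rgt C A W W eW s)) (sig C V (A ** W) (?a t))"
    by (rule lw_cong[OF _ _ _ LW]) simp_all
  also have "\<dots> = lw V (A ** W) W lW (lw V (C ** A ** W) (A ** W) (\<lambda>s. lft C A A W eA s \<oplus>\<^bsub>A ** W\<^esub> rgt C A W W eW s) (sig C V (A ** W) (?a t)))"
    by (rule lw_lw[symmetric]) (simp_all add: lp del: tensor_sel)
  also have "\<dots> = lw V (A ** W) W lW (rgt C V (A ** W) (A ** W) (lft C A A W eA) (?a t) \<oplus>\<^bsub>V ** A ** W\<^esub> rgt C V (A ** W) (A ** W) (rgt C A W W eW) (?a t))"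
    by (subst lw_add) (simp_all add: rgt_def[of C V "A ** W" "A ** W"] del: tensor_sel)
  also have "\<dots> = lw V (A ** W) W lW (Assoc H V A W (p2 \<oplus>\<^bsub>?R\<^esub> p3))"
    unfolding rgt_lft_Assoc[OF t e(2)] rgt_rgt_Assoc[OF t e(3)] p2_def[symmetric] p3_def[symmetric]
    by (simp only: lin_add[OF Assoc_linear[OF V A W] p(2,3)])
  finally have 4: "?l = lw V (A ** W) W lW (Assoc H V A W (p2 \<oplus>\<^bsub>?R\<^esub> p3))" .
  have lt: "lw C ?R ?T (rw (V ** A) V W rV) t = tp H C ?T c (rw (V ** A) V W rV r)"
    "lw C (V ** A ** W) ?T (lw V (A ** W) W lW) (?a t) = tp H C ?T c (lw V (A ** W) W lW (Assoc H V A W r))"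
    using c r by (simp_all add: t_def)
  have fl: "is_linear k ?T ?T f"
    unfolding f_def by (rule lin_plus_mor; (rule lin_comp[OF lin_tp_right[OF _ _ lin_id]])?) (use c in simp_all)
  let ?s = "p1 \<oplus>\<^bsub>?R\<^esub> p2 \<oplus>\<^bsub>?R\<^esub> p3"
  have s: "?s \<in> carrier ?R" using p by (intro R.M.a_closed)
  have f1: "f (rw (V ** A) V W rV r) = rw (V ** A) V W rV ?s"
    unfolding f_def lt[symmetric] 1 2 by (simp only: lin_add[OF rl] p R.M.a_closed)
  have f2: "f (lw V (A ** W) W lW (Assoc H V A W r)) = lw V (A ** W) W lW (Assoc H V A W ?s)"
    unfolding f_def lt[symmetric] 3 4 by (simp only: lin_add[OF ll] p R.M.a_closed R.M.a_assoc)
  have "f (b r) = f (rw (V ** A) V W rV r) \<ominus>\<^bsub>?T\<^esub> f (lw V (A ** W) W lW (Assoc H V A W r))"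
    unfolding b_def by (rule lin_minus[OF mT mT fl lin_closed[OF rl r] lin_closed[OF ll r]])
  also have "\<dots> = b ?s" unfolding f1 f2 b_def ..
  finally show ?thesis using s by (rule image_eqI)
qed

end

end

text \<open>The commutation relation in \<open>end(V)\<close>, evaluated on \<open>V\<close>.\<close>

lemma leibniz_left:
  assumes C: "is_hmod H C" and A: "is_hmod H A" and V: "is_hmod H V" and l: "is_mor H (A ** V) V l"
    and p: "is_mor H C (ihom H V V) p" and d: "is_mor H C (ihom H A A) d"
    and br: "!!y. y \<in> carrier (C ** A) ==> bra V (tmap H (ihom H V V) (ihom H V V) p (zeta H A V V l) y) = zeta H A V V l (ev H A A (rw C (ihom H A A) A d y))"
    and s: "s \<in> carrier (C ** A ** V)"
  defines "eV \<equiv> \<lambda>s. ev H V V (rw C (ihom H V V) V p s)" and "eA \<equiv> \<lambda>s. ev H A A (rw C (ihom H A A) A d s)"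
  shows "eV (lw C (A ** V) V l s) = l (lft C A A V eA s \<oplus>\<^bsub>A ** V\<^esub> rgt C A V V eV s)"
proof -
  note [simp] = C A V l p d
  let ?E = "ihom H V V"
  have eV [simp]: "is_mor H (C ** V) V eV" and eA [simp]: "is_mor H (C ** A) A eA"
    unfolding eV_def eA_def by (rule mor_comp[OF mor_rw mor_ev]; simp)+
  have lh [simp]: "is_mor H A ?E (zeta H A V V l)" by (rule mor_zeta) simp_all
  have mV: "module k V" by simp
  interpret V: module k V by (rule mV)
  \<comment> \<open>The bracketing \<open>(C ** A) ** V\<close> is used because \<open>br\<close>
    relates elements of \<open>end(V)\<close> indexed by \<open>C ** A\<close>, which are to be
    evaluated on \<open>V\<close>.\<close>
  let ?F = "\<lambda>r. eV (lw C (A ** V) V l (Assoc H C A V r))"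
  let ?G = "\<lambda>r. l (lft C A A V eA (Assoc H C A V r)) \<oplus>\<^bsub>V\<^esub> l (rgt C A V V eV (Assoc H C A V r))"
  have lF: "is_linear k ((C ** A) ** V) V ?F" by (rule lin_comp[OF lin_comp[OF Assoc_linear lw_linear]]) simp_all
  have lG: "is_linear k ((C ** A) ** V) V ?G"
    by (rule lin_plus_mor; (rule lin_comp[OF lin_comp[OF Assoc_linear lft_linear]] lin_comp[OF lin_comp[OF Assoc_linear rgt_linear]])?) simp_all
  have "?F r = ?G r" if "r \<in> carrier ((C ** A) ** V)" for r
  proof (rule tensor_ext[OF _ _ _ lF lG _ that])
    fix y v assume y [simp]: "y \<in> carrier (C ** A)" and v [simp]: "v \<in> carrier V"
    let ?r = "tp H (C ** A) V y v"
    have E: "module k ?E" by simp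
    have ty: "tmap H ?E ?E p (zeta H A V V l) y \<in> carrier (?E ** ?E)"
      by (rule mor_closed[OF mor_tmap y]) simp_all
    have b: "braid H ?E ?E (tmap H ?E ?E p (zeta H A V V l) y) = tmap H ?E ?E (zeta H A V V l) p (braid H C A y)"
      by (rule braid_tmap) simp_all
    have zl: "ev H V V (rw A ?E V (zeta H A V V l) t) = l t" if "t \<in> carrier (A ** V)" for t
      by (rule ev_zeta) (use that in simp_all)
    have i1: "ev H V V (tp H ?E V (icomp H V V V (tmap H ?E ?E p (zeta H A V V l) y)) v) = ?F ?r"
      by (rule icomp_action) (simp_all add: eV_def zl)
    \<comment> \<open>In the braided term \<open>C\<close> acts on \<open>V\<close> after it has
      been moved past \<open>A\<close>; by \<open>sig_Assoc\<close> this is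
      \<open>rgt\<close>.\<close>
    have i2: "ev H V V (tp H ?E V (icomp H V V V (tmap H ?E ?E (zeta H A V V l) p (braid H C A y))) v) = l (rgt C A V V eV (Assoc H C A V ?r))"
    proof -
      have "ev H V V (tp H ?E V (icomp H V V V (tmap H ?E ?E (zeta H A V V l) p (braid H C A y))) v) = l (lw A (C ** V) V eV (Assoc H A C V (tp H (A ** C) V (braid H C A y) v)))"
        by (rule icomp_action) (simp_all add: eV_def zl)
      then show ?thesis by (simp add: rgt_def sig_Assoc)
    qed
    have i3: "ev H V V (tp H ?E V (zeta H A V V l (eA y)) v) = l (lft C A A V eA (Assoc H C A V ?r))"
      using zl[of "tp H A V (eA y) v"] by (simp add: lft_def mor_closed[OF eA])
    have ic: "icomp H V V V (tmap H ?E ?E p (zeta H A V V l) y) \<in> carrier ?E" "icomp H V V V (tmap H ?E ?E (zeta H A V V l) p (braid H C A y)) \<in> carrier ?E"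
      using mor_closed[OF mor_icomp[OF V V V] ty] mor_closed[OF mor_icomp[OF V V V] braid_closed[OF _ _ ty]] by (simp_all add: b)
    have "ev H V V (tp H ?E V (bra V (tmap H ?E ?E p (zeta H A V V l) y)) v) = ?F ?r \<ominus>\<^bsub>V\<^esub> l (rgt C A V V eV (Assoc H C A V ?r))"
      unfolding bra_def b i1[symmetric] i2[symmetric]
      by (rule lin_minus[OF E mV lin_comp[OF lin_tp_left[OF E mV lin_id v] ev_linear[OF V V]] ic])
    then have "?F ?r \<ominus>\<^bsub>V\<^esub> l (rgt C A V V eV (Assoc H C A V ?r)) = l (lft C A A V eA (Assoc H C A V ?r))"
      using br[OF y] i3 by (simp add: eA_def)
    moreover have "?F ?r \<in> carrier V" "l (rgt C A V V eV (Assoc H C A V ?r)) \<in> carrier V"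
      by (simp_all add: mor_closed[OF eV] mor_closed[OF l])
    ultimately show "?F ?r = ?G ?r"
      by (metis V.M.minus_eq V.M.a_assoc V.M.l_neg V.M.r_zero V.M.a_inv_closed)
  qed simp_all
  from this[of "Assoc_inv H C A V s"] s
  have "eV (lw C (A ** V) V l s) = l (lft C A A V eA s) \<oplus>\<^bsub>V\<^esub> l (rgt C A V V eV s)" by simp
  also have "\<dots> = l (lft C A A V eA s \<oplus>\<^bsub>A ** V\<^esub> rgt C A V V eV s)"
    using s by (simp add: lin_add[OF mor_linear[OF l]] del: tensor_sel)
  finally show ?thesis .
qed

section \<open>Induced endomorphisms of a quotient\<close>

lemma mor_minus:
  assumes X: "is_hmod H X" and Y: "is_hmod H Y" and f: "is_mor H X Y f" and g: "is_mor H X Y g"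
  shows "is_mor H X Y (\<lambda>x. f x \<ominus>\<^bsub>Y\<^esub> g x)"
proof (rule morI)
  have mY: "module k Y" using Y by simp
  show "is_linear k X Y (\<lambda>x. f x \<ominus>\<^bsub>Y\<^esub> g x)" by (intro lin_diff mY mor_linear[OF f] mor_linear[OF g])
  show "f v \<ominus>\<^bsub>Y\<^esub> g v \<in> gr Y n" if "v \<in> gr X n" for n v
    unfolding a_minus_def by (intro gr_add[OF Y] gr_neg[OF Y] mor_gr[OF f that] mor_gr[OF g that])
  show "f (act X h v) \<ominus>\<^bsub>Y\<^esub> g (act X h v) = act Y h (f v \<ominus>\<^bsub>Y\<^esub> g v)" if "h \<in> carrier H" "v \<in> carrier X" for h v
    using that by (simp add: mor_act[OF f] mor_act[OF g] lin_minus[OF mY mY hmod_act_linear[OF Y that(1)] mor_closed[OF f that(2)] mor_closed[OF g that(2)]])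
qed

text \<open>An endomorphism \<open>M\<close> induced by \<open>L\<close> on a quotient satisfies
  \<open>q \<circ> L = M \<circ> q\<close>. The two sides are given by \<open>ipost\<close> and
  \<open>ipre\<close>; both depend on \<open>L\<close> or \<open>M\<close> through morphisms of
  internal homs, so the relation can be tested by evaluation.\<close>

definition ipost where "ipost V q L = (\<lambda>t\<in>carrier V. q (L t))"
definition ipre where "ipre T q M = (\<lambda>t\<in>carrier T. M (q t))"

context
  fixes V and T and X and q
  assumes V: "is_hmod H V" and T: "is_hmod H T" and X: "is_hmod H X" and q: "is_mor H T X q"
  notes [simp] = V T X q
begin

lemma mor_ipost: "is_mor H (ihom H V T) (ihom H V X) (ipost V q)"
proof (rule morI)
  have c: "(ipost V q) L \<in> carrier (ihom H V X)" if "L \<in> carrier (ihom H V T)" for L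
    unfolding ipost_def by (rule ihom_restrict[OF V X lin_comp[OF ihom_linear[OF V T that] mor_linear[OF q]]])
  show "is_linear k (ihom H V T) (ihom H V X) (ipost V q)"
  proof (rule lin_into_ihom[OF V X c])
    fix t assume t: "t \<in> carrier V"
    show "is_linear k (ihom H V T) X (\<lambda>L. (ipost V q) L t)"
      using lin_comp[OF lin_eval[OF V T t] mor_linear[OF q]] t by (simp add: ipost_def)
  qed simp_all
  show "(ipost V q) L \<in> gr (ihom H V X) n" if L: "L \<in> gr (ihom H V T) n" for n L
    using L c mor_gr[OF q] gr_closed[OF V] by (auto simp: ihom_gr ipost_def)
  show "(ipost V q) (act (ihom H V T) h L) = act (ihom H V X) h ((ipost V q) L)" if h: "h \<in> carrier H" and L: "L \<in> carrier (ihom H V T)" for h L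
  proof (rule ihom_eqI[OF V X c act_closed[OF _ h c[OF L]]])
    fix t assume t: "t \<in> carrier V"
    show "(ipost V q) (act (ihom H V T) h L) t = act (ihom H V X) h ((ipost V q) L) t"
      using t h ihom_closed[OF V T L]
      by (simp add: ihom_act_app ipost_def lin_swD[OF mor_linear[OF q]] mor_act[OF q])
  qed (use h L in simp_all)
qed

lemma ev_ipost:
  assumes L: "L \<in> carrier (ihom H V T)" and t: "t \<in> carrier V"
  shows "ev H V X (tp H (ihom H V X) V ((ipost V q) L) t) = q (ev H V T (tp H (ihom H V T) V L t))"
  using L t mor_closed[OF mor_ipost L] ihom_closed[OF V T L]
  by (simp add: ev_tp ipost_def lin_swP[OF mor_linear[OF q]] mor_act[OF q])

lemma mor_ipre: "is_mor H (ihom H X X) (ihom H T X) (ipre T q)"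
proof (rule morI)
  have c: "(ipre T q) M \<in> carrier (ihom H T X)" if "M \<in> carrier (ihom H X X)" for M
    unfolding ipre_def by (rule ihom_restrict[OF T X lin_comp[OF mor_linear[OF q] ihom_linear[OF X X that]]])
  show "is_linear k (ihom H X X) (ihom H T X) (ipre T q)"
  proof (rule lin_into_ihom[OF T X c])
    fix t assume t: "t \<in> carrier T"
    show "is_linear k (ihom H X X) X (\<lambda>L. (ipre T q) L t)"
      using lin_eval[OF X X mor_closed[OF q t]] t by (simp add: ipre_def)
  qed simp_all
  show "(ipre T q) L \<in> gr (ihom H T X) n" if L: "L \<in> gr (ihom H X X) n" for n L
    using L c mor_gr[OF q] gr_closed[OF T] by (auto simp: ihom_gr ipre_def)
  show "(ipre T q) (act (ihom H X X) h L) = act (ihom H T X) h ((ipre T q) L)" if h: "h \<in> carrier H" and L: "L \<in> carrier (ihom H X X)" for h L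
  proof (rule ihom_eqI[OF T X c act_closed[OF _ h c[OF L]]])
    fix t assume t: "t \<in> carrier T"
    show "(ipre T q) (act (ihom H X X) h L) t = act (ihom H T X) h ((ipre T q) L) t"
      using t h by (simp add: ihom_act_app ipre_def mor_act[OF q] mor_closed[OF q])
  qed (use h L in simp_all)
qed

lemma ev_ipre:
  assumes M: "M \<in> carrier (ihom H X X)" and t: "t \<in> carrier T"
  shows "ev H T X (tp H (ihom H T X) T ((ipre T q) M) t) = ev H X X (tp H (ihom H X X) X M (q t))"
  using M t mor_closed[OF mor_ipre M] mor_closed[OF q] by (simp add: ev_tp ipre_def mor_act[OF q])

end

text \<open>\<open>X\<close> is any record with the graded module structure of the quotient of
  \<open>T\<close> by \<open>N\<close>, since \<open>tensor_over\<close> extends the quotient by its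
  two module actions. \<open>N\<close> is given as the image of a morphism, which makes it graded
  and stable under \<open>H\<close>.\<close>

context
  fixes R and T and X :: "('k, 'h, 't set, 'm3) hmod_scheme" and \<rho> and N
  assumes R: "is_hmod H R" and T: "is_hmod H T" and \<rho>: "is_mor H R T \<rho>" and N: "N = \<rho> ` carrier R"
    and X: "carrier X = carrier (quot_obj T N)" "zero X = zero (quot_obj T N)" "add X = add (quot_obj T N)"
      "smult X = smult (quot_obj T N)" "act X = act (quot_obj T N)" "gr X = gr (quot_obj T N)"
begin

private lemma mdT: "module k T" and mR: "module k R" using T R by simp_all
interpretation T: module k T by (rule mdT)

private abbreviation (input) "q \<equiv> a_r_coset T N"

private lemma Nc: "n \<in> N ==> n \<in> carrier T" using mor_closed[OF \<rho>] by (auto simp: N)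

private lemma N_sub: "submodule N k T"
proof (rule submoduleI'[OF mdT])
  interpret R: module k R by (rule mR)
  show "\<zero>\<^bsub>T\<^esub> \<in> N" unfolding N lin_zero[OF mR mdT mor_linear[OF \<rho>], symmetric] by (rule imageI) simp
  show "x \<oplus>\<^bsub>T\<^esub> y \<in> N" if "x \<in> N" "y \<in> N" for x y
    using that unfolding N by (auto simp: lin_add[OF mor_linear[OF \<rho>], symmetric])
  show "c \<odot>\<^bsub>T\<^esub> x \<in> N" if "c \<in> carrier k" "x \<in> N" for c x
    using that unfolding N by (auto simp: lin_smult[OF mor_linear[OF \<rho>], symmetric])
qed (use Nc in blast)

private lemma N_act: "h \<in> carrier H ==> n \<in> N ==> act T h n \<in> N"
  using R unfolding N by (auto simp: mor_act[OF \<rho>, symmetric])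

interpretation Q: abelian_subgroup N T
  by (rule abelian_subgroupI3[OF additive_subgroup.intro T.M.abelian_group_axioms]) (use N_sub in \<open>simp add: submodule_def\<close>)

private lemma q_eq: "x \<in> carrier T ==> y \<in> carrier T ==> q x = q y \<longleftrightarrow> x \<ominus>\<^bsub>T\<^esub> y \<in> N"
  using Q.a_rcos_self[of x] Q.a_rcos_module[of y x] Q.a_repr_independence'[of x y]
  unfolding a_minus_def by metis

private lemma q_crep: assumes x: "x \<in> carrier T" shows "crep (q x) \<in> carrier T" "q (crep (q x)) = q x"
proof -
  have "crep (q x) \<in> q x" unfolding crep_def by (rule someI[of "\<lambda>y. y \<in> q x" x]) (rule Q.a_rcos_self[OF x])
  then show "crep (q x) \<in> carrier T" "q (crep (q x)) = q x"
    using Q.a_elemrcos_carrier[OF x] Q.a_repr_independence'[OF _ x] by simp_all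
qed

private lemma q_lin: assumes f: "is_linear k T T f" and fN: "!!n. n \<in> N ==> f n \<in> N" and x: "x \<in> carrier T" and y: "y \<in> carrier T" and e: "q x = q y"
  shows "q (f x) = q (f y)"
  using fN[of "x \<ominus>\<^bsub>T\<^esub> y"] e x y lin_closed[OF f] by (simp add: q_eq lin_minus[OF mdT mdT f])

private lemma quot:
  shows "carrier X = q ` carrier T"
    and "x \<in> carrier T ==> y \<in> carrier T ==> q x \<oplus>\<^bsub>X\<^esub> q y = q (x \<oplus>\<^bsub>T\<^esub> y)"
    and "c \<in> carrier k ==> x \<in> carrier T ==> c \<odot>\<^bsub>X\<^esub> q x = q (c \<odot>\<^bsub>T\<^esub> x)"
    and "\<zero>\<^bsub>X\<^esub> = q \<zero>\<^bsub>T\<^esub>"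
    and "h \<in> carrier H ==> x \<in> carrier T ==> act X h (q x) = q (act T h x)"
    and "gr X n = q ` gr T n"
    and "x \<in> carrier T ==> y \<in> carrier T ==> q x = q y ==> q (hcomp T n x) = q (hcomp T n y)"
proof -
  show "carrier X = q ` carrier T" by (auto simp: X quot_obj_def A_RCOSETS_def')
  show "q x \<oplus>\<^bsub>X\<^esub> q y = q (x \<oplus>\<^bsub>T\<^esub> y)" if "x \<in> carrier T" "y \<in> carrier T"
    using that by (simp add: X quot_obj_def Q.a_rcos_sum)
  show "c \<odot>\<^bsub>X\<^esub> q x = q (c \<odot>\<^bsub>T\<^esub> x)" if "c \<in> carrier k" "x \<in> carrier T"
    unfolding X quot_obj_def
    using q_lin[OF lin_smul[OF mdT lin_id that(1)] _ q_crep(1)[OF that(2)] that(2) q_crep(2)[OF that(2)]] that(1) N_sub by (simp add: submodule_def submodule_axioms_def)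
  show "\<zero>\<^bsub>X\<^esub> = q \<zero>\<^bsub>T\<^esub>" using T.M.a_coset_add_zero[of N] Nc by (simp add: X quot_obj_def subset_iff)
  show "act X h (q x) = q (act T h x)" if "h \<in> carrier H" "x \<in> carrier T"
    unfolding X quot_obj_def
    using q_lin[OF hmod_act_linear[OF T that(1)] N_act[OF that(1)] q_crep(1)[OF that(2)] that(2) q_crep(2)[OF that(2)]] by simp
  show "gr X n = q ` gr T n" by (simp add: X quot_obj_def)
  \<comment> \<open>As the image of a morphism \<open>N\<close> contains the homogeneous components
    of its elements, so these components descend to the quotient.\<close>
  have "hcomp T n m \<in> N" if "m \<in> N" for m
    using that R unfolding N by (auto simp: mor_hcomp[OF R T \<rho>, symmetric])
  then show "q (hcomp T n x) = q (hcomp T n y)" if "x \<in> carrier T" "y \<in> carrier T" "q x = q y"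
    by (rule q_lin[OF hcomp_linear[OF T] _ that])
qed

lemma hmod_quot: "is_hmod H X"
  by (rule hmod_image[OF T quot])

lemma mor_quot: "is_mor H T X q"
  by (rule mor_image[OF T quot])

context
  notes [simp] = R T \<rho> hmod_quot mor_quot
begin

private abbreviation (input) "eT \<equiv> ihom H T T"
private abbreviation (input) "eQ \<equiv> ihom H X X"

private lemma q_zero: "x \<in> carrier T ==> q x = \<zero>\<^bsub>X\<^esub> \<longleftrightarrow> x \<in> N"
proof -
  assume x: "x \<in> carrier T"
  have "\<ominus>\<^bsub>T\<^esub> \<zero>\<^bsub>T\<^esub> = \<zero>\<^bsub>T\<^esub>" by (metis T.M.r_neg T.M.l_zero T.M.a_inv_closed T.M.zero_closed)
  then have "x \<ominus>\<^bsub>T\<^esub> \<zero>\<^bsub>T\<^esub> = x" unfolding a_minus_def using T.M.r_zero[OF x] by metis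
  then show "q x = \<zero>\<^bsub>X\<^esub> \<longleftrightarrow> x \<in> N"
    unfolding quot(4) q_eq[OF x T.M.zero_closed] by metis
qed

private abbreviation (input) "g \<equiv> \<lambda>s. q (ev H T T (lw eT R T \<rho> s))"

private lemma mor_g: "is_mor H (eT ** R) X g"
  by (rule mor_comp[OF mor_comp[OF mor_lw mor_ev] mor_quot]) simp_all

text \<open>
  A kernel, hence an object of the category. Its elements are the \<open>L\<close> all of whose translates map \<open>N\<close> to
  \<open>N\<close> under evaluation; these \<open>L\<close> preserve \<open>N\<close> also as plain functions.
\<close>

private definition "stab = ker_obj eT (ihom H R X) (zeta H eT R X g)"

private lemma mor_zg: "is_mor H eT (ihom H R X) (zeta H eT R X g)"
  by (rule mor_zeta[OF _ _ _ mor_g]) simp_all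

private lemma stab: "is_hmod H stab" "is_mor H stab eT (\<lambda>x. x)" "L \<in> carrier stab \<longleftrightarrow> L \<in> carrier eT \<and> zeta H eT R X g L = \<zero>\<^bsub>ihom H R X\<^esub>"
  unfolding stab_def by (rule hmod_ker[OF _ _ mor_zg]; simp)+

text \<open>The formula for \<zeta> evaluates the translates of \<open>L\<close> by the first legs
  of the inverse of \<phi>; this is why the criterion quantifies over \<open>h\<close>.\<close>

private lemma stab_I:
  assumes L: "L \<in> carrier eT" and e: "!!h n. h \<in> carrier H ==> n \<in> N ==> ev H T T (tp H eT T (act eT h L) n) \<in> N"
  shows "L \<in> carrier stab"
  unfolding stab(3)
proof (intro conjI L, rule ihom_eqI[OF R hmod_quot])
  show "zeta H eT R X g L \<in> carrier (ihom H R X)" by (rule mor_closed[OF mor_zg L])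
  show "\<zero>\<^bsub>ihom H R X\<^esub> \<in> carrier (ihom H R X)" by (rule mor_zero_closed) simp
  fix r assume r: "r \<in> carrier R"
  have z: "g (tp H eT R (act eT a L) (act R b r)) = \<zero>\<^bsub>X\<^esub>" if "a \<in> carrier H" "b \<in> carrier H" for a b
  proof -
    have "\<rho> (act R b r) \<in> N" unfolding N by (rule imageI) (use that r in simp)
    then have "ev H T T (tp H eT T (act eT a L) (\<rho> (act R b r))) \<in> N" by (rule e[OF that(1)])
    then show ?thesis using that r L Nc by (simp add: q_zero)
  qed
  have "swPi X (\<lambda>a b c. g (tp H eT R (act eT a L) (act R (b \<otimes> qbeta H \<otimes> antip H c) r))) \<in> {\<zero>\<^bsub>X\<^esub>}"
    by (rule swP_in(2)) (simp_all add: z module_zero_add[OF hmod_module[OF hmod_quot]])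
  then show "zeta H eT R X g L r = \<zero>\<^bsub>ihom H R X\<^esub> r"
    using r by (simp add: zeta_app ihom_zero)
qed

text \<open>\<open>stab\<close> is a subobject, so all translates of \<open>L\<close> satisfy the
  kernel condition. By \<open>ev_zeta\<close> their evaluations map \<open>N\<close> to
  \<open>N\<close>, and \<open>ev_expand\<close> recovers \<open>L n\<close> from these
  evaluations.\<close>

private lemma stab_D:
  assumes L: "L \<in> carrier stab" and n: "n \<in> N" shows "L n \<in> N"
proof -
  have Lc: "L \<in> carrier eT" using L by (simp add: stab)
  have e: "ev H T T (tp H eT T (act eT h L) n') \<in> N" if h: "h \<in> carrier H" and n': "n' \<in> N" for h n'
  proof -
    obtain r where r: "r \<in> carrier R" "n' = \<rho> r" using n' unfolding N by auto
    have hL: "act stab h L \<in> carrier stab" by (rule act_closed[OF stab(1) h L])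
    have eq: "act stab h L = act eT h L" by (simp add: stab_def ker_obj_def)
    have hc: "act eT h L \<in> carrier eT" and z: "zeta H eT R X g (act eT h L) = \<zero>\<^bsub>ihom H R X\<^esub>" using hL unfolding eq stab(3) by simp_all
    have "g (tp H eT R (act eT h L) r) = ev H R X (rw eT (ihom H R X) R (zeta H eT R X g) (tp H eT R (act eT h L) r))"
      by (rule ev_zeta[OF _ _ _ mor_g, symmetric]) (use hc r in simp_all)
    also have "\<dots> = ev H R X (tp H (ihom H R X) R \<zero>\<^bsub>ihom H R X\<^esub> r)" using hc r z by (simp add: mor_linear[OF mor_zg])
    also have "\<dots> = \<zero>\<^bsub>X\<^esub>"
      by (rule lin_zero[OF _ _ lin_comp[OF lin_tp_left[OF _ _ lin_id] ev_linear]]) (use r in simp_all)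
    finally show ?thesis using hc r by (simp add: q_zero mor_closed[OF \<rho>])
  qed
  show ?thesis
    unfolding ev_expand[OF T T Lc Nc[OF n], symmetric]
    by (rule swP_in(2)[OF submodule_zero[OF mdT N_sub] submodule_add[OF mdT N_sub]]) (use e N_act n in simp_all)
qed

private abbreviation (input) "ind \<equiv> induced_end T N"

private lemma ind_q: assumes L: "L \<in> carrier stab" and t: "t \<in> carrier T" shows "ind L (q t) = q (L t)"
proof -
  have Lc: "L \<in> carrier eT" using L by (simp add: stab)
  have "q t \<in> a_rcosets\<^bsub>T\<^esub> N" using quot(1) t by (auto simp: X quot_obj_def)
  then show ?thesis using q_lin[OF ihom_linear[OF T T Lc] stab_D[OF L] q_crep(1)[OF t] t q_crep(2)[OF t]] by (simp add: induced_end_def)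
qed

private lemma XE: "x \<in> carrier X ==> (!!t. t \<in> carrier T ==> x = q t ==> P) ==> P" using quot(1) by auto

private lemma eQ_eqI: "M \<in> carrier eQ ==> M' \<in> carrier eQ ==> (!!t. t \<in> carrier T ==> M (q t) = M' (q t)) ==> M = M'"
  by (rule ihom_eqI[OF hmod_quot hmod_quot]) (simp_all, erule XE, simp)

private lemma q_closed: "t \<in> carrier T ==> q t \<in> carrier X" by (rule mor_closed[OF mor_quot])

private lemma ind_closed: assumes L: "L \<in> carrier stab" shows "ind L \<in> carrier eQ"
  unfolding ihom_carrier[OF hmod_quot hmod_quot]
proof (intro conjI linI)
  have Lc: "L \<in> carrier eT" using L by (simp add: stab)
  note c = ihom_closed[OF T T Lc]
  show "ind L \<in> extensional (carrier X)" unfolding induced_end_def X quot_obj_def by simp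
  show "ind L x \<in> carrier X" if x: "x \<in> carrier X" for x
  proof (rule XE[OF x])
    fix t assume t: "t \<in> carrier T" "x = q t"
    show ?thesis unfolding t(2) ind_q[OF L t(1)] by (rule q_closed[OF c[OF t(1)]])
  qed
  show "ind L (x \<oplus>\<^bsub>X\<^esub> y) = ind L x \<oplus>\<^bsub>X\<^esub> ind L y" if x: "x \<in> carrier X" and y: "y \<in> carrier X" for x y
  proof (rule XE[OF x], rule XE[OF y])
    fix s t assume st: "s \<in> carrier T" "t \<in> carrier T" "x = q s" "y = q t"
    show ?thesis
      unfolding st(3,4) quot(2)[OF st(1,2)] ind_q[OF L st(1)] ind_q[OF L st(2)] ind_q[OF L T.M.a_closed[OF st(1,2)]]
        quot(2)[OF c[OF st(1)] c[OF st(2)]] lin_add[OF ihom_linear[OF T T Lc] st(1,2)] ..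
  qed
  show "ind L (a \<odot>\<^bsub>X\<^esub> x) = a \<odot>\<^bsub>X\<^esub> ind L x" if a: "a \<in> carrier k" and x: "x \<in> carrier X" for a x
  proof (rule XE[OF x])
    fix t assume t: "t \<in> carrier T" "x = q t"
    show ?thesis
      unfolding t(2) quot(3)[OF a t(1)] ind_q[OF L t(1)] ind_q[OF L T.smult_closed[OF a t(1)]] quot(3)[OF a c[OF t(1)]]
        lin_smult[OF ihom_linear[OF T T Lc] a t(1)] ..
  qed
qed

text \<open>On \<open>stab\<close> the choice of representatives made by \<open>induced_end\<close>
  does not matter, so linearity, degree and equivariance can be checked on the classes
  \<open>q t\<close>.\<close>

private lemma mor_ind: "is_mor H stab eQ ind"
proof (rule morI)
  note sc = act_closed[OF stab(1)]
  have mS: "module k stab" using stab(1) by simp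
  interpret S: module k stab by (rule mS)
  have sel: "add stab = add eT" "smult stab = smult eT" "act stab = act eT" by (simp_all add: stab_def ker_obj_def)
  have eTc: "L \<in> carrier eT" if "L \<in> carrier stab" for L using that by (simp add: stab)
  show "is_linear k stab eQ ind"
  proof (rule lin_into_ihom[OF hmod_quot hmod_quot ind_closed _ mS])
    fix x assume "x \<in> carrier X"
    then obtain t where t: "t \<in> carrier T" "x = q t" by (rule XE)
    have "is_linear k stab X (\<lambda>L. q (L t))"
      by (rule lin_comp[OF lin_comp[OF mor_linear[OF stab(2)] lin_eval[OF T T t(1)]] mor_linear[OF mor_quot]])
    then show "is_linear k stab X (\<lambda>L. ind L x)"
      by (rule lin_cong[OF _ mS]) (simp add: t ind_q)
  qed
  show "ind L \<in> gr eQ n" if L: "L \<in> gr stab n" for n L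
  proof -
    have Ls: "L \<in> carrier stab" by (rule gr_closed[OF stab(1) L])
    have g: "L t \<in> gr T (m + n)" if "t \<in> gr T m" for t m
      using mor_gr[OF stab(2) L] that by (simp add: ihom_gr)
    show ?thesis unfolding ihom_gr[OF hmod_quot hmod_quot] quot(6)
      using ind_closed[OF Ls] g gr_closed[OF T] by (auto simp: ind_q[OF Ls])
  qed
  show "ind (act stab h L) = act eQ h (ind L)" if h: "h \<in> carrier H" and L: "L \<in> carrier stab" for h L
  proof (rule eQ_eqI[OF ind_closed[OF sc[OF h L]] act_closed[OF _ h ind_closed[OF L]]])
    fix t assume t: "t \<in> carrier T"
    show "ind (act stab h L) (q t) = act eQ h (ind L) (q t)"
      using ind_q[OF sc[OF h L] t] t h L ihom_closed[OF T T eTc[OF L]]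
      by (simp add: sel ihom_act_app q_closed quot(5) ind_q lin_swD[OF mor_linear[OF mor_quot]])
  qed simp
qed

private lemmas [simp] = stab(1,2) mor_ind

private lemma ind_action:
  assumes s: "s \<in> carrier (stab ** T)"
  shows "ev H X X (rw stab eQ X ind (lw stab T X q s)) = q (ev H T T (rw stab eT T (\<lambda>x. x) s))"
proof (rule tensor_ext[OF _ _ _ lin_comp[OF lin_comp[OF lw_linear rw_linear] ev_linear] lin_comp[OF lin_comp[OF rw_linear ev_linear] mor_linear[OF mor_quot]] _ s])
  fix L t assume L: "L \<in> carrier stab" and t: "t \<in> carrier T"
  have Lc: "L \<in> carrier eT" using L by (simp add: stab)
  show "ev H X X (rw stab eQ X ind (lw stab T X q (tp H stab T L t))) = q (ev H T T (rw stab eT T (\<lambda>x. x) (tp H stab T L t)))"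
    using t L Lc ihom_closed[OF T T Lc]
    by (simp add: mor_closed[OF mor_ind] mor_linear[OF stab(2)] q_closed ev_tp quot(5) ind_q lin_swP[OF mor_linear[OF mor_quot]])
qed simp_all

private abbreviation (input) "post \<equiv> ipost T q"
private abbreviation (input) "pre \<equiv> ipre T q"

text \<open>Both composites are compared as morphisms into \<open>hom(T, X)\<close>, where
  \<open>ind_action\<close> moves \<open>q\<close> past one evaluation after the other.\<close>

private lemma icomp_ind:
  assumes y: "y \<in> carrier (stab ** stab)"
  shows "post (icomp H T T T (tmap H eT eT (\<lambda>x. x) (\<lambda>x. x) y)) = pre (icomp H X X X (tmap H eQ eQ ind ind y))"
proof (rule mor_ev_ext[OF _ T hmod_quot mor_comp[OF mor_comp[OF mor_tmap mor_icomp] mor_ipost[OF T T hmod_quot mor_quot]] mor_comp[OF mor_comp[OF mor_tmap mor_icomp] mor_ipre[OF T T hmod_quot mor_quot]] _ y])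
  fix y t assume y [simp]: "y \<in> carrier (stab ** stab)" and t [simp]: "t \<in> carrier T"
  let ?a = "\<lambda>s. ev H T T (rw stab eT T (\<lambda>x. x) s)" and ?b = "\<lambda>s. ev H X X (rw stab eQ X ind s)"
  let ?s = "Assoc H stab stab T (tp H (stab ** stab) T y t)"
  have al: "is_linear k (stab ** T) T ?a" "is_linear k (stab ** X) X ?b"
    by (rule lin_comp[OF rw_linear ev_linear]; simp)+
  have i: "icomp H T T T (tmap H eT eT (\<lambda>x. x) (\<lambda>x. x) y) \<in> carrier eT" "icomp H X X X (tmap H eQ eQ ind ind y) \<in> carrier eQ"
    by (rule mor_closed[OF mor_icomp mor_closed[OF mor_tmap y]]; simp)+
  have "ev H T X (tp H (ihom H T X) T (pre (icomp H X X X (tmap H eQ eQ ind ind y))) t) = ?b (lw stab (stab ** X) X ?b (Assoc H stab stab X (tp H (stab ** stab) X y (q t))))"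
    unfolding ev_ipre[OF T T hmod_quot mor_quot i(2) t] by (rule icomp_action) (simp_all add: q_closed)
  also have "Assoc H stab stab X (tp H (stab ** stab) X y (q t)) = lw stab (stab ** T) (stab ** X) (lw stab T X q) ?s"
    using Assoc_nat(3)[of stab stab T stab stab X q "tp H (stab ** stab) T y t"] by simp
  also have "lw stab (stab ** X) X ?b \<dots> = lw stab T X q (lw stab (stab ** T) T ?a ?s)"
    using al by (simp add: lw_lw ind_action cong: lw_cong)
  also have "?b \<dots> = q (?a (lw stab (stab ** T) T ?a ?s))"
    using al by (simp add: ind_action)
  also have "\<dots> = ev H T X (tp H (ihom H T X) T (post (icomp H T T T (tmap H eT eT (\<lambda>x. x) (\<lambda>x. x) y))) t)"
    unfolding ev_ipost[OF T T hmod_quot mor_quot i(1) t] by (rule arg_cong[OF icomp_action[symmetric]]) simp_all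
  finally show "ev H T X (tp H (ihom H T X) T (post (icomp H T T T (tmap H eT eT (\<lambda>x. x) (\<lambda>x. x) y))) t) =
    ev H T X (tp H (ihom H T X) T (pre (icomp H X X X (tmap H eQ eQ ind ind y))) t)" ..
qed simp_all

private lemma bra_ind:
  assumes y: "y \<in> carrier (stab ** stab)"
  shows "post (bra T (tmap H eT eT (\<lambda>x. x) (\<lambda>x. x) y)) = pre (bra X (tmap H eQ eQ ind ind y))"
proof -
  have b: "braid H stab stab y \<in> carrier (stab ** stab)" using y by simp
  have i: "icomp H T T T (tmap H eT eT (\<lambda>x. x) (\<lambda>x. x) r) \<in> carrier eT" "icomp H X X X (tmap H eQ eQ ind ind r) \<in> carrier eQ" if "r \<in> carrier (stab ** stab)" for r
    by (rule mor_closed[OF mor_icomp mor_closed[OF mor_tmap that]]; simp)+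
  have t: "braid H eT eT (tmap H eT eT (\<lambda>x. x) (\<lambda>x. x) y) = tmap H eT eT (\<lambda>x. x) (\<lambda>x. x) (braid H stab stab y)"
    "braid H eQ eQ (tmap H eQ eQ ind ind y) = tmap H eQ eQ ind ind (braid H stab stab y)"
    by (rule braid_tmap; simp add: y del: tensor_sel)+
  have m: "module k eT" "module k eQ" "module k (ihom H T X)" by simp_all
  show ?thesis
    unfolding bra_def t lin_minus[OF m(1,3) mor_linear[OF mor_ipost[OF T T hmod_quot mor_quot]] i(1)[OF y] i(1)[OF b]]
      lin_minus[OF m(2,3) mor_linear[OF mor_ipre[OF T T hmod_quot mor_quot]] i(2)[OF y] i(2)[OF b]] icomp_ind[OF y] icomp_ind[OF b] ..
qed

lemma ibracket_induced:
  assumes L: "L \<in> carrier (ihom H T T)" and e: "!!h n. h \<in> carrier H ==> n \<in> N ==> ev H T T (tp H (ihom H T T) T (act (ihom H T T) h L) n) \<in> N"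
  shows "ibracket H X (induced_end T N L) (induced_end T N L) = induced_end T N (ibracket H T L L)"
proof -
  have S [simp]: "L \<in> carrier stab" by (rule stab_I[OF L e])
  let ?y = "tp H stab stab L L"
  have y: "?y \<in> carrier (stab ** stab)" by (simp del: tensor_sel)
  have t: "tmap H eT eT (\<lambda>x. x) (\<lambda>x. x) ?y = tp H eT eT L L" "tmap H eQ eQ ind ind ?y = tp H eQ eQ (ind L) (ind L)"
    by (simp_all add: tmap_tp mor_linear[OF stab(2)])
  define B where "B = ibracket H T L L"
  define B' where "B' = ibracket H X (ind L) (ind L)"
  have B: "B \<in> carrier eT" unfolding B_def ibracket_bra using L by (simp del: tensor_sel)
  have B': "B' \<in> carrier eQ" unfolding B'_def ibracket_bra using ind_closed[OF S] by (simp del: tensor_sel)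
  have pp: "post B = pre B'" using bra_ind[OF y] unfolding t B_def B'_def ibracket_bra .
  have p: "q (B t) = B' (q t)" if "t \<in> carrier T" for t
    using that fun_cong[OF pp, of t] by (simp add: ipost_def ipre_def)
  \<comment> \<open>By \<open>p\<close> the class \<open>q (B t)\<close> depends on
    \<open>q t\<close> only, so the representative chosen by \<open>crep\<close> inside
    \<open>ind B\<close> does not matter.\<close>
  have "B' Z = ind B Z" for Z
  proof (cases "Z \<in> carrier X")
    case True
    then obtain t where t: "t \<in> carrier T" "Z = q t" by (rule XE)
    have "Z \<in> a_rcosets\<^bsub>T\<^esub> N" using True by (simp add: X quot_obj_def)
    then have "ind B Z = q (B (crep (q t)))" using t by (simp add: induced_end_def)
    also have "\<dots> = B' Z" using p[OF q_crep(1)[OF t(1)]] q_crep(2)[OF t(1)] t by simp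
    finally show ?thesis ..
  next
    \<comment> \<open>Outside the carrier both functions take the value \<open>undefined\<close>,
      the one as an element of an internal hom, the other by its definition.\<close>
    case False
    then have "B' Z = undefined" using B' extensional_arb[of B' "carrier X" Z] by (simp add: ihom_carrier)
    moreover have "ind B Z = undefined" using False by (simp add: induced_end_def X quot_obj_def)
    ultimately show ?thesis by simp
  qed
  then show ?thesis unfolding B_def B'_def by blast
qed

end

end

section \<open>Connections\<close>

lemma mor_cong:
  assumes X: "is_hmod H X" and f: "is_mor H X Y f" and e: "!!x. x \<in> carrier X ==> g x = f x"
  shows "is_mor H X Y g"
proof (rule morI)
  show "is_linear k X Y g" by (rule lin_cong[OF mor_linear[OF f] hmod_module[OF X] e[symmetric]])
  show "g v \<in> gr Y n" if "v \<in> gr X n" for n v using mor_gr[OF f that] e[OF gr_closed[OF X that]] by simp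
  show "g (act X h v) = act Y h (g v)" if "h \<in> carrier H" "v \<in> carrier X" for h v
    using mor_act[OF f that] e that X by simp
qed

text \<open>For \<open>d\<close>, which is given as a morphism into the kernel \<open>der\<close>
  and is used below as one into \<open>end(A)\<close>.\<close>

lemma mor_from_ker:
  assumes "is_mor H U (ker_obj V W f) g" shows "is_mor H U V g"
proof (rule morI)
  have c: "g x \<in> carrier (ker_obj V W f)" if "x \<in> carrier U" for x by (rule mor_closed[OF assms that])
  show "is_linear k U V g"
    by (rule linI) (use c lin_add[OF mor_linear[OF assms]] lin_smult[OF mor_linear[OF assms]] in \<open>simp_all add: ker_obj_def a_kernel_def'\<close>)
  show "g v \<in> gr V n" if "v \<in> gr U n" for n v using mor_gr[OF assms that] by (simp add: ker_obj_def)
qed (use mor_act[OF assms] in \<open>simp add: ker_obj_def\<close>)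

context
  fixes A :: "('k, 'h, 'a) halg" and d :: "'k \<Rightarrow> 'a \<Rightarrow> 'a" and V :: "('k, 'h, 'a, 'v) hbimod"
  assumes A: "is_hmod H A" and d: "is_mor H (unit_obj H 1) (ihom H A A) d" and V: "is_hmod H V" and l: "is_mor H (A ** V) V (lact V)"
  notes [simp] = A d V l hmod_unit_obj
begin

private abbreviation (input) "I1 \<equiv> unit_obj H 1"
private abbreviation (input) "cV \<equiv> ihom H V V"
private abbreviation (input) "cA \<equiv> ihom H A A"
private abbreviation (input) "cP \<equiv> prod_obj cV I1"
private abbreviation (input) "lh \<equiv> zeta H A V V (lact V)"

private definition "con_defect = tlift cV (\<lambda>(L, c) a. ibracket H V L (lh a) \<ominus>\<^bsub>cV\<^esub> lh (ev H A A (tp H cA A (d c) a)))"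

private lemma lh: "is_mor H A cV lh" by (rule mor_zeta) simp_all

private lemma P: "is_hmod H cP" "is_mor H cP cV fst" "is_mor H cP I1 snd" by (rule hmod_prod; simp)+

private lemmas [simp] = lh P

private lemma con_eq: "con H A d V = ker_obj cP (ihom H A cV) (zeta H cP A cV con_defect)"
  by (simp add: con_def con_defect_def Let_def lhat_def iend_def case_prod_beta')

private lemma bra_mor': "is_mor H (cV ** cV) cV (bra V)"
  unfolding bra_def[abs_def] by (rule mor_minus[OF _ _ mor_icomp mor_comp[OF mor_braid mor_icomp]]) simp_all

private lemma dsnd: "is_mor H cP cA (\<lambda>p. d (snd p))" by (rule mor_comp[OF P(3) d])

text \<open>A composite of morphisms that agrees on the carrier with the map defining
  \<open>con\<close>. Through it \<open>con\<close> is recognised as the kernel of a morphism, and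
  hence as an object of the category.\<close>

private abbreviation (input) "con_mor \<equiv> \<lambda>s. bra V (tmap H cV cV fst lh s) \<ominus>\<^bsub>cV\<^esub> lh (ev H A A (rw cP cA A (\<lambda>p. d (snd p)) s))"

private lemma con_mor: "is_mor H (cP ** A) cV con_mor"
proof -
  have 1: "is_mor H (cP ** A) cV (\<lambda>s. bra V (tmap H cV cV fst lh s))" by (rule mor_comp[OF mor_tmap bra_mor']) simp_all
  have 2: "is_mor H (cP ** A) cV (\<lambda>s. lh (ev H A A (rw cP cA A (\<lambda>p. d (snd p)) s)))"
    by (rule mor_comp[OF mor_comp[OF mor_rw mor_ev] lh]) (simp_all add: dsnd)
  show ?thesis by (rule mor_minus[OF _ _ 1 2]) simp_all
qed

private lemma con_mor_tp:
  assumes "p \<in> carrier cP" "a \<in> carrier A"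
  shows "con_mor (tp H cP A p a) = ibracket H V (fst p) (lh a) \<ominus>\<^bsub>cV\<^esub> lh (ev H A A (tp H cA A (d (snd p)) a))"
  using assms by (simp add: tmap_tp ibracket_bra mor_linear[OF dsnd])

private lemma con_defect_tp:
  "bilin k cP A cV (\<lambda>(L, c) a. ibracket H V L (lh a) \<ominus>\<^bsub>cV\<^esub> lh (ev H A A (tp H cA A (d c) a)))" (is "bilin _ _ _ _ ?F")
proof (rule bilinI)
  have mP: "module k cP" and mA: "module k A" by simp_all
  have F: "?F p a = con_mor (tp H cP A p a)" if "p \<in> carrier cP" "a \<in> carrier A" for p a
    unfolding con_mor_tp[OF that] by (cases p) (simp only: prod.case fst_conv snd_conv)
  show "is_linear k cP cV (\<lambda>p. ?F p a)" if "a \<in> carrier A" for a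
    by (rule lin_cong[OF lin_comp[OF lin_tp_left[OF mP mA lin_id that] mor_linear[OF con_mor]] mP]) (rule F[OF _ that, symmetric])
  show "is_linear k A cV (?F p)" if "p \<in> carrier cP" for p
    by (rule lin_cong[OF lin_comp[OF lin_tp_right[OF mP mA lin_id that] mor_linear[OF con_mor]] mA]) (rule F[OF that, symmetric])
qed

private lemma con_defect:
  assumes s: "s \<in> carrier (cP ** A)" shows "con_defect s = con_mor s"
proof (rule tensor_ext[OF _ _ _ _ mor_linear[OF con_mor] _ s])
  show "is_linear k (cP ** A) cV con_defect" unfolding con_defect_def by (rule tlift_tensor_linear[OF _ _ _ con_defect_tp]) simp_all
  show "con_defect (tp H cP A p a) = con_mor (tp H cP A p a)" if "p \<in> carrier cP" "a \<in> carrier A" for p a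
    unfolding con_defect_def con_mor_tp[OF that] tlift_tp[OF hmod_module[OF P(1)] hmod_module[OF A] hmod_module[OF hmod_ihom[OF V V]] con_defect_tp that]
    by (cases p) (simp only: prod.case fst_conv snd_conv)
qed simp_all

private lemma mor_con_defect: "is_mor H (cP ** A) cV con_defect"
  by (rule mor_cong[OF _ con_mor con_defect]) simp

private lemma mor_zc: "is_mor H cP (ihom H A cV) (zeta H cP A cV con_defect)"
  by (rule mor_zeta[OF _ _ _ mor_con_defect]) simp_all

lemma hmod_con: "is_hmod H (con H A d V)"
  unfolding con_eq by (rule hmod_ker(1)[OF _ _ mor_zc]) simp_all

private lemma mor_con: "is_mor H (con H A d V) cP (\<lambda>x. x)"
  unfolding con_eq by (rule hmod_ker(2)[OF _ _ mor_zc]) simp_all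

lemma mor_con_fst: "is_mor H (con H A d V) cV fst" by (rule mor_comp[OF mor_con P(2)])

lemma mor_con_snd: "is_mor H (con H A d V) I1 snd" by (rule mor_comp[OF mor_con P(3)])

text \<open>Membership in \<open>con\<close> says that a curried map vanishes at \<open>x\<close>.
  Evaluating it by \<open>ev_zeta\<close> gives back the commutation relation itself for each
  \<open>a\<close>.\<close>

lemma con_leibniz:
  assumes x: "x \<in> carrier (con H A d V)" and a: "a \<in> carrier A"
  shows "bra V (tp H cV cV (fst x) (lh a)) = lh (ev H A A (tp H cA A (d (snd x)) a))"
proof -
  have xP: "x \<in> carrier cP" and z: "zeta H cP A cV con_defect x = \<zero>\<^bsub>ihom H A cV\<^esub>"
    using x hmod_ker(3)[OF _ _ mor_zc, of x] unfolding con_eq by simp_all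
  have m: "module k cV" "module k (ihom H A cV)" "module k A" by simp_all
  interpret E: module k cV by (rule m)
  have t: "tp H cP A x a \<in> carrier (cP ** A)" using xP a by (simp del: tensor_sel)
  have "con_mor (tp H cP A x a) = ev H A cV (rw cP (ihom H A cV) A (zeta H cP A cV con_defect) (tp H cP A x a))"
    unfolding con_defect[OF t, symmetric] by (rule ev_zeta[OF _ _ _ mor_con_defect t, symmetric]) simp_all
  also have "\<dots> = ev H A cV (tp H (ihom H A cV) A \<zero>\<^bsub>ihom H A cV\<^esub> a)" using xP a z by (simp add: mor_linear[OF mor_zc])
  also have "\<dots> = \<zero>\<^bsub>cV\<^esub>"
    by (rule lin_zero[OF m(2,1) lin_comp[OF lin_tp_left[OF m(2,3) lin_id a] ev_linear]]) simp_all
  finally have e: "bra V (tp H cV cV (fst x) (lh a)) \<ominus>\<^bsub>cV\<^esub> lh (ev H A A (tp H cA A (d (snd x)) a)) = \<zero>\<^bsub>cV\<^esub>"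
    unfolding con_mor_tp[OF xP a] ibracket_bra .
  have c: "bra V (tp H cV cV (fst x) (lh a)) \<in> carrier cV" "lh (ev H A A (tp H cA A (d (snd x)) a)) \<in> carrier cV"
    using mor_closed[OF P(2) xP] mor_closed[OF dsnd xP] a mor_closed[OF lh] by (simp_all del: tensor_sel)
  show ?thesis using e c by (simp add: E.M.minus_eq) (metis E.M.minus_equality E.M.minus_minus E.M.a_inv_closed)
qed

end

section \<open>The curvature identity\<close>

lemma curv_boxplus:
  fixes A :: "('k, 'h, 'a) halg" and d :: "'k \<Rightarrow> 'a \<Rightarrow> 'a" and V :: "('k, 'h, 'a, 'v) hbimod" and W :: "('k, 'h, 'a, 'w) hbimod"
  assumes dc: "is_diff_calc H A d" and bV: "is_bimod_sym H A V" and bW: "is_bimod_sym H A W"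
    and L: "(L, \<one>\<^bsub>k\<^esub>) \<in> carrier (con H A d V)" and L': "(L', \<one>\<^bsub>k\<^esub>) \<in> carrier (con H A d W)"
  shows "curv H (tensor_over H A V W) (boxplus H A V W (L, \<one>\<^bsub>k\<^esub>) (L', \<one>\<^bsub>k\<^esub>)) =
    induced_end (V ** W) (bal_rel H A V W)
      (itensor H V V W W (tp H (iend H V) (iend H W) (curv H V (L, \<one>\<^bsub>k\<^esub>)) (iunit H W))
        \<oplus>\<^bsub>iend H (V ** W)\<^esub>
       itensor H V V W W (tp H (iend H V) (iend H W) (iunit H V) (curv H W (L', \<one>\<^bsub>k\<^esub>))))"
proof -
  let ?T = "V ** W" and ?R = "(V ** A) ** W" and ?N = "bal_rel H A V W" and ?I = "unit_obj H 1"
  have A: "is_hmod H A" using dc by (simp add: is_diff_calc_def is_halg_com_def is_halg_def)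
  have V: "is_hmod H V" and W: "is_hmod H W" and lV: "is_mor H (A ** V) V (lact V)" and lW: "is_mor H (A ** W) W (lact W)"
    and rV: "is_mor H (V ** A) V (ract V)" and sV: "!!t. t \<in> carrier (V ** A) ==> lact V (braid H V A t) = ract V t"
    using bV bW by (simp_all add: is_bimod_sym_def is_bimod_def del: tensor_sel)
  have d: "is_mor H ?I (ihom H A A) d"
    using dc mor_from_ker unfolding is_diff_calc_def der_def Let_def iend_def by blast
  note [simp] = A V W lV lW rV d hmod_unit_obj
  let ?EV = "ihom H V V" and ?EW = "ihom H W W" and ?EA = "ihom H A A" and ?ET = "ihom H ?T ?T"
  let ?\<rho> = "\<lambda>t. rw (V ** A) V W (ract V) t \<ominus>\<^bsub>?T\<^esub> lw V (A ** W) W (lact W) (Assoc H V A W t)"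
  have \<rho>: "is_mor H ?R ?T ?\<rho>" by (rule mor_minus[OF _ _ mor_rw mor_comp[OF mor_Assoc mor_lw]]) simp_all
  have N: "?N = ?\<rho> ` carrier ?R" by (simp only: bal_rel_def rw_def lw_def)
  let ?KV = "con H A d V" and ?KW = "con H A d W"
  have K: "is_hmod H ?KV" "is_hmod H ?KW" by (rule hmod_con; simp)+
  have Kf: "is_mor H ?KV ?EV fst" "is_mor H ?KW ?EW fst" by (rule mor_con_fst; simp)+
  have Ks: "is_mor H ?KV ?I snd" "is_mor H ?KW ?I snd" by (rule mor_con_snd; simp)+
  let ?P = "prod_obj ?KV ?KW"
  have P: "is_hmod H ?P" "is_mor H ?P ?KV fst" "is_mor H ?P ?KW snd" by (rule hmod_prod[OF K])+
  let ?g = "\<lambda>x. snd (fst x) \<ominus>\<^bsub>?I\<^esub> snd (snd x)"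
  have g: "is_mor H ?P ?I ?g" by (rule mor_minus[OF _ _ mor_comp[OF P(2) Ks(1)] mor_comp[OF P(3) Ks(2)]]) (simp_all add: P)
  \<comment> \<open>The pullback of \<open>con(V)\<close> and \<open>con(W)\<close> over
    \<open>I[1]\<close>, taken as a kernel so that it is an object and closed under the action of
    \<open>H\<close>.\<close>
  define C where "C = ker_obj ?P ?I ?g"
  have C: "is_hmod H C" "is_mor H C ?P (\<lambda>x. x)" "!!x. x \<in> carrier C \<longleftrightarrow> x \<in> carrier ?P \<and> ?g x = \<zero>\<^bsub>?I\<^esub>"
    unfolding C_def by (rule hmod_ker[OF P(1) hmod_unit_obj g])+
  \<comment> \<open>The actions of \<open>C\<close> on \<open>V\<close>, \<open>W\<close> and
    \<open>A\<close>. The last is read off the first connection, which on \<open>C\<close> is the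
    same as reading it off the second.\<close>
  let ?p = "\<lambda>x. fst (fst x)" and ?w = "\<lambda>x. fst (snd x)" and ?d = "\<lambda>x. d (snd (fst x))"
  have p: "is_mor H C ?EV ?p" by (rule mor_comp[OF mor_comp[OF C(2) P(2)] Kf(1)])
  have w: "is_mor H C ?EW ?w" by (rule mor_comp[OF mor_comp[OF C(2) P(3)] Kf(2)])
  have dm: "is_mor H C ?EA ?d" by (rule mor_comp[OF mor_comp[OF mor_comp[OF C(2) P(2)] Ks(1)] d])
  note [simp] = C(1) p w dm
  have mI: "module k ?I" by simp
  interpret I: module k ?I by (rule mI)
  have Cc: "fst x \<in> carrier ?KV" "snd x \<in> carrier ?KW" "snd (fst x) = snd (snd x)" if x: "x \<in> carrier C" for x
  proof -
    have xP: "x \<in> carrier ?P" and e: "?g x = \<zero>\<^bsub>?I\<^esub>" using x C(3) by blast+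
    show 1: "fst x \<in> carrier ?KV" and 2: "snd x \<in> carrier ?KW" by (rule mor_closed[OF P(2) xP], rule mor_closed[OF P(3) xP])
    show "snd (fst x) = snd (snd x)"
      using e mor_closed[OF Ks(1) 1] mor_closed[OF Ks(2) 2] by (metis I.M.minus_eq I.M.minus_equality I.M.minus_minus I.M.a_inv_closed)
  qed
  have lhV: "is_mor H A ?EV (zeta H A V V (lact V))" and lhW: "is_mor H A ?EW (zeta H A W W (lact W))" by (rule mor_zeta; simp)+
  have brV: "bra V (tmap H ?EV ?EV ?p (zeta H A V V (lact V)) y) = zeta H A V V (lact V) (ev H A A (rw C ?EA A ?d y))" if y: "y \<in> carrier (C ** A)" for y
  proof (rule tensor_ext[OF _ _ _ lin_comp[OF mor_linear[OF mor_tmap] bra_linear] lin_comp[OF lin_comp[OF rw_linear ev_linear] mor_linear[OF lhV]] _ y])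
    fix x a assume x: "x \<in> carrier C" and a: "a \<in> carrier A"
    show "bra V (tmap H ?EV ?EV ?p (zeta H A V V (lact V)) (tp H C A x a)) = zeta H A V V (lact V) (ev H A A (rw C ?EA A ?d (tp H C A x a)))"
      using x a con_leibniz[OF A d V lV Cc(1)[OF x] a] by (simp add: tmap_tp mor_linear[OF lhV])
  qed (simp_all add: lhV)
  have brW: "bra W (tmap H ?EW ?EW ?w (zeta H A W W (lact W)) y) = zeta H A W W (lact W) (ev H A A (rw C ?EA A ?d y))" if y: "y \<in> carrier (C ** A)" for y
  proof (rule tensor_ext[OF _ _ _ lin_comp[OF mor_linear[OF mor_tmap] bra_linear] lin_comp[OF lin_comp[OF rw_linear ev_linear] mor_linear[OF lhW]] _ y])
    fix x a assume x: "x \<in> carrier C" and a: "a \<in> carrier A"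
    show "bra W (tmap H ?EW ?EW ?w (zeta H A W W (lact W)) (tp H C A x a)) = zeta H A W W (lact W) (ev H A A (rw C ?EA A ?d (tp H C A x a)))"
      using x a con_leibniz[OF A d W lW Cc(2)[OF x] a] Cc(3)[OF x] by (simp add: tmap_tp mor_linear[OF lhW])
  qed (simp_all add: lhW)
  let ?eV = "\<lambda>s. ev H V V (rw C ?EV V ?p s)" and ?eA = "\<lambda>s. ev H A A (rw C ?EA A ?d s)" and ?eW = "\<lambda>s. ev H W W (rw C ?EW W ?w s)"
  have e: "is_mor H (C ** V) V ?eV" "is_mor H (C ** A) A ?eA" "is_mor H (C ** W) W ?eW"
    by (rule mor_comp[OF mor_rw mor_ev]; simp)+
  have bal: "lft C V V W ?eV (tp H C ?T c n) \<oplus>\<^bsub>?T\<^esub> rgt C V W W ?eW (tp H C ?T c n) \<in> ?N" if c: "c \<in> carrier C" and n: "n \<in> ?N" for c n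
  proof -
    obtain r where r: "r \<in> carrier ?R" "n = ?\<rho> r" using n unfolding N by auto
    show ?thesis unfolding r(2) N
      by (rule leibniz_balanced[OF C(1) A V W e lV rV lW sV leibniz_left[OF C(1) A V lV p dm brV] leibniz_left[OF C(1) A W lW w dm brW] c r(1)])
  qed
  \<comment> \<open>The two given connections together form one element of \<open>C\<close>;
    translates of \<open>f\<close> are expressed through translates of it.\<close>
  define c where "c = ((L, \<one>\<^bsub>k\<^esub>), (L', \<one>\<^bsub>k\<^esub>))"
  have one: "\<one>\<^bsub>k\<^esub> \<in> carrier ?I" using mor_closed[OF Ks(1) L] by simp
  have c: "c \<in> carrier C"
    unfolding C(3) using L L' I.M.r_neg[OF one] by (simp add: c_def prod_obj_def I.M.minus_eq)
  have Lc: "L \<in> carrier ?EV" "L' \<in> carrier ?EW" using mor_closed[OF Kf(1) L] mor_closed[OF Kf(2) L'] by simp_all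
  note i = mor_inl[OF V W] mor_inr[OF V W]
  define f where "f = inl V W L \<oplus>\<^bsub>?ET\<^esub> inr V W L'"
  have mE: "module k ?ET" and mT: "module k ?T" by simp_all
  interpret E: module k ?ET by (rule mE)
  have fc: "f \<in> carrier ?ET" unfolding f_def by (intro E.M.a_closed mor_closed[OF i(1) Lc(1)] mor_closed[OF i(2) Lc(2)])
  \<comment> \<open>The translate of \<open>f\<close> by \<open>h\<close> is built from the
    components of \<open>act C h c\<close>, which lies in \<open>C\<close> again. So
    \<open>bal\<close>, proved for all of \<open>C\<close>, covers every translate, as
    \<open>ibracket_induced\<close> demands.\<close>
  have st: "ev H ?T ?T (tp H ?ET ?T (act ?ET h f) n) \<in> ?N" if h: "h \<in> carrier H" and n: "n \<in> ?N" for h n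
  proof -
    have nc: "n \<in> carrier ?T" using n mor_closed[OF \<rho>] unfolding N by auto
    have hc: "act C h c \<in> carrier C" using h c by simp
    have ph: "?p (act C h c) = act ?EV h L" "?w (act C h c) = act ?EW h L'"
      using mor_act[OF p h c] mor_act[OF w h c] by (simp_all add: c_def)
    have ec: "act ?EV h L \<in> carrier ?EV" "act ?EW h L' \<in> carrier ?EW" using h Lc by simp_all
    have a: "inl V W (act ?EV h L) \<in> carrier ?ET" "inr V W (act ?EW h L') \<in> carrier ?ET"
      by (rule mor_closed[OF i(1) ec(1)], rule mor_closed[OF i(2) ec(2)])
    have t: "tp H C ?T (act C h c) n \<in> carrier (C ** ?T)" using hc nc by (simp del: tensor_sel)
    have 1: "lft C V V W ?eV (tp H C ?T (act C h c) n) = ev H ?T ?T (tp H ?ET ?T (inl V W (act ?EV h L)) n)"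
      using lft_rw[OF C(1) hmod_ihom[OF V V] V V W p mor_ev[OF V V] t] hc nc ev_itensor_left[OF V W ec(1) nc] by (simp add: ph inl_def)
    have 2: "rgt C V W W ?eW (tp H C ?T (act C h c) n) = ev H ?T ?T (tp H ?ET ?T (inr V W (act ?EW h L')) n)"
      using rgt_rw[OF C(1) hmod_ihom[OF W W] W W V w mor_ev[OF W W] t] hc nc ev_itensor_right[OF V W ec(2) nc] by (simp add: ph inr_def)
    have "act ?ET h f = inl V W (act ?EV h L) \<oplus>\<^bsub>?ET\<^esub> inr V W (act ?EW h L')"
      unfolding f_def mor_act[OF i(1) h Lc(1)] mor_act[OF i(2) h Lc(2)]
      by (rule lin_add[OF hmod_act_linear[OF _ h] mor_closed[OF i(1) Lc(1)] mor_closed[OF i(2) Lc(2)]]) simp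
    then have "ev H ?T ?T (tp H ?ET ?T (act ?ET h f) n) = lft C V V W ?eV (tp H C ?T (act C h c) n) \<oplus>\<^bsub>?T\<^esub> rgt C V W W ?eW (tp H C ?T (act C h c) n)"
      unfolding 1 2 using lin_add[OF lin_comp[OF lin_tp_left[OF mE mT lin_id nc] ev_linear] a] by simp
    then show ?thesis using bal[OF hc n] by simp
  qed
  have "ibracket H (tensor_over H A V W) (induced_end ?T ?N f) (induced_end ?T ?N f) = induced_end ?T ?N (ibracket H ?T f f)"
    by (rule ibracket_induced[OF _ _ \<rho> N _ _ _ _ _ _ fc st]) (simp_all add: tensor_over_def Let_def hmod.extend_def)
  moreover have "ibracket H ?T f f = inl V W (ibracket H V L L) \<oplus>\<^bsub>?ET\<^esub> inr V W (ibracket H W L' L')"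
    unfolding f_def by (rule ibracket_sum[OF V W Lc])
  ultimately show ?thesis
    by (simp add: curv_def boxplus_def f_def inl_def inr_def iend_def)
qed

end

theorem proposition5p4:
  fixes H :: "('k, 'h) qhopf"
    and A :: "('k, 'h, 'a) halg"
    and d :: "'k \<Rightarrow> 'a \<Rightarrow> 'a"
    and V :: "('k, 'h, 'a, 'v) hbimod"
    and W :: "('k, 'h, 'a, 'w) hbimod"
    and L :: "'v \<Rightarrow> 'v"
    and L' :: "'w \<Rightarrow> 'w"
  assumes "is_triangular H"
    and "is_diff_calc H A d"
    and "is_bimod_sym H A V"
    and "is_bimod_sym H A W"
    and "(L, \<one>\<^bsub>base H\<^esub>) \<in> carrier (con H A d V)"
    and "(L', \<one>\<^bsub>base H\<^esub>) \<in> carrier (con H A d W)"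
  shows "curv H (tensor_over H A V W) (boxplus H A V W (L, \<one>\<^bsub>base H\<^esub>) (L', \<one>\<^bsub>base H\<^esub>)) =
    induced_end (tensor H V W) (bal_rel H A V W)
      (itensor H V V W W (tp H (iend H V) (iend H W) (curv H V (L, \<one>\<^bsub>base H\<^esub>)) (iunit H W))
        \<oplus>\<^bsub>iend H (tensor H V W)\<^esub>
       itensor H V V W W (tp H (iend H V) (iend H W) (iunit H V) (curv H W (L', \<one>\<^bsub>base H\<^esub>))))"
  by (rule triangular_qhopf.curv_boxplus[OF triangular_qhopf.intro[OF assms(1)] assms(2-6)])

end
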